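(* Let $s>s_1>\frac12$ and let $u\in L^2_s(\mathbb{R})$ be real-valued. Let $\rho(L_u)$ be the resolvent set of $L_u=\frac1i\partial_x-C_+uC_+$, regarded as an operator on $\mathbb{H}^+$. Then for every $k\in\rho(L_u)\cup(\mathbb{R}^+\pm 0i)$ and every $\lambda>0$ there exist unique $m_1(\cdot,k)\in L^\infty_{-(s-s_1)}(\mathbb{R})$ and $m_e(\cdot,\lambda\pm 0i)\in L^\infty_{-(s-s_1)}(\mathbb{R})$ solving respectively $$m_1(x,k)=1+G_k*(u\,m_1(\cdot,k))(x),$$ $$m_e(x,\lambda\pm 0i)=e^{i\lambda x}+G_{\lambda\pm 0i}*(u\,m_e(\cdot,\lambda\pm 0i))(x),$$ and moreover $m_1(\cdot,k),\,m_e(\cdot,\lambda\pm 0i)\in L^\infty(\mathbb{R})$. Furthermore, writing $m_1(k)=m_1(\cdot,k)$ and $m_e(\lambda\pm0i)=m_e(\cdot,\lambda\pm0i)$, the map $k\mapsto m_1(k)$ is analytic from $\rho(L_u)$ to $L^\infty_{-(s-s_1)}(\mathbb{R})$, and there is some $\gamma\in(0,1)$ such that $m_1(k)\in C^{0,\gamma}_{loc}\big(\rho(L_u)\cup(\mathbb{R}^+\pm0i),\,L^\infty_{-(s-s_1)}(\mathbb{R})\big)$ and $m_e(\lambda\pm 0i)\in C^{0,\gamma}_{loc}\big((0,\infty),\,L^\infty_{-(s-s_1)}(\mathbb{R})\big)$ (as functions of $k$ and of $\lambda$ respectively).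
   Context: Notation. $w(x)=1+|x|$; $L^p_s(\mathbb{R})=\{f: w^sf\in L^p(\mathbb{R})\}$ with norm $\|w^sf\|_p$, for $1\le p\le\infty$, $s\in\mathbb{R}$. $\mathbb{R}^+=(0,\infty)$, $\mathbb{R}^-=(-\infty,0)$. Fourier transform $\hat f(\xi)=\int e^{-i\xi x}f(x)\,dx$. $C_+$ is the Cauchy projection $\widehat{C_+f}=\chi_{\mathbb{R}^+}\hat f$. $\mathbb{H}^+=C_+(L^2(\mathbb{R}))$ is the $L^2$ Hardy space of the upper half plane. The operator $L_u\varphi=\frac1i\varphi'-C_+(uC_+\varphi)$ acts on $\mathbb{H}^+$ with its natural domain $\{\varphi\in\mathbb{H}^+:\varphi'\in L^2\}$. $\mathbb{R}^+\pm 0i$ denotes two disjoint copies of $(0,\infty)$, with points written $\lambda+0i$ and $\lambda-0i$; $\rho(L_u)\cup(\mathbb{R}^+\pm0i)$ is the resolvent set with these two copies glued on as the upper and lower edges of the cut along $(0,\infty)$ (so $\lambda+0i$ is approached from $\mathrm{Im}\,k\ge0$, $\lambda-0i$ from $\mathrm{Im}\,k\le 0$), and local Hölder continuity on it is meant up to these edges, from each side separately. Kernels: for $k\in\mathbb{C}\setminus[0,\infty)$, $G_k(x)=\frac1{2\pi}\int_0^\infty\frac{e^{ix\xi}}{\xi-k}\,d\xi$; for $k\in\mathbb{C}\setminus(-\infty,0]$, $\widetilde G_k(x)=\frac1{2\pi}\int_{-\infty}^0\frac{e^{ix\xi}}{\xi-k}\,d\xi$ (equivalently the inverse Fourier transforms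 of $\chi_{\mathbb{R}^\pm}(\xi)/(\xi-k)$); for $\lambda>0$, $G_{\lambda\pm0i}(x)=\lim_{\epsilon\searrow0}G_{\lambda\pm i\epsilon}(x)=\pm ie^{i\lambda x}\chi_{\mathbb{R}^\pm}(x)-\widetilde G_\lambda(x)$. Signs $\pm$ are read consistently. *)

theory Defs
  imports "HOL-Analysis.Analysis" "HOL-Probability.Essential_Supremum"
begin

text \<open>Elements of the Lebesgue spaces are represented by Borel functions, and equality in these
  spaces is equality almost everywhere. Every Lebesgue class has a Borel representative.\<close>

definition w :: "real \<Rightarrow> real" where
  "w x = 1 + \<bar>x\<bar>"

definition L2w :: "real \<Rightarrow> (real \<Rightarrow> complex) set" where
  "L2w s = {f \<in> borel_measurable lborel. integrable lborel (\<lambda>x. (w x powr s * cmod (f x))\<^sup>2)}"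

abbreviation L2 :: "(real \<Rightarrow> complex) set" where
  "L2 \<equiv> L2w 0"

definition L2_norm :: "(real \<Rightarrow> complex) \<Rightarrow> real" where
  "L2_norm f = sqrt (LINT x|lborel. (cmod (f x))\<^sup>2)"

definition Linfw_norm :: "real \<Rightarrow> (real \<Rightarrow> complex) \<Rightarrow> ennreal" where
  "Linfw_norm s f = esssup lborel (\<lambda>x. ennreal (w x powr s * cmod (f x)))"

definition Linfw :: "real \<Rightarrow> (real \<Rightarrow> complex) set" where
  "Linfw s = {f \<in> borel_measurable lborel. Linfw_norm s f < \<infinity>}"

abbreviation Linf :: "(real \<Rightarrow> complex) set" where
  "Linf \<equiv> Linfw 0"


text \<open>The Fourier transform on \<open>L2\<close> is the \<open>L2\<close>-limit of the truncated Fourier integrals. It and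
  the operators built from it are determined up to null sets; the choice operator picks a
  representative.\<close>

definition has_fourier :: "(real \<Rightarrow> complex) \<Rightarrow> (real \<Rightarrow> complex) \<Rightarrow> bool" where
  "has_fourier f g \<longleftrightarrow> g \<in> L2 \<and>
     ((\<lambda>R. \<integral>\<^sup>+ \<xi>. ennreal ((cmod (g \<xi> -
          (LINT x:{-R..R}|lborel. exp (- (\<i> * of_real (\<xi> * x))) * f x)))\<^sup>2) \<partial>lborel)
       \<longlongrightarrow> 0) at_top"

definition fourier :: "(real \<Rightarrow> complex) \<Rightarrow> real \<Rightarrow> complex" where
  "fourier f = (SOME g. has_fourier f g)"

definition Cplus :: "(real \<Rightarrow> complex) \<Rightarrow> real \<Rightarrow> complex" where
  "Cplus f = (SOME h. h \<in> L2 \<and>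
     (AE \<xi> in lborel. fourier h \<xi> = indicator {0<..} \<xi> * fourier f \<xi>))"

definition Hardy :: "(real \<Rightarrow> complex) set" where
  "Hardy = {\<phi> \<in> L2. \<exists>f \<in> L2. AE x in lborel. \<phi> x = Cplus f x}"


text \<open>Distributional derivatives in \<open>L2\<close>. Real test functions suffice because the defining identity
  is complex linear in the test function.\<close>

definition test_function :: "(real \<Rightarrow> real) \<Rightarrow> bool" where
  "test_function \<eta> \<longleftrightarrow>
     (\<forall>n x. ((deriv ^^ n) \<eta>) field_differentiable (at x)) \<and> (\<exists>R. \<forall>x. \<bar>x\<bar> > R \<longrightarrow> \<eta> x = 0)"

definition has_weak_deriv :: "(real \<Rightarrow> complex) \<Rightarrow> (real \<Rightarrow> complex) \<Rightarrow> bool" where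
  "has_weak_deriv \<phi> \<psi> \<longleftrightarrow> (\<forall>\<eta>. test_function \<eta> \<longrightarrow>
     (LINT x|lborel. \<phi> x * of_real (deriv \<eta> x)) = - (LINT x|lborel. \<psi> x * of_real (\<eta> x)))"

definition weak_deriv :: "(real \<Rightarrow> complex) \<Rightarrow> real \<Rightarrow> complex" where
  "weak_deriv \<phi> = (SOME \<psi>. \<psi> \<in> L2 \<and> has_weak_deriv \<phi> \<psi>)"

definition Lax_dom :: "(real \<Rightarrow> complex) set" where
  "Lax_dom = {\<phi> \<in> Hardy. \<exists>\<psi> \<in> L2. has_weak_deriv \<phi> \<psi>}"

definition Lax :: "(real \<Rightarrow> real) \<Rightarrow> (real \<Rightarrow> complex) \<Rightarrow> real \<Rightarrow> complex" where
  "Lax u \<phi> x = 1 / \<i> * weak_deriv \<phi> x - Cplus (\<lambda>y. of_real (u y) * Cplus \<phi> y) x"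

definition Lax_resolvent_set :: "(real \<Rightarrow> real) \<Rightarrow> complex set" where
  "Lax_resolvent_set u = {k.
     (\<forall>f \<in> Hardy. \<exists>\<phi> \<in> Lax_dom.
        (AE x in lborel. Lax u \<phi> x - k * \<phi> x = f x) \<and>
        (\<forall>\<phi>' \<in> Lax_dom. (AE x in lborel. Lax u \<phi>' x - k * \<phi>' x = f x)
           \<longrightarrow> (AE x in lborel. \<phi>' x = \<phi> x))) \<and>
     (\<exists>C. \<forall>\<phi> \<in> Lax_dom. L2_norm \<phi> \<le> C * L2_norm (\<lambda>x. Lax u \<phi> x - k * \<phi> x))}"


text \<open>The integrand decays only like \<open>1 / \<xi>\<close>, so the integral over the half line is improper. It
  converges for \<open>x \<noteq> 0\<close>; at \<open>x = 0\<close> it diverges, which does not affect convolutions.\<close>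

definition G :: "complex \<Rightarrow> real \<Rightarrow> complex" where
  "G k x = 1 / (2 * of_real pi) *
     Lim at_top (\<lambda>R. integral {0..R} (\<lambda>\<xi>. exp (\<i> * of_real (x * \<xi>)) / (of_real \<xi> - k)))"

datatype edge = Upper | Lower

fun edge_sign :: "edge \<Rightarrow> real" where
  "edge_sign Upper = 1"
| "edge_sign Lower = -1"

definition G_edge :: "edge \<Rightarrow> real \<Rightarrow> real \<Rightarrow> complex" where
  "G_edge e l x = Lim (at_right 0) (\<lambda>\<epsilon>. G (Complex l (edge_sign e * \<epsilon>)) x)"


text \<open>The plane with the two edges of the cut along the positive half line glued on:
  \<open>On_edge Upper l\<close> is \<open>l + 0i\<close> and \<open>On_edge Lower l\<close> is \<open>l - 0i\<close>. The basic neighbourhoods of an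
  edge point are half discs on the corresponding side of the cut.\<close>

datatype cut_point = Off_edge complex | On_edge edge real

fun cut_pos :: "cut_point \<Rightarrow> complex" where
  "cut_pos (Off_edge k) = k"
| "cut_pos (On_edge e l) = of_real l"

fun cut_nbhd :: "cut_point \<Rightarrow> real \<Rightarrow> cut_point set" where
  "cut_nbhd (Off_edge k) r = Off_edge ` ball k r"
| "cut_nbhd (On_edge e l) r =
     Off_edge ` {k \<in> ball (of_real l) r. edge_sign e * Im k > 0} \<union> On_edge e ` ball l r"

definition cut_domain :: "complex set \<Rightarrow> cut_point set" where
  "cut_domain S = Off_edge ` S \<union> {On_edge e l | e l. l > 0}"

fun G_cut :: "cut_point \<Rightarrow> real \<Rightarrow> complex" where
  "G_cut (Off_edge k) = G k"
| "G_cut (On_edge e l) = G_edge e l"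


definition convol :: "(real \<Rightarrow> complex) \<Rightarrow> (real \<Rightarrow> complex) \<Rightarrow> real \<Rightarrow> complex" where
  "convol g f x = (LINT y|lborel. g (x - y) * f y)"

definition solves ::
  "(real \<Rightarrow> real) \<Rightarrow> (real \<Rightarrow> complex) \<Rightarrow> (real \<Rightarrow> complex) \<Rightarrow> (real \<Rightarrow> complex) \<Rightarrow> bool" where
  "solves u g b m \<longleftrightarrow> (AE x in lborel. m x = b x + convol g (\<lambda>y. of_real (u y) * m y) x)"

definition unique_in ::
  "(real \<Rightarrow> complex) set \<Rightarrow> ((real \<Rightarrow> complex) \<Rightarrow> bool) \<Rightarrow> (real \<Rightarrow> complex) \<Rightarrow> bool" where
  "unique_in X P m \<longleftrightarrow> m \<in> X \<and> P m \<and> (\<forall>m' \<in> X. P m' \<longrightarrow> (AE x in lborel. m' x = m x))"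


text \<open>Analyticity of a map into the Banach space \<open>Linfw s\<close> is complex differentiability in norm on an
  open set.\<close>

definition analytic_Linfw :: "real \<Rightarrow> complex set \<Rightarrow> (complex \<Rightarrow> real \<Rightarrow> complex) \<Rightarrow> bool" where
  "analytic_Linfw s S F \<longleftrightarrow> open S \<and> (\<forall>k\<in>S. F k \<in> Linfw s) \<and>
     (\<forall>k\<in>S. \<exists>D \<in> Linfw s.
        ((\<lambda>z. Linfw_norm s (\<lambda>x. (F z x - F k x) / (z - k) - D x)) \<longlongrightarrow> 0) (at k))"

definition loc_Holder_Linfw ::
  "real \<Rightarrow> real \<Rightarrow> ('p \<Rightarrow> real \<Rightarrow> 'p set) \<Rightarrow> ('p \<Rightarrow> 'p \<Rightarrow> real) \<Rightarrow> 'p set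
     \<Rightarrow> ('p \<Rightarrow> real \<Rightarrow> complex) \<Rightarrow> bool" where
  "loc_Holder_Linfw s \<gamma> nbhd d A F \<longleftrightarrow> (\<forall>p\<in>A. F p \<in> Linfw s) \<and>
     (\<forall>p\<in>A. \<exists>r>0. \<exists>C. \<forall>q \<in> A \<inter> nbhd p r. \<forall>q' \<in> A \<inter> nbhd p r.
        Linfw_norm s (\<lambda>x. F q x - F q' x) \<le> ennreal (C * d q q' powr \<gamma>))"

end

theory Submission
  imports Defs "HOL-Probability.Probability" "HOL-Complex_Analysis.Great_Picard"
begin

text \<open>On a function decaying in \<open>L\<^sup>2\<close>, convolution with \<open>G k\<close> is the Fourier multiplier
  \<open>\<chi> / (\<xi> - k)\<close>. Multiplied by \<open>u\<close> it is a compact operator of the weighted space of continuous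
  functions, depending Hoelder continuously on \<open>k\<close> up to the edges of the cut, where the kernel
  splits into a one-sided exponential and a regular multiplier. By the Fredholm alternative the
  integral equations are uniquely solvable wherever the homogeneous equation has only the trivial
  solution, and the solutions inherit the regularity of the operators.

  Off the cut, solutions of the homogeneous equation are eigenfunctions of \<open>L\<^sub>u\<close>, so that
  unique solvability is membership of \<open>k\<close> in the resolvent set. On an edge, \<open>\<lambda> > 0\<close>, the
  homogeneous solution \<open>m\<close> is excluded by an energy identity: testing with \<open>m e\<^sup>i\<^sup>\<eta>\<^sup>x\<close> for small
  \<open>\<eta>\<close> off the pole and averaging over \<open>\<eta>\<close> with a Fejer weight, the only source term left is
  \<open>\<bar>F 0\<bar>\<^sup>2 / (0 - \<lambda>)\<close> with \<open>F\<close> the transform of \<open>u m\<close>, which has the wrong sign.\<close>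

section \<open>Square integrable functions\<close>

text \<open>The decay of \<open>u\<close> is spent in two portions,
  \<open>s = s1 + \<sigma>\<close>: the portion \<sigma> pays for solutions that are only controlled
  after division by \<open>w\<close> to the power \<sigma>, and the remaining
  \<open>s1 > 1/2\<close> still makes \<open>u m\<close> both integrable and square integrable. The
  obstacle is the edge. There the exponential part of the kernel does not decay, so a homogeneous
  solution is a priori only bounded and Plancherel does not apply to it. Hence the energy identity
  is applied to \<open>convol (G k) (u m)\<close> with \<open>k\<close> off the cut, which is square
  integrable, and only integrals of nonnegative functions are carried to the edge, by Fatou. The
  defect of the approximation is the integral of \<open>f cnj h - cnj f h\<close>, which tends to
  zero because \<open>u\<close> is real. Near the pole nothing useful is available: for
  \<open>s\<close> close to 1/2 the decay guarantees the transform of \<open>u m\<close> only a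
  small Hoelder exponent, too small to make its quotient by \<open>\<xi> - \<lambda>\<close> square
  integrable even if it vanishes at \<lambda>. This is why only frequencies close to 0 are tested.
  The averaged identity yields square integrability of \<open>m\<close> and its vanishing at the
  same time.\<close>

lemma w_pos [simp]: "0 < w x" "0 \<le> w x" "1 \<le> w x" "w x \<noteq> 0"
  by (auto simp: w_def)

lemma measurable_w [measurable]: "w \<in> borel_measurable borel"
  by (simp add: w_def[abs_def])

lemma measurable_cnj [measurable (raw)]:
  "f \<in> borel_measurable M \<Longrightarrow> (\<lambda>x. cnj (f x)) \<in> borel_measurable M"
  by (rule borel_measurable_continuous_on[of cnj]) (auto intro: continuous_intros)

lemma L2_iff: "f \<in> L2 \<longleftrightarrow> f \<in> borel_measurable borel \<and> integrable lborel (\<lambda>x. (cmod (f x))\<^sup>2)"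
  by (simp add: L2w_def)

lemma L2_measurable [measurable_dest]: "f \<in> L2 \<Longrightarrow> f \<in> borel_measurable borel"
  by (simp add: L2_iff)

lemma L2_norm_nonneg [simp]: "0 \<le> L2_norm f"
  by (simp add: L2_norm_def)

lemma L2_norm_sq: "(L2_norm f)\<^sup>2 = (LINT x|lborel. (cmod (f x))\<^sup>2)"
  by (simp add: L2_norm_def)

lemma L2_dominated:
  assumes "f \<in> L2" "g \<in> borel_measurable borel" "AE x in lborel. cmod (g x) \<le> C * cmod (f x)"
  shows "g \<in> L2"
proof -
  have "integrable lborel (\<lambda>x. C\<^sup>2 * (cmod (f x))\<^sup>2)"
    using assms(1) by (simp add: L2_iff)
  then have "integrable lborel (\<lambda>x. (cmod (g x))\<^sup>2)"
  proof (rule Bochner_Integration.integrable_bound)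
    show "AE x in lborel. norm ((cmod (g x))\<^sup>2) \<le> norm (C\<^sup>2 * (cmod (f x))\<^sup>2)"
      using assms(3)
      by eventually_elim (metis abs_of_nonneg norm_ge_zero power_mono power_mult_distrib real_norm_def
        zero_le_power2)
  qed (use assms(2) in measurable)
  with assms(2) show ?thesis by (simp add: L2_iff)
qed

lemma L2_norm_mono:
  assumes "f \<in> L2" "g \<in> borel_measurable borel" "0 \<le> C" "AE x in lborel. cmod (g x) \<le> C * cmod (f x)"
  shows "L2_norm g \<le> C * L2_norm f"
proof -
  have "g \<in> L2" by (rule L2_dominated[OF assms(1,2,4)])
  have "(LINT x|lborel. (cmod (g x))\<^sup>2) \<le> (LINT x|lborel. C\<^sup>2 * (cmod (f x))\<^sup>2)"
  proof (rule integral_mono_AE)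
    show "AE x in lborel. (cmod (g x))\<^sup>2 \<le> C\<^sup>2 * (cmod (f x))\<^sup>2"
      using assms(4)
      by eventually_elim (metis norm_ge_zero power_mono power_mult_distrib)
  qed (use assms(1) \<open>g \<in> L2\<close> in \<open>auto simp: L2_iff\<close>)
  then have "(L2_norm g)\<^sup>2 \<le> (C * L2_norm f)\<^sup>2"
    by (simp add: L2_norm_sq power_mult_distrib)
  then show ?thesis by (rule power2_le_imp_le) (simp add: assms(3))
qed

lemma L2_norm_cong_AE:
  assumes "f \<in> borel_measurable borel" "g \<in> borel_measurable borel" "AE x in lborel. f x = g x"
  shows "L2_norm f = L2_norm g"
  unfolding L2_norm_def
  by (intro arg_cong[where f=sqrt] integral_cong_AE) (use assms in auto)

lemma L2_cong_AE:
  assumes "f \<in> L2" "g \<in> borel_measurable borel" "AE x in lborel. f x = g x"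
  shows "g \<in> L2"
  by (rule L2_dominated[OF assms(1,2), of 1]) (use assms in auto)

lemma L2_mult_integrable:
  assumes "f \<in> L2" "g \<in> L2"
  shows "integrable lborel (\<lambda>x. f x * g x)"
proof (rule Bochner_Integration.integrable_bound)
  show "integrable lborel (\<lambda>x. (cmod (f x))\<^sup>2 + (cmod (g x))\<^sup>2)"
    using assms by (auto simp: L2_iff)
  show "(\<lambda>x. f x * g x) \<in> borel_measurable lborel"
    using assms by measurable
  have "a * b \<le> a\<^sup>2 + b\<^sup>2" if "0 \<le> a" "0 \<le> b" for a b :: real
    using sum_squares_bound[of a b] that mult_nonneg_nonneg[OF that] by linarith
  then show "AE x in lborel. norm (f x * g x) \<le> norm ((cmod (f x))\<^sup>2 + (cmod (g x))\<^sup>2)"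
    by (simp add: norm_mult)
qed

lemma L2_Cauchy_Schwarz:
  assumes "f \<in> L2" "g \<in> L2"
  shows "(LINT x|lborel. cmod (f x) * cmod (g x)) \<le> L2_norm f * L2_norm g"
proof -
  have [measurable]: "f \<in> borel_measurable borel" "g \<in> borel_measurable borel"
    using assms by measurable
  have i: "integrable lborel (\<lambda>x. cmod (f x) * cmod (g x))"
    using integrable_norm[OF L2_mult_integrable[OF assms]] by (simp add: norm_mult)
  let ?I = "LINT x|lborel. cmod (f x) * cmod (g x)"
  have "(\<integral>\<^sup>+x. ennreal (cmod (f x)) * ennreal (cmod (g x)) \<partial>lborel)\<^sup>2
      \<le> (\<integral>\<^sup>+x. (ennreal (cmod (f x)))\<^sup>2 \<partial>lborel) * (\<integral>\<^sup>+x. (ennreal (cmod (g x)))\<^sup>2 \<partial>lborel)"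
    by (rule Cauchy_Schwarz_nn_integral) auto
  moreover have "(\<integral>\<^sup>+x. ennreal (cmod (f x)) * ennreal (cmod (g x)) \<partial>lborel) = ennreal ?I"
    using nn_integral_eq_integral[OF i] by (simp add: ennreal_mult)
  moreover have "(\<integral>\<^sup>+x. (ennreal (cmod (f x)))\<^sup>2 \<partial>lborel) = ennreal ((L2_norm f)\<^sup>2)"
    using nn_integral_eq_integral[of lborel "\<lambda>x. (cmod (f x))\<^sup>2"] assms
    by (simp add: ennreal_power L2_norm_sq L2_iff)
  moreover have "(\<integral>\<^sup>+x. (ennreal (cmod (g x)))\<^sup>2 \<partial>lborel) = ennreal ((L2_norm g)\<^sup>2)"
    using nn_integral_eq_integral[of lborel "\<lambda>x. (cmod (g x))\<^sup>2"] assms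
    by (simp add: ennreal_power L2_norm_sq L2_iff)
  moreover have "0 \<le> ?I" by simp
  ultimately have "ennreal (?I\<^sup>2) \<le> ennreal ((L2_norm f)\<^sup>2 * (L2_norm g)\<^sup>2)"
    by (simp add: ennreal_power ennreal_mult)
  then have "?I\<^sup>2 \<le> (L2_norm f * L2_norm g)\<^sup>2"
    by (simp add: power_mult_distrib)
  then show ?thesis by (rule power2_le_imp_le) simp
qed

lemma L2_mult_integral_bound:
  assumes "f \<in> L2" "g \<in> L2"
  shows "cmod (LINT x|lborel. f x * g x) \<le> L2_norm f * L2_norm g"
proof -
  have "cmod (LINT x|lborel. f x * g x) \<le> (LINT x|lborel. cmod (f x * g x))"
    by (rule integral_norm_bound)
  then show ?thesis using L2_Cauchy_Schwarz[OF assms] by (simp add: norm_mult)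
qed

lemma L2_add [intro]:
  assumes "f \<in> L2" "g \<in> L2"
  shows "(\<lambda>x. f x + g x) \<in> L2"
proof -
  have [measurable]: "f \<in> borel_measurable borel" "g \<in> borel_measurable borel"
    using assms by measurable
  have "integrable lborel (\<lambda>x. 2 * (cmod (f x))\<^sup>2 + 2 * (cmod (g x))\<^sup>2)"
    using assms by (auto simp: L2_iff)
  then have "integrable lborel (\<lambda>x. (cmod (f x + g x))\<^sup>2)"
  proof (rule Bochner_Integration.integrable_bound)
    have "(cmod (a + b))\<^sup>2 \<le> 2 * (cmod a)\<^sup>2 + 2 * (cmod b)\<^sup>2" for a b :: complex
    proof -
      have "(cmod (a + b))\<^sup>2 \<le> (cmod a + cmod b)\<^sup>2" by (simp add: norm_triangle_ineq power_mono)
      also have "\<dots> \<le> 2 * (cmod a)\<^sup>2 + 2 * (cmod b)\<^sup>2"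
        using sum_squares_bound[of "cmod a" "cmod b"] by (simp add: power2_sum)
      finally show ?thesis .
    qed
    then show "AE x in lborel. norm ((cmod (f x + g x))\<^sup>2) \<le> norm (2 * (cmod (f x))\<^sup>2 + 2 * (cmod (g x))\<^sup>2)"
      by simp
  qed measurable
  then show ?thesis by (simp add: L2_iff)
qed

lemma L2_cmult [intro]: "f \<in> L2 \<Longrightarrow> (\<lambda>x. c * f x) \<in> L2"
  by (rule L2_dominated[of f _ "cmod c"]) (auto simp: L2_iff norm_mult)

lemma L2_norm_cmult: "L2_norm (\<lambda>x. c * f x) = cmod c * L2_norm f"
  by (simp add: L2_norm_def norm_mult power_mult_distrib real_sqrt_mult)

lemma L2_diff [intro]: "f \<in> L2 \<Longrightarrow> g \<in> L2 \<Longrightarrow> (\<lambda>x. f x - g x) \<in> L2"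
  using L2_add[of f "\<lambda>x. (-1) * g x"] L2_cmult[of g "-1"] by simp

lemma L2_cnj [intro]: "f \<in> L2 \<Longrightarrow> (\<lambda>x. cnj (f x)) \<in> L2"
  by (auto simp: L2_iff)

lemma L2_norm_cnj [simp]: "L2_norm (\<lambda>x. cnj (f x)) = L2_norm f"
  by (simp add: L2_norm_def)

lemma L2_zero [simp]: "(\<lambda>x. 0) \<in> L2"
  by (simp add: L2_iff)

lemma L2_norm_zero [simp]: "L2_norm (\<lambda>x. 0) = 0"
  by (simp add: L2_norm_def)

lemma L2_bounded_mult:
  assumes "f \<in> L2" "b \<in> borel_measurable borel" "\<And>x. cmod (b x) \<le> C"
  shows "(\<lambda>x. b x * f x) \<in> L2" "L2_norm (\<lambda>x. b x * f x) \<le> C * L2_norm f"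
proof -
  have "0 \<le> C" using assms(3)[of 0] norm_ge_zero order_trans by blast
  have m: "(\<lambda>x. b x * f x) \<in> borel_measurable borel" using assms by measurable
  have *: "AE x in lborel. cmod (b x * f x) \<le> C * cmod (f x)"
    using assms(3) by (simp add: norm_mult mult_right_mono)
  show "(\<lambda>x. b x * f x) \<in> L2" by (rule L2_dominated[OF assms(1) m *])
  show "L2_norm (\<lambda>x. b x * f x) \<le> C * L2_norm f" by (rule L2_norm_mono[OF assms(1) m \<open>0 \<le> C\<close> *])
qed

lemma L2_reflect:
  assumes "f \<in> L2" shows "(\<lambda>x. f (- x)) \<in> L2" "L2_norm (\<lambda>x. f (- x)) = L2_norm f"
proof -
  have [measurable]: "f \<in> borel_measurable borel" using assms by measurable
  have "integrable lborel (\<lambda>x. (cmod (f (0 + (-1) * x)))\<^sup>2)"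
    by (subst lborel_integrable_real_affine_iff) (use assms in \<open>auto simp: L2_iff\<close>)
  then show "(\<lambda>x. f (- x)) \<in> L2" by (simp add: L2_iff)
  show "L2_norm (\<lambda>x. f (- x)) = L2_norm f"
    using lborel_integral_real_affine[of "-1" "\<lambda>x. (cmod (f x))\<^sup>2" 0]
    by (simp add: L2_norm_def)
qed

lemma L2_Minkowski:
  assumes "f \<in> L2" "g \<in> L2"
  shows "L2_norm (\<lambda>x. f x + g x) \<le> L2_norm f + L2_norm g"
proof -
  have [measurable]: "f \<in> borel_measurable borel" "g \<in> borel_measurable borel"
    using assms by measurable
  have i: "integrable lborel (\<lambda>x. cmod (f x) * cmod (g x))"
    using integrable_norm[OF L2_mult_integrable[OF assms]] by (simp add: norm_mult)
  have "(L2_norm (\<lambda>x. f x + g x))\<^sup>2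
      \<le> (LINT x|lborel. (cmod (f x))\<^sup>2 + 2 * (cmod (f x) * cmod (g x)) + (cmod (g x))\<^sup>2)"
    unfolding L2_norm_sq
  proof (rule integral_mono)
    show "integrable lborel (\<lambda>x. (cmod (f x + g x))\<^sup>2)" using L2_add[OF assms] by (simp add: L2_iff)
    show "integrable lborel (\<lambda>x. (cmod (f x))\<^sup>2 + 2 * (cmod (f x) * cmod (g x)) + (cmod (g x))\<^sup>2)"
      using assms i by (auto simp: L2_iff)
    fix x
    have "(cmod (f x + g x))\<^sup>2 \<le> (cmod (f x) + cmod (g x))\<^sup>2"
      by (simp add: norm_triangle_ineq power_mono)
    then show "(cmod (f x + g x))\<^sup>2 \<le> (cmod (f x))\<^sup>2 + 2 * (cmod (f x) * cmod (g x)) + (cmod (g x))\<^sup>2"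
      by (simp add: power2_sum algebra_simps)
  qed
  also have "\<dots> = (L2_norm f)\<^sup>2 + 2 * (LINT x|lborel. cmod (f x) * cmod (g x)) + (L2_norm g)\<^sup>2"
    using assms i by (simp add: L2_iff L2_norm_sq)
  also have "\<dots> \<le> (L2_norm f + L2_norm g)\<^sup>2"
    using L2_Cauchy_Schwarz[OF assms] by (simp add: power2_sum)
  finally show ?thesis by (rule power2_le_imp_le) simp
qed

lemma L2_norm_diff_commute: "L2_norm (\<lambda>x. f x - g x) = L2_norm (\<lambda>x. g x - f x)"
  by (simp add: L2_norm_def norm_minus_commute)

lemma L2_triangle:
  assumes "f \<in> L2" "g \<in> L2" "h \<in> L2"
  shows "L2_norm (\<lambda>x. f x - h x) \<le> L2_norm (\<lambda>x. f x - g x) + L2_norm (\<lambda>x. g x - h x)"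
  using L2_Minkowski[OF L2_diff[OF assms(1,2)] L2_diff[OF assms(2,3)]] by simp

lemma L2_norm_diff_ineq:
  assumes "f \<in> L2" "g \<in> L2"
  shows "\<bar>L2_norm f - L2_norm g\<bar> \<le> L2_norm (\<lambda>x. f x - g x)"
proof -
  have "L2_norm f \<le> L2_norm (\<lambda>x. f x - g x) + L2_norm g"
    using L2_Minkowski[OF L2_diff[OF assms] assms(2)] by simp
  moreover have "L2_norm g \<le> L2_norm (\<lambda>x. g x - f x) + L2_norm f"
    using L2_Minkowski[OF L2_diff[OF assms(2,1)] assms(1)] by simp
  ultimately show ?thesis by (simp add: L2_norm_diff_commute[of g f])
qed

lemma L2_norm_tendsto:
  assumes "\<And>n. f n \<in> L2" "g \<in> L2" "((\<lambda>n. L2_norm (\<lambda>x. f n x - g x)) \<longlongrightarrow> 0) F"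
  shows "((\<lambda>n. L2_norm (f n)) \<longlongrightarrow> L2_norm g) F"
proof (rule Lim_transform_eventually)
  show "((\<lambda>n. L2_norm g + (L2_norm (f n) - L2_norm g)) \<longlongrightarrow> L2_norm g) F"
  proof -
    have "((\<lambda>n. L2_norm (f n) - L2_norm g) \<longlongrightarrow> 0) F"
      by (rule tendsto_0_le[OF assms(3), of _ 1])
         (use L2_norm_diff_ineq[OF assms(1,2)] in auto)
    from tendsto_add[OF tendsto_const[of "L2_norm g"] this] show ?thesis by simp
  qed
qed auto

lemma L2_integral_mult_tendsto:
  assumes "\<And>n. f n \<in> L2" "g \<in> L2" "h \<in> L2" "((\<lambda>n. L2_norm (\<lambda>x. f n x - g x)) \<longlongrightarrow> 0) F"
  shows "((\<lambda>n. LINT x|lborel. f n x * h x) \<longlongrightarrow> (LINT x|lborel. g x * h x)) F"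
proof (rule Lim_transform)
  show "((\<lambda>n. LINT x|lborel. g x * h x) \<longlongrightarrow> (LINT x|lborel. g x * h x)) F" by simp
  have eq: "(LINT x|lborel. f n x * h x) - (LINT x|lborel. g x * h x)
      = (LINT x|lborel. (f n x - g x) * h x)" for n
    using L2_mult_integrable[OF assms(1,3)] L2_mult_integrable[OF assms(2,3)]
    by (simp add: left_diff_distrib)
  show "((\<lambda>n. (LINT x|lborel. f n x * h x) - (LINT x|lborel. g x * h x)) \<longlongrightarrow> 0) F"
    unfolding eq
    by (rule tendsto_0_le[OF assms(4), of _ "L2_norm h"])
       (use L2_mult_integral_bound[OF L2_diff[OF assms(1,2)] assms(3)] in \<open>auto\<close>)
qed

lemma L2_norm_eq_0:
  assumes "f \<in> L2" "L2_norm f = 0" shows "AE x in lborel. f x = 0"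
proof -
  have "(LINT x|lborel. (cmod (f x))\<^sup>2) = 0" using assms(2) by (simp add: L2_norm_def)
  then have "AE x in lborel. (cmod (f x))\<^sup>2 = 0"
    using integral_nonneg_eq_0_iff_AE[of lborel "\<lambda>x. (cmod (f x))\<^sup>2"] assms(1) by (simp add: L2_iff)
  then show ?thesis by simp
qed

lemma L2_AE_subseq:
  assumes "\<And>n. f n \<in> L2" "g \<in> L2" "(\<lambda>n. L2_norm (\<lambda>x. f n x - g x)) \<longlonglongrightarrow> 0"
  obtains r :: "nat \<Rightarrow> nat" where "strict_mono r" "AE x in lborel. (\<lambda>n. f (r n) x) \<longlonglongrightarrow> g x"
proof -
  have "(\<lambda>n. LINT x|lborel. norm ((cmod (f n x - g x))\<^sup>2)) \<longlonglongrightarrow> 0"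
    using tendsto_power[OF assms(3), of 2] by (simp add: L2_norm_sq)
  moreover have "integrable lborel (\<lambda>x. (cmod (f n x - g x))\<^sup>2)" for n
    using L2_diff[OF assms(1,2)] by (simp add: L2_iff)
  ultimately obtain r :: "nat \<Rightarrow> nat"
    where r: "strict_mono r" "AE x in lborel. (\<lambda>n. (cmod (f (r n) x - g x))\<^sup>2) \<longlonglongrightarrow> 0"
    using tendsto_L1_AE_subseq[of lborel "\<lambda>n x. (cmod (f n x - g x))\<^sup>2"] by blast
  have "AE x in lborel. (\<lambda>n. f (r n) x) \<longlonglongrightarrow> g x"
    using r(2)
  proof eventually_elim
    case (elim x)
    then have "(\<lambda>n. cmod (f (r n) x - g x)) \<longlonglongrightarrow> 0"
      using tendsto_real_sqrt[OF elim] by simp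
    then show ?case using LIM_zero_iff tendsto_norm_zero_iff by blast
  qed
  with r(1) that show ?thesis by blast
qed

lemma L2_limit_AE_unique:
  assumes "\<And>n. f n \<in> L2" "g \<in> L2" "h \<in> L2" "(F::'i filter) \<noteq> bot"
    "((\<lambda>n. L2_norm (\<lambda>x. f n x - g x)) \<longlongrightarrow> 0) F" "((\<lambda>n. L2_norm (\<lambda>x. f n x - h x)) \<longlongrightarrow> 0) F"
  shows "AE x in lborel. g x = h x"
proof -
  have "((\<lambda>n. L2_norm (\<lambda>x. f n x - g x) + L2_norm (\<lambda>x. f n x - h x)) \<longlongrightarrow> 0 + 0) F"
    by (intro tendsto_add assms)
  moreover have "L2_norm (\<lambda>x. g x - h x) \<le> L2_norm (\<lambda>x. f n x - g x) + L2_norm (\<lambda>x. f n x - h x)" for n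
    using L2_triangle[OF assms(2,1,3), of n] L2_norm_diff_commute[of g "f n"] by simp
  ultimately have "L2_norm (\<lambda>x. g x - h x) \<le> 0"
    using assms(4) by (intro tendsto_lowerbound[where F=F]) auto
  then have "L2_norm (\<lambda>x. g x - h x) = 0" using L2_norm_nonneg order_antisym by blast
  from L2_norm_eq_0[OF L2_diff[OF assms(2,3)] this] show ?thesis by simp
qed

section \<open>Lower semicontinuity of the norm and completeness\<close>

lemma L2_Fatou:
  assumes "\<And>n. f n \<in> L2" "g \<in> borel_measurable borel" "AE x in lborel. (\<lambda>n. f n x) \<longlonglongrightarrow> g x"
    "\<And>n. n \<ge> N \<Longrightarrow> L2_norm (f n) \<le> C"
  shows "g \<in> L2" "L2_norm g \<le> C"
proof -
  have [measurable]: "f n \<in> borel_measurable borel" for n using assms(1) by measurable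
  note [measurable] = assms(2)
  have C: "0 \<le> C" using assms(4)[of N] L2_norm_nonneg order_trans by blast
  have "(\<integral>\<^sup>+x. ennreal ((cmod (g x))\<^sup>2) \<partial>lborel)
      \<le> (\<integral>\<^sup>+x. liminf (\<lambda>n. ennreal ((cmod (f n x))\<^sup>2)) \<partial>lborel)"
  proof (rule nn_integral_mono_AE, use assms(3) in eventually_elim)
    case (elim x)
    have "(\<lambda>n. ennreal ((cmod (f n x))\<^sup>2)) \<longlonglongrightarrow> ennreal ((cmod (g x))\<^sup>2)"
      by (intro tendsto_ennrealI tendsto_power tendsto_norm elim)
    from lim_imp_Liminf[OF _ this] show ?case by simp
  qed
  also have "\<dots> \<le> liminf (\<lambda>n. \<integral>\<^sup>+x. ennreal ((cmod (f n x))\<^sup>2) \<partial>lborel)"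
    by (rule nn_integral_liminf) auto
  also have "\<dots> \<le> ennreal (C\<^sup>2)"
  proof -
    have "eventually (\<lambda>n. (\<integral>\<^sup>+x. ennreal ((cmod (f n x))\<^sup>2) \<partial>lborel) \<le> ennreal (C\<^sup>2)) sequentially"
      using eventually_ge_at_top[of N]
    proof eventually_elim
      case (elim n)
      have "(\<integral>\<^sup>+x. ennreal ((cmod (f n x))\<^sup>2) \<partial>lborel) = ennreal ((L2_norm (f n))\<^sup>2)"
        unfolding L2_norm_sq by (rule nn_integral_eq_integral) (use assms(1) in \<open>auto simp: L2_iff\<close>)
      also have "\<dots> \<le> ennreal (C\<^sup>2)" by (intro ennreal_leI power_mono assms(4) elim) auto
      finally show ?case .
    qed
    then have "liminf (\<lambda>n. \<integral>\<^sup>+x. ennreal ((cmod (f n x))\<^sup>2) \<partial>lborel) \<le> liminf (\<lambda>n::nat. ennreal (C\<^sup>2))"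
      by (rule Liminf_mono)
    then show ?thesis by (simp add: Liminf_const)
  qed
  finally have le: "(\<integral>\<^sup>+x. ennreal ((cmod (g x))\<^sup>2) \<partial>lborel) \<le> ennreal (C\<^sup>2)" .
  have int: "integrable lborel (\<lambda>x. (cmod (g x))\<^sup>2)"
    by (rule integrableI_bounded) (use le in \<open>auto intro: le_less_trans\<close>)
  then show "g \<in> L2" by (simp add: L2_iff)
  have "ennreal (LINT x|lborel. (cmod (g x))\<^sup>2) \<le> ennreal (C\<^sup>2)"
    using le by (subst (asm) nn_integral_eq_integral[OF int]) auto
  then have "(L2_norm g)\<^sup>2 \<le> C\<^sup>2"
    by (simp add: L2_norm_sq)
  then show "L2_norm g \<le> C" by (rule power2_le_imp_le) (rule C)
qed

text \<open>A subsequence with geometrically small increments telescopes to a series that converges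
  a.e.; Fatou along this subsequence then bounds the distance of every late \<open>f n\<close> from
  the limit, so the whole sequence converges.\<close>

theorem L2_complete:
  assumes "\<And>n. f n \<in> L2"
    and "\<And>e. 0 < e \<Longrightarrow> \<exists>N. \<forall>m\<ge>N. \<forall>n\<ge>N. L2_norm (\<lambda>x. f m x - f n x) < e"
  obtains g where "g \<in> L2" "(\<lambda>n. L2_norm (\<lambda>x. f n x - g x)) \<longlonglongrightarrow> 0"
proof -
  have [measurable]: "f n \<in> borel_measurable borel" for n using assms(1) by measurable
  have "\<exists>N. \<forall>k. \<forall>m\<ge>N k. \<forall>n\<ge>N k. L2_norm (\<lambda>x. f m x - f n x) < (1/2)^k"
    using assms(2)[of "(1/2)^k" for k] by (intro choice) auto
  then obtain N where N: "\<And>k m n. m \<ge> N k \<Longrightarrow> n \<ge> N k \<Longrightarrow> L2_norm (\<lambda>x. f m x - f n x) < (1/2)^k"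
    by blast
  define r where "r = rec_nat (N 0) (\<lambda>k p. max (N (Suc k)) (Suc p))"
  have r0: "r 0 = N 0" and rS: "r (Suc k) = max (N (Suc k)) (Suc (r k))" for k
    by (auto simp: r_def)
  have rN: "N k \<le> r k" for k by (cases k) (auto simp: r0 rS)
  have rmono: "strict_mono r" by (auto simp: strict_mono_Suc_iff rS)
  define d where "d k x = f (r (Suc k)) x - f (r k) x" for k x
  have [measurable]: "d k \<in> borel_measurable borel" for k unfolding d_def[abs_def] by measurable
  have dL2: "d k \<in> L2" for k unfolding d_def by (intro L2_diff assms)
  have dn: "L2_norm (d k) \<le> (1/2)^k" for k
    unfolding d_def using N[of k "r (Suc k)" "r k"] rN[of k] strict_monoD[OF rmono, of k "Suc k"]
    by simp
  \<comment> \<open>A strictly positive element of \<open>L2\<close>: pairing the increments with it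
    turns summable norms into an integrable sum by Cauchy-Schwarz, and it can be divided out again
    at each point.\<close>
  define e where "e x = complex_of_real (sqrt (std_normal_density x))" for x
  have [measurable]: "e \<in> borel_measurable borel" unfolding e_def[abs_def] by measurable
  have eL2: "e \<in> L2" by (simp add: L2_iff e_def)
  have epos: "0 < cmod (e x)" for x by (simp add: e_def std_normal_density_def)
  have "(\<integral>\<^sup>+x. (\<Sum>k. ennreal (cmod (d k x) * cmod (e x))) \<partial>lborel)
      = (\<Sum>k. \<integral>\<^sup>+x. ennreal (cmod (d k x) * cmod (e x)) \<partial>lborel)"
    by (rule nn_integral_suminf) auto
  also have "\<dots> \<le> (\<Sum>k. ennreal ((1/2)^k * L2_norm e))"
  proof (rule suminf_le)
    fix k
    have i: "integrable lborel (\<lambda>x. cmod (d k x) * cmod (e x))"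
      using integrable_norm[OF L2_mult_integrable[OF dL2 eL2]] by (simp add: norm_mult)
    have "(\<integral>\<^sup>+x. ennreal (cmod (d k x) * cmod (e x)) \<partial>lborel)
        = ennreal (LINT x|lborel. cmod (d k x) * cmod (e x))"
      by (rule nn_integral_eq_integral[OF i]) auto
    also have "\<dots> \<le> ennreal ((1/2)^k * L2_norm e)"
      by (intro ennreal_leI order_trans[OF L2_Cauchy_Schwarz[OF dL2 eL2]] mult_right_mono dn) auto
    finally show "(\<integral>\<^sup>+x. ennreal (cmod (d k x) * cmod (e x)) \<partial>lborel) \<le> ennreal ((1/2)^k * L2_norm e)" .
  qed auto
  also have "\<dots> = ennreal (\<Sum>k. (1/2)^k * L2_norm e)"
    by (rule suminf_ennreal2) (auto intro!: summable_mult2 summable_geometric)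
  also have "\<dots> < \<infinity>" by simp
  finally have fin: "(\<integral>\<^sup>+x. (\<Sum>k. ennreal (cmod (d k x) * cmod (e x))) \<partial>lborel) < \<infinity>" .
  have "AE x in lborel. (\<Sum>k. ennreal (cmod (d k x) * cmod (e x))) \<noteq> \<infinity>"
    by (rule nn_integral_PInf_AE) (use fin in auto)
  then have conv: "AE x in lborel. convergent (\<lambda>n. f (r n) x)"
  proof eventually_elim
    case (elim x)
    have "summable (\<lambda>k. cmod (d k x) * cmod (e x))"
      by (rule summable_suminf_not_top) (use elim in auto)
    then have "summable (\<lambda>k. cmod (d k x) * cmod (e x) * (1 / cmod (e x)))"
      by (rule summable_mult2)
    then have "summable (\<lambda>k. cmod (d k x))" using epos[of x] by simp
    then have "summable (\<lambda>k. d k x)" by (rule summable_norm_cancel)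
    then have "convergent (\<lambda>n. f (r 0) x + (\<Sum>k<n. d k x))"
      by (intro convergent_add convergent_const) (simp only: summable_iff_convergent)
    moreover have "f (r 0) x + (\<Sum>k<n. d k x) = f (r n) x" for n
      unfolding d_def by (induction n) (auto simp: algebra_simps)
    ultimately show ?case by simp
  qed
  define g where "g x = lim (\<lambda>n. f (r n) x)" for x
  have gm [measurable]: "g \<in> borel_measurable borel"
    unfolding g_def[abs_def] by (rule borel_measurable_lim_metric) measurable
  have glim: "AE x in lborel. (\<lambda>n. f (r n) x) \<longlonglongrightarrow> g x"
    using conv by eventually_elim (auto simp: g_def convergent_LIMSEQ_iff)
  have key: "(\<lambda>x. f n x - g x) \<in> L2 \<and> L2_norm (\<lambda>x. f n x - g x) \<le> (1/2)^k" if "n \<ge> N k" for n k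
  proof -
    have m: "(\<lambda>x. f n x - g x) \<in> borel_measurable borel" by measurable
    have "AE x in lborel. (\<lambda>j. f n x - f (r j) x) \<longlonglongrightarrow> f n x - g x"
      using glim by eventually_elim (intro tendsto_intros)
    moreover have "L2_norm (\<lambda>x. f n x - f (r j) x) \<le> (1/2)^k" if "j \<ge> k" for j
    proof -
      have "r j \<ge> r k" using that rmono by (simp add: strict_mono_less_eq)
      then have "r j \<ge> N k" using rN[of k] by simp
      then show ?thesis using N[of k n "r j"] \<open>n \<ge> N k\<close> by simp
    qed
    ultimately show ?thesis
      using L2_Fatou[of "\<lambda>j x. f n x - f (r j) x" "\<lambda>x. f n x - g x" k "(1/2)^k"] m assms(1) by blast
  qed
  have "(\<lambda>x. f (N 0) x - g x) \<in> L2" using key[of 0 "N 0"] by simp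
  from L2_diff[OF assms(1)[of "N 0"] this] have "g \<in> L2" by simp
  moreover have "(\<lambda>n. L2_norm (\<lambda>x. f n x - g x)) \<longlonglongrightarrow> 0"
  proof (rule LIMSEQ_I)
    fix e :: real assume "0 < e"
    then obtain k where k: "(1/2)^k < e" using real_arch_pow_inv[of e "1/2"] by auto
    have "norm (L2_norm (\<lambda>x. f n x - g x) - 0) < e" if "n \<ge> N k" for n
      using key[OF that] k by simp
    then show "\<exists>no. \<forall>n\<ge>no. norm (L2_norm (\<lambda>x. f n x - g x) - 0) < e" by blast
  qed
  ultimately show ?thesis using that by blast
qed

section \<open>The Fourier transform\<close>

lemma tendsto_0_squeeze:
  fixes a b :: "'i \<Rightarrow> real"
  assumes "\<And>n. 0 \<le> a n" "\<And>n. a n \<le> b n" "(b \<longlongrightarrow> 0) F"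
  shows "(a \<longlongrightarrow> 0) F"
  by (rule tendsto_sandwich[OF _ _ tendsto_const assms(3)]) (use assms in auto)

lemma norm_integral_le_nn_integral:
  fixes f :: "'a \<Rightarrow> 'b::{banach, second_countable_topology}"
  shows "ennreal (norm (integral\<^sup>L M f)) \<le> (\<integral>\<^sup>+x. ennreal (norm (f x)) \<partial>M)"
  by (cases "integrable M f") (auto simp: integral_norm_bound_ennreal not_integrable_integral_eq)

lemma exp_minus_i_eq_cis: "exp (- (\<i> * complex_of_real t)) = cis (- t)"
  by (simp add: cis_conv_exp)

lemma measurable_cis [measurable (raw)]:
  "f \<in> borel_measurable M \<Longrightarrow> (\<lambda>x. cis (f x)) \<in> borel_measurable M"
  by (rule borel_measurable_continuous_on[of cis]) (auto intro: continuous_intros)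

lemma has_vector_derivative_cis_mult:
  "((\<lambda>x. cis (t * x)) has_vector_derivative (\<i> * of_real t * cis (t * x))) (at x within S)"
proof -
  have "((\<lambda>z. exp (\<i> * of_real t * z)) has_field_derivative (exp (\<i> * of_real t * of_real x)
      * (\<i> * of_real t))) (at (of_real x))"
    by (auto intro!: derivative_eq_intros)
  from has_vector_derivative_real_field[OF this, of S] show ?thesis
    by (simp add: cis_conv_exp mult_ac)
qed

text \<open>The filter has a countable base, so sequences suffice. The set \<open>S\<close> allows a
  majorant that is valid only near the limit point.\<close>

lemma dominated_convergence_at_within:
  fixes s :: "'t::first_countable_topology \<Rightarrow> 'a \<Rightarrow> 'b::{banach, second_countable_topology}"
      and w :: "'a \<Rightarrow> real"
  assumes "f \<in> borel_measurable M" "\<And>t. t \<in> S \<Longrightarrow> s t \<in> borel_measurable M"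
    and "integrable M w"
    and "AE x in M. ((\<lambda>t. s t x) \<longlongrightarrow> f x) (at a within S)"
    and "\<And>t. t \<in> S \<Longrightarrow> AE x in M. norm (s t x) \<le> w x"
  shows "((\<lambda>t. integral\<^sup>L M (s t)) \<longlongrightarrow> integral\<^sup>L M f) (at a within S)"
  unfolding tendsto_at_iff_sequentially
proof (intro allI impI)
  fix X assume X: "\<forall>i. X i \<in> S - {a}" "X \<longlonglongrightarrow> a"
  show "((\<lambda>t. integral\<^sup>L M (s t)) \<circ> X) \<longlonglongrightarrow> integral\<^sup>L M f"
    unfolding comp_def
  proof (rule integral_dominated_convergence)
    show "AE x in M. (\<lambda>i. s (X i) x) \<longlonglongrightarrow> f x"
      using assms(4)
    proof eventually_elim
      case (elim x)
      then show ?case using X unfolding tendsto_at_iff_sequentially comp_def by blast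
    qed
    show "AE x in M. norm (s (X i) x) \<le> w x" for i using assms(5) X(1) by blast
  qed (use assms(1-3) X(1) in auto)
qed

section \<open>The transform of integrable functions\<close>

definition FT :: "(real \<Rightarrow> complex) \<Rightarrow> real \<Rightarrow> complex" where
  "FT f \<xi> = (LINT x|lborel. cis (- (\<xi> * x)) * f x)"

definition trunc :: "real \<Rightarrow> (real \<Rightarrow> complex) \<Rightarrow> real \<Rightarrow> complex" where
  "trunc R f x = indicator {-R..R} x * f x"

lemma measurable_FT [measurable]:
  assumes [measurable]: "f \<in> borel_measurable borel"
  shows "FT f \<in> borel_measurable borel"
  unfolding FT_def[abs_def] by measurable

text \<open>The complex double integrals below consist of phases and bounded factors times a product
  of two integrable functions, so a majorant in product form covers these interchanges.\<close>

lemma Fubini_dominated: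
  fixes h :: "real \<Rightarrow> real \<Rightarrow> complex"
  assumes h [measurable]: "case_prod h \<in> borel_measurable (lborel \<Otimes>\<^sub>M lborel)"
    and A: "integrable lborel A" and B: "integrable lborel B"
    and le: "\<And>x y. cmod (h x y) \<le> A x * B y"
  shows "(LINT x|lborel. LINT y|lborel. h x y) = (LINT y|lborel. LINT x|lborel. h x y)"
    and "integrable lborel (\<lambda>x. LINT y|lborel. h x y)"
    and "integrable lborel (\<lambda>y. LINT x|lborel. h x y)"
proof -
  have [measurable]: "A \<in> borel_measurable borel" "B \<in> borel_measurable borel"
    using A B by auto
  have AB: "integrable (lborel \<Otimes>\<^sub>M lborel) (\<lambda>(x, y). A x * B y)"
  proof (rule lborel_pair.Fubini_integrable)
    show "integrable lborel (\<lambda>x. LINT y|lborel. norm (case (x, y) of (x, y) \<Rightarrow> A x * B y))"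
      using A by (simp add: abs_mult)
    show "AE x in lborel. integrable lborel (\<lambda>y. case (x, y) of (x, y) \<Rightarrow> A x * B y)"
      using B by simp
  qed measurable
  have I: "integrable (lborel \<Otimes>\<^sub>M lborel) (case_prod h)"
    by (rule Bochner_Integration.integrable_bound[OF AB])
       (use le in \<open>auto intro!: AE_I2 order_trans[OF _ abs_ge_self]\<close>)
  show "(LINT x|lborel. LINT y|lborel. h x y) = (LINT y|lborel. LINT x|lborel. h x y)"
    using lborel_pair.Fubini_integral[OF I] by simp
  show "integrable lborel (\<lambda>x. LINT y|lborel. h x y)"
    using lborel_pair.integrable_fst[OF I] .
  show "integrable lborel (\<lambda>y. LINT x|lborel. h x y)"
    using lborel_pair.integrable_snd[OF I] .
qed

lemma FT_integrand:
  assumes "integrable lborel f"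
  shows "integrable lborel (\<lambda>x. cis (- (\<xi> * x)) * f x)"
proof (rule Bochner_Integration.integrable_bound[OF assms])
  have [measurable]: "f \<in> borel_measurable borel" using assms by auto
  show "(\<lambda>x. cis (- (\<xi> * x)) * f x) \<in> borel_measurable lborel" by measurable
qed (simp add: norm_mult)

lemma FT_bound: "cmod (FT f \<xi>) \<le> (LINT x|lborel. cmod (f x))"
  unfolding FT_def by (rule order_trans[OF integral_norm_bound]) (simp add: norm_mult)

lemma FT_add: "integrable lborel f \<Longrightarrow> integrable lborel g \<Longrightarrow> FT (\<lambda>x. f x + g x) \<xi> = FT f \<xi> + FT g \<xi>"
  unfolding FT_def by (simp add: distrib_left FT_integrand)

lemma FT_diff: "integrable lborel f \<Longrightarrow> integrable lborel g \<Longrightarrow> FT (\<lambda>x. f x - g x) \<xi> = FT f \<xi> - FT g \<xi>"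
  unfolding FT_def by (simp add: right_diff_distrib FT_integrand)

lemma FT_cmult: "FT (\<lambda>x. c * f x) \<xi> = c * FT f \<xi>"
proof -
  have "FT (\<lambda>x. c * f x) \<xi> = (LINT x|lborel. c * (cis (- (\<xi> * x)) * f x))"
    by (simp add: FT_def mult_ac)
  then show ?thesis by (simp add: FT_def)
qed

lemma cnj_FT: "cnj (FT f \<xi>) = FT (\<lambda>x. cnj (f x)) (- \<xi>)"
  unfolding FT_def using Bochner_Integration.integral_cnj[of lborel "\<lambda>x. cis (- (\<xi> * x)) * f x"]
    by (simp add: cis_cnj)

lemma continuous_FT:
  assumes "integrable lborel f"
  shows "isCont (FT f) \<xi>"
  unfolding isCont_def FT_def
proof (rule dominated_convergence_at_within[where w="\<lambda>x. cmod (f x)"])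
  show "AE x in lborel. (\<lambda>t. cis (- (t * x)) * f x) \<midarrow>\<xi>\<rightarrow> cis (- (\<xi> * x)) * f x"
    by (intro AE_I2 tendsto_intros)
qed (use assms in \<open>auto simp: norm_mult\<close>)

section \<open>Gaussian regularisation and Bessel's inequality\<close>

lemma std_normal_char:
  "(LINT x|lborel. std_normal_density x *\<^sub>R cis (t * x)) = of_real (exp (- (t\<^sup>2) / 2))"
proof -
  have "(LINT x|lborel. std_normal_density x *\<^sub>R cis (t * x)) = char std_normal_distribution t"
    unfolding char_def by (subst integral_density) (auto simp: cis_conv_exp)
  then show ?thesis by (simp add: char_std_normal_distribution)
qed

lemma scaled_normal_char:
  assumes "0 < a"
  shows "(LINT x|lborel. of_real (std_normal_density (a * x)) * cis (t * x))
    = of_real (exp (- ((t / a)\<^sup>2) / 2) / a)"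
proof -
  have "of_real (exp (- ((t / a)\<^sup>2) / 2)) = (LINT x|lborel. std_normal_density x *\<^sub>R cis (t / a * x))"
    by (rule std_normal_char[symmetric])
  also have "\<dots> = \<bar>a\<bar> *\<^sub>R (LINT x|lborel. std_normal_density (0 + a * x) *\<^sub>R cis (t / a * (0 + a * x)))"
    by (rule lborel_integral_real_affine) (use assms in auto)
  also have "\<dots> = of_real a * (LINT x|lborel. of_real (std_normal_density (a * x)) * cis (t * x))"
    using assms by (simp add: scaleR_conv_of_real)
  finally show ?thesis using assms by (simp add: field_simps)
qed

lemma nn_integral_gauss_kernel:
  assumes "0 < a"
  shows "(\<integral>\<^sup>+y. ennreal (exp (- (((y - x) / a)\<^sup>2) / 2) / a) \<partial>lborel) = ennreal (sqrt (2 * pi))"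
proof -
  have "(\<integral>\<^sup>+y. ennreal (exp (- (((y - x) / a)\<^sup>2) / 2) / a) \<partial>lborel)
      = \<bar>a\<bar> * (\<integral>\<^sup>+y. ennreal (exp (- (((x + a * y - x) / a)\<^sup>2) / 2) / a) \<partial>lborel)"
    by (rule nn_integral_real_affine) (use assms in auto)
  also have "\<dots> = (\<integral>\<^sup>+y. ennreal a * ennreal (exp (- (((x + a * y - x) / a)\<^sup>2) / 2) / a) \<partial>lborel)"
    using assms by (subst nn_integral_cmult) auto
  also have "\<dots> = (\<integral>\<^sup>+y. ennreal (sqrt (2 * pi)) * ennreal (std_normal_density y) \<partial>lborel)"
    using assms by (intro nn_integral_cong) (simp add: std_normal_density_def flip: ennreal_mult)
  also have "\<dots> = ennreal (sqrt (2 * pi)) * (\<integral>\<^sup>+y. ennreal (std_normal_density y) \<partial>lborel)"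
    by (rule nn_integral_cmult) auto
  also have "(\<integral>\<^sup>+y. ennreal (std_normal_density y) \<partial>lborel) = 1"
    by (subst nn_integral_eq_integral) auto
  finally show ?thesis by simp
qed

text \<open>With the Gaussian weight the square of the transform expands into an absolutely
  convergent double integral. The transform of the weight is the positive kernel \<open>g\<close> of
  total mass \<open>sqrt (2 * pi)\<close>, and Schur's test, in the form of the inequality between
  the product and the mean of the squares, bounds the resulting quadratic form.\<close>

lemma FT_gauss_bound:
  assumes f: "integrable lborel f" "f \<in> L2" and a: "0 < a"
  shows "(LINT \<xi>|lborel. std_normal_density (a * \<xi>) * (cmod (FT f \<xi>))\<^sup>2) \<le> sqrt (2 * pi) * (L2_norm f)\<^sup>2"
proof -
  have [measurable]: "f \<in> borel_measurable borel" using f by auto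
  define b where "b = (LINT x|lborel. cmod (f x))"
  have b0: "0 \<le> b" by (simp add: b_def)
  have bF: "cmod (FT f \<xi>) \<le> b" for \<xi> unfolding b_def by (rule FT_bound)
  define \<gamma> where "\<gamma> \<xi> = std_normal_density (a * \<xi>)" for \<xi>
  have [measurable]: "\<gamma> \<in> borel_measurable borel" by (simp add: \<gamma>_def[abs_def])
  have \<gamma>0: "0 \<le> \<gamma> \<xi>" for \<xi> by (simp add: \<gamma>_def)
  have \<gamma>i: "integrable lborel \<gamma>"
    using lborel_integrable_real_affine[of std_normal_density a 0] a by (simp add: \<gamma>_def[abs_def])
  define g where "g t = exp (- ((t / a)\<^sup>2) / 2) / a" for t
  have [measurable]: "g \<in> borel_measurable borel" by (simp add: g_def[abs_def])
  have g0: "0 \<le> g t" for t using a by (simp add: g_def)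
  define H where "H x = (LINT \<xi>|lborel. cis (- (\<xi> * x)) * (of_real (\<gamma> \<xi>) * cnj (FT f \<xi>)))" for x
  have [measurable]: "H \<in> borel_measurable borel" unfolding H_def[abs_def] by measurable
  have H: "H x = (LINT y|lborel. cnj (f y) * of_real (g (y - x)))" for x
  proof -
    have "H x = (LINT \<xi>|lborel. LINT y|lborel.
        of_real (\<gamma> \<xi>) * cis ((y - x) * \<xi>) * cnj (f y))"
      unfolding H_def
    proof (intro Bochner_Integration.integral_cong refl)
      fix \<xi>
      have "cis (- (\<xi> * x)) * (of_real (\<gamma> \<xi>) * cnj (FT f \<xi>))
        = (LINT y|lborel. cis (- (\<xi> * x)) * of_real (\<gamma> \<xi>) * (cis (\<xi> * y) * cnj (f y)))"
        unfolding cnj_FT by (simp add: FT_def)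
      also have "\<dots> = (LINT y|lborel. of_real (\<gamma> \<xi>) * cis ((y - x) * \<xi>) * cnj (f y))"
        by (intro Bochner_Integration.integral_cong refl)
           (simp add: cis_mult algebra_simps)
      finally show "cis (- (\<xi> * x)) * (of_real (\<gamma> \<xi>) * cnj (FT f \<xi>))
        = (LINT y|lborel. of_real (\<gamma> \<xi>) * cis ((y - x) * \<xi>) * cnj (f y))" .
    qed
    also have "\<dots> = (LINT y|lborel. LINT \<xi>|lborel. of_real (\<gamma> \<xi>) * cis ((y - x) * \<xi>) * cnj (f y))"
      by (rule Fubini_dominated(1)[where A=\<gamma> and B="\<lambda>y. cmod (f y)"])
         (use \<gamma>i f \<gamma>0 in \<open>auto simp: norm_mult\<close>)
    also have "\<dots> = (LINT y|lborel. cnj (f y) * of_real (g (y - x)))"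
      by (simp only: integral_mult_left_zero scaled_normal_char[OF a] \<gamma>_def g_def mult.commute[of "cnj _"])
    finally show ?thesis .
  qed
  have "complex_of_real (LINT \<xi>|lborel. \<gamma> \<xi> * (cmod (FT f \<xi>))\<^sup>2)
      = (LINT \<xi>|lborel. LINT x|lborel. cis (- (\<xi> * x)) * f x * (of_real (\<gamma> \<xi>) * cnj (FT f \<xi>)))"
    unfolding integral_complex_of_real[symmetric]
  proof (intro Bochner_Integration.integral_cong refl)
    fix \<xi>
    have "complex_of_real (\<gamma> \<xi> * (cmod (FT f \<xi>))\<^sup>2) = FT f \<xi> * (of_real (\<gamma> \<xi>) * cnj (FT f \<xi>))"
      using complex_norm_square[of "FT f \<xi>"] by simp
    then show "complex_of_real (\<gamma> \<xi> * (cmod (FT f \<xi>))\<^sup>2)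
      = (LINT x|lborel. cis (- (\<xi> * x)) * f x * (of_real (\<gamma> \<xi>) * cnj (FT f \<xi>)))"
      using FT_integrand[OF f(1), of \<xi>] by (simp add: FT_def)
  qed
  also have "\<dots> = (LINT x|lborel. LINT \<xi>|lborel. cis (- (\<xi> * x)) * f x * (of_real (\<gamma> \<xi>) * cnj (FT f \<xi>)))"
  proof (rule Fubini_dominated(1)[where A="\<lambda>\<xi>. \<gamma> \<xi> * b" and B="\<lambda>y. cmod (f y)"])
    fix \<xi> x
    have "\<gamma> \<xi> * cmod (FT f \<xi>) * cmod (f x) \<le> \<gamma> \<xi> * b * cmod (f x)"
      by (intro mult_right_mono mult_left_mono bF \<gamma>0) auto
    then show "cmod (cis (- (\<xi> * x)) * f x * (of_real (\<gamma> \<xi>) * cnj (FT f \<xi>))) \<le> \<gamma> \<xi> * b * cmod (f x)"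
      using \<gamma>0[of \<xi>] by (simp add: norm_mult mult_ac)
  qed (use \<gamma>i f in auto)
  also have "\<dots> = (LINT x|lborel. f x * H x)"
    by (simp add: H_def mult_ac flip: integral_mult_right_zero)
  finally have eq: "complex_of_real (LINT \<xi>|lborel. \<gamma> \<xi> * (cmod (FT f \<xi>))\<^sup>2) = (LINT x|lborel. f x * H x)" .
  have nf: "(\<integral>\<^sup>+x. ennreal ((cmod (f x))\<^sup>2) \<partial>lborel) = ennreal ((L2_norm f)\<^sup>2)"
    unfolding L2_norm_sq by (rule nn_integral_eq_integral) (use f(2) in \<open>auto simp: L2_iff\<close>)
  define S where "S = ennreal (sqrt (2 * pi)) * ennreal ((L2_norm f)\<^sup>2)"
  have S1: "(\<integral>\<^sup>+x. \<integral>\<^sup>+y. ennreal ((cmod (f x))\<^sup>2) * ennreal (g (y - x)) \<partial>lborel \<partial>lborel) = S"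
  proof -
    have "(\<integral>\<^sup>+x. \<integral>\<^sup>+y. ennreal ((cmod (f x))\<^sup>2) * ennreal (g (y - x)) \<partial>lborel \<partial>lborel)
        = (\<integral>\<^sup>+x. ennreal ((cmod (f x))\<^sup>2) * (\<integral>\<^sup>+y. ennreal (g (y - x)) \<partial>lborel) \<partial>lborel)"
      by (intro nn_integral_cong nn_integral_cmult) auto
    also have "\<dots> = (\<integral>\<^sup>+x. ennreal ((cmod (f x))\<^sup>2) * ennreal (sqrt (2 * pi)) \<partial>lborel)"
      using nn_integral_gauss_kernel[OF a] by (simp add: g_def)
    also have "\<dots> = S" using nf by (subst nn_integral_multc) (auto simp: S_def mult.commute)
    finally show ?thesis .
  qed
  have gsym: "g (y - x) = g (x - y)" for x y
    by (simp add: g_def power_divide power2_commute)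
  have S2: "(\<integral>\<^sup>+x. \<integral>\<^sup>+y. ennreal ((cmod (f y))\<^sup>2) * ennreal (g (y - x)) \<partial>lborel \<partial>lborel) = S"
  proof -
    have "(\<integral>\<^sup>+x. \<integral>\<^sup>+y. ennreal ((cmod (f y))\<^sup>2) * ennreal (g (y - x)) \<partial>lborel \<partial>lborel)
      = (\<integral>\<^sup>+y. \<integral>\<^sup>+x. ennreal ((cmod (f y))\<^sup>2) * ennreal (g (y - x)) \<partial>lborel \<partial>lborel)"
      by (rule lborel_pair.Fubini') measurable
    also have "\<dots> = S" using S1 by (subst gsym) simp
    finally show ?thesis .
  qed
  have "ennreal (LINT \<xi>|lborel. \<gamma> \<xi> * (cmod (FT f \<xi>))\<^sup>2) = ennreal (cmod (LINT x|lborel. f x * H x))"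
    unfolding eq[symmetric] using \<gamma>0 by simp
  also have "\<dots> \<le> (\<integral>\<^sup>+x. ennreal (cmod (f x * H x)) \<partial>lborel)"
    by (rule norm_integral_le_nn_integral)
  also have "\<dots> \<le> (\<integral>\<^sup>+x. \<integral>\<^sup>+y. (ennreal ((cmod (f x))\<^sup>2) * ennreal (g (y - x)) + ennreal ((cmod (f y))\<^sup>2)
      * ennreal (g (y - x))) / 2 \<partial>lborel \<partial>lborel)"
  proof (intro nn_integral_mono)
    fix x
    have "ennreal (cmod (f x * H x)) = ennreal (cmod (f x)) * ennreal (cmod (H x))"
      by (simp add: norm_mult ennreal_mult)
    also have "\<dots> \<le> ennreal (cmod (f x)) * (\<integral>\<^sup>+y. ennreal (cmod (cnj (f y) * of_real (g (y - x)))) \<partial>lborel)"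
      unfolding H by (intro mult_left_mono norm_integral_le_nn_integral) auto
    also have "\<dots> = (\<integral>\<^sup>+y. ennreal (cmod (f x)) * ennreal (cmod (cnj (f y) * of_real (g (y - x)))) \<partial>lborel)"
      by (rule nn_integral_cmult[symmetric]) auto
    also have "\<dots> \<le> (\<integral>\<^sup>+y. (ennreal ((cmod (f x))\<^sup>2) * ennreal (g (y - x)) + ennreal ((cmod (f y))\<^sup>2)
        * ennreal (g (y - x))) / 2 \<partial>lborel)"
    proof (intro nn_integral_mono)
      fix y
      have "cmod (f x) * cmod (f y) * g (y - x) \<le> ((cmod (f x))\<^sup>2 + (cmod (f y))\<^sup>2) / 2 * g (y - x)"
        using sum_squares_bound[of "cmod (f x)" "cmod (f y)"] by (intro mult_right_mono g0) simp
      then have "ennreal (cmod (f x) * cmod (f y) * g (y - x))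
          \<le> ennreal (((cmod (f x))\<^sup>2 * g (y - x) + (cmod (f y))\<^sup>2 * g (y - x)) / 2)"
        by (intro ennreal_leI) (simp add: field_simps)
      then show "ennreal (cmod (f x)) * ennreal (cmod (cnj (f y) * of_real (g (y - x))))
        \<le> (ennreal ((cmod (f x))\<^sup>2) * ennreal (g (y - x)) + ennreal ((cmod (f y))\<^sup>2) * ennreal (g (y - x)))
            / 2"
        using g0 by (simp add: norm_mult mult.assoc ennreal_divide_numeral flip: ennreal_mult ennreal_plus)
    qed
    finally show "ennreal (cmod (f x * H x))
        \<le> (\<integral>\<^sup>+y. (ennreal ((cmod (f x))\<^sup>2) * ennreal (g (y - x)) + ennreal ((cmod (f y))\<^sup>2) * ennreal (g (y
            - x))) / 2 \<partial>lborel)" .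
  qed
  also have "\<dots> = (S + S) / 2"
    unfolding divide_ennreal_def
    by (simp add: nn_integral_multc nn_integral_add S1 S2)
  also have "\<dots> = ennreal (sqrt (2 * pi) * (L2_norm f)\<^sup>2)"
    unfolding S_def by (simp add: ennreal_divide_numeral flip: ennreal_mult ennreal_plus)
  finally have "ennreal (LINT \<xi>|lborel. \<gamma> \<xi> * (cmod (FT f \<xi>))\<^sup>2) \<le> ennreal (sqrt (2 * pi) * (L2_norm f)\<^sup>2)"
      .
  then show ?thesis
    by (subst (asm) ennreal_le_iff) (auto simp: \<gamma>_def)
qed

text \<open>The weight flattens as its scale tends to 0, and Fatou applies to its square root times
  the transform. The limit of the weight is \<open>1 / sqrt (2 * pi)\<close>; dividing by it turns
  the factor \<open>sqrt (2 * pi)\<close> of the squared norms into \<open>2 * pi\<close>.\<close>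

lemma FT_Bessel:
  assumes f: "integrable lborel f" "f \<in> L2"
  shows "FT f \<in> L2" "L2_norm (FT f) \<le> sqrt (2 * pi) * L2_norm f"
proof -
  have [measurable]: "f \<in> borel_measurable borel" using f by auto
  define b where "b = (LINT x|lborel. cmod (f x))"
  have bF: "cmod (FT f \<xi>) \<le> b" for \<xi> unfolding b_def by (rule FT_bound)
  define a where "a n = inverse (real (Suc n))" for n
  have a0: "0 < a n" for n by (simp add: a_def)
  have alim: "a \<longlonglongrightarrow> 0" unfolding a_def by (rule LIMSEQ_inverse_real_of_nat)
  define h where "h n \<xi> = of_real (sqrt (std_normal_density (a n * \<xi>))) * FT f \<xi>" for n \<xi>
  have [measurable]: "h n \<in> borel_measurable borel" for n by (simp add: h_def[abs_def])
  have hsq: "(cmod (h n \<xi>))\<^sup>2 = std_normal_density (a n * \<xi>) * (cmod (FT f \<xi>))\<^sup>2" for n \<xi>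
    by (simp add: h_def norm_mult power_mult_distrib)
  have h2: "h n \<in> L2" for n
  proof -
    have "integrable lborel (\<lambda>\<xi>. b\<^sup>2 * std_normal_density (0 + a n * \<xi>))"
      using a0[of n] by (intro integrable_mult_right lborel_integrable_real_affine) auto
    then have "integrable lborel (\<lambda>\<xi>. (cmod (h n \<xi>))\<^sup>2)"
    proof (rule Bochner_Integration.integrable_bound)
      have "(cmod (h n \<xi>))\<^sup>2 \<le> b\<^sup>2 * std_normal_density (0 + a n * \<xi>)" for \<xi>
        unfolding hsq by (subst mult.commute) (auto intro!: mult_right_mono power_mono bF)
      then show "AE \<xi> in lborel. norm ((cmod (h n \<xi>))\<^sup>2) \<le> norm (b\<^sup>2 * std_normal_density (0 + a n * \<xi>))"
        by simp
    qed simp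
    then show ?thesis by (simp add: L2_iff)
  qed
  have hn: "L2_norm (h n) \<le> sqrt (sqrt (2 * pi)) * L2_norm f" for n
  proof (rule power2_le_imp_le)
    show "(L2_norm (h n))\<^sup>2 \<le> (sqrt (sqrt (2 * pi)) * L2_norm f)\<^sup>2"
      using FT_gauss_bound[OF f a0[of n]] unfolding L2_norm_sq[of "h n"] hsq
        by (simp add: power_mult_distrib)
  qed simp
  define c where "c = complex_of_real (sqrt (std_normal_density 0))"
  have lim: "(\<lambda>n. h n \<xi>) \<longlonglongrightarrow> c * FT f \<xi>" for \<xi>
  proof -
    have "(\<lambda>n. std_normal_density (a n * \<xi>)) \<longlonglongrightarrow> std_normal_density (0 * \<xi>)"
      unfolding std_normal_density_def by (intro tendsto_intros alim) auto
    then show ?thesis unfolding h_def c_def by (intro tendsto_intros) simp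
  qed
  have m: "(\<lambda>\<xi>. c * FT f \<xi>) \<in> borel_measurable borel" by measurable
  have c0: "c \<noteq> 0" "cmod c = 1 / sqrt (sqrt (2 * pi))"
    by (auto simp: c_def std_normal_density_def real_sqrt_divide norm_divide)
  have c: "(\<lambda>\<xi>. c * FT f \<xi>) \<in> L2" "L2_norm (\<lambda>\<xi>. c * FT f \<xi>) \<le> sqrt (sqrt (2 * pi)) * L2_norm f"
    using L2_Fatou[OF h2 m AE_I2[OF lim] hn] by auto
  show "FT f \<in> L2" using L2_cmult[OF c(1), of "1 / c"] c0 by simp
  have "L2_norm (FT f) / sqrt (sqrt (2 * pi)) \<le> sqrt (sqrt (2 * pi)) * L2_norm f"
    using c(2) c0(2) by (simp add: L2_norm_cmult)
  then have "L2_norm (FT f) \<le> sqrt (sqrt (2 * pi)) * L2_norm f * sqrt (sqrt (2 * pi))"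
    by (subst (asm) pos_divide_le_eq) auto
  also have "\<dots> = (sqrt (sqrt (2 * pi)) * sqrt (sqrt (2 * pi))) * L2_norm f" by (simp only: mult_ac)
  also have "\<dots> = sqrt (2 * pi) * L2_norm f" by (subst real_sqrt_mult_self) auto
  finally show "L2_norm (FT f) \<le> sqrt (2 * pi) * L2_norm f" .
qed

section \<open>Truncation and the extension of the transform to \<open>L2\<close>\<close>

lemma trunc_measurable [measurable]:
  "f \<in> borel_measurable borel \<Longrightarrow> trunc R f \<in> borel_measurable borel"
  by (simp add: trunc_def[abs_def])

lemma indicator_Icc_L2: "(\<lambda>x. indicator {a..b::real} x :: complex) \<in> L2"
proof -
  have "integrable lborel (\<lambda>x. indicator {a..b} x :: real)"
    by (rule integrable_real_indicator) (auto simp: emeasure_lborel_Icc_eq)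
  moreover have "(\<lambda>x. (cmod (indicator {a..b} x))\<^sup>2) = (\<lambda>x. indicator {a..b} x :: real)"
    by (auto simp: indicator_def)
  ultimately show ?thesis by (simp add: L2_iff)
qed

lemma indicator_Icc_integrable: "integrable lborel (\<lambda>x. indicator {a..b::real} x :: complex)"
  using L2_mult_integrable[OF indicator_Icc_L2[of a b] indicator_Icc_L2[of a b]]
  by (simp flip: indicator_inter_arith)

lemma trunc_L2:
  assumes "f \<in> L2" shows "trunc R f \<in> L2" "integrable lborel (trunc R f)"
proof -
  have m: "trunc R f \<in> borel_measurable borel" using assms by measurable
  show "trunc R f \<in> L2"
    by (rule L2_dominated[OF assms m, of 1]) (auto simp: trunc_def indicator_def)
  show "integrable lborel (trunc R f)"
    unfolding trunc_def[abs_def] by (rule L2_mult_integrable[OF indicator_Icc_L2 assms])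
qed

lemma trunc_tendsto:
  assumes "f \<in> L2" shows "((\<lambda>R. L2_norm (\<lambda>x. trunc R f x - f x)) \<longlongrightarrow> 0) at_top"
proof -
  have [measurable]: "f \<in> borel_measurable borel" using assms by measurable
  have "((\<lambda>R. LINT x|lborel. (cmod (trunc R f x - f x))\<^sup>2) \<longlongrightarrow> (LINT x|(lborel :: real measure). (0::real)))
      at_top"
  proof (rule integral_dominated_convergence_at_top[where w="\<lambda>x. (cmod (f x))\<^sup>2"])
    show "integrable lborel (\<lambda>x. (cmod (f x))\<^sup>2)" using assms by (simp add: L2_iff)
    show "AE x in lborel. ((\<lambda>R. (cmod (trunc R f x - f x))\<^sup>2) \<longlongrightarrow> 0) at_top"
    proof (rule AE_I2)
      fix x
      have "eventually (\<lambda>R. (cmod (trunc R f x - f x))\<^sup>2 = 0) at_top"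
        using eventually_ge_at_top[of "\<bar>x\<bar>"]
        by eventually_elim (auto simp: trunc_def indicator_def)
      then show "((\<lambda>R. (cmod (trunc R f x - f x))\<^sup>2) \<longlongrightarrow> 0) at_top"
        by (rule tendsto_eventually)
    qed
  qed (auto simp: trunc_def indicator_def)
  then have "((\<lambda>R. sqrt (LINT x|lborel. (cmod (trunc R f x - f x))\<^sup>2)) \<longlongrightarrow> sqrt 0) at_top"
    by (intro tendsto_real_sqrt) simp
  then show ?thesis by (simp add: L2_norm_def)
qed

lemma trunc_tendsto_nat:
  "f \<in> L2 \<Longrightarrow> (\<lambda>n. L2_norm (\<lambda>x. trunc (real n) f x - f x)) \<longlonglongrightarrow> 0"
  by (rule filterlim_compose[OF trunc_tendsto filterlim_real_sequentially])

lemma FT_diff_Bessel: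
  assumes "f \<in> L2" "integrable lborel f" "g \<in> L2" "integrable lborel g"
  shows "L2_norm (\<lambda>\<xi>. FT f \<xi> - FT g \<xi>) \<le> sqrt (2 * pi) * L2_norm (\<lambda>x. f x - g x)"
proof -
  have "FT (\<lambda>x. f x - g x) = (\<lambda>\<xi>. FT f \<xi> - FT g \<xi>)" by (intro ext FT_diff assms)
  then show ?thesis using FT_Bessel(2)[of "\<lambda>x. f x - g x"] assms by (simp add: L2_diff)
qed

text \<open>Bessel's inequality makes every integral in the definition finite, so the condition can
  be read as convergence of \<open>L2_norm\<close>.\<close>

lemma has_fourier_iff:
  assumes "f \<in> L2"
  shows "has_fourier f g \<longleftrightarrow> g \<in> L2 \<and> ((\<lambda>R. L2_norm (\<lambda>\<xi>. FT (trunc R f) \<xi> - g \<xi>)) \<longlongrightarrow> 0) at_top"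
proof -
  have eq: "(LINT x:{-R..R}|lborel. exp (- (\<i> * of_real (\<xi> * x))) * f x) = FT (trunc R f) \<xi>" for R \<xi>
    unfolding set_lebesgue_integral_def FT_def trunc_def exp_minus_i_eq_cis
    by (intro Bochner_Integration.integral_cong) (auto simp: indicator_def)
  have "((\<lambda>R. \<integral>\<^sup>+ \<xi>. ennreal ((cmod (g \<xi> - FT (trunc R f) \<xi>))\<^sup>2) \<partial>lborel) \<longlongrightarrow> 0) at_top
    \<longleftrightarrow> ((\<lambda>R. L2_norm (\<lambda>\<xi>. FT (trunc R f) \<xi> - g \<xi>)) \<longlongrightarrow> 0) at_top" if g: "g \<in> L2"
  proof -
    have "(\<integral>\<^sup>+ \<xi>. ennreal ((cmod (g \<xi> - FT (trunc R f) \<xi>))\<^sup>2) \<partial>lborel)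
      = ennreal ((L2_norm (\<lambda>\<xi>. FT (trunc R f) \<xi> - g \<xi>))\<^sup>2)" for R
      unfolding L2_norm_sq norm_minus_commute[of "g _"]
      by (rule nn_integral_eq_integral)
         (use L2_diff[OF FT_Bessel(1)[OF trunc_L2(2)[OF assms] trunc_L2(1)[OF assms]] g] in \<open>auto simp:
             L2_iff\<close>)
    moreover have "((\<lambda>R. ennreal ((L2_norm (\<lambda>\<xi>. FT (trunc R f) \<xi> - g \<xi>))\<^sup>2)) \<longlongrightarrow> ennreal 0) at_top
      \<longleftrightarrow> ((\<lambda>R. (L2_norm (\<lambda>\<xi>. FT (trunc R f) \<xi> - g \<xi>))\<^sup>2) \<longlongrightarrow> 0) at_top"
      by (rule tendsto_ennreal_iff) auto
    moreover have "((\<lambda>R. (L2_norm (\<lambda>\<xi>. FT (trunc R f) \<xi> - g \<xi>))\<^sup>2) \<longlongrightarrow> 0) at_top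
      \<longleftrightarrow> ((\<lambda>R. L2_norm (\<lambda>\<xi>. FT (trunc R f) \<xi> - g \<xi>)) \<longlongrightarrow> 0) at_top"
    proof
      assume "((\<lambda>R. (L2_norm (\<lambda>\<xi>. FT (trunc R f) \<xi> - g \<xi>))\<^sup>2) \<longlongrightarrow> 0) at_top"
      from tendsto_real_sqrt[OF this] show "((\<lambda>R. L2_norm (\<lambda>\<xi>. FT (trunc R f) \<xi> - g \<xi>)) \<longlongrightarrow> 0) at_top"
        by simp
    next
      assume "((\<lambda>R. L2_norm (\<lambda>\<xi>. FT (trunc R f) \<xi> - g \<xi>)) \<longlongrightarrow> 0) at_top"
      from tendsto_power[OF this, of 2] show "((\<lambda>R. (L2_norm (\<lambda>\<xi>. FT (trunc R f) \<xi> - g \<xi>))\<^sup>2) \<longlongrightarrow> 0) at_top"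
        by simp
    qed
    ultimately show ?thesis by simp
  qed
  then show ?thesis unfolding has_fourier_def eq by blast
qed

lemma has_fourier_ex:
  assumes f: "f \<in> L2"
  shows "\<exists>g. has_fourier f g"
proof -
  let ?F = "\<lambda>n::nat. FT (trunc (real n) f)"
  have F2: "FT (trunc R f) \<in> L2" for R by (intro FT_Bessel trunc_L2 f)
  let ?C = "sqrt (2 * pi)"
  have C: "0 < ?C" by simp
  have dist: "L2_norm (\<lambda>\<xi>. FT (trunc R f) \<xi> - FT (trunc S f) \<xi>)
      \<le> ?C * (L2_norm (\<lambda>x. trunc R f x - f x) + L2_norm (\<lambda>x. trunc S f x - f x))" for R S
  proof -
    have "L2_norm (\<lambda>\<xi>. FT (trunc R f) \<xi> - FT (trunc S f) \<xi>) \<le> ?C * L2_norm (\<lambda>x. trunc R f x - trunc S f x)"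
      by (intro FT_diff_Bessel trunc_L2 f)
    also have "L2_norm (\<lambda>x. trunc R f x - trunc S f x) \<le> L2_norm (\<lambda>x. trunc R f x - f x)
        + L2_norm (\<lambda>x. trunc S f x - f x)"
      using L2_triangle[OF trunc_L2(1)[OF f] f trunc_L2(1)[OF f]] L2_norm_diff_commute[of f] by metis
    finally show ?thesis using C by simp
  qed
  obtain g where g: "g \<in> L2" "(\<lambda>n. L2_norm (\<lambda>x. ?F n x - g x)) \<longlonglongrightarrow> 0"
  proof (rule L2_complete[of ?F])
    show "?F n \<in> L2" for n by (rule F2)
    fix e :: real assume e: "0 < e"
    then have "eventually (\<lambda>n. L2_norm (\<lambda>x. trunc (real n) f x - f x) < e / (2 * ?C)) sequentially"
      using order_tendstoD(2)[OF trunc_tendsto_nat[OF f]] C by simp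
    then obtain N where N: "\<And>n. n \<ge> N \<Longrightarrow> L2_norm (\<lambda>x. trunc (real n) f x - f x) < e / (2 * ?C)"
      unfolding eventually_sequentially by blast
    show "\<exists>N. \<forall>m\<ge>N. \<forall>n\<ge>N. L2_norm (\<lambda>x. ?F m x - ?F n x) < e"
    proof (intro exI allI impI)
      fix m n assume "N \<le> m" "N \<le> n"
      then have "L2_norm (\<lambda>x. trunc (real m) f x - f x) + L2_norm (\<lambda>x. trunc (real n) f x - f x) < e / ?C"
        using N[of m] N[of n] by (simp add: field_simps)
      then have "?C * (L2_norm (\<lambda>x. trunc (real m) f x - f x) + L2_norm (\<lambda>x. trunc (real n) f x - f x)) < e"
        by (subst (asm) pos_less_divide_eq[OF C]) (simp only: mult.commute)
      then show "L2_norm (\<lambda>x. ?F m x - ?F n x) < e" using dist[of "real m" "real n"] by linarith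
    qed
  qed blast
  \<comment> \<open>The limit \<open>g\<close> was found along integers only. For fixed real
    \<open>R\<close>, letting \<open>n\<close> tend to infinity bounds the error at \<open>R\<close>
    by the truncation error alone, which gives convergence along all real \<open>R\<close>.\<close>
  have "L2_norm (\<lambda>\<xi>. FT (trunc R f) \<xi> - g \<xi>) \<le> ?C * L2_norm (\<lambda>x. trunc R f x - f x)" for R
  proof -
    let ?b = "\<lambda>n. ?C * (L2_norm (\<lambda>x. trunc R f x - f x) + L2_norm (\<lambda>x. trunc (real n) f x - f x))
        + L2_norm (\<lambda>x. ?F n x - g x)"
    have "?b \<longlonglongrightarrow> ?C * (L2_norm (\<lambda>x. trunc R f x - f x) + 0) + 0"
      by (intro tendsto_intros trunc_tendsto_nat f g)
    moreover have "L2_norm (\<lambda>\<xi>. FT (trunc R f) \<xi> - g \<xi>) \<le> ?b n" for n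
      using L2_triangle[OF F2[of R] F2[of "real n"] g(1)] dist[of R "real n"] by linarith
    ultimately show ?thesis by (intro tendsto_lowerbound[where F=sequentially]) auto
  qed
  then have "((\<lambda>R. L2_norm (\<lambda>\<xi>. FT (trunc R f) \<xi> - g \<xi>)) \<longlongrightarrow> 0) at_top"
    by (intro tendsto_0_le[OF trunc_tendsto[OF f], of _ ?C] always_eventually) (auto simp: mult.commute)
  with g(1) show ?thesis using has_fourier_iff[OF f] by blast
qed

lemma has_fourier_fourier: "f \<in> L2 \<Longrightarrow> has_fourier f (fourier f)"
  unfolding fourier_def by (rule someI_ex[OF has_fourier_ex])

lemma fourier_L2 [intro]: "f \<in> L2 \<Longrightarrow> fourier f \<in> L2"
  using has_fourier_fourier has_fourier_iff by blast

lemma fourier_tendsto: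
  assumes "f \<in> L2"
  shows "(\<lambda>n. L2_norm (\<lambda>\<xi>. FT (trunc (real n) f) \<xi> - fourier f \<xi>)) \<longlonglongrightarrow> 0"
  using has_fourier_fourier[OF assms] has_fourier_iff[OF assms]
  by (intro filterlim_compose[OF _ filterlim_real_sequentially]) auto

text \<open>An equality of functions, not only almost everywhere: the predicate
  \<open>has_fourier f\<close> ignores null sets, so the choice operator meets the same predicate on
  both sides.\<close>

lemma fourier_cong_AE:
  assumes "f \<in> borel_measurable borel" "g \<in> borel_measurable borel" "AE x in lborel. f x = g x"
  shows "fourier f = fourier g"
proof -
  have "(LINT x:{-R..R}|lborel. exp (- (\<i> * of_real (\<xi> * x))) * f x)
      = (LINT x:{-R..R}|lborel. exp (- (\<i> * of_real (\<xi> * x))) * g x)" for R \<xi>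
    unfolding set_lebesgue_integral_def exp_minus_i_eq_cis using assms by (intro integral_cong_AE) auto
  then have "has_fourier f = has_fourier g" by (simp add: has_fourier_def fun_eq_iff)
  then show ?thesis by (simp add: fourier_def)
qed

text \<open>Frees the transform from sharp truncations: any integrable approximation of
  \<open>f\<close> in \<open>L2\<close>, such as a smooth cutoff or a translated truncation,
  computes \<open>fourier f\<close> up to its own error.\<close>

lemma fourier_near_FT:
  assumes f: "f \<in> L2" and h: "h \<in> L2" "integrable lborel h"
  shows "L2_norm (\<lambda>\<xi>. FT h \<xi> - fourier f \<xi>) \<le> sqrt (2 * pi) * L2_norm (\<lambda>x. h x - f x)"
proof -
  let ?C = "sqrt (2 * pi)"
  let ?b = "\<lambda>n. ?C * (L2_norm (\<lambda>x. h x - f x) + L2_norm (\<lambda>x. trunc (real n) f x - f x))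
      + L2_norm (\<lambda>\<xi>. FT (trunc (real n) f) \<xi> - fourier f \<xi>)"
  have "?b \<longlonglongrightarrow> ?C * (L2_norm (\<lambda>x. h x - f x) + 0) + 0"
    by (intro tendsto_intros trunc_tendsto_nat f fourier_tendsto)
  moreover have "L2_norm (\<lambda>\<xi>. FT h \<xi> - fourier f \<xi>) \<le> ?b n" for n
  proof -
    let ?t = "trunc (real n) f"
    have "L2_norm (\<lambda>\<xi>. FT h \<xi> - fourier f \<xi>) \<le> L2_norm (\<lambda>\<xi>. FT h \<xi> - FT ?t \<xi>) + L2_norm (\<lambda>\<xi>. FT ?t \<xi>
        - fourier f \<xi>)"
      by (intro L2_triangle FT_Bessel trunc_L2 fourier_L2 f h)
    moreover have "L2_norm (\<lambda>\<xi>. FT h \<xi> - FT ?t \<xi>) \<le> ?C * L2_norm (\<lambda>x. h x - ?t x)"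
      by (intro FT_diff_Bessel trunc_L2 f h)
    moreover have "L2_norm (\<lambda>x. h x - ?t x) \<le> L2_norm (\<lambda>x. h x - f x) + L2_norm (\<lambda>x. ?t x - f x)"
      using L2_triangle[OF h(1) f trunc_L2(1)[OF f]] L2_norm_diff_commute[of f] by metis
    then have "?C * L2_norm (\<lambda>x. h x - ?t x) \<le> ?C * (L2_norm (\<lambda>x. h x - f x) + L2_norm (\<lambda>x. ?t x - f x))"
      by simp
    ultimately show ?thesis by linarith
  qed
  ultimately show ?thesis by (intro tendsto_lowerbound[where F=sequentially]) auto
qed

lemma fourier_eq_FT:
  assumes "f \<in> L2" "integrable lborel f" shows "AE \<xi> in lborel. fourier f \<xi> = FT f \<xi>"
proof -
  have d: "(\<lambda>\<xi>. FT f \<xi> - fourier f \<xi>) \<in> L2" by (intro L2_diff FT_Bessel fourier_L2 assms)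
  have "L2_norm (\<lambda>\<xi>. FT f \<xi> - fourier f \<xi>) \<le> 0" using fourier_near_FT[OF assms(1) assms] by simp
  then have "L2_norm (\<lambda>\<xi>. FT f \<xi> - fourier f \<xi>) = 0" using L2_norm_nonneg order_antisym by blast
  from L2_norm_eq_0[OF d this] show ?thesis by eventually_elim simp
qed

lemma fourier_Bessel:
  assumes "f \<in> L2" shows "L2_norm (fourier f) \<le> sqrt (2 * pi) * L2_norm f"
proof -
  have "(\<lambda>n. L2_norm (FT (trunc (real n) f))) \<longlonglongrightarrow> L2_norm (fourier f)"
    by (intro L2_norm_tendsto FT_Bessel trunc_L2 fourier_L2 fourier_tendsto assms)
  moreover have "L2_norm (FT (trunc (real n) f)) \<le> sqrt (2 * pi) * L2_norm f" for n
  proof -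
    have "L2_norm (trunc (real n) f) \<le> 1 * L2_norm f"
      by (rule L2_norm_mono) (use assms in \<open>auto simp: trunc_def[abs_def] indicator_def\<close>)
    then have "sqrt (2 * pi) * L2_norm (trunc (real n) f) \<le> sqrt (2 * pi) * L2_norm f" by simp
    then show ?thesis using FT_Bessel(2)[OF trunc_L2(2)[OF assms] trunc_L2(1)[OF assms], of "real n"]
        by linarith
  qed
  ultimately show ?thesis by (intro tendsto_upperbound[where F=sequentially]) auto
qed

lemma fourier_add_cmult:
  assumes f: "f \<in> L2" and g: "g \<in> L2"
  shows "AE \<xi> in lborel. fourier (\<lambda>x. f x + c * g x) \<xi> = fourier f \<xi> + c * fourier g \<xi>"
proof (rule L2_limit_AE_unique[where F=sequentially])
  let ?t = "\<lambda>n. trunc (real n)"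
  let ?h = "\<lambda>x. f x + c * g x"
  have h: "?h \<in> L2" by (intro L2_add L2_cmult f g)
  show "FT (?t n ?h) \<in> L2" for n by (intro FT_Bessel trunc_L2 h)
  show "fourier ?h \<in> L2" "(\<lambda>\<xi>. fourier f \<xi> + c * fourier g \<xi>) \<in> L2"
    by (intro fourier_L2 L2_add L2_cmult f g)+
  show "(\<lambda>n. L2_norm (\<lambda>\<xi>. FT (?t n ?h) \<xi> - fourier ?h \<xi>)) \<longlonglongrightarrow> 0" by (rule fourier_tendsto[OF h])
  have "FT (?t n ?h) \<xi> = FT (?t n f) \<xi> + c * FT (?t n g) \<xi>" for n \<xi>
  proof -
    have "?t n ?h = (\<lambda>x. ?t n f x + c * ?t n g x)" by (auto simp: trunc_def algebra_simps)
    then show ?thesis using trunc_L2(2)[OF f] trunc_L2(2)[OF g] by (simp add: FT_add FT_cmult)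
  qed
  then have eq: "(\<lambda>\<xi>. FT (?t n ?h) \<xi> - (fourier f \<xi> + c * fourier g \<xi>))
      = (\<lambda>\<xi>. (FT (?t n f) \<xi> - fourier f \<xi>) + c * (FT (?t n g) \<xi> - fourier g \<xi>))" for n
    by (simp add: algebra_simps)
  have "L2_norm (\<lambda>\<xi>. FT (?t n ?h) \<xi> - (fourier f \<xi> + c * fourier g \<xi>))
      \<le> L2_norm (\<lambda>\<xi>. FT (?t n f) \<xi> - fourier f \<xi>) + cmod c * L2_norm (\<lambda>\<xi>. FT (?t n g) \<xi> - fourier g
          \<xi>)" for n
    unfolding eq L2_norm_cmult[symmetric]
    by (intro L2_Minkowski L2_cmult L2_diff FT_Bessel trunc_L2 fourier_L2 f g)
  moreover have "(\<lambda>n. L2_norm (\<lambda>\<xi>. FT (?t n f) \<xi> - fourier f \<xi>) + cmod c * L2_norm (\<lambda>\<xi>. FT (?t n g) \<xi>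
      - fourier g \<xi>)) \<longlonglongrightarrow> 0 + cmod c * 0"
    by (intro tendsto_intros fourier_tendsto f g)
  then have "(\<lambda>n. L2_norm (\<lambda>\<xi>. FT (?t n f) \<xi> - fourier f \<xi>) + cmod c * L2_norm (\<lambda>\<xi>. FT (?t n g) \<xi>
      - fourier g \<xi>)) \<longlonglongrightarrow> 0" by simp
  ultimately show "(\<lambda>n. L2_norm (\<lambda>\<xi>. FT (?t n ?h) \<xi> - (fourier f \<xi> + c * fourier g \<xi>))) \<longlonglongrightarrow> 0"
    by - (rule tendsto_0_squeeze[OF L2_norm_nonneg], assumption+)
qed simp

lemma fourier_diff:
  assumes "f \<in> L2" "g \<in> L2"
  shows "AE \<xi> in lborel. fourier (\<lambda>x. f x - g x) \<xi> = fourier f \<xi> - fourier g \<xi>"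
  using fourier_add_cmult[OF assms, of "-1"] by simp

lemma fourier_diff_Bessel:
  assumes "f \<in> L2" "g \<in> L2"
  shows "L2_norm (\<lambda>\<xi>. fourier f \<xi> - fourier g \<xi>) \<le> sqrt (2 * pi) * L2_norm (\<lambda>x. f x - g x)"
proof -
  have [measurable]: "fourier f \<in> borel_measurable borel" "fourier g \<in> borel_measurable borel"
      "fourier (\<lambda>x. f x - g x) \<in> borel_measurable borel"
    using fourier_L2[OF assms(1)] fourier_L2[OF assms(2)] fourier_L2[OF L2_diff[OF assms]] by auto
  have "L2_norm (\<lambda>\<xi>. fourier f \<xi> - fourier g \<xi>) = L2_norm (fourier (\<lambda>x. f x - g x))"
    by (rule L2_norm_cong_AE) (use fourier_diff[OF assms] in auto)
  then show ?thesis using fourier_Bessel[OF L2_diff[OF assms]] by simp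
qed

lemma fourier_tendsto_L2:
  assumes "\<And>n. f n \<in> L2" "g \<in> L2" "((\<lambda>n. L2_norm (\<lambda>x. f n x - g x)) \<longlongrightarrow> 0) F"
  shows "((\<lambda>n. L2_norm (\<lambda>\<xi>. fourier (f n) \<xi> - fourier g \<xi>)) \<longlongrightarrow> 0) F"
  by (rule tendsto_0_le[OF assms(3), of _ "sqrt (2 * pi)"])
     (use fourier_diff_Bessel[OF assms(1,2)] in \<open>auto simp: mult.commute\<close>)

lemma fourier_mult_L1:
  assumes f: "f \<in> L2" "integrable lborel f" and g: "g \<in> L2" "integrable lborel g"
  shows "(LINT \<xi>|lborel. fourier f \<xi> * g \<xi>) = (LINT x|lborel. f x * fourier g x)"
proof -
  have [measurable]: "f \<in> borel_measurable borel" "g \<in> borel_measurable borel" using f g by auto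
  have [measurable]: "fourier f \<in> borel_measurable borel" "fourier g \<in> borel_measurable borel"
    using fourier_L2[OF f(1)] fourier_L2[OF g(1)] by auto
  have "(LINT \<xi>|lborel. fourier f \<xi> * g \<xi>) = (LINT \<xi>|lborel. FT f \<xi> * g \<xi>)"
    by (rule integral_cong_AE) (use fourier_eq_FT[OF f] in auto)
  also have "\<dots> = (LINT \<xi>|lborel. LINT x|lborel. cis (- (\<xi> * x)) * f x * g \<xi>)"
    by (simp add: FT_def)
  also have "\<dots> = (LINT x|lborel. LINT \<xi>|lborel. cis (- (\<xi> * x)) * f x * g \<xi>)"
    by (rule Fubini_dominated(1)[where A="\<lambda>x. cmod (g x)" and B="\<lambda>y. cmod (f y)"])
       (use f g in \<open>auto simp: norm_mult\<close>)
  also have "\<dots> = (LINT x|lborel. f x * FT g x)"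
  proof (intro Bochner_Integration.integral_cong refl)
    fix x
    have "f x * FT g x = (LINT \<xi>|lborel. f x * (cis (- (x * \<xi>)) * g \<xi>))" by (simp add: FT_def)
    then show "(LINT \<xi>|lborel. cis (- (\<xi> * x)) * f x * g \<xi>) = f x * FT g x"
        by (metis (no_types, lifting) Bochner_Integration.integral_cong mult.commute mult.left_commute)
  qed
  also have "\<dots> = (LINT x|lborel. f x * fourier g x)"
    by (rule integral_cong_AE) (use fourier_eq_FT[OF g] in auto)
  finally show ?thesis .
qed

text \<open>Fubini gives the formula for integrable functions; the two factors are then approximated
  one at a time, because both transforms are continuous in norm.\<close>

lemma fourier_mult:
  assumes f: "f \<in> L2" and g: "g \<in> L2"
  shows "(LINT \<xi>|lborel. fourier f \<xi> * g \<xi>) = (LINT x|lborel. f x * fourier g x)"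
proof -
  have *: "(LINT \<xi>|lborel. fourier f \<xi> * g \<xi>) = (LINT x|lborel. f x * fourier g x)"
    if f: "f \<in> L2" and g: "g \<in> L2" "integrable lborel g" for f g
  proof (rule LIMSEQ_unique)
    let ?f = "\<lambda>n. trunc (real n) f"
    note t = trunc_L2[OF f] trunc_tendsto_nat[OF f]
    show "(\<lambda>n. LINT \<xi>|lborel. fourier (?f n) \<xi> * g \<xi>) \<longlonglongrightarrow> (LINT \<xi>|lborel. fourier f \<xi> * g \<xi>)"
      by (intro L2_integral_mult_tendsto fourier_tendsto_L2 fourier_L2 t f g)
    show "(\<lambda>n. LINT \<xi>|lborel. fourier (?f n) \<xi> * g \<xi>) \<longlonglongrightarrow> (LINT x|lborel. f x * fourier g x)"
      unfolding fourier_mult_L1[OF t(1,2) g]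
      by (intro L2_integral_mult_tendsto fourier_L2 t f g)
  qed
  show ?thesis
  proof (rule LIMSEQ_unique)
    let ?g = "\<lambda>n. trunc (real n) g"
    note t = trunc_L2[OF g] trunc_tendsto_nat[OF g]
    have "(\<lambda>n. LINT \<xi>|lborel. ?g n \<xi> * fourier f \<xi>) \<longlonglongrightarrow> (LINT \<xi>|lborel. g \<xi> * fourier f \<xi>)"
      by (intro L2_integral_mult_tendsto fourier_L2 t f g)
    then show "(\<lambda>n. LINT \<xi>|lborel. fourier f \<xi> * ?g n \<xi>) \<longlonglongrightarrow> (LINT \<xi>|lborel. fourier f \<xi> * g \<xi>)"
      by (simp add: mult.commute)
    have "(\<lambda>n. LINT \<xi>|lborel. fourier (?g n) \<xi> * f \<xi>) \<longlonglongrightarrow> (LINT \<xi>|lborel. fourier g \<xi> * f \<xi>)"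
      by (intro L2_integral_mult_tendsto fourier_tendsto_L2 fourier_L2 t f g)
    then show "(\<lambda>n. LINT \<xi>|lborel. fourier f \<xi> * ?g n \<xi>) \<longlonglongrightarrow> (LINT x|lborel. f x * fourier g x)"
      unfolding *[OF f t(1,2)] by (simp add: mult.commute)
  qed
qed

text \<open>On each window from \<open>- n\<close> to \<open>n\<close> the sets over which
  \<open>D\<close> has integral 0 form a Dynkin system that contains the intervals, hence all Borel
  sets.\<close>

lemma AE_0_if_interval_integrals_0:
  fixes D :: "real \<Rightarrow> complex"
  assumes D: "\<And>n::nat. integrable lborel (\<lambda>x. indicator {-real n..real n} x *\<^sub>R D x)"
    and 0: "\<And>a b. a \<le> b \<Longrightarrow> (LINT x|lborel. indicator {a..b} x *\<^sub>R D x) = 0"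
  shows "AE x in lborel. D x = 0"
proof -
  have "AE x in lborel. indicator {-real n..real n} x *\<^sub>R D x = 0" for n :: nat
  proof (rule sigma_finite_measure.density_zero[OF lborel.sigma_finite_measure_axioms D])
    let ?D = "\<lambda>x. indicator {-real n..real n} x *\<^sub>R D x"
    have int: "integrable lborel (\<lambda>x. indicator A x *\<^sub>R ?D x)" if "A \<in> sets borel" for A
      using integrable_mult_indicator[OF _ D[of n], of A] that by simp
    fix A :: "real set" assume "A \<in> sets lborel"
    then have "A \<in> sets borel" by simp
    then show "set_lebesgue_integral lborel A ?D = 0"
      unfolding set_lebesgue_integral_def
    proof (induction rule: borel_set_induct)
      case empty
      then show ?case by simp
    next
      case (interval a b)
      have "(\<lambda>x. indicator {a..b} x *\<^sub>R ?D x)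
          = (\<lambda>x. indicator {max a (- real n)..min b (real n)} x *\<^sub>R D x)"
        by (auto simp: indicator_def)
      then show ?case using 0[of "max a (- real n)" "min b (real n)"]
        by (cases "max a (- real n) \<le> min b (real n)") auto
    next
      case (compl A)
      have *: "indicator (- A) x *\<^sub>R ?D x = ?D x - indicator A x *\<^sub>R ?D x" for x
        by (auto simp: indicator_def)
      \<comment> \<open>The window itself is an interval, so the total integral vanishes and
        complements are covered.\<close>
      have "(LINT x|lborel. ?D x) = 0" by (rule 0) simp
      then show ?case unfolding *
        using compl.IH by (subst Bochner_Integration.integral_diff[OF D int[OF compl.hyps]]) simp
    next
      case (union f)
      have fm: "f i \<in> sets lborel" for i using union.hyps by auto
      have "set_integrable lborel (\<Union>(range f)) ?D"
        unfolding set_integrable_def using fm by (intro int) auto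
      then have "set_lebesgue_integral lborel (\<Union>(range f)) ?D = (\<Sum>i. set_lebesgue_integral lborel (f i) ?D)"
        using union.hyps(1) by (intro lebesgue_integral_countable_add fm) (auto simp:
          disjoint_family_on_def)
      then show ?case using union.IH by (simp only: set_lebesgue_integral_def suminf_zero)
    qed
  qed
  then have "AE x in lborel. \<forall>n::nat. indicator {-real n..real n} x *\<^sub>R D x = 0"
    unfolding AE_all_countable by blast
  then show ?thesis
  proof eventually_elim
    case (elim x)
    obtain n :: nat where "\<bar>x\<bar> \<le> real n" using real_arch_simple by blast
    then show ?case using elim[rule_format, of n] by (auto simp: indicator_def abs_le_iff)
  qed
qed

section \<open>Dirichlet kernels and the sine integral\<close>

lemma integral_cis_Icc:
  assumes "0 \<le> N"
  shows "(LINT \<xi>|lborel. indicator {-N..N} \<xi> *\<^sub>R cis (- (\<xi> * t))) = of_real (2 * N * sinc (N * t))"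
proof (cases "t = 0")
  case True
  have "(LINT \<xi>|lborel. indicator {-N..N} \<xi> *\<^sub>R (1::complex)) = of_real (2 * N) - of_real 0"
    using assms integral_FTC_atLeastAtMost[of "-N" N "\<lambda>x. complex_of_real x" "\<lambda>_. 1"]
    by (auto intro!: derivative_eq_intros simp: has_vector_derivative_of_real scaleR_conv_of_real)
  then show ?thesis using True by simp
next
  case False
  define F where "F \<xi> = \<i> / of_real t * cis (- t * \<xi>)" for \<xi>
  have "(F has_vector_derivative cis (- (\<xi> * t))) (at \<xi> within S)" for \<xi> S
  proof -
    have "(F has_vector_derivative (\<i> / of_real t * (\<i> * of_real (- t) * cis (- t * \<xi>)))) (at \<xi> within S)"
      unfolding F_def by (intro has_vector_derivative_mult_right has_vector_derivative_cis_mult)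
    then show ?thesis using False by (simp add: mult_ac field_simps)
  qed
  then have "(LINT \<xi>|lborel. indicator {-N..N} \<xi> *\<^sub>R cis (- (\<xi> * t))) = F N - F (- N)"
    using assms by (intro integral_FTC_atLeastAtMost) (auto intro!: continuous_intros)
  also have "\<dots> = of_real (2 * sin (N * t) / t)"
    by (simp add: F_def complex_eq_iff cis.ctr mult.commute)
  also have "2 * sin (N * t) / t = 2 * N * sinc (N * t)"
    using False by (cases "N = 0") auto
  finally show ?thesis .
qed

lemma integral_sinc_Icc:
  assumes "a \<le> b"
  shows "(LINT x|lborel. indicator {a..b} x *\<^sub>R complex_of_real (2 * N * sinc (N * (x + y))))
    = of_real (2 * (Si (N * (b + y)) - Si (N * (a + y))))"
proof -
  have "((\<lambda>x. complex_of_real (2 * Si (N * (x + y)))) has_vector_derivative of_real (2 * N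
      * sinc (N * (x + y)))) (at x within S)" for x S
  proof -
    have "((\<lambda>x. 2 * Si (N * (x + y))) has_real_derivative 2 * N * sinc (N * (x + y))) (at x within S)"
      by (rule derivative_eq_intros DERIV_chain2[OF DERIV_Si] refl | simp)+
    then show ?thesis
      by (intro has_vector_derivative_of_real) (simp add: has_real_derivative_iff_has_vector_derivative)
  qed
  moreover have "continuous_on {a..b} (\<lambda>x. complex_of_real (2 * N * sinc (N * (x + y))))"
    by (intro continuous_intros)
  ultimately show ?thesis
    using integral_FTC_atLeastAtMost[OF assms, of "\<lambda>x. complex_of_real (2 * Si (N * (x + y)))"
      "\<lambda>x. complex_of_real (2 * N * sinc (N * (x + y)))"]
    by (simp only: right_diff_distrib of_real_diff)
qed

lemma Dirichlet_limit:
  assumes "t \<noteq> 0"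
  shows "(\<lambda>n. Si (real n * t)) \<longlonglongrightarrow> pi / 2 * sgn t"
proof (cases "0 < t")
  case True
  then have "filterlim (\<lambda>n. real n * t) at_top sequentially"
    by (intro filterlim_at_top_mult_tendsto_pos[OF tendsto_const _ filterlim_real_sequentially])
  from filterlim_compose[OF Si_at_top this] True show ?thesis by simp
next
  case False
  with assms have "0 < - t" by simp
  then have "filterlim (\<lambda>n. real n * - t) at_top sequentially"
    by (intro filterlim_at_top_mult_tendsto_pos[OF tendsto_const _ filterlim_real_sequentially])
  from tendsto_minus[OF filterlim_compose[OF Si_at_top this]]
  have "(\<lambda>n. - Si (- (real n * t))) \<longlonglongrightarrow> - (pi / 2)" by simp
  moreover have "- Si (- x) = Si x" for x
    by (cases "0 \<le> x") (use Si_neg[of x] Si_neg[of "-x"] in auto)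
  ultimately show ?thesis using \<open>0 < - t\<close> by simp
qed

section \<open>Plancherel and inversion\<close>

lemma fourier_char:
  assumes "f \<in> L2" "g \<in> L2" "(\<lambda>n. L2_norm (\<lambda>\<xi>. FT (trunc (real n) f) \<xi> - g \<xi>)) \<longlonglongrightarrow> 0"
  shows "AE \<xi> in lborel. fourier f \<xi> = g \<xi>"
  by (rule L2_limit_AE_unique[OF _ _ _ _ fourier_tendsto[OF assms(1)] assms(3)])
     (auto intro!: FT_Bessel trunc_L2 assms fourier_L2)

lemma integral_reflect:
  fixes f :: "real \<Rightarrow> complex"
  shows "(LINT x|lborel. f (- x)) = (LINT x|lborel. f x)"
  using lborel_integral_real_affine[of "-1" f 0] by simp

lemma AE_reflect:
  assumes "AE x in lborel. P x" shows "AE x in lborel. P (- x :: real)"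
proof -
  obtain N where N: "N \<in> null_sets lborel" "{x \<in> space lborel. \<not> P x} \<subseteq> N"
    using assms by (auto simp: eventually_ae_filter)
  have "AE x in lborel. x \<notin> N" by (rule AE_not_in[OF N(1)])
  moreover have "Measurable.pred borel (\<lambda>x. x \<notin> N)" using N(1) by (auto simp: null_sets_def)
  ultimately have "AE x in lborel. 0 + (-1) * x \<notin> N" by (intro AE_borel_affine) auto
  then show ?thesis by eventually_elim (use N(2) in auto)
qed

lemma fourier_reflect:
  fixes f :: "real \<Rightarrow> complex"
  assumes f: "f \<in> L2"
  shows "AE \<xi> in lborel. fourier (\<lambda>x. f (- x)) \<xi> = fourier f (- \<xi>)"
proof (rule fourier_char)
  have "FT (trunc (real n) (\<lambda>x. f (- x))) \<xi> = FT (trunc (real n) f) (- \<xi>)" for n \<xi>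
    unfolding FT_def by (subst integral_reflect[symmetric]) (auto simp: trunc_def indicator_def intro!:
      Bochner_Integration.integral_cong)
  then have "L2_norm (\<lambda>\<xi>. FT (trunc (real n) (\<lambda>x. f (- x))) \<xi> - fourier f (- \<xi>))
      = L2_norm (\<lambda>\<xi>. FT (trunc (real n) f) \<xi> - fourier f \<xi>)" for n
    using L2_reflect(2)[OF L2_diff[OF FT_Bessel(1)[OF trunc_L2(2,1)[OF f]] fourier_L2[OF f]]] by simp
  then show "(\<lambda>n. L2_norm (\<lambda>\<xi>. FT (trunc (real n) (\<lambda>x. f (- x))) \<xi> - fourier f (- \<xi>))) \<longlonglongrightarrow> 0"
    using fourier_tendsto[OF f] by simp
qed (auto intro!: L2_reflect fourier_L2 f)

lemma fourier_cnj:
  fixes f :: "real \<Rightarrow> complex"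
  assumes f: "f \<in> L2"
  shows "AE \<xi> in lborel. fourier (\<lambda>x. cnj (f x)) \<xi> = cnj (fourier f (- \<xi>))"
proof (rule fourier_char)
  have "FT (trunc (real n) (\<lambda>x. cnj (f x))) \<xi> = cnj (FT (trunc (real n) f) (- \<xi>))" for n \<xi>
    unfolding cnj_FT by (auto simp: trunc_def[abs_def] indicator_def intro!: arg_cong[where f="\<lambda>h. FT h \<xi>"])
  then have "L2_norm (\<lambda>\<xi>. FT (trunc (real n) (\<lambda>x. cnj (f x))) \<xi> - cnj (fourier f (- \<xi>)))
      = L2_norm (\<lambda>\<xi>. FT (trunc (real n) f) (- \<xi>) - fourier f (- \<xi>))" for n
    by (simp only: L2_norm_cnj flip: complex_cnj_diff)
  also have "\<dots> n = L2_norm (\<lambda>\<xi>. FT (trunc (real n) f) \<xi> - fourier f \<xi>)" for n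
    using L2_reflect(2)[OF L2_diff[OF FT_Bessel(1)[OF trunc_L2(2,1)[OF f]] fourier_L2[OF f]]] by simp
  finally have "L2_norm (\<lambda>\<xi>. FT (trunc (real n) (\<lambda>x. cnj (f x))) \<xi> - cnj (fourier f (- \<xi>)))
      = L2_norm (\<lambda>\<xi>. FT (trunc (real n) f) \<xi> - fourier f \<xi>)" for n .
  then show "(\<lambda>n. L2_norm (\<lambda>\<xi>. FT (trunc (real n) (\<lambda>x. cnj (f x))) \<xi> - cnj (fourier f (- \<xi>)))) \<longlonglongrightarrow> 0"
    using fourier_tendsto[OF f] by simp
qed (auto intro!: L2_reflect(1)[OF fourier_L2] fourier_L2 f)

text \<open>The truncated inversion integral of an indicator: integrating in frequency first
  produces a Dirichlet kernel, whose primitive is the sine integral. The formula is exact at every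
  \<open>y\<close> and bounded uniformly in \<open>n\<close>.\<close>

lemma FT_trunc_FT_indicator:
  assumes "a \<le> b"
  shows "FT (trunc (real n) (FT (\<lambda>x. indicator {a..b} x))) y
      = of_real (2 * (Si (real n * (b + y)) - Si (real n * (a + y))))"
proof -
  let ?i = "\<lambda>x. indicator {a..b} x :: complex" and ?n = "\<lambda>x. indicator {-real n..real n} x :: complex"
  have "FT (trunc (real n) (FT ?i)) y = (LINT \<xi>|lborel. LINT x|lborel. cis (- (y * \<xi>))
      * (?n \<xi> * (cis (- (\<xi> * x)) * ?i x)))"
    by (simp add: FT_def trunc_def)
  also have "\<dots> = (LINT x|lborel. LINT \<xi>|lborel. cis (- (y * \<xi>)) * (?n \<xi> * (cis (- (\<xi> * x)) * ?i x)))"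
  proof (rule Fubini_dominated(1)[where A="indicator {-real n..real n}" and B="indicator {a..b}"])
    show "integrable lborel (indicat_real {- real n..real n})" "integrable lborel (indicat_real {a..b})"
      by (rule integrable_real_indicator; auto simp: emeasure_lborel_Icc_eq)+
  qed (auto simp: norm_mult indicator_def)
  also have "\<dots> = (LINT x|lborel. indicator {a..b} x *\<^sub>R complex_of_real (2 * real n
      * sinc (real n * (x + y))))"
  proof (intro Bochner_Integration.integral_cong refl)
    fix x
    have "(LINT \<xi>|lborel. cis (- (y * \<xi>)) * (?n \<xi> * (cis (- (\<xi> * x)) * ?i x)))
       = (LINT \<xi>|lborel. indicator {a..b} x *\<^sub>R (indicator {-real n..real n} \<xi> *\<^sub>R cis (- (\<xi> * (x + y)))))"
      by (intro Bochner_Integration.integral_cong refl) (auto simp: indicator_def cis_mult algebra_simps)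
    also have "\<dots> = indicator {a..b} x *\<^sub>R complex_of_real (2 * real n * sinc (real n * (x + y)))"
      by (subst integral_scaleR_right, subst integral_cis_Icc) auto
    finally show "(LINT \<xi>|lborel. cis (- (y * \<xi>)) * (?n \<xi> * (cis (- (\<xi> * x)) * ?i x)))
       = indicator {a..b} x *\<^sub>R complex_of_real (2 * real n * sinc (real n * (x + y)))" .
  qed
  also have "\<dots> = of_real (2 * (Si (real n * (b + y)) - Si (real n * (a + y))))"
    by (rule integral_sinc_Icc[OF assms])
  finally show ?thesis .
qed

text \<open>Inversion tested against an interval. The multiplication formula moves both transforms
  onto the indicator, where the truncated double transform is known explicitly; it converges
  boundedly to \<open>2 * pi\<close> times the reflected indicator.\<close>

lemma fourier_fourier_test:
  fixes f :: "real \<Rightarrow> complex"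
  assumes f: "f \<in> L2" "integrable lborel f" and ab: "a \<le> b"
  shows "(LINT x|lborel. fourier (fourier f) x * indicator {a..b} x)
      = 2 * pi * (LINT y|lborel. f y * indicator {a..b} (- y))"
proof (rule LIMSEQ_unique)
  let ?i = "\<lambda>x. indicator {a..b} x :: complex"
  have [measurable]: "f \<in> borel_measurable borel" using f by auto
  have i2: "?i \<in> L2" by (rule indicator_Icc_L2)
  define h where "h = fourier ?i"
  have h2: "h \<in> L2" unfolding h_def by (rule fourier_L2[OF i2])
  have [measurable]: "h \<in> borel_measurable borel" using h2 by auto
  note t = trunc_L2[OF h2] trunc_tendsto_nat[OF h2]
  have "(\<lambda>n. LINT \<xi>|lborel. trunc (real n) h \<xi> * fourier f \<xi>) \<longlonglongrightarrow> (LINT \<xi>|lborel. h \<xi> * fourier f \<xi>)"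
    by (intro L2_integral_mult_tendsto fourier_L2 t h2 f)
  moreover have "(LINT \<xi>|lborel. h \<xi> * fourier f \<xi>) = (LINT x|lborel. fourier (fourier f) x * ?i x)"
    unfolding h_def using fourier_mult[OF fourier_L2[OF f(1)] i2] by (simp add: mult.commute)
  ultimately show "(\<lambda>n. LINT \<xi>|lborel. trunc (real n) h \<xi> * fourier f \<xi>)
      \<longlonglongrightarrow> (LINT x|lborel. fourier (fourier f) x * ?i x)"
    by simp
  let ?S = "\<lambda>n y. 2 * (Si (real n * (b + y)) - Si (real n * (a + y)))"
  have "(LINT \<xi>|lborel. trunc (real n) h \<xi> * fourier f \<xi>) = (LINT y|lborel. of_real (?S n y) * f y)" for n
  proof -
    let ?t = "trunc (real n) h"
    have [measurable]: "fourier ?t \<in> borel_measurable borel" using fourier_L2[OF t(1)] by auto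
    have "AE \<xi> in lborel. h \<xi> = FT ?i \<xi>"
      unfolding h_def by (rule fourier_eq_FT[OF i2 indicator_Icc_integrable])
    then have "FT ?t y = FT (trunc (real n) (FT ?i)) y" for y
      unfolding FT_def[of ?t] FT_def[of "trunc (real n) (FT ?i)"]
        by (intro integral_cong_AE) (auto simp: trunc_def)
    then have FTt: "FT ?t y = of_real (?S n y)" for y by (simp add: FT_trunc_FT_indicator[OF ab])
    have "(LINT \<xi>|lborel. ?t \<xi> * fourier f \<xi>) = (LINT y|lborel. fourier ?t y * f y)"
      by (rule fourier_mult[OF t(1) f(1), symmetric])
    also have "\<dots> = (LINT y|lborel. of_real (?S n y) * f y)"
    proof (rule integral_cong_AE)
      show "AE y in lborel. fourier ?t y * f y = of_real (?S n y) * f y"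
        using fourier_eq_FT[OF t(1,2), of n] by eventually_elim (simp only: FTt)
    qed auto
    finally show ?thesis .
  qed
  moreover have "(\<lambda>n. LINT y|lborel. of_real (?S n y) * f y)
      \<longlonglongrightarrow> (LINT y|lborel. of_real (2 * pi * indicator {a..b} (- y)) * f y)"
  proof -
    obtain B where B: "\<And>T. \<bar>Si T\<bar> \<le> B" using bounded_Si by blast
    show ?thesis
    proof (rule integral_dominated_convergence[where w="\<lambda>y. 4 * B * cmod (f y)"])
      show "integrable lborel (\<lambda>y. 4 * B * cmod (f y))" using f by simp
      show "AE y in lborel. norm (of_real (?S n y) * f y) \<le> 4 * B * cmod (f y)" for n
      proof (intro AE_I2)
        fix y
        have aux: "\<bar>2 * (s - t)\<bar> \<le> 4 * B" if "\<bar>s\<bar> \<le> B" "\<bar>t\<bar> \<le> B" for s t using that unfolding abs_le_iff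
            by simp
        have "\<bar>?S n y\<bar> \<le> 4 * B" by (rule aux[OF B B])
        then show "norm (of_real (?S n y) * f y) \<le> 4 * B * cmod (f y)"
          unfolding norm_mult norm_of_real by (intro mult_right_mono) auto
      qed
      \<comment> \<open>At the two reflected endpoints a sine integral is stuck at 0 and the limit
        would differ from the indicator.\<close>
      have "AE y in lborel. y \<notin> {- a, - b}" by (intro AE_I'[OF finite_imp_null_set_lborel[of
          "{-a,-b}"]]) auto
      then show "AE y in lborel. (\<lambda>n. complex_of_real (?S n y) * f y)
          \<longlonglongrightarrow> of_real (2 * pi * indicator {a..b} (- y)) * f y"
      proof eventually_elim
        case (elim y)
        have "(\<lambda>n. ?S n y) \<longlonglongrightarrow> 2 * (pi / 2 * sgn (b + y) - pi / 2 * sgn (a + y))"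
          using elim by (intro tendsto_intros Dirichlet_limit) auto
        moreover have "2 * (pi / 2 * sgn (b + y) - pi / 2 * sgn (a + y)) = 2 * pi * indicator {a..b} (- y)"
          using elim ab by (auto simp: indicator_def sgn_if)
        ultimately have "(\<lambda>n. ?S n y) \<longlonglongrightarrow> 2 * pi * indicator {a..b} (- y)" by simp
        then show ?case by (intro tendsto_mult_right tendsto_of_real)
      qed
    qed auto
  qed
  moreover have "(LINT y|lborel. of_real (2 * pi * indicator {a..b} (- y)) * f y)
      = 2 * pi * (LINT y|lborel. f y * indicator {a..b} (- y))"
  proof -
    have "of_real (2 * pi * indicator {a..b} (- y)) * f y = 2 * pi * (f y * indicator {a..b} (- y))" for y
      by (auto simp: indicator_def)
    then show ?thesis by (simp only: integral_mult_right_zero)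
  qed
  ultimately show "(\<lambda>n. LINT \<xi>|lborel. trunc (real n) h \<xi> * fourier f \<xi>)
      \<longlonglongrightarrow> 2 * pi * (LINT y|lborel. f y * indicator {a..b} (- y))"
    by simp
qed

text \<open>For integrable \<open>f\<close> the two sides have equal integrals over all intervals.
  The general case follows by truncation, since applying the transform twice is continuous on
  \<open>L2\<close>.\<close>

theorem fourier_inversion:
  fixes f :: "real \<Rightarrow> complex"
  assumes f: "f \<in> L2"
  shows "AE x in lborel. fourier (fourier f) x = 2 * pi * f (- x)"
proof -
  have *: "AE x in lborel. fourier (fourier f) x = 2 * pi * f (- x)" if f: "f \<in> L2" "integrable lborel f"
      for f :: "real \<Rightarrow> complex"
  proof -
    let ?D = "\<lambda>x. fourier (fourier f) x - 2 * pi * f (- x)"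
    have D: "?D \<in> L2" by (intro L2_diff L2_cmult fourier_L2 L2_reflect(1) f)
    have si: "indicator A x *\<^sub>R z = z * indicator A x" for A :: "real set" and x and z :: complex
      by (auto simp: indicator_def)
    have "AE x in lborel. ?D x = 0"
    proof (rule AE_0_if_interval_integrals_0)
      show "integrable lborel (\<lambda>x. indicator {-real n..real n} x *\<^sub>R ?D x)" for n
        unfolding si by (intro L2_mult_integrable D indicator_Icc_L2)
      fix a b :: real assume ab: "a \<le> b"
      have "(LINT x|lborel. ?D x * indicator {a..b} x)
        = (LINT x|lborel. fourier (fourier f) x * indicator {a..b} x) - (LINT x|lborel. 2 * pi * f (- x) *
            indicator {a..b} x)"
        unfolding left_diff_distrib
        by (intro Bochner_Integration.integral_diff L2_mult_integrable L2_cmult fourier_L2 L2_reflect(1) f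
          indicator_Icc_L2)
      also have "(LINT x|lborel. 2 * pi * f (- x) * indicator {a..b} x)
          = 2 * pi * (LINT x|lborel. f (- x) * indicator {a..b} x)"
        by (simp add: mult.assoc)
      also have "(LINT x|lborel. f (- x) * indicator {a..b} x)
          = (LINT y|lborel. f y * indicator {a..b} (- y))"
        using integral_reflect[of "\<lambda>y. f y * indicator {a..b} (- y)"] by simp
      finally show "(LINT x|lborel. indicator {a..b} x *\<^sub>R ?D x) = 0"
        unfolding si using fourier_fourier_test[OF f ab] by simp
    qed
    then show ?thesis by simp
  qed
  let ?f = "\<lambda>n. trunc (real n) f"
  note t = trunc_L2[OF f] trunc_tendsto_nat[OF f]
  have [measurable]: "f \<in> borel_measurable borel" using f by auto
  show ?thesis
  proof (rule L2_limit_AE_unique[where F=sequentially])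
    show ff: "fourier (fourier (?f n)) \<in> L2" for n by (intro fourier_L2 t)
    show "(\<lambda>n. L2_norm (\<lambda>x. fourier (fourier (?f n)) x - fourier (fourier f) x)) \<longlonglongrightarrow> 0"
      by (intro fourier_tendsto_L2 fourier_L2 t f)
    have "L2_norm (\<lambda>x. fourier (fourier (?f n)) x - 2 * pi * f (- x)) = 2 * pi * L2_norm (\<lambda>x. ?f n x - f x)"
        for n
    proof -
      have "L2_norm (\<lambda>x. fourier (fourier (?f n)) x - 2 * pi * f (- x))
          = L2_norm (\<lambda>x. (2 * pi) * (?f n (- x) - f (- x)))"
      proof (rule L2_norm_cong_AE)
        show "AE x in lborel. fourier (fourier (?f n)) x - 2 * pi * f (- x)
            = (2 * pi) * (?f n (- x) - f (- x))"
          using *[OF t(1,2), of n] by eventually_elim (simp add: algebra_simps)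
      qed (use ff[of n] f in measurable)
      also have "\<dots> = 2 * pi * L2_norm (\<lambda>x. ?f n (- x) - f (- x))"
        using L2_norm_cmult[of "2 * pi"] by simp
      also have "L2_norm (\<lambda>x. ?f n (- x) - f (- x)) = L2_norm (\<lambda>x. ?f n x - f x)"
        by (rule L2_reflect(2)[OF L2_diff[OF t(1) f]])
      finally show ?thesis .
    qed
    moreover have "(\<lambda>n. 2 * pi * L2_norm (\<lambda>x. ?f n x - f x)) \<longlonglongrightarrow> 2 * pi * 0"
      by (intro tendsto_intros t)
    ultimately show "(\<lambda>n. L2_norm (\<lambda>x. fourier (fourier (?f n)) x - 2 * pi * f (- x))) \<longlonglongrightarrow> 0" by simp
  qed (auto intro!: L2_cmult fourier_L2 L2_reflect(1) f)
qed

text \<open>The conjugated transform of \<open>g\<close> is the reflected transform of its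
  conjugate; the multiplication formula moves the transform off \<open>f\<close>, and inversion
  returns \<open>cnj (g x)\<close> with the factor \<open>2 * pi\<close>.\<close>

theorem fourier_Parseval:
  assumes f: "f \<in> L2" and g: "g \<in> L2"
  shows "(LINT \<xi>|lborel. fourier f \<xi> * cnj (fourier g \<xi>)) = 2 * pi * (LINT x|lborel. f x * cnj (g x))"
proof -
  let ?h = "\<lambda>x. cnj (g x)"
  have h: "?h \<in> L2" by (rule L2_cnj[OF g])
  let ?k = "\<lambda>\<xi>. fourier ?h (- \<xi>)"
  have k: "?k \<in> L2" by (intro L2_reflect(1) fourier_L2 h)
  have [measurable]: "f \<in> borel_measurable borel" "g \<in> borel_measurable borel"
     "fourier f \<in> borel_measurable borel" "fourier g \<in> borel_measurable borel"
         "fourier ?h \<in> borel_measurable borel"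
     "fourier ?k \<in> borel_measurable borel"
    using f g fourier_L2[OF f] fourier_L2[OF g] fourier_L2[OF h] fourier_L2[OF k] by measurable
  have "(LINT \<xi>|lborel. fourier f \<xi> * cnj (fourier g \<xi>)) = (LINT \<xi>|lborel. fourier f \<xi> * ?k \<xi>)"
    by (rule integral_cong_AE) (use AE_reflect[OF fourier_cnj[OF g]] in auto)
  also have "\<dots> = (LINT x|lborel. f x * fourier ?k x)"
    by (rule fourier_mult[OF f k])
  also have "\<dots> = (LINT x|lborel. 2 * pi * (f x * cnj (g x)))"
  proof (rule integral_cong_AE)
    show "AE x in lborel. f x * fourier ?k x = 2 * pi * (f x * cnj (g x))"
      using fourier_reflect[OF fourier_L2[OF h]] AE_reflect[OF fourier_inversion[OF h]]
      by eventually_elim (simp add: mult_ac)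
  qed auto
  finally show ?thesis by simp
qed

corollary fourier_Plancherel:
  assumes f: "f \<in> L2" shows "L2_norm (fourier f) = sqrt (2 * pi) * L2_norm f"
proof -
  have *: "complex_of_real ((L2_norm g)\<^sup>2) = (LINT x|lborel. g x * cnj (g x))" for g
    unfolding L2_norm_sq integral_complex_of_real[symmetric] complex_norm_square ..
  have "complex_of_real ((L2_norm (fourier f))\<^sup>2) = complex_of_real (2 * pi * (L2_norm f)\<^sup>2)"
    using fourier_Parseval[OF f f] by (simp only: * of_real_mult)
  then have "(L2_norm (fourier f))\<^sup>2 = 2 * pi * (L2_norm f)\<^sup>2" by (simp only: of_real_eq_iff)
  then have "(L2_norm (fourier f))\<^sup>2 = (sqrt (2 * pi) * L2_norm f)\<^sup>2" by (simp add: power_mult_distrib)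
  then show ?thesis by (rule power2_eq_imp_eq) auto
qed

lemma fourier_inj:
  assumes "f \<in> L2" "g \<in> L2" "AE \<xi> in lborel. fourier f \<xi> = fourier g \<xi>"
  shows "AE x in lborel. f x = g x"
proof -
  have d: "(\<lambda>x. f x - g x) \<in> L2" by (rule L2_diff[OF assms(1,2)])
  have [measurable]: "fourier (\<lambda>x. f x - g x) \<in> borel_measurable borel" using fourier_L2[OF d] by auto
  have "L2_norm (fourier (\<lambda>x. f x - g x)) = L2_norm (\<lambda>x. 0)"
    by (rule L2_norm_cong_AE) (use assms(3) fourier_diff[OF assms(1,2)] in auto)
  then have "L2_norm (\<lambda>x. f x - g x) = 0" by (simp add: fourier_Plancherel[OF d])
  from L2_norm_eq_0[OF d this] show ?thesis by simp
qed

section \<open>The inverse transform, in mean and pointwise\<close>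

definition inv_fourier :: "(real \<Rightarrow> complex) \<Rightarrow> real \<Rightarrow> complex" where
  "inv_fourier h x = 1 / (2 * pi) * fourier h (- x)"

lemma inv_fourier_L2 [intro]: "h \<in> L2 \<Longrightarrow> inv_fourier h \<in> L2"
  unfolding inv_fourier_def[abs_def] by (intro L2_cmult L2_reflect(1) fourier_L2)

lemma fourier_cmult:
  assumes "f \<in> L2" shows "AE \<xi> in lborel. fourier (\<lambda>x. c * f x) \<xi> = c * fourier f \<xi>"
proof -
  have "AE \<xi> in lborel. fourier (\<lambda>x. 0) \<xi> = FT (\<lambda>x. 0) \<xi>" by (rule fourier_eq_FT) auto
  then have "AE \<xi> in lborel. fourier (\<lambda>x. 0) \<xi> = 0" by (simp add: FT_def)
  with fourier_add_cmult[OF L2_zero assms, of c] show ?thesis by eventually_elim simp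
qed

lemma fourier_inv_fourier:
  assumes h: "h \<in> L2" shows "AE \<xi> in lborel. fourier (inv_fourier h) \<xi> = h \<xi>"
proof -
  have "AE \<xi> in lborel. fourier (inv_fourier h) \<xi> = 1 / (2 * pi) * fourier (\<lambda>x. fourier h (- x)) \<xi>"
    unfolding inv_fourier_def[abs_def] by (intro fourier_cmult L2_reflect(1) fourier_L2 h)
  with fourier_reflect[OF fourier_L2[OF h]] AE_reflect[OF fourier_inversion[OF h]]
  show ?thesis by eventually_elim simp
qed

lemma inv_fourier_fourier:
  assumes f: "f \<in> L2" shows "AE x in lborel. inv_fourier (fourier f) x = f x"
  by (rule fourier_inj[OF inv_fourier_L2[OF fourier_L2[OF f]] f fourier_inv_fourier[OF fourier_L2[OF f]]])

text \<open>For integrable \<open>h\<close> this has a definite value at every point, whereas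
  \<open>inv_fourier\<close> is fixed only up to null sets. All later pointwise identities and
  continuity statements go through it.\<close>

definition IFT :: "(real \<Rightarrow> complex) \<Rightarrow> real \<Rightarrow> complex" where
  "IFT h x = 1 / (2 * pi) * (LINT \<xi>|lborel. cis (x * \<xi>) * h \<xi>)"

lemma IFT_FT: "IFT h x = 1 / (2 * pi) * FT h (- x)"
  by (simp add: IFT_def FT_def)

lemma inv_fourier_IFT:
  assumes "h \<in> L2" "integrable lborel h" shows "AE x in lborel. inv_fourier h x = IFT h x"
proof -
  have "AE x in lborel. fourier h (- x) = FT h (- x)"
    by (rule AE_reflect[OF fourier_eq_FT[OF assms]])
  then show ?thesis by eventually_elim (simp add: inv_fourier_def IFT_FT)
qed

lemma IFT_measurable [measurable]:
  assumes [measurable]: "h \<in> borel_measurable borel" shows "IFT h \<in> borel_measurable borel"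
  unfolding IFT_def[abs_def] by measurable

lemma IFT_L2:
  assumes "h \<in> L2" "integrable lborel h" shows "IFT h \<in> L2"
  by (rule L2_cong_AE[OF inv_fourier_L2[OF assms(1)] _ inv_fourier_IFT[OF assms]]) (use assms in auto)

lemma fourier_IFT:
  assumes h: "h \<in> L2" "integrable lborel h" shows "AE \<xi> in lborel. fourier (IFT h) \<xi> = h \<xi>"
proof -
  have "fourier (inv_fourier h) = fourier (IFT h)"
    by (rule fourier_cong_AE[OF _ _ inv_fourier_IFT[OF h]]) (use inv_fourier_L2[OF h(1)] IFT_L2[OF h] in
      auto)
  then show ?thesis using fourier_inv_fourier[OF h(1)] by simp
qed

lemma IFT_fourier:
  assumes f: "f \<in> L2" "integrable lborel (fourier f)" shows "AE x in lborel. IFT (fourier f) x = f x"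
  using inv_fourier_fourier[OF f(1)] inv_fourier_IFT[OF fourier_L2[OF f(1)] f(2)] by eventually_elim simp

section \<open>Test functions\<close>

lemma DERIV_0_off_support:
  fixes f :: "real \<Rightarrow> real"
  assumes "\<And>x. \<bar>x\<bar> > R \<Longrightarrow> f x = 0" "\<bar>x\<bar> > R"
  shows "(f has_real_derivative 0) (at x)"
proof (rule has_field_derivative_transform_within_open[where S="{x. R < \<bar>x\<bar>}"])
  show "((\<lambda>x. 0) has_real_derivative 0) (at x)" by simp
  show "open {x. R < \<bar>x\<bar>}" by (intro open_Collect_less continuous_intros)
qed (use assms in auto)

text \<open>The classical smooth functions that vanish to infinite order at 0. The polynomial factor
  is carried along so that the family is closed under differentiation.\<close>

definition flat_exp :: "real poly \<Rightarrow> real \<Rightarrow> real" where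
  "flat_exp p x = (if x > 0 then poly p (1 / x) * exp (- (1 / x)) else 0)"

lemma poly_exp_decay: "((\<lambda>y. poly p y * exp (- y)) \<longlongrightarrow> (0::real)) at_top"
proof -
  have "((\<lambda>y. \<Sum>i\<le>degree p. coeff p i * (y ^ i / exp y)) \<longlongrightarrow> (\<Sum>i\<le>degree p. coeff p i * 0)) at_top"
    by (intro tendsto_intros tendsto_power_div_exp_0)
  then show ?thesis by (simp add: poly_altdef sum_distrib_right exp_minus divide_inverse mult.assoc)
qed

text \<open>With \<open>y = 1 / x\<close> one has \<open>dy/dx = - y\<^sup>2\<close>, which turns
  \<open>p\<close> into the polynomial \<open>y\<^sup>2 * (p - p')\<close>. At 0 the right
  difference quotient is again a polynomial in \<open>y\<close> times \<open>exp (- y)\<close> and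
  the left one is 0.\<close>

lemma flat_exp_deriv:
  "(flat_exp p has_real_derivative flat_exp ([:0, 0, 1:] * (p - pderiv p)) x) (at x)"
proof -
  consider "x > 0" | "x < 0" | "x = 0" by linarith
  then show ?thesis
  proof cases
    case 1
    have "((\<lambda>x. poly p (1 / x) * exp (- (1 / x))) has_real_derivative
      poly p (1 / x) * (exp (- (1 / x)) * (1 / x\<^sup>2)) + (poly (pderiv p) (1 / x) * (- (1 / x\<^sup>2))) * exp (- (1
          / x))) (at x)"
      using 1 by (auto intro!: derivative_eq_intros simp: power2_eq_square field_simps)
    also have "poly p (1 / x) * (exp (- (1 / x)) * (1 / x\<^sup>2)) + (poly (pderiv p) (1 / x) * (- (1 / x\<^sup>2)))
        * exp (- (1 / x))
        = flat_exp ([:0, 0, 1:] * (p - pderiv p)) x"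
      using 1 by (simp add: flat_exp_def algebra_simps power2_eq_square)
    finally show ?thesis
    proof (rule DERIV_cong_ev[THEN iffD1, rotated -1])
      show "\<forall>\<^sub>F x in nhds x. poly p (1 / x) * exp (- (1 / x)) = flat_exp p x"
        using eventually_nhds_in_open[of "{0<..}" x] 1 by (auto elim!: eventually_mono simp: flat_exp_def)
    qed auto
  next
    case 2
    have "((\<lambda>x. 0) has_real_derivative 0) (at x)" by simp
    then show ?thesis
    proof (rule DERIV_cong_ev[THEN iffD1, rotated -1])
      show "\<forall>\<^sub>F x in nhds x. 0 = flat_exp p x"
        using eventually_nhds_in_open[of "{..<0}" x] 2 by (auto elim!: eventually_mono simp: flat_exp_def)
    qed (use 2 in \<open>auto simp: flat_exp_def\<close>)
  next
    case 3
    have r: "((\<lambda>h. flat_exp p h / h) \<longlongrightarrow> 0) (at_right 0)"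
    proof (rule Lim_transform_eventually)
      show "((\<lambda>h. poly ([:0, 1:] * p) (inverse h) * exp (- inverse h)) \<longlongrightarrow> 0) (at_right 0)"
        by (rule filterlim_compose[OF poly_exp_decay filterlim_inverse_at_top_right])
      show "\<forall>\<^sub>F h in at_right 0. poly ([:0, 1:] * p) (inverse h) * exp (- inverse h) = flat_exp p h / h"
        using eventually_at_right_less[of 0]
        by eventually_elim (simp add: flat_exp_def field_simps)
    qed
    have l: "((\<lambda>h. flat_exp p h / h) \<longlongrightarrow> 0) (at_left 0)"
      by (rule tendsto_eventually) (auto simp: flat_exp_def eventually_at_filter)
    have "((\<lambda>h. flat_exp p h / h) \<longlongrightarrow> 0) (at 0)"
      using l r by (simp add: filterlim_split_at)
    then show ?thesis using 3 by (simp add: DERIV_def flat_exp_def)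
  qed
qed

text \<open>An algebra of functions closed under differentiation; each member is therefore smooth.\<close>

inductive_set smooth_alg :: "(real \<Rightarrow> real) set" where
  flat: "(\<lambda>x. flat_exp p (a * x + b)) \<in> smooth_alg"
| cosine: "(\<lambda>x. c * cos (t * x + d)) \<in> smooth_alg"
| add: "f \<in> smooth_alg \<Longrightarrow> g \<in> smooth_alg \<Longrightarrow> (\<lambda>x. f x + g x) \<in> smooth_alg"
| mult: "f \<in> smooth_alg \<Longrightarrow> g \<in> smooth_alg \<Longrightarrow> (\<lambda>x. f x * g x) \<in> smooth_alg"

lemma smooth_alg_deriv:
  "f \<in> smooth_alg \<Longrightarrow> \<exists>g \<in> smooth_alg. \<forall>x. (f has_real_derivative g x) (at x)"
proof (induction rule: smooth_alg.induct)
  case (flat p a b)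
  let ?q = "smult a ([:0, 0, 1:] * (p - pderiv p))"
  have "((\<lambda>x. flat_exp p (a * x + b)) has_real_derivative flat_exp ?q (a * x + b)) (at x)" for x
  proof -
    have "((\<lambda>x. flat_exp p (a * x + b)) has_real_derivative flat_exp ([:0, 0, 1:] * (p - pderiv p)) (a * x
        + b) * a) (at x)"
      by (rule DERIV_chain2[OF flat_exp_deriv]) (auto intro!: derivative_eq_intros)
    moreover have "flat_exp ?q y = flat_exp ([:0, 0, 1:] * (p - pderiv p)) y * a" for y
      by (simp add: flat_exp_def)
    ultimately show ?thesis by (simp only:)
  qed
  then show ?case by (intro bexI[OF _ smooth_alg.flat[of ?q a b]]) blast
next
  case (cosine c t d)
  \<comment> \<open>The derivative is written as a cosine with phase advanced by
    \<open>pi / 2\<close>, so a single generator covers sines as well.\<close>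
  have "((\<lambda>x. c * cos (t * x + d)) has_real_derivative ((c * t) * cos (t * x + (d + pi / 2)))) (at x)" for x
    by (auto intro!: derivative_eq_intros simp: cos_add sin_add algebra_simps)
  then show ?case by (intro bexI[OF _ smooth_alg.cosine[of "c * t" t "d + pi / 2"]]) blast
next
  case (add f g)
  then obtain f' g' where "f' \<in> smooth_alg" "g' \<in> smooth_alg"
    "\<forall>x. (f has_real_derivative f' x) (at x)" "\<forall>x. (g has_real_derivative g' x) (at x)" by blast
  then show ?case
    by (intro bexI[of _ "\<lambda>x. f' x + g' x"]) (auto intro!: DERIV_add smooth_alg.add)
next
  case (mult f g)
  then obtain f' g' where "f' \<in> smooth_alg" "g' \<in> smooth_alg"
    "\<forall>x. (f has_real_derivative f' x) (at x)" "\<forall>x. (g has_real_derivative g' x) (at x)" by blast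
  then show ?case using mult.hyps
    by (intro bexI[of _ "\<lambda>x. f' x * g x + g' x * f x"]) (auto intro!: DERIV_mult smooth_alg.add
      smooth_alg.mult)
qed

lemma smooth_alg_deriv_in:
  assumes "f \<in> smooth_alg" shows "deriv f \<in> smooth_alg" "(f has_real_derivative deriv f x) (at x)"
proof -
  obtain g where g: "g \<in> smooth_alg" "\<And>x. (f has_real_derivative g x) (at x)"
    using smooth_alg_deriv[OF assms] by blast
  have "deriv f = g" using g(2) by (auto intro: DERIV_imp_deriv)
  with g show "deriv f \<in> smooth_alg" "(f has_real_derivative deriv f x) (at x)" by auto
qed

lemma smooth_alg_test_function:
  assumes "f \<in> smooth_alg" "\<And>x. \<bar>x\<bar> > R \<Longrightarrow> f x = 0"
  shows "test_function f"
proof -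
  have "(deriv ^^ n) f \<in> smooth_alg" for n
    by (induction n) (auto intro: assms smooth_alg_deriv_in)
  then show ?thesis
    unfolding test_function_def field_differentiable_def using smooth_alg_deriv_in(2) assms(2) by blast
qed

text \<open>Each factor switches off one end of the interval of radius \<open>1 / a\<close>; the
  factor \<open>exp 2\<close> normalises the value at 0 to 1, so that the cutoffs tend to 1 as
  \<open>a\<close> tends to 0.\<close>

definition cutoff :: "real \<Rightarrow> real \<Rightarrow> real" where
  "cutoff a x = exp 2 * (flat_exp 1 (a * x + 1) * flat_exp 1 (- a * x + 1))"

lemma cutoff_smooth: "cutoff a \<in> smooth_alg"
proof -
  have "(\<lambda>x. (exp 2 * cos (0 * x + 0)) * (flat_exp 1 (a * x + 1) * flat_exp 1 (- a * x + 1))) \<in> smooth_alg"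
    by (intro smooth_alg.intros)
  then show ?thesis by (simp add: cutoff_def[abs_def])
qed

lemma cutoff_0 [simp]: "cutoff a 0 = 1" "cutoff 0 x = 1"
  using exp_add[of "1::real" 1] by (auto simp: cutoff_def flat_exp_def exp_minus field_simps)

lemma cutoff_bounded: "0 \<le> cutoff a x" "cutoff a x \<le> exp 2"
proof -
  have f: "0 \<le> flat_exp 1 y \<and> flat_exp 1 y \<le> 1" for y by (auto simp: flat_exp_def)
  show "0 \<le> cutoff a x" using f by (simp add: cutoff_def)
  have "flat_exp 1 (a * x + 1) * flat_exp 1 (- a * x + 1) \<le> 1 * 1" using f by (intro mult_mono) auto
  then show "cutoff a x \<le> exp 2" by (simp add: cutoff_def)
qed

lemma cutoff_support:
  assumes "0 < a" "\<bar>x\<bar> > 1 / a" shows "cutoff a x = 0"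
proof -
  have "a * x + 1 \<le> 0 \<or> - a * x + 1 \<le> 0"
    using assms by (auto simp: field_simps abs_if split: if_splits)
  then show ?thesis by (auto simp: cutoff_def flat_exp_def)
qed

lemma cutoff_scale: "cutoff a x = cutoff 1 (a * x)"
  by (simp add: cutoff_def)

text \<open>By scaling, one bound for \<open>a = 1\<close> serves all \<open>a\<close>. The factor
  \<open>a\<close> is what removes the commutator term when the cutoff is released.\<close>

lemma cutoff_deriv:
  obtains B where "\<And>a x. \<bar>deriv (cutoff a) x\<bar> \<le> B * \<bar>a\<bar>"
proof -
  have c: "(cutoff a has_real_derivative a * deriv (cutoff 1) (a * x)) (at x)" for a x
    by (subst ext[of "cutoff a" "\<lambda>x. cutoff 1 (a * x)"], rule cutoff_scale, rule DERIV_cong[OF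
      DERIV_chain2[OF smooth_alg_deriv_in(2)[OF cutoff_smooth]]]) (auto intro!: derivative_eq_intros)
  have d: "deriv (cutoff a) x = a * deriv (cutoff 1) (a * x)" for a x
    by (rule DERIV_imp_deriv[OF c])
  have "continuous_on {-2..2} (deriv (cutoff 1))"
    using smooth_alg_deriv_in(2)[OF smooth_alg_deriv_in(1)[OF cutoff_smooth]]
    by (intro continuous_at_imp_continuous_on ballI) (blast intro: DERIV_isCont)
  then have "bounded (deriv (cutoff 1) ` {-2..2})"
    by (intro compact_imp_bounded compact_continuous_image) auto
  then have "\<exists>B. \<forall>x\<in>{-2..2}. \<bar>deriv (cutoff 1) x\<bar> \<le> B"
    unfolding bounded_iff by simp
  then obtain B where B: "\<And>x. x \<in> {-2..2} \<Longrightarrow> \<bar>deriv (cutoff 1) x\<bar> \<le> B"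
    by blast
  have "\<bar>deriv (cutoff 1) x\<bar> \<le> B" for x
  proof (cases "x \<in> {-2..2}")
    case False
    then have "1 < \<bar>x\<bar>" by auto
    then have "(cutoff 1 has_real_derivative 0) (at x)"
      by (intro DERIV_0_off_support[of 1]) (auto simp: cutoff_support[of 1])
    then have "deriv (cutoff 1) x = 0" by (rule DERIV_imp_deriv)
    then show ?thesis using B[of 0] by auto
  qed (use B in auto)
  then have "\<bar>a\<bar> * \<bar>deriv (cutoff 1) (a * x)\<bar> \<le> \<bar>a\<bar> * B" for a x
    by (intro mult_left_mono) auto
  moreover have "\<bar>deriv (cutoff a) x\<bar> = \<bar>a\<bar> * \<bar>deriv (cutoff 1) (a * x)\<bar>" for a x
    using d[of a x] by (simp only: abs_mult)
  ultimately have "\<bar>deriv (cutoff a) x\<bar> \<le> B * \<bar>a\<bar>" for a x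
    by (metis mult.commute)
  then show ?thesis using that by blast
qed

lemma cutoff_measurable [measurable]: "cutoff a \<in> borel_measurable borel"
proof -
  have "continuous_on UNIV (cutoff a)"
    using smooth_alg_deriv_in(2)[OF cutoff_smooth]
      by (intro continuous_at_imp_continuous_on ballI) (blast intro: DERIV_isCont)
  then show ?thesis by (rule borel_measurable_continuous_onI)
qed

lemma deriv_cutoff_measurable [measurable]: "deriv (cutoff a) \<in> borel_measurable borel"
proof -
  have "continuous_on UNIV (deriv (cutoff a))"
    using smooth_alg_deriv_in(2)[OF smooth_alg_deriv_in(1)[OF cutoff_smooth]]
    by (intro continuous_at_imp_continuous_on ballI) (blast intro: DERIV_isCont)
  then show ?thesis by (rule borel_measurable_continuous_onI)
qed

section \<open>The Hardy space and weak derivatives\<close>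

lemma Cplus_spec:
  assumes f: "f \<in> L2"
  shows "Cplus f \<in> L2 \<and> (AE \<xi> in lborel. fourier (Cplus f) \<xi> = indicator {0<..} \<xi> * fourier f \<xi>)"
proof -
  let ?P = "\<lambda>h. h \<in> L2 \<and> (AE \<xi> in lborel. fourier h \<xi> = indicator {0<..} \<xi> * fourier f \<xi>)"
  have h: "(\<lambda>\<xi>. indicator {0<..} \<xi> * fourier f \<xi>) \<in> L2"
    by (rule L2_bounded_mult(1)[OF fourier_L2[OF f], of _ 1]) (auto simp: indicator_def)
  have "\<exists>h. ?P h" using inv_fourier_L2[OF h] fourier_inv_fourier[OF h] by blast
  then have "?P (SOME h. ?P h)" by (rule someI_ex)
  then show ?thesis by (simp only: Cplus_def)
qed

lemma Cplus_L2 [intro]: "f \<in> L2 \<Longrightarrow> Cplus f \<in> L2"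
  using Cplus_spec by blast

lemma fourier_Cplus: "f \<in> L2 \<Longrightarrow> AE \<xi> in lborel. fourier (Cplus f) \<xi> = indicator {0<..} \<xi> * fourier f \<xi>"
  using Cplus_spec by blast

text \<open>Replaces the range of the chosen projection by a support condition on the transform,
  which does not depend on representatives.\<close>

lemma Hardy_iff: "\<phi> \<in> Hardy \<longleftrightarrow> \<phi> \<in> L2 \<and> (AE \<xi> in lborel. \<xi> \<le> 0 \<longrightarrow> fourier \<phi> \<xi> = 0)"
proof safe
  assume "\<phi> \<in> Hardy"
  then obtain f where f: "\<phi> \<in> L2" "f \<in> L2" "AE x in lborel. \<phi> x = Cplus f x" by (auto simp: Hardy_def)
  have "fourier \<phi> = fourier (Cplus f)"
    by (rule fourier_cong_AE[OF _ _ f(3)]) (use f(1) Cplus_L2[OF f(2)] in auto)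
  with fourier_Cplus[OF f(2)] show "AE \<xi> in lborel. \<xi> \<le> 0 \<longrightarrow> fourier \<phi> \<xi> = 0" by auto
next
  assume \<phi>: "\<phi> \<in> L2" "AE \<xi> in lborel. \<xi> \<le> 0 \<longrightarrow> fourier \<phi> \<xi> = 0"
  have "AE \<xi> in lborel. fourier \<phi> \<xi> = fourier (Cplus \<phi>) \<xi>"
    using \<phi>(2) fourier_Cplus[OF \<phi>(1)] by eventually_elim (auto simp: indicator_def)
  from fourier_inj[OF \<phi>(1) Cplus_L2[OF \<phi>(1)] this] \<phi>(1) show "\<phi> \<in> Hardy" by (auto simp: Hardy_def)
qed (auto simp: Hardy_def)

lemma Cplus_Hardy:
  assumes "\<phi> \<in> Hardy" shows "AE x in lborel. Cplus \<phi> x = \<phi> x"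
proof -
  have \<phi>: "\<phi> \<in> L2" "AE \<xi> in lborel. \<xi> \<le> 0 \<longrightarrow> fourier \<phi> \<xi> = 0" using assms by (auto simp: Hardy_iff)
  have "AE \<xi> in lborel. fourier (Cplus \<phi>) \<xi> = fourier \<phi> \<xi>"
    using \<phi>(2) fourier_Cplus[OF \<phi>(1)] by eventually_elim (auto simp: indicator_def)
  from fourier_inj[OF Cplus_L2[OF \<phi>(1)] \<phi>(1) this] show ?thesis .
qed

lemma integral_diff_cmult:
  fixes f g :: "'a \<Rightarrow> complex"
  assumes "integrable M f" "integrable M g"
  shows "(LINT x|M. f x - c * g x) = (LINT x|M. f x) - c * (LINT x|M. g x)"
  using assms by simp

section \<open>Weak differentiation as multiplication by \<open>\<i> * \<xi>\<close>\<close>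

lemma bounded_support_L2:
  assumes "f \<in> borel_measurable borel" "\<And>x. cmod (f x) \<le> B" "\<And>x. \<bar>x\<bar> > R \<Longrightarrow> f x = 0"
  shows "f \<in> L2"
proof (rule L2_dominated[OF indicator_Icc_L2[of "-R" R] assms(1), of B])
  have "cmod (f x) \<le> B * cmod (indicator {-R..R} x)" for x
    using assms(2)[of x] assms(3)[of x] by (cases "\<bar>x\<bar> > R") (auto simp: indicator_def abs_le_iff)
  then show "AE x in lborel. cmod (f x) \<le> B * cmod (indicator {-R..R} x :: complex)" by simp
qed

lemma cutoff_tendsto: "(\<lambda>n. cutoff (1 / real (Suc n)) x) \<longlonglongrightarrow> 1"
proof -
  have "isCont (cutoff 1) 0" using smooth_alg_deriv_in(2)[OF cutoff_smooth] by (blast intro: DERIV_isCont)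
  moreover have "(\<lambda>n. 1 / real (Suc n) * x) \<longlonglongrightarrow> 0 * x"
    by (intro tendsto_intros LIMSEQ_Suc lim_1_over_n)
  ultimately have "(\<lambda>n. cutoff 1 (1 / real (Suc n) * x)) \<longlonglongrightarrow> cutoff 1 0"
    by (intro isCont_tendsto_compose[where g="cutoff 1"]) auto
  then show ?thesis using cutoff_scale[of "1 / real (Suc n)" x for n] by (simp only: cutoff_0)
qed

lemma cutoff_L2_tendsto:
  assumes f: "f \<in> L2"
  shows "(\<lambda>n. L2_norm (\<lambda>x. of_real (cutoff (1 / real (Suc n)) x) * f x - f x)) \<longlonglongrightarrow> 0"
proof -
  have [measurable]: "f \<in> borel_measurable borel" using f by auto
  let ?B = "exp 2 + 1 :: real"
  have "(\<lambda>n. LINT x|lborel. (cmod (of_real (cutoff (1 / real (Suc n)) x) * f x - f x))\<^sup>2)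
      \<longlonglongrightarrow> (LINT x|(lborel :: real measure). (0::real))"
  proof (rule integral_dominated_convergence[where w="\<lambda>x. ?B\<^sup>2 * (cmod (f x))\<^sup>2"])
    show "integrable lborel (\<lambda>x. ?B\<^sup>2 * (cmod (f x))\<^sup>2)" using f by (simp add: L2_iff)
    show "AE x in lborel. (\<lambda>n. (cmod (of_real (cutoff (1 / real (Suc n)) x) * f x - f x))\<^sup>2) \<longlonglongrightarrow> 0"
    proof (rule AE_I2)
      fix x
      have "(\<lambda>n. (cmod (of_real (cutoff (1 / real (Suc n)) x) * f x - f x))\<^sup>2)
          \<longlonglongrightarrow> (cmod (of_real 1 * f x - f x))\<^sup>2"
        by (intro tendsto_intros cutoff_tendsto)
      then show "(\<lambda>n. (cmod (of_real (cutoff (1 / real (Suc n)) x) * f x - f x))\<^sup>2) \<longlonglongrightarrow> 0" by simp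
    qed
    show "AE x in lborel. norm ((cmod (of_real (cutoff (1 / real (Suc n)) x) * f x - f x))\<^sup>2)
        \<le> ?B\<^sup>2 * (cmod (f x))\<^sup>2" for n
    proof (rule AE_I2)
      fix x
      have "\<bar>cutoff (1 / real (Suc n)) x - 1\<bar> \<le> ?B" using cutoff_bounded[of "1 / real (Suc n)" x]
          by linarith
      then have "cmod (of_real (cutoff (1 / real (Suc n)) x - 1) * f x) \<le> ?B * cmod (f x)"
        unfolding norm_mult norm_of_real by (rule mult_right_mono) simp
      then have "(cmod (of_real (cutoff (1 / real (Suc n)) x) * f x - f x))\<^sup>2 \<le> (?B * cmod (f x))\<^sup>2"
        by (intro power_mono) (auto simp: left_diff_distrib)
      then show "norm ((cmod (of_real (cutoff (1 / real (Suc n)) x) * f x - f x))\<^sup>2)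
          \<le> ?B\<^sup>2 * (cmod (f x))\<^sup>2"
        by (simp add: power_mult_distrib)
    qed
  qed auto
  from tendsto_real_sqrt[OF this] show ?thesis by (simp add: L2_norm_def)
qed

text \<open>The plane wave is not a test function, but its product with a cutoff is smooth with
  compact support. Test functions are real, so the identity is applied to a cosine with a free phase
  \<open>t\<close> and recombined. The last term is the commutator with the cutoff.\<close>

lemma weak_deriv_fourier_cutoff:
  assumes \<phi>: "\<phi> \<in> L2" and \<psi>: "\<psi> \<in> L2" and wd: "has_weak_deriv \<phi> \<psi>" and a: "0 < a"
  shows "FT (\<lambda>x. of_real (cutoff a x) * \<psi> x) \<xi>
    = \<i> * of_real \<xi> * FT (\<lambda>x. of_real (cutoff a x) * \<phi> x) \<xi> - FT (\<lambda>x. of_real (deriv (cutoff a) x) * \<phi> x) \<xi>"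
proof -
  have [measurable]: "\<phi> \<in> borel_measurable borel" "\<psi> \<in> borel_measurable borel" using \<phi> \<psi> by auto
  define c where "c = cutoff a"
  define d where "d = deriv (cutoff a)"
  have [measurable]: "c \<in> borel_measurable borel" "d \<in> borel_measurable borel" by (auto simp: c_def d_def)
  have dc: "(c has_real_derivative d x) (at x)" for x
    unfolding c_def d_def by (rule smooth_alg_deriv_in(2)[OF cutoff_smooth])
  obtain B where B: "\<And>a x. \<bar>deriv (cutoff a) x\<bar> \<le> B * \<bar>a\<bar>" using cutoff_deriv by blast
  have d0: "d x = 0" if "\<bar>x\<bar> > 1 / a" for x
  proof -
    have "(c has_real_derivative 0) (at x)"
      by (rule DERIV_0_off_support[OF _ that]) (auto simp: c_def cutoff_support[OF a])
    then show ?thesis using dc DERIV_unique by blast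
  qed
  have c2: "(\<lambda>x. complex_of_real (c x)) \<in> L2"
    by (rule bounded_support_L2[of _ "exp 2" "1/a"]) (use cutoff_bounded[of a] cutoff_support[OF a] in \<open>auto
      simp: c_def\<close>)
  have d2: "(\<lambda>x. complex_of_real (d x)) \<in> L2"
    by (rule bounded_support_L2[of _ "B * \<bar>a\<bar>" "1/a"]) (use B d0 in \<open>auto simp: d_def\<close>)
  have mi: "integrable lborel (\<lambda>x. cis (- (\<xi> * x)) * (of_real (g x) * f x))"
    if "(\<lambda>x. complex_of_real (g x)) \<in> L2" "f \<in> L2" for f :: "real \<Rightarrow> complex" and g
    by (intro FT_integrand L2_mult_integrable that)
  have key: "(LINT x|lborel. \<phi> x * of_real (d x * cos (\<xi> * x + t) - \<xi> * c x * sin (\<xi> * x + t)))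
      = - (LINT x|lborel. \<psi> x * of_real (c x * cos (\<xi> * x + t)))" for t
  proof -
    let ?\<eta> = "\<lambda>x. c x * cos (\<xi> * x + t)"
    have "test_function ?\<eta>"
    proof (rule smooth_alg_test_function[of _ "1 / a"])
      show "?\<eta> \<in> smooth_alg"
        using smooth_alg.mult[OF cutoff_smooth[of a] smooth_alg.cosine[of 1 \<xi> t]] by (simp add: c_def)
    qed (use cutoff_support[OF a] in \<open>auto simp: c_def\<close>)
    then have "(LINT x|lborel. \<phi> x * of_real (deriv ?\<eta> x)) = - (LINT x|lborel. \<psi> x * of_real (?\<eta> x))"
      using wd unfolding has_weak_deriv_def by blast
    moreover have "deriv ?\<eta> x = d x * cos (\<xi> * x + t) - \<xi> * c x * sin (\<xi> * x + t)" for x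
      by (rule DERIV_imp_deriv) (auto intro!: derivative_eq_intros dc simp: algebra_simps)
    ultimately show ?thesis by (simp only:)
  qed
  \<comment> \<open>The phases 0 and \<open>- (pi / 2)\<close> give the real and the imaginary part
    of the plane wave.\<close>
  have cisx: "cis (- (\<xi> * x)) = of_real (cos (\<xi> * x + 0)) - \<i> * of_real (cos (\<xi> * x + - (pi / 2)))" for x
    by (simp add: complex_eq_iff cos_diff)
  have icos: "integrable lborel (\<lambda>x. f x * of_real (g x * cos (\<xi> * x + t)))"
    if "(\<lambda>x. complex_of_real (g x)) \<in> L2" "f \<in> L2" for f :: "real \<Rightarrow> complex" and g t
  proof -
    have "(\<lambda>x. complex_of_real (cos (\<xi> * x + t)) * of_real (g x)) \<in> L2"
      by (rule L2_bounded_mult(1)[OF that(1), of _ 1]) auto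
    from L2_mult_integrable[OF that(2) this] show ?thesis by (simp add: mult_ac)
  qed
  have sc: "sin y = cos (y + - (pi / 2))" for y :: real by (simp add: cos_diff)
  have isin: "integrable lborel (\<lambda>x. f x * of_real (g x * sin (\<xi> * x + t)))"
    if "(\<lambda>x. complex_of_real (g x)) \<in> L2" "f \<in> L2" for f :: "real \<Rightarrow> complex" and g t
    unfolding sc using icos[OF that, of "t + - (pi / 2)"] by (simp only: add.assoc)
  have i1: "integrable lborel (\<lambda>x. \<phi> x * of_real (d x * cos (\<xi> * x + t) - \<xi> * c x * sin (\<xi> * x + t)))" for t
  proof -
    have "integrable lborel (\<lambda>x. \<phi> x * of_real (d x * cos (\<xi> * x + t)) - of_real \<xi>
        * (\<phi> x * of_real (c x * sin (\<xi> * x + t))))"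
      by (intro Bochner_Integration.integrable_diff integrable_mult_right icos isin c2 d2 \<phi>)
    then show ?thesis by (simp add: algebra_simps)
  qed
  have "FT (\<lambda>x. of_real (c x) * \<psi> x) \<xi> = (LINT x|lborel. \<psi> x * of_real (c x * cos (\<xi> * x + 0)) - \<i>
      * (\<psi> x * of_real (c x * cos (\<xi> * x + - (pi / 2)))))"
    unfolding FT_def by (intro Bochner_Integration.integral_cong refl) (simp only: cisx, simp add:
      algebra_simps)
  also have "\<dots> = (LINT x|lborel. \<psi> x * of_real (c x * cos (\<xi> * x + 0))) - \<i> * (LINT x|lborel. \<psi> x
      * of_real (c x * cos (\<xi> * x + - (pi / 2))))"
    by (intro integral_diff_cmult icos c2 \<psi>)
  also have "\<dots> = - (LINT x|lborel. \<phi> x * of_real (d x * cos (\<xi> * x + 0) - \<xi> * c x * sin (\<xi> * x + 0)))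
     - \<i> * - (LINT x|lborel. \<phi> x * of_real (d x * cos (\<xi> * x + - (pi / 2)) - \<xi> * c x * sin (\<xi> * x + - (pi /
         2))))"
    unfolding key by simp
  also have "\<dots> = - (LINT x|lborel. \<phi> x * of_real (d x * cos (\<xi> * x + 0) - \<xi> * c x * sin (\<xi> * x + 0))
     - \<i> * (\<phi> x * of_real (d x * cos (\<xi> * x + - (pi / 2)) - \<xi> * c x * sin (\<xi> * x + - (pi / 2)))))"
    by (subst integral_diff_cmult) (intro i1, intro i1, simp)
  also have "\<dots> = - (LINT x|lborel. cis (- (\<xi> * x)) * (of_real (d x) * \<phi> x) - \<i> * of_real \<xi>
      * (cis (- (\<xi> * x)) * (of_real (c x) * \<phi> x)))"
  proof (intro arg_cong[where f=uminus] Bochner_Integration.integral_cong refl)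
    fix x
    show "\<phi> x * of_real (d x * cos (\<xi> * x + 0) - \<xi> * c x * sin (\<xi> * x + 0))
      - \<i> * (\<phi> x * of_real (d x * cos (\<xi> * x + - (pi / 2)) - \<xi> * c x * sin (\<xi> * x + - (pi / 2))))
      = cis (- (\<xi> * x)) * (of_real (d x) * \<phi> x) - \<i> * of_real \<xi> * (cis (- (\<xi> * x)) * (of_real (c x) * \<phi> x))"
      unfolding cisx by (simp add: cos_diff sin_diff algebra_simps)
  qed
  also have "\<dots> = - (FT (\<lambda>x. of_real (d x) * \<phi> x) \<xi> - \<i> * of_real \<xi> * FT (\<lambda>x. of_real (c x) * \<phi> x) \<xi>)"
    unfolding FT_def
    by (subst integral_diff_cmult) (intro mi c2 d2 \<phi>, intro mi c2 d2 \<phi>, simp)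
  finally show ?thesis by (simp add: c_def d_def)
qed

text \<open>The cutoff is released: by Bessel the cut off functions converge in \<open>L2\<close> on
  the Fourier side, and the commutator is of size \<open>a n\<close>.\<close>

lemma weak_deriv_fourier:
  assumes \<phi>: "\<phi> \<in> L2" and \<psi>: "\<psi> \<in> L2" and wd: "has_weak_deriv \<phi> \<psi>"
  shows "AE \<xi> in lborel. fourier \<psi> \<xi> = \<i> * of_real \<xi> * fourier \<phi> \<xi>"
proof -
  have [measurable]: "\<phi> \<in> borel_measurable borel" "\<psi> \<in> borel_measurable borel"
    "fourier \<phi> \<in> borel_measurable borel" "fourier \<psi> \<in> borel_measurable borel"
    using \<phi> \<psi> fourier_L2[OF \<phi>] fourier_L2[OF \<psi>] by auto
  obtain B where B: "\<And>a x. \<bar>deriv (cutoff a) x\<bar> \<le> B * \<bar>a\<bar>" using cutoff_deriv by blast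
  define a where "a n = 1 / real (Suc n)" for n
  have a0: "0 < a n" for n by (simp add: a_def)
  have alim: "a \<longlonglongrightarrow> 0" unfolding a_def by (intro LIMSEQ_Suc lim_1_over_n)
  let ?c = "\<lambda>n f x. of_real (cutoff (a n) x) * f x :: complex"
  let ?d = "\<lambda>n x. of_real (deriv (cutoff (a n)) x) * \<phi> x :: complex"
  have c2: "(\<lambda>x. complex_of_real (cutoff (a n) x)) \<in> L2" for n
    by (rule bounded_support_L2[of _ "exp 2" "1/a n"]) (use cutoff_bounded[of
      "a n"] cutoff_support[OF a0] in auto)
  have cf: "?c n f \<in> L2" "integrable lborel (?c n f)" if "f \<in> L2" for f n
    by (rule L2_bounded_mult(1)[OF that, of _ "exp 2"], measurable, use cutoff_bounded in auto)
       (rule L2_mult_integrable[OF c2 that])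
  have df: "?d n \<in> L2" "L2_norm (?d n) \<le> B * a n * L2_norm \<phi>" for n
    using L2_bounded_mult[OF \<phi>, of "\<lambda>x. of_real (deriv (cutoff (a n)) x)" "B * a n"] B[of "a n"] a0[of n]
    by auto
  have di: "integrable lborel (?d n)" for n
  proof -
    have eq: "?d n = (\<lambda>x. ?d n x * indicator {-1/a n..1/a n} x)"
    proof (rule ext)
      fix x show "?d n x = ?d n x * indicator {-1/a n..1/a n} x"
    proof (cases "\<bar>x\<bar> > 1 / a n")
      case True
      have "(cutoff (a n) has_real_derivative 0) (at x)"
        by (rule DERIV_0_off_support[OF _ True]) (auto simp: cutoff_support[OF a0])
      then have "deriv (cutoff (a n)) x = 0" by (rule DERIV_imp_deriv)
      then show ?thesis by simp
    qed (auto simp: indicator_def)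
    qed
    have "integrable lborel (\<lambda>x. ?d n x * indicator {-1/a n..1/a n} x)"
      by (intro L2_mult_integrable df indicator_Icc_L2)
    then show ?thesis by (simp only: eq[symmetric])
  qed
  \<comment> \<open>It is not yet known that \<xi> times the transform of \<phi> is square
    integrable. The nowhere vanishing factor \<open>b\<close> tames the growth of \<xi>, so that the
    difference of both sides can be measured in \<open>L2\<close>.\<close>
  define b where "b \<xi> = complex_of_real (1 / (1 + \<bar>\<xi>\<bar>))" for \<xi> :: real
  have [measurable]: "b \<in> borel_measurable borel" by (simp add: b_def[abs_def])
  have b1: "cmod (b \<xi>) \<le> 1" "cmod (\<i> * of_real \<xi> * b \<xi>) \<le> 1" for \<xi>
    unfolding b_def norm_mult norm_of_real by (auto simp: field_simps)
  have b0: "b \<xi> \<noteq> 0" for \<xi> unfolding b_def of_real_eq_0_iff by simp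
  let ?A = "\<lambda>\<xi>. b \<xi> * fourier \<psi> \<xi> - \<i> * of_real \<xi> * b \<xi> * fourier \<phi> \<xi>"
  have A2: "?A \<in> L2"
    by (intro L2_diff L2_bounded_mult(1)[of _ b 1] L2_bounded_mult(1)[of _
      "\<lambda>\<xi>. \<i> * of_real \<xi> * b \<xi>" 1] fourier_L2 \<phi> \<psi> b1) auto
  let ?e = "\<lambda>n f. L2_norm (\<lambda>x. ?c n f x - f x)"
  have bound: "L2_norm ?A \<le> sqrt (2 * pi) * (?e n \<psi> + ?e n \<phi> + B * a n * L2_norm \<phi>)" for n
  proof -
    let ?X = "\<lambda>\<xi>. b \<xi> * (fourier \<psi> \<xi> - FT (?c n \<psi>) \<xi>)"
    let ?Y = "\<lambda>\<xi>. \<i> * of_real \<xi> * b \<xi> * (FT (?c n \<phi>) \<xi> - fourier \<phi> \<xi>)"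
    let ?Z = "\<lambda>\<xi>. - b \<xi> * FT (?d n) \<xi>"
    have X: "(\<lambda>\<xi>. fourier \<psi> \<xi> - FT (?c n \<psi>) \<xi>) \<in> L2" "(\<lambda>\<xi>. FT (?c n \<phi>) \<xi> - fourier \<phi> \<xi>) \<in> L2"
        "FT (?d n) \<in> L2"
      by (intro L2_diff fourier_L2 FT_Bessel cf df di \<phi> \<psi>)+
    have X2: "?X \<in> L2" "?Y \<in> L2" "?Z \<in> L2"
      by (rule L2_bounded_mult(1)[OF X(1), of b 1] L2_bounded_mult(1)[OF X(2), of
        "\<lambda>\<xi>. \<i> * of_real \<xi> * b \<xi>" 1]
        L2_bounded_mult(1)[OF X(3), of "\<lambda>\<xi>. - b \<xi>" 1]; use b1 in auto)+
    have Xn: "L2_norm ?X \<le> 1 * L2_norm (\<lambda>\<xi>. fourier \<psi> \<xi> - FT (?c n \<psi>) \<xi>)"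
       "L2_norm ?Y \<le> 1 * L2_norm (\<lambda>\<xi>. FT (?c n \<phi>) \<xi> - fourier \<phi> \<xi>)"
       "L2_norm ?Z \<le> 1 * L2_norm (FT (?d n))"
      by (rule L2_bounded_mult(2)[OF X(1), of b 1] L2_bounded_mult(2)[OF X(2), of
        "\<lambda>\<xi>. \<i> * of_real \<xi> * b \<xi>" 1]
        L2_bounded_mult(2)[OF X(3), of "\<lambda>\<xi>. - b \<xi>" 1]; use b1 in auto)+
    have "?A = (\<lambda>\<xi>. ?X \<xi> + (?Y \<xi> + ?Z \<xi>))"
      by (rule ext, simp only: weak_deriv_fourier_cutoff[OF \<phi> \<psi> wd a0]) (simp add: algebra_simps)
    then have "L2_norm ?A = L2_norm (\<lambda>\<xi>. ?X \<xi> + (?Y \<xi> + ?Z \<xi>))" by simp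
    also have "\<dots> \<le> L2_norm ?X + L2_norm (\<lambda>\<xi>. ?Y \<xi> + ?Z \<xi>)"
      by (intro L2_Minkowski L2_add X2)
    also have "L2_norm (\<lambda>\<xi>. ?Y \<xi> + ?Z \<xi>) \<le> L2_norm ?Y + L2_norm ?Z" by (intro L2_Minkowski X2)
    finally have "L2_norm ?A \<le> L2_norm (\<lambda>\<xi>. fourier \<psi> \<xi> - FT (?c n \<psi>) \<xi>)
        + (L2_norm (\<lambda>\<xi>. FT (?c n \<phi>) \<xi> - fourier \<phi> \<xi>) + L2_norm (FT (?d n)))"
      using Xn by linarith
    moreover have "L2_norm (\<lambda>\<xi>. fourier \<psi> \<xi> - FT (?c n \<psi>) \<xi>) \<le> sqrt (2 * pi) * ?e n \<psi>"
      unfolding L2_norm_diff_commute[of "fourier \<psi>"] by (intro fourier_near_FT cf \<psi>)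
    moreover have "L2_norm (\<lambda>\<xi>. FT (?c n \<phi>) \<xi> - fourier \<phi> \<xi>) \<le> sqrt (2 * pi) * ?e n \<phi>"
      by (intro fourier_near_FT cf \<phi>)
    moreover have "L2_norm (FT (?d n)) \<le> sqrt (2 * pi) * (B * a n * L2_norm \<phi>)"
      by (rule order_trans[OF FT_Bessel(2)[OF di df(1)] mult_left_mono[OF df(2)]]) simp
    ultimately show ?thesis unfolding distrib_left by linarith
  qed
  have "(\<lambda>n. sqrt (2 * pi) * (?e n \<psi> + ?e n \<phi> + B * a n * L2_norm \<phi>))
      \<longlonglongrightarrow> sqrt (2 * pi) * (0 + 0 + B * 0 * L2_norm \<phi>)"
    by (intro tendsto_intros alim cutoff_L2_tendsto[OF \<phi>, folded a_def] cutoff_L2_tendsto[OF \<psi>, folded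
      a_def])
  then have "L2_norm ?A \<le> sqrt (2 * pi) * (0 + 0 + B * 0 * L2_norm \<phi>)"
    by (rule LIMSEQ_le_const) (use bound in blast)
  then have "L2_norm ?A \<le> 0" by simp
  then have "L2_norm ?A = 0" using L2_norm_nonneg order_antisym by blast
  from L2_norm_eq_0[OF A2 this] show ?thesis
  proof eventually_elim
    case (elim \<xi>)
    then have "b \<xi> * (fourier \<psi> \<xi> - \<i> * of_real \<xi> * fourier \<phi> \<xi>) = 0" by (simp add: algebra_simps)
    then show ?case using b0 by simp
  qed
qed

text \<open>Parseval against the test function: integration by parts is elementary for the compactly
  supported \<open>\<eta>\<close>, and its factor \<open>\<i> * \<xi>\<close> changes sign under
  conjugation.\<close>

lemma fourier_weak_deriv:
  assumes \<phi>: "\<phi> \<in> L2" and \<psi>: "\<psi> \<in> L2" and eq: "AE \<xi> in lborel. fourier \<psi> \<xi> = \<i> * of_real \<xi> * fourier \<phi> \<xi>"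
  shows "has_weak_deriv \<phi> \<psi>"
  unfolding has_weak_deriv_def
proof (intro allI impI)
  fix \<eta> assume "test_function \<eta>"
  then obtain R where d: "\<And>n x. ((deriv ^^ n) \<eta>) field_differentiable (at x)" and R: "\<And>x. \<bar>x\<bar> > R \<Longrightarrow> \<eta> x = 0"
    unfolding test_function_def by blast
  have d1: "(\<eta> has_real_derivative deriv \<eta> x) (at x)" for x
    using d[of 0 x] by (auto simp: field_differentiable_derivI)
  have c1: "isCont \<eta> x" for x using d1 by (rule DERIV_isCont)
  have c2: "isCont (deriv \<eta>) x" for x using d[of 1 x] field_differentiable_imp_continuous_at by simp
  have [measurable]: "\<eta> \<in> borel_measurable borel" "deriv \<eta> \<in> borel_measurable borel"
    using c1 c2 by (auto intro!: borel_measurable_continuous_onI continuous_at_imp_continuous_on)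
  define S where "S = \<bar>R\<bar> + 1"
  have S: "\<eta> x = 0" "deriv \<eta> x = 0" if "\<bar>x\<bar> \<ge> S" for x
  proof -
    show "\<eta> x = 0" using that by (intro R) (auto simp: S_def)
    have "(\<eta> has_real_derivative 0) (at x)"
      by (rule DERIV_0_off_support[of R]) (use that in \<open>auto simp: S_def intro!: R\<close>)
    then show "deriv \<eta> x = 0" by (rule DERIV_imp_deriv)
  qed
  have bnd: "\<exists>B. \<forall>x. \<bar>f x\<bar> \<le> B" if c: "\<And>x. isCont f x" and z: "\<And>x. \<bar>x\<bar> \<ge> S \<Longrightarrow> f x = 0" for f :: "real \<Rightarrow> real"
  proof -
    have "bounded (f ` {-S..S})"
      using c by (intro compact_imp_bounded compact_continuous_image continuous_at_imp_continuous_on) auto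
    then obtain B where B: "\<forall>x\<in>{-S..S}. \<bar>f x\<bar> \<le> B" unfolding bounded_iff by auto
    have "\<bar>f x\<bar> \<le> max B 0" for x
    proof (cases "\<bar>x\<bar> \<ge> S")
      case False
      then have "x \<in> {-S..S}" by auto
      with B have "\<bar>f x\<bar> \<le> B" by blast
      then show ?thesis by simp
    qed (use z[of x] in simp)
    then show ?thesis by blast
  qed
  let ?e = "\<lambda>x. complex_of_real (\<eta> x)" and ?e' = "\<lambda>x. complex_of_real (deriv \<eta> x)"
  have supp: "f \<in> L2 \<and> integrable lborel f"
    if f: "f = (\<lambda>x. complex_of_real (g x))" "g \<in> borel_measurable borel" "\<And>x. isCont g x" "\<And>x. \<bar>x\<bar> \<ge> S \<Longrightarrow>
        g x = 0" for f g
  proof -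
    note fg = f that(3,4)
    obtain B where B: "\<And>x. \<bar>g x\<bar> \<le> B" using bnd[OF fg(3,4)] by blast
    have f2: "f \<in> L2" unfolding fg(1) by (rule bounded_support_L2[of _ B S]) (use B fg in auto)
    have "f = (\<lambda>x. f x * indicator {-S..S} x)"
    proof (rule ext)
      fix x show "f x = f x * indicator {-S..S} x"
        using fg(4)[of x] by (cases "\<bar>x\<bar> \<ge> S") (auto simp: fg(1) indicator_def)
    qed
    then have "integrable lborel f" using L2_mult_integrable[OF f2 indicator_Icc_L2, of "-S" S] by simp
    with f2 show ?thesis by simp
  qed
  have e: "?e \<in> L2" "integrable lborel ?e" using supp[OF refl _ c1 S(1)] by auto
  have e': "?e' \<in> L2" "integrable lborel ?e'" using supp[OF refl _ c2 S(2)] by auto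
  have FTe: "FT ?e' \<xi> = \<i> * of_real \<xi> * FT ?e \<xi>" for \<xi>
  proof -
    let ?g = "\<lambda>x. cis (- \<xi> * x) * of_real (\<eta> x)"
    let ?g' = "\<lambda>x. cis (- \<xi> * x) * of_real (deriv \<eta> x) + (\<i> * of_real (- \<xi>) * cis (- \<xi> * x))
        * of_real (\<eta> x)"
    have "(?g has_vector_derivative ?g' x) (at x within A)" for x A
      by (intro has_vector_derivative_mult has_vector_derivative_cis_mult has_vector_derivative_of_real)
         (use d1 in \<open>auto simp: has_real_derivative_iff_has_vector_derivative intro:
             has_vector_derivative_at_within\<close>)
    moreover have "continuous_on {-S..S} ?g'"
      by (intro continuous_intros continuous_at_imp_continuous_on ballI c1 c2)
    ultimately have "(LINT x|lborel. indicator {-S..S} x *\<^sub>R ?g' x) = ?g S - ?g (-S)"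
      by (intro integral_FTC_atLeastAtMost) (auto simp: S_def)
    also have "\<dots> = 0" using S(1)[of S] S(1)[of "-S"] by (auto simp: S_def)
    also have "(\<lambda>x. indicator {-S..S} x *\<^sub>R ?g' x) = (\<lambda>x. cis (- (\<xi> * x)) * ?e' x - \<i> * of_real \<xi>
        * (cis (- (\<xi> * x)) * ?e x))"
    proof
      fix x
      show "indicator {-S..S} x *\<^sub>R ?g' x = cis (- (\<xi> * x)) * ?e' x - \<i> * of_real \<xi> * (cis (- (\<xi> * x))
          * ?e x)"
        using S[of x] by (cases "\<bar>x\<bar> \<ge> S") (auto simp: indicator_def)
    qed
    also have "(LINT x|lborel. cis (- (\<xi> * x)) * ?e' x - \<i> * of_real \<xi> * (cis (- (\<xi> * x)) * ?e x))
        = FT ?e' \<xi> - \<i> * of_real \<xi> * FT ?e \<xi>"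
      unfolding FT_def
      by (intro integral_diff_cmult FT_integrand e e')
    finally show ?thesis by simp
  qed
  have [measurable]: "fourier \<phi> \<in> borel_measurable borel" "fourier \<psi> \<in> borel_measurable borel"
      "fourier ?e \<in> borel_measurable borel"
    "fourier ?e' \<in> borel_measurable borel"
    using fourier_L2[OF \<phi>] fourier_L2[OF \<psi>] fourier_L2[OF e(1)] fourier_L2[OF e'(1)] by auto
  have "2 * pi * (LINT x|lborel. \<phi> x * cnj (?e' x)) = (LINT \<xi>|lborel. fourier \<phi> \<xi> * cnj (fourier ?e' \<xi>))"
    by (rule fourier_Parseval[OF \<phi> e'(1), symmetric])
  also have "\<dots> = (LINT \<xi>|lborel. - (fourier \<psi> \<xi> * cnj (fourier ?e \<xi>)))"
  proof (rule integral_cong_AE)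
    show "AE \<xi> in lborel. fourier \<phi> \<xi> * cnj (fourier ?e' \<xi>) = - (fourier \<psi> \<xi> * cnj (fourier ?e \<xi>))"
      using eq fourier_eq_FT[OF e] fourier_eq_FT[OF e'] by eventually_elim (simp add: FTe)
  qed auto
  also have "\<dots> = - (2 * pi * (LINT x|lborel. \<psi> x * cnj (?e x)))"
    using fourier_Parseval[OF \<psi> e(1)] by simp
  finally have "complex_of_real (2 * pi) * (LINT x|lborel. \<phi> x * ?e' x) = complex_of_real (2 * pi) *
      - (LINT x|lborel. \<psi> x * ?e x)"
    by simp
  then show "(LINT x|lborel. \<phi> x * ?e' x) = - (LINT x|lborel. \<psi> x * ?e x)"
    by (subst (asm) mult_left_cancel) auto
qed

section \<open>The Lax operator on the Fourier side\<close>

lemma weak_deriv_L2: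
  assumes "\<phi> \<in> L2" "\<psi> \<in> L2" "has_weak_deriv \<phi> \<psi>"
  shows "weak_deriv \<phi> \<in> L2" "AE \<xi> in lborel. fourier (weak_deriv \<phi>) \<xi> = \<i> * of_real \<xi> * fourier \<phi> \<xi>"
proof -
  have "weak_deriv \<phi> \<in> L2 \<and> has_weak_deriv \<phi> (weak_deriv \<phi>)"
    unfolding weak_deriv_def by (rule someI_ex[of "\<lambda>\<psi>. \<psi> \<in> L2 \<and> has_weak_deriv \<phi> \<psi>"]) (use assms in blast)
  then show "weak_deriv \<phi> \<in> L2" "AE \<xi> in lborel. fourier (weak_deriv \<phi>) \<xi> = \<i> * of_real \<xi> * fourier \<phi> \<xi>"
    using weak_deriv_fourier[OF assms(1)] by auto
qed

text \<open>Domain membership expressed entirely by the transform; the reverse direction builds the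
  weak derivative by inverting \<open>\<i> * \<xi> * fourier \<phi> \<xi>\<close>.\<close>

lemma Lax_dom_iff:
  "\<phi> \<in> Lax_dom \<longleftrightarrow> \<phi> \<in> L2 \<and> (AE \<xi> in lborel. \<xi> \<le> 0 \<longrightarrow> fourier \<phi> \<xi> = 0) \<and> (\<lambda>\<xi>. of_real \<xi> * fourier \<phi> \<xi>) \<in> L2"
proof -
  have "(\<exists>\<psi> \<in> L2. has_weak_deriv \<phi> \<psi>) \<longleftrightarrow> (\<lambda>\<xi>. of_real \<xi> * fourier \<phi> \<xi>) \<in> L2" if \<phi>: "\<phi> \<in> L2"
  proof
    have [measurable]: "fourier \<phi> \<in> borel_measurable borel" using fourier_L2[OF \<phi>] by auto
    assume "\<exists>\<psi> \<in> L2. has_weak_deriv \<phi> \<psi>"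
    then obtain \<psi> where \<psi>: "\<psi> \<in> L2" "has_weak_deriv \<phi> \<psi>" by blast
    show "(\<lambda>\<xi>. of_real \<xi> * fourier \<phi> \<xi>) \<in> L2"
    proof (rule L2_dominated[OF fourier_L2[OF \<psi>(1)], of _ 1])
      show "AE \<xi> in lborel. cmod (of_real \<xi> * fourier \<phi> \<xi>) \<le> 1 * cmod (fourier \<psi> \<xi>)"
        using weak_deriv_fourier[OF \<phi> \<psi>] by eventually_elim (simp add: norm_mult)
    qed measurable
  next
    assume "(\<lambda>\<xi>. of_real \<xi> * fourier \<phi> \<xi>) \<in> L2"
    then have h: "(\<lambda>\<xi>. \<i> * (of_real \<xi> * fourier \<phi> \<xi>)) \<in> L2" by (rule L2_cmult)
    have "has_weak_deriv \<phi> (inv_fourier (\<lambda>\<xi>. \<i> * (of_real \<xi> * fourier \<phi> \<xi>)))"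
      by (rule fourier_weak_deriv[OF \<phi> inv_fourier_L2[OF h]])
         (use fourier_inv_fourier[OF h] in \<open>simp add: mult.assoc\<close>)
    with inv_fourier_L2[OF h] show "\<exists>\<psi> \<in> L2. has_weak_deriv \<phi> \<psi>" by blast
  qed
  then show ?thesis by (auto simp: Lax_dom_def Hardy_iff)
qed

lemma w_powr_integrable:
  assumes "1 < p" shows "integrable lborel (\<lambda>x. w x powr (- p))"
proof -
  let ?f = "\<lambda>x::real. (1 + x) powr (- p)"
  have "(\<integral>\<^sup>+x. ennreal (w x powr (- p)) * indicator {0..} x \<partial>lborel)
      = ennreal (0 - (- (1 / (p - 1)) * (1 + 0) powr (1 - p)))"
  proof (rule nn_integral_FTC_atLeast)
    show "(\<lambda>x. w x powr (- p)) \<in> borel_measurable borel" by measurable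
    fix x :: real assume "0 \<le> x"
    then have "((\<lambda>x. - (1 / (p - 1)) * (1 + x) powr (1 - p)) has_real_derivative
        - (1 / (p - 1)) * ((1 - p) * (1 + x) powr (1 - p - of_nat 1) * 1)) (at x)"
      by (intro DERIV_cmult DERIV_fun_powr) (auto intro!: derivative_eq_intros)
    moreover have "- (1 / (p - 1)) * ((1 - p) * (1 + x) powr (1 - p - of_nat 1) * 1) = w x powr (- p)"
      using assms \<open>0 \<le> x\<close> by (simp add: w_def field_simps)
    ultimately show "((\<lambda>x. - (1 / (p - 1)) * (1 + x) powr (1 - p)) has_real_derivative w x powr (- p))
        (at x)"
      by simp
  next
    have "((\<lambda>x. - (1 / (p - 1)) * (1 + x) powr (1 - p)) \<longlongrightarrow> - (1 / (p - 1)) * 0) at_top"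
      using assms by (intro tendsto_intros tendsto_neg_powr filterlim_tendsto_add_at_top[OF tendsto_const
        filterlim_ident]) auto
    then show "((\<lambda>x. - (1 / (p - 1)) * (1 + x) powr (1 - p)) \<longlongrightarrow> 0) at_top" by simp
  qed auto
  then have 1: "(\<integral>\<^sup>+x. ennreal (w x powr (- p)) * indicator {0..} x \<partial>lborel) < \<infinity>" by simp
  have "(\<integral>\<^sup>+x. ennreal (w x powr (- p)) \<partial>lborel)
    \<le> (\<integral>\<^sup>+x. ennreal (w x powr (- p)) * indicator {0..} x + ennreal (w (- x) powr (- p)) * indicator {0..}
        (- x) \<partial>lborel)"
    by (intro nn_integral_mono) (auto simp: indicator_def w_def)
  also have "\<dots> = (\<integral>\<^sup>+x. ennreal (w x powr (- p)) * indicator {0..} x \<partial>lborel)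
      + (\<integral>\<^sup>+x. ennreal (w (- x) powr (- p)) * indicator {0..} (- x) \<partial>lborel)"
    by (rule nn_integral_add) auto
  also have "(\<integral>\<^sup>+x. ennreal (w (- x) powr (- p)) * indicator {0..} (- x) \<partial>lborel)
      = (\<integral>\<^sup>+x. ennreal (w x powr (- p)) * indicator {0..} x \<partial>lborel)"
    using nn_integral_real_affine[of "\<lambda>x. ennreal (w x powr (- p)) * indicator {0..} x" "-1" 0] by simp
  also have "\<dots> + \<dots> < \<infinity>" using 1 by simp
  finally show ?thesis by (intro integrableI_bounded) auto
qed

lemma w_powr_L2:
  assumes "1/2 < a" shows "(\<lambda>x. complex_of_real (w x powr (- a))) \<in> L2"
proof -
  have "(\<lambda>x. (cmod (complex_of_real (w x powr (- a))))\<^sup>2) = (\<lambda>x. w x powr (- (2 * a)))"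
    by (auto simp: powr_powr[symmetric] simp flip: powr_numeral)
       (simp add: powr_powr mult.commute)
  then show ?thesis using w_powr_integrable[of "2 * a"] assms by (simp add: L2_iff)
qed

lemma L2_if_decay:
  assumes "f \<in> borel_measurable borel" "\<And>x. cmod (f x) * w x \<le> C"
  shows "f \<in> L2" "L2_norm f \<le> C * L2_norm (\<lambda>x. complex_of_real (w x powr (- 1)))"
proof -
  have C: "0 \<le> C" using assms(2)[of 0] by (rule order_trans[rotated]) simp
  have *: "AE x in lborel. cmod (f x) \<le> C * cmod (complex_of_real (w x powr (- 1)))"
    using assms(2) by (intro AE_I2) (simp only: norm_of_real, simp add: powr_minus_divide field_simps)
  show "f \<in> L2" by (rule L2_dominated[OF w_powr_L2 assms(1) *]) simp
  show "L2_norm f \<le> C * L2_norm (\<lambda>x. complex_of_real (w x powr (- 1)))"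
    by (rule L2_norm_mono[OF w_powr_L2 assms(1) C *]) simp
qed

text \<open>Cauchy-Schwarz against \<open>w\<close> to the power \<open>- 1\<close>, which is square
  integrable.\<close>

lemma integrable_if_weighted_L2:
  assumes h: "h \<in> L2" and xh: "(\<lambda>\<xi>. of_real \<xi> * h \<xi>) \<in> L2"
  shows "integrable lborel h"
proof -
  have [measurable]: "h \<in> borel_measurable borel" using h by auto
  have "(\<lambda>\<xi>. complex_of_real (w \<xi>) * h \<xi>) \<in> L2"
  proof (rule L2_dominated)
    have "(\<lambda>\<xi>. complex_of_real \<bar>\<xi>\<bar> * h \<xi>) \<in> L2"
      by (rule L2_dominated[OF xh, of _ 1]) (auto simp: norm_mult)
    from L2_add[OF L2_cmult[OF h, of 1] this] show "(\<lambda>\<xi>. 1 * h \<xi> + complex_of_real \<bar>\<xi>\<bar> * h \<xi>) \<in> L2" .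
    show "AE \<xi> in lborel. cmod (complex_of_real (w \<xi>) * h \<xi>)
        \<le> 1 * cmod (1 * h \<xi> + complex_of_real \<bar>\<xi>\<bar> * h \<xi>)"
      by (simp add: w_def algebra_simps)
  qed measurable
  from L2_mult_integrable[OF w_powr_L2[of 1] this] show ?thesis
    by (simp add: powr_minus_divide field_simps)
qed

lemma IFT_bound: "cmod (IFT h x) \<le> 1 / (2 * pi) * (LINT \<xi>|lborel. cmod (h \<xi>))"
  unfolding IFT_FT norm_mult using FT_bound[of h "- x"]
  by (simp add: norm_divide divide_right_mono)

text \<open>The one-dimensional Sobolev embedding: elements of the domain are bounded, so
  \<open>u\<close> times such an element is square integrable although \<open>u\<close> itself need
  not be bounded.\<close>

lemma Lax_dom_bounded:
  assumes "\<phi> \<in> Lax_dom"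
  shows "integrable lborel (fourier \<phi>)" "AE x in lborel. \<phi> x = IFT (fourier \<phi>) x"
proof -
  show i: "integrable lborel (fourier \<phi>)"
    by (rule integrable_if_weighted_L2) (use assms in \<open>auto simp: Lax_dom_iff\<close>)
  show "AE x in lborel. \<phi> x = IFT (fourier \<phi>) x"
    using IFT_fourier[OF _ i] assms by (auto simp: Lax_dom_iff)
qed

lemma measurable_of_real_cancel:
  assumes "(\<lambda>x. complex_of_real (u x)) \<in> borel_measurable M" shows "u \<in> borel_measurable M"
proof -
  have "(\<lambda>x. Re (complex_of_real (u x))) \<in> borel_measurable M" using assms by measurable
  then show ?thesis by simp
qed

lemma potential_mult_L2:
  fixes u :: "real \<Rightarrow> real"
  assumes u: "(\<lambda>x. complex_of_real (u x)) \<in> L2" and m: "f \<in> borel_measurable borel"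
      and b: "AE x in lborel. cmod (f x) \<le> C" and C: "0 \<le> C"
  shows "(\<lambda>x. of_real (u x) * f x) \<in> L2" "L2_norm (\<lambda>x. of_real (u x) * f x)
      \<le> C * L2_norm (\<lambda>x. complex_of_real (u x))"
proof -
  have [measurable]: "u \<in> borel_measurable borel"
    by (rule measurable_of_real_cancel[OF L2_measurable[OF u]])
  have *: "AE x in lborel. cmod (of_real (u x) * f x) \<le> C * cmod (complex_of_real (u x))"
    using b
  proof eventually_elim
    case (elim x)
    from mult_right_mono[OF elim, of "\<bar>u x\<bar>"] show ?case by (simp add: norm_mult mult.commute)
  qed
  show "(\<lambda>x. of_real (u x) * f x) \<in> L2" by (rule L2_dominated[OF u _ *]) (use m in measurable)
  show "L2_norm (\<lambda>x. of_real (u x) * f x) \<le> C * L2_norm (\<lambda>x. complex_of_real (u x))"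
    by (rule L2_norm_mono[OF u _ C *]) (use m in measurable)
qed

lemma Lax_dom_potential_L2:
  assumes u: "(\<lambda>x. complex_of_real (u x)) \<in> L2" and \<phi>: "\<phi> \<in> Lax_dom"
  shows "(\<lambda>x. of_real (u x) * \<phi> x) \<in> L2"
proof (rule potential_mult_L2(1)[OF u])
  show "\<phi> \<in> borel_measurable borel" using \<phi> by (auto simp: Lax_dom_iff)
  show "AE x in lborel. cmod (\<phi> x) \<le> 1 / (2 * pi) * (LINT \<xi>|lborel. cmod (fourier \<phi> \<xi>))"
    using Lax_dom_bounded(2)[OF \<phi>] by eventually_elim (use IFT_bound in simp)
qed auto

text \<open>All chosen representatives in \<open>Lax\<close> disappear here. On the domain the inner
  projection acts as the identity, and the outer one becomes the indicator of the positive half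
  line.\<close>

lemma Lax_fourier:
  assumes u: "(\<lambda>x. complex_of_real (u x)) \<in> L2" and \<phi>: "\<phi> \<in> Lax_dom"
  shows "(\<lambda>x. Lax u \<phi> x - k * \<phi> x) \<in> L2"
    "AE \<xi> in lborel. fourier (\<lambda>x. Lax u \<phi> x - k * \<phi> x) \<xi>
      = (of_real \<xi> - k) * fourier \<phi> \<xi> - indicator {0<..} \<xi> * fourier (\<lambda>x. of_real (u x) * \<phi> x) \<xi>"
proof -
  have \<phi>2: "\<phi> \<in> L2" using \<phi> by (simp add: Lax_dom_iff)
  have \<phi>H: "\<phi> \<in> Hardy" using \<phi> by (simp add: Lax_dom_def)
  have [measurable]: "u \<in> borel_measurable borel" "\<phi> \<in> borel_measurable borel"
      "Cplus \<phi> \<in> borel_measurable borel"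
    using measurable_of_real_cancel[OF L2_measurable[OF u]] \<phi>2 Cplus_L2[OF \<phi>2] by auto
  obtain \<psi> where \<psi>: "\<psi> \<in> L2" "has_weak_deriv \<phi> \<psi>" using \<phi> by (auto simp: Lax_dom_def)
  note wd = weak_deriv_L2[OF \<phi>2 \<psi>]
  let ?v = "\<lambda>x. of_real (u x) * \<phi> x" and ?v' = "\<lambda>x. of_real (u x) * Cplus \<phi> x"
  have v: "?v \<in> L2" by (rule Lax_dom_potential_L2[OF u \<phi>])
  have ae: "AE x in lborel. ?v x = ?v' x" using Cplus_Hardy[OF \<phi>H] by eventually_elim simp
  have v': "?v' \<in> L2" by (rule L2_cong_AE[OF v _ ae]) measurable
  have fv: "fourier ?v = fourier ?v'" by (rule fourier_cong_AE[OF _ _ ae]) measurable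
  let ?a = "\<lambda>x. 1 / \<i> * weak_deriv \<phi> x" and ?b = "\<lambda>x. Cplus ?v' x"
  have a: "?a \<in> L2" by (intro L2_cmult wd)
  have b: "?b \<in> L2" by (intro Cplus_L2 v')
  have eq: "(\<lambda>x. Lax u \<phi> x - k * \<phi> x) = (\<lambda>x. (?a x + (-1) * ?b x) + (- k) * \<phi> x)"
    by (auto simp: Lax_def fun_eq_iff)
  have ab: "(\<lambda>x. ?a x + (-1) * ?b x) \<in> L2" by (intro L2_add L2_cmult wd Cplus_L2 v')
  show "(\<lambda>x. Lax u \<phi> x - k * \<phi> x) \<in> L2" unfolding eq by (intro L2_add L2_cmult wd Cplus_L2 v' \<phi>2)
  show "AE \<xi> in lborel. fourier (\<lambda>x. Lax u \<phi> x - k * \<phi> x) \<xi>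
      = (of_real \<xi> - k) * fourier \<phi> \<xi> - indicator {0<..} \<xi> * fourier ?v \<xi>"
    unfolding eq fv
    using fourier_add_cmult[OF ab \<phi>2, of "- k"] fourier_add_cmult[OF a b, of
      "-1"] fourier_cmult[OF wd(1), of "1 / \<i>"]
      wd(2) fourier_Cplus[OF v']
    by eventually_elim (simp only:, simp add: algebra_simps)
qed

lemma Lax_eq_iff:
  assumes u: "(\<lambda>x. complex_of_real (u x)) \<in> L2" and \<phi>: "\<phi> \<in> Lax_dom" and f: "f \<in> L2"
  shows "(AE x in lborel. Lax u \<phi> x - k * \<phi> x = f x) \<longleftrightarrow>
    (AE \<xi> in lborel. (of_real \<xi> - k) * fourier \<phi> \<xi> - indicator {0<..} \<xi> * fourier (\<lambda>x. of_real (u x) * \<phi> x)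
        \<xi> = fourier f \<xi>)"
proof
  note L = Lax_fourier[OF u \<phi>, of k]
  assume "AE x in lborel. Lax u \<phi> x - k * \<phi> x = f x"
  then have "fourier (\<lambda>x. Lax u \<phi> x - k * \<phi> x) = fourier f"
    by (intro fourier_cong_AE) (use L(1) f in auto)
  with L(2) show "AE \<xi> in lborel. (of_real \<xi> - k) * fourier \<phi> \<xi> - indicator {0<..} \<xi>
      * fourier (\<lambda>x. of_real (u x) * \<phi> x) \<xi> = fourier f \<xi>"
    by (auto elim: eventually_mono)
next
  note L = Lax_fourier[OF u \<phi>, of k]
  assume *: "AE \<xi> in lborel. (of_real \<xi> - k) * fourier \<phi> \<xi> - indicator {0<..} \<xi> * fourier (\<lambda>x. of_real (u x)
      * \<phi> x) \<xi> = fourier f \<xi>"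
  have "AE \<xi> in lborel. fourier (\<lambda>x. Lax u \<phi> x - k * \<phi> x) \<xi> = fourier f \<xi>"
    using L(2) * by eventually_elim simp
  then show "AE x in lborel. Lax u \<phi> x - k * \<phi> x = f x" by (rule fourier_inj[OF L(1) f])
qed

lemma Lax_Hardy:
  assumes u: "(\<lambda>x. complex_of_real (u x)) \<in> L2" and \<phi>: "\<phi> \<in> Lax_dom"
  shows "(\<lambda>x. Lax u \<phi> x - k * \<phi> x) \<in> Hardy"
  unfolding Hardy_iff
proof (intro conjI Lax_fourier(1)[OF u \<phi>])
  have "AE \<xi> in lborel. \<xi> \<le> 0 \<longrightarrow> fourier \<phi> \<xi> = 0" using \<phi> by (simp add: Lax_dom_iff)
  with Lax_fourier(2)[OF u \<phi>, of k] show "AE \<xi> in lborel. \<xi> \<le> 0 \<longrightarrow> fourier (\<lambda>x. Lax u \<phi> x - k * \<phi> x) \<xi> = 0"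
    by eventually_elim auto
qed

text \<open>Wave packets with frequencies in a short interval to the right of \<open>k\<close>
  violate the resolvent bound. They spread out in space, so the potential acts on them as a small
  perturbation even though it is only in \<open>L2\<close>.\<close>

lemma resolvent_not_nonneg:
  assumes u: "(\<lambda>x. complex_of_real (u x)) \<in> L2" and k: "0 \<le> k"
  shows "complex_of_real k \<notin> Lax_resolvent_set u"
proof
  assume "complex_of_real k \<in> Lax_resolvent_set u"
  then obtain C0 where C0: "\<And>\<phi> :: real \<Rightarrow> complex. \<phi> \<in> Lax_dom \<Longrightarrow> L2_norm \<phi>
      \<le> C0 * L2_norm (\<lambda>x. Lax u \<phi> x - k * \<phi> x)"
    unfolding Lax_resolvent_set_def by auto
  \<comment> \<open>The constant of the resolvent bound comes without a sign; monotonicity below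
    needs it nonnegative.\<close>
  define C where "C = max C0 0"
  have C: "L2_norm \<phi> \<le> C * L2_norm (\<lambda>x. Lax u \<phi> x - k * \<phi> x)" if "\<phi> \<in> Lax_dom" for \<phi> :: "real \<Rightarrow> complex"
    using C0[OF that] by (rule order_trans) (auto simp: C_def intro!: mult_right_mono)
  let ?U = "L2_norm (\<lambda>x. complex_of_real (u x))" and ?s = "sqrt (2 * pi)"
  have main: "1 \<le> C * (e * e + ?s * (e * ?U))" if e: "0 < e" for e :: real
  proof -
    \<comment> \<open>The band has width \<open>e * e\<close>, so its indicator has
      \<open>L2\<close> norm \<open>e\<close> but integral \<open>e * e\<close>. The sup norm of the
      packet, and with it the potential term, is therefore smaller than the packet norm by a factor
      of order \<open>e\<close>.\<close>
    define E where "E = e * e"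
    have E0: "0 < E" using e by (simp add: E_def)
    define h :: "real \<Rightarrow> complex" where "h \<xi> = indicator {k..k + E} \<xi>" for \<xi>
    have h2: "h \<in> L2" and hi: "integrable lborel h"
      unfolding h_def[abs_def] by (rule indicator_Icc_L2, rule indicator_Icc_integrable)
    have "(\<lambda>\<xi>. (cmod (h \<xi>))\<^sup>2) = indicator {k..k + E}" by (auto simp: h_def indicator_def)
    then have hn: "L2_norm h = e" using e by (simp add: L2_norm_def E_def real_sqrt_mult)
    have "(\<lambda>\<xi>. cmod (h \<xi>)) = indicator {k..k + E}" by (auto simp: h_def indicator_def)
    then have h1: "(LINT \<xi>|lborel. cmod (h \<xi>)) = E" using E0 by simp
    define \<phi> where "\<phi> = IFT h"
    have \<phi>2: "\<phi> \<in> L2" unfolding \<phi>_def by (rule IFT_L2[OF h2 hi])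
    have f\<phi>: "AE \<xi> in lborel. fourier \<phi> \<xi> = h \<xi>" unfolding \<phi>_def by (rule fourier_IFT[OF h2 hi])
    have [measurable]: "h \<in> borel_measurable borel" "fourier \<phi> \<in> borel_measurable borel"
      using h2 fourier_L2[OF \<phi>2] by auto
    have "AE \<xi> in lborel. \<xi> \<noteq> (0::real)" by (rule AE_lborel_singleton)
    then have supp: "AE \<xi> in lborel. \<xi> \<le> 0 \<longrightarrow> fourier \<phi> \<xi> = 0"
      using f\<phi> by eventually_elim (use k in \<open>auto simp: h_def indicator_def\<close>)
    have xh: "(\<lambda>\<xi>. of_real \<xi> * fourier \<phi> \<xi>) \<in> L2"
    proof (rule L2_dominated[OF h2, of _ "k + E"])
      show "AE \<xi> in lborel. cmod (of_real \<xi> * fourier \<phi> \<xi>) \<le> (k + E) * cmod (h \<xi>)"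
        using f\<phi> by eventually_elim (use k in \<open>auto simp: h_def indicator_def\<close>)
    qed measurable
    have dom: "\<phi> \<in> Lax_dom" unfolding Lax_dom_iff using \<phi>2 supp xh by blast
    let ?g = "\<lambda>x. Lax u \<phi> x - k * \<phi> x" and ?v = "\<lambda>x. of_real (u x) * \<phi> x"
    have "cmod (\<phi> x) \<le> E" for x
    proof -
      have "cmod (\<phi> x) \<le> 1 / (2 * pi) * E" using IFT_bound[of h x] by (simp add: \<phi>_def h1)
      also have "\<dots> \<le> 1 * E" using pi_gt3 E0 by (intro mult_right_mono) auto
      finally show ?thesis by simp
    qed
    then have v: "?v \<in> L2" "L2_norm ?v \<le> E * ?U"
      using potential_mult_L2[OF u, of \<phi> E] \<phi>2 E0 by auto
    have [measurable]: "fourier ?v \<in> borel_measurable borel" using fourier_L2[OF v(1)] by auto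
    note g2 = Lax_fourier(1)[OF u dom, of k]
    have [measurable]: "fourier ?g \<in> borel_measurable borel" using fourier_L2[OF g2] by auto
    have A: "(\<lambda>\<xi>. (of_real \<xi> - of_real k) * h \<xi>) \<in> L2" "L2_norm (\<lambda>\<xi>. (of_real \<xi> - of_real k) * h \<xi>)
        \<le> E * L2_norm h"
    proof -
      have *: "AE \<xi> in lborel. cmod ((of_real \<xi> - of_real k) * h \<xi>) \<le> E * cmod (h \<xi>)"
        by (rule AE_I2) (auto simp: h_def indicator_def norm_mult simp flip: of_real_diff)
      show "(\<lambda>\<xi>. (of_real \<xi> - of_real k) * h \<xi>) \<in> L2" by (rule L2_dominated[OF h2 _ *]) measurable
      show "L2_norm (\<lambda>\<xi>. (of_real \<xi> - of_real k) * h \<xi>) \<le> E * L2_norm h"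
        by (rule L2_norm_mono[OF h2 _ _ *]) (use E0 in auto)
    qed
    have B: "(\<lambda>\<xi>. (- indicator {0<..} \<xi>) * fourier ?v \<xi>) \<in> L2"
        "L2_norm (\<lambda>\<xi>. (- indicator {0<..} \<xi>) * fourier ?v \<xi>) \<le> 1 * L2_norm (fourier ?v)"
      by (rule L2_bounded_mult[OF fourier_L2[OF v(1)]]; auto simp: indicator_def)+
    have "L2_norm (fourier ?g) = L2_norm (\<lambda>\<xi>. (of_real \<xi> - of_real k) * h \<xi> + (- indicator {0<..} \<xi>)
        * fourier ?v \<xi>)"
    proof (rule L2_norm_cong_AE)
      show "AE \<xi> in lborel. fourier ?g \<xi> = (of_real \<xi> - of_real k) * h \<xi> + (- indicator {0<..} \<xi>)
          * fourier ?v \<xi>"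
        using Lax_fourier(2)[OF u dom, of k] f\<phi> by eventually_elim simp
    qed measurable
    also have "\<dots> \<le> E * L2_norm h + 1 * L2_norm (fourier ?v)"
      using L2_Minkowski[OF A(1) B(1)] A(2) B(2) by linarith
    also have "L2_norm (fourier ?v) = ?s * L2_norm ?v" by (rule fourier_Plancherel[OF v(1)])
    finally have "L2_norm (fourier ?g) \<le> E * e + ?s * L2_norm ?v" by (simp add: hn)
    also have "?s * L2_norm ?v \<le> ?s * (E * ?U)" using v(2) by (intro mult_left_mono) auto
    finally have G: "L2_norm (fourier ?g) \<le> E * e + ?s * (E * ?U)" by simp
    have "e = L2_norm (fourier \<phi>)"
      unfolding hn[symmetric] by (rule L2_norm_cong_AE) (use f\<phi> in auto)
    also have "\<dots> = ?s * L2_norm \<phi>" by (rule fourier_Plancherel[OF \<phi>2])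
    also have "\<dots> \<le> ?s * (C * L2_norm ?g)" using C[OF dom] by (intro mult_left_mono) auto
    also have "\<dots> = C * L2_norm (fourier ?g)" by (simp add: fourier_Plancherel[OF g2])
    also have "\<dots> \<le> C * (E * e + ?s * (E * ?U))" using G by (intro mult_left_mono) (auto simp: C_def)
    also have "\<dots> = e * (C * (e * e + ?s * (e * ?U)))" by (simp add: E_def algebra_simps)
    finally have "e * 1 \<le> e * (C * (e * e + ?s * (e * ?U)))" by simp
    then show ?thesis using e by (simp only: mult_le_cancel_left_pos)
  qed
  have "((\<lambda>e. C * (e * e + ?s * (e * ?U))) \<longlongrightarrow> C * (0 * 0 + ?s * (0 * ?U))) (at_right 0)"
    by (intro tendsto_intros)
  then have "1 \<le> C * (0 * 0 + ?s * (0 * ?U))"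
    by (rule tendsto_lowerbound) (use main in \<open>auto intro: eventually_mono[OF eventually_at_right_less]\<close>)
  then show False by simp
qed

section \<open>Riesz theory of compact operators\<close>

text \<open>The sequential form of compactness. Linearity is over the reals, which is enough for the
  alternative below.\<close>

definition compact_operator :: "('a::real_normed_vector \<Rightarrow> 'a) \<Rightarrow> bool" where
  "compact_operator K \<longleftrightarrow> bounded_linear K \<and>
     (\<forall>x :: nat \<Rightarrow> 'a. bounded (range x) \<longrightarrow> (\<exists>r l. strict_mono r \<and> (\<lambda>n. K (x (r n))) \<longlonglongrightarrow> l))"

text \<open>Otherwise unit vectors \<open>z n\<close> exist with \<open>z n - K (z n)\<close>
  tending to 0; compactness makes a subsequence converge to a unit vector fixed by
  \<open>K\<close>.\<close>

lemma compact_operator_bounded_below: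
  fixes K :: "'a::real_normed_vector \<Rightarrow> 'a"
  assumes K: "compact_operator K" and inj: "\<And>x. K x = x \<Longrightarrow> x = 0"
  shows "\<exists>c>0. \<forall>x. c * norm x \<le> norm (x - K x)"
proof (rule ccontr)
  interpret K: bounded_linear K using K by (simp add: compact_operator_def)
  assume "\<not> ?thesis"
  then have "\<forall>n. \<exists>x. norm (x - K x) < 1 / real (Suc n) * norm x"
    by (metis not_le of_nat_0_less_iff zero_less_Suc zero_less_divide_1_iff)
  then obtain x where x: "\<And>n. norm (x n - K (x n)) < 1 / real (Suc n) * norm (x n)" by metis
  have nz: "0 < norm (x n)" for n
    using x[of n] by (metis mult_zero_right norm_ge_zero not_less order_le_less)
  define z where "z n = x n /\<^sub>R norm (x n)" for n
  have z1: "norm (z n) = 1" for n using nz[of n] by (simp add: z_def)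
  have zK: "norm (z n - K (z n)) < 1 / real (Suc n)" for n
  proof -
    have "z n - K (z n) = (x n - K (x n)) /\<^sub>R norm (x n)"
      by (simp add: z_def K.scaleR scaleR_diff_right)
    then show ?thesis using x[of n] nz[of n] by (simp add: divide_simps mult_ac)
  qed
  have "bounded (range z)" using z1 by (auto simp: bounded_iff)
  then obtain r l where r: "strict_mono r" "(\<lambda>n. K (z (r n))) \<longlonglongrightarrow> l"
    using K unfolding compact_operator_def by blast
  have d: "(\<lambda>n. z n - K (z n)) \<longlonglongrightarrow> 0"
    by (rule tendsto_norm_zero_cancel, rule tendsto_sandwich[OF _ _ tendsto_const LIMSEQ_Suc[OF
      lim_1_over_n]])
       (use zK in \<open>auto intro!: always_eventually less_imp_le\<close>)
  have "(\<lambda>n. (z (r n) - K (z (r n))) + K (z (r n))) \<longlonglongrightarrow> 0 + l"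
    by (intro tendsto_add r(2) LIMSEQ_subseq_LIMSEQ[OF d r(1), unfolded comp_def])
  then have zl: "(\<lambda>n. z (r n)) \<longlonglongrightarrow> l" by simp
  from K.tendsto[OF zl] r(2) have "K l = l" by (rule LIMSEQ_unique)
  then have "l = 0" by (rule inj)
  moreover have "norm l = 1"
    using tendsto_norm[OF zl] by (simp add: z1 LIMSEQ_const_iff)
  ultimately show False by simp
qed

text \<open>If \<open>y\<close> were not attained, the ranges of the powers of \<open>1 - K\<close>
  would form a strictly decreasing chain of closed subspaces. Almost orthogonal unit vectors chosen
  along the chain have images under \<open>K\<close> without a convergent subsequence.\<close>

theorem Fredholm_alternative:
  fixes K :: "'a::{real_normed_vector, complete_space} \<Rightarrow> 'a"
  assumes K: "compact_operator K" and inj: "\<And>x. K x = x \<Longrightarrow> x = 0"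
  shows "\<exists>x. x - K x = y"
proof (rule ccontr)
  assume no: "\<not> (\<exists>x. x - K x = y)"
  interpret K: bounded_linear K using K by (simp add: compact_operator_def)
  define S where "S x = x - K x" for x
  interpret S: bounded_linear S unfolding S_def[abs_def]
      by (intro bounded_linear_intros K.bounded_linear_axioms)
  obtain c where c: "c > 0" "\<And>x. c * norm x \<le> norm (S x)"
    using compact_operator_bounded_below[OF K inj] unfolding S_def by blast
  have Sn: "bounded_linear (S ^^ n)" for n
  proof (induction n)
    case (Suc n)
    then show ?case using bounded_linear_compose[OF S.bounded_linear_axioms Suc] by (simp add: comp_def)
  qed (simp add: id_def)
  have Snb: "c ^ n * norm x \<le> norm ((S ^^ n) x)" for n x
  proof (induction n)
    case (Suc n)
    have "c ^ Suc n * norm x \<le> c * norm ((S ^^ n) x)" using Suc c(1) by simp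
    then show ?case using c(2)[of "(S ^^ n) x"] by simp
  qed simp
  define R where "R n = range (S ^^ n)" for n
  have Rsub: "subspace (R n)" for n
    unfolding R_def using Sn
      by (intro linear_subspace_image bounded_linear.linear) (auto simp: subspace_UNIV)
  have Rclosed: "closed (R n)" for n
    unfolding R_def
  proof (rule complete_imp_closed, rule complete_isometric_image[of "c ^ n"])
    show "\<forall>x\<in>UNIV. c ^ n * norm x \<le> norm ((S ^^ n) x)" using Snb by simp
  qed (use c(1) Sn in \<open>auto simp: complete_UNIV\<close>)
  have RSuc: "R (Suc n) \<subseteq> R n" for n by (auto simp: R_def funpow_swap1)
  have Rdec: "R m \<subseteq> R n" if "n \<le> m" for m n
    using that by (induction rule: dec_induct) (use RSuc in auto)
  \<comment> \<open>Riesz's lemma for consecutive ranges. The witness outside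
    \<open>R (Suc n)\<close> is the image of \<open>y\<close> under the \<open>n\<close>-th power of
    \<open>S\<close>, since powers of \<open>S\<close> are injective.\<close>
  have "\<exists>z. z \<in> R n \<and> norm z = 1 \<and> (\<forall>r\<in>R (Suc n). 1 / 2 \<le> norm (z - r))" for n
  proof -
    define a where "a = (S ^^ n) y"
    have "a \<notin> R (Suc n)"
    proof
      assume "a \<in> R (Suc n)"
      then obtain x where "(S ^^ n) y = (S ^^ n) (S x)" by (auto simp: R_def a_def funpow_swap1)
      then have "(S ^^ n) (y - S x) = 0"
        using linear_diff[OF bounded_linear.linear[OF Sn]] by simp
      then have "c ^ n * norm (y - S x) \<le> 0" using Snb[of n "y - S x"] by simp
      then have "y = S x" using zero_less_power[OF c(1), of n] by (simp add: mult_le_0_iff)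
      then show False using no by (auto simp: S_def)
    qed
    then have d: "0 < infdist a (R (Suc n))"
      using Rclosed[of "Suc n"] subspace_0[OF Rsub[of "Suc n"]]
      by (metis empty_iff in_closed_iff_infdist_zero infdist_nonneg order_le_less)
    \<comment> \<open>A minimiser of the distance need not exist; a point within twice the distance
      is the origin of the constant 1/2.\<close>
    obtain r where r: "r \<in> R (Suc n)" "dist a r < 2 * infdist a (R (Suc n))"
    proof (rule ccontr)
      assume "\<not> thesis"
      then have "\<And>r. r \<in> R (Suc n) \<Longrightarrow> 2 * infdist a (R (Suc n)) \<le> dist a r" using that by force
      then have "2 * infdist a (R (Suc n)) \<le> (INF r\<in>R (Suc n). dist a r)"
        using subspace_0[OF Rsub[of "Suc n"]] by (intro cINF_greatest) auto
      also have "\<dots> = infdist a (R (Suc n))"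
        using subspace_0[OF Rsub[of "Suc n"]] by (auto simp: infdist_def)
      finally show False using d by simp
    qed
    define t where "t = norm (a - r)"
    have t: "0 < t" "t < 2 * infdist a (R (Suc n))"
      using r \<open>a \<notin> R (Suc n)\<close> by (auto simp: t_def dist_norm)
    define z where "z = (a - r) /\<^sub>R t"
    have "a \<in> R n" by (simp add: a_def R_def)
    then have "z \<in> R n" unfolding z_def
      using r(1) RSuc[of n] by (intro subspace_scale subspace_diff Rsub) auto
    moreover have "norm z = 1" using t(1) by (simp add: z_def t_def)
    moreover have "1 / 2 \<le> norm (z - r')" if r': "r' \<in> R (Suc n)" for r'
    proof -
      have "r + t *\<^sub>R r' \<in> R (Suc n)" by (intro subspace_add subspace_scale Rsub r r')
      then have "infdist a (R (Suc n)) \<le> norm (a - (r + t *\<^sub>R r'))"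
        using infdist_le by (metis dist_norm)
      also have "a - (r + t *\<^sub>R r') = t *\<^sub>R (z - r')"
        using t(1) by (simp add: z_def scaleR_diff_right)
      finally have "infdist a (R (Suc n)) \<le> t * norm (z - r')" using t(1) by simp
      then have "t * (1 / 2) \<le> t * norm (z - r')" using t(2) by simp
      then show ?thesis using t(1) by (simp only: mult_le_cancel_left_pos)
    qed
    ultimately show ?thesis by blast
  qed
  then obtain z where z: "\<And>n. z n \<in> R n" "\<And>n. norm (z n) = 1" "\<And>n r. r \<in> R (Suc n) \<Longrightarrow> 1 / 2 \<le> norm (z n - r)"
    by metis
  have SR: "S x \<in> R (Suc n)" if "x \<in> R n" for x n using that by (auto simp: R_def)
  have far: "1 / 2 \<le> norm (K (z n) - K (z m))" if "n < m" for n m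
  proof -
    \<comment> \<open>Subtracting this vector from \<open>z n\<close> leaves exactly
      \<open>K (z n) - K (z m)\<close>.\<close>
    have "S (z n) + z m - S (z m) \<in> R (Suc n)"
      using SR[OF z(1)[of n]] z(1)[of m] SR[OF z(1)[of m]] Rdec[of "Suc n" m] Rdec[of "Suc n" "Suc m"] that
      by (intro subspace_diff subspace_add Rsub) auto
    from z(3)[OF this] show ?thesis by (simp add: S_def algebra_simps)
  qed
  have "bounded (range z)" using z(2) by (auto simp: bounded_iff)
  then obtain r l where r: "strict_mono r" "(\<lambda>n. K (z (r n))) \<longlonglongrightarrow> l"
    using K unfolding compact_operator_def by blast
  have "Cauchy (\<lambda>n. K (z (r n)))" using r(2) by (rule LIMSEQ_imp_Cauchy)
  then obtain N where "\<forall>m\<ge>N. \<forall>n\<ge>N. norm (K (z (r m)) - K (z (r n))) < 1 / 2"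
    unfolding Cauchy_iff by (meson half_gt_zero zero_less_one)
  then have "norm (K (z (r N)) - K (z (r (Suc N)))) < 1 / 2" by simp
  moreover have "r N < r (Suc N)" using r(1) by (simp add: strict_mono_Suc_iff)
  ultimately show False using far by fastforce
qed

section \<open>The kernel off the cut\<close>

definition off :: "complex \<Rightarrow> bool" where
  "off k \<longleftrightarrow> \<not> (Im k = 0 \<and> 0 \<le> Re k)"

text \<open>A positive distance from the half line and linear growth at infinity combine into one
  bound by \<open>w\<close>, which gives decay of the multiplier and its invertibility
  together.\<close>

lemma off_lower:
  assumes "off k" shows "\<exists>\<delta>>0. \<forall>\<xi>\<ge>0. \<delta> * w \<xi> \<le> cmod (of_real \<xi> - k)"
proof -
  obtain d where d: "d > 0" "\<And>\<xi>. \<xi> \<ge> 0 \<Longrightarrow> d \<le> cmod (of_real \<xi> - k)"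
  proof (cases "Im k = 0")
    case True
    then have "Re k < 0" using assms by (auto simp: off_def)
    moreover have "- Re k \<le> cmod (of_real \<xi> - k)" if "\<xi> \<ge> 0" for \<xi>
      using complex_Re_le_cmod[of "of_real \<xi> - k"] that by simp
    ultimately show ?thesis using that[of "- Re k"] by auto
  next
    case False
    moreover have "\<bar>Im k\<bar> \<le> cmod (of_real \<xi> - k)" for \<xi>
      using abs_Im_le_cmod[of "of_real \<xi> - k"] by simp
    ultimately show ?thesis using that[of "\<bar>Im k\<bar>"] by auto
  qed
  \<comment> \<open>The summand 1 accounts for growth, and the quotient converts the constant
    \<open>1 + cmod k\<close> into a multiple of the distance \<open>d\<close>.\<close>
  define M where "M = (1 + cmod k) / d + 1"
  have M: "0 < M" using d(1) by (auto simp: M_def intro!: add_nonneg_pos divide_nonneg_pos)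
  have "1 / M * w \<xi> \<le> cmod (of_real \<xi> - k)" if "\<xi> \<ge> 0" for \<xi>
  proof -
    have "\<xi> \<le> cmod k + cmod (of_real \<xi> - k)"
      using norm_triangle_ineq[of k "of_real \<xi> - k"] that by simp
    then have "w \<xi> \<le> (1 + cmod k) + cmod (of_real \<xi> - k)" using that by (simp add: w_def)
    also have "(1 + cmod k) \<le> (1 + cmod k) / d * cmod (of_real \<xi> - k)"
    proof -
      have "(1 + cmod k) * d \<le> (1 + cmod k) * cmod (of_real \<xi> - k)"
        using d(2)[OF that] by (intro mult_left_mono) auto
      then show ?thesis using d(1) by (simp add: field_simps)
    qed
    finally have "w \<xi> \<le> M * cmod (of_real \<xi> - k)" by (simp add: M_def distrib_right)
    then show ?thesis using M by (simp add: field_simps)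
  qed
  then show ?thesis using M by (intro exI[of _ "1 / M"]) auto
qed

lemma off_if_lower:
  assumes "\<And>\<xi>. \<xi> \<ge> 0 \<Longrightarrow> \<delta> * w \<xi> \<le> cmod (of_real \<xi> - k)" "0 < \<delta>" shows "off k"
proof -
  have "0 < \<delta> * w (Re k)" using assms(2) by simp
  then have "Re k \<ge> 0 \<Longrightarrow> of_real (Re k) \<noteq> k" using assms(1)[of "Re k"] by auto
  then show ?thesis unfolding off_def by (metis complex_is_Real_iff of_real_Re)
qed

text \<open>Since \<open>w\<close> is at least 1, moving \<open>k\<close> by less than half of the
  constant costs at most half of the bound.\<close>

lemma off_lower_uniform:
  assumes "off k"
  obtains \<delta> r where "\<delta> > 0" "r > 0" "\<And>k' \<xi>. k' \<in> ball k r \<Longrightarrow> \<xi> \<ge> 0 \<Longrightarrow> \<delta> * w \<xi> \<le> cmod (of_real \<xi> - k')"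
    "\<And>k'. k' \<in> ball k r \<Longrightarrow> off k'"
proof -
  obtain \<delta> where d: "\<delta> > 0" "\<And>\<xi>. \<xi> \<ge> 0 \<Longrightarrow> \<delta> * w \<xi> \<le> cmod (of_real \<xi> - k)"
    using off_lower[OF assms] by blast
  have *: "\<delta> / 2 * w \<xi> \<le> cmod (of_real \<xi> - k')" if "k' \<in> ball k (\<delta> / 2)" "\<xi> \<ge> 0" for k' \<xi>
  proof -
    have "cmod (of_real \<xi> - k) \<le> cmod (of_real \<xi> - k') + cmod (k' - k)"
      using norm_triangle_ineq[of "of_real \<xi> - k'" "k' - k"] by simp
    moreover have "cmod (k' - k) \<le> \<delta> / 2" using that(1) by (simp add: dist_norm norm_minus_commute)
    moreover have "\<delta> / 2 * 1 \<le> \<delta> / 2 * w \<xi>" using d(1) by (intro mult_left_mono) auto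
    ultimately show ?thesis using d(2)[OF that(2)] by (simp add: field_simps)
  qed
  show ?thesis
  proof (rule that[of "\<delta> / 2" "\<delta> / 2"])
    show "off k'" if "k' \<in> ball k (\<delta> / 2)" for k'
      by (rule off_if_lower[OF *[OF that]]) (use d in auto)
  qed (use * d(1) in auto)
qed

lemma off_ne: "off k \<Longrightarrow> \<xi> \<ge> 0 \<Longrightarrow> of_real \<xi> \<noteq> k"
  by (auto simp: off_def)

lemma cmod_cis_diff_1: "cmod (cis t - 1) \<le> \<bar>t\<bar>" "cmod (cis t - 1) \<le> 2"
proof -
  show "cmod (cis t - 1) \<le> \<bar>t\<bar>" using iexp_approx1[of t 0] by (simp add: cis_conv_exp)
  show "cmod (cis t - 1) \<le> 2" using norm_triangle_ineq4[of "cis t" 1] by simp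
qed

text \<open>Interpolation between a Lipschitz bound and a trivial bound: it trades smoothness for
  slower growth and produces the fractional exponents in the estimates of oscillating
  exponentials.\<close>

lemma min_powr_bound:
  assumes "0 \<le> \<alpha>" "\<alpha> \<le> 1" "(a::real) \<le> t" "a \<le> 2" "0 \<le> t" shows "a \<le> 2 * t powr \<alpha>"
proof (cases "t \<le> 1")
  case True
  show ?thesis
  proof (cases "t = 0")
    case False
    then have "t powr 1 \<le> t powr \<alpha>" using True assms by (intro powr_mono') auto
    then show ?thesis using assms False powr_ge_zero[of t \<alpha>] by simp
  qed (use assms in auto)
next
  case False
  then have "1 \<le> t powr \<alpha>" using assms by (intro ge_one_powr_ge_zero) auto
  then show ?thesis using assms by simp
qed

text \<open>After one integration by parts the oscillating integral defining \<^term>\<open>G k\<close> converges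
  absolutely.\<close>

definition Gint :: "complex \<Rightarrow> real \<Rightarrow> real \<Rightarrow> complex" where
  "Gint k x \<xi> = (cis (x * \<xi>) - 1) / (\<i> * of_real x * (of_real \<xi> - k)\<^sup>2)"

definition Gabs :: "complex \<Rightarrow> real \<Rightarrow> complex" where
  "Gabs k x = 1 / (2 * pi) * (LINT \<xi>|lborel. indicator {0..} \<xi> *\<^sub>R Gint k x \<xi>)"

lemma Gint_measurable [measurable]: "(\<lambda>\<xi>. Gint k x \<xi>) \<in> borel_measurable borel"
  unfolding Gint_def by measurable

lemma Gint_bound:
  assumes d: "\<And>\<xi>. \<xi> \<ge> 0 \<Longrightarrow> \<delta> * w \<xi> \<le> cmod (of_real \<xi> - k)" "0 < \<delta>" and x: "0 < a" "a \<le> \<bar>x\<bar>"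
  shows "cmod (indicator {0..} \<xi> *\<^sub>R Gint k x \<xi>) \<le> 2 / (a * \<delta>\<^sup>2) * w \<xi> powr (- 2)"
proof (cases "\<xi> \<ge> 0")
  case True
  have "(\<delta> * w \<xi>)\<^sup>2 \<le> (cmod (of_real \<xi> - k))\<^sup>2"
    using d(1)[OF True] d(2) by (intro power_mono) auto
  then have "cmod (Gint k x \<xi>) \<le> 2 / (a * (\<delta> * w \<xi>)\<^sup>2)"
    unfolding Gint_def norm_divide norm_mult norm_power using x d(2)
    by (intro frac_le mult_mono cmod_cis_diff_1) auto
  also have "\<dots> = 2 / (a * \<delta>\<^sup>2) * w \<xi> powr (- 2)"
    by (simp add: powr_minus_divide power_mult_distrib flip: powr_numeral)
  finally show ?thesis using True by simp
qed (use x in simp)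

text \<open>The primitive of the oscillating factor is normalised by subtracting 1, so the boundary
  term at 0 vanishes and only the one at \<open>R\<close> remains.\<close>

lemma G_truncated:
  assumes k: "off k" and x: "x \<noteq> 0" and R: "0 \<le> R"
  shows "(LINT \<xi>|lborel. indicator {0..R} \<xi> *\<^sub>R (cis (x * \<xi>) / (of_real \<xi> - k)))
    = (cis (x * R) - 1) / (\<i> * of_real x * (of_real R - k)) + (LINT \<xi>|lborel. indicator {0..R} \<xi> *\<^sub>R Gint k
        x \<xi>)"
proof -
  let ?F = "\<lambda>\<xi>. (cis (x * \<xi>) - 1) * (1 / (\<i> * of_real x) * (1 / (of_real \<xi> - k)))"
  let ?f = "\<lambda>\<xi>. cis (x * \<xi>) / (of_real \<xi> - k) - Gint k x \<xi>"
  have D: "(?F has_vector_derivative ?f \<xi>) (at \<xi> within {0..R})" if "0 \<le> \<xi>" for \<xi>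
  proof -
    have ne: "of_real \<xi> - k \<noteq> 0" using off_ne[OF k that] by simp
    have "((\<lambda>z. 1 / (\<i> * of_real x) * (1 / (z - k))) has_field_derivative (1 / (\<i> * of_real x)
        * (- 1 / (of_real \<xi> - k)\<^sup>2))) (at (of_real \<xi>))"
      using ne x by (auto intro!: derivative_eq_intros simp: power2_eq_square)
    from has_vector_derivative_real_field[OF this]
    have 1: "((\<lambda>\<xi>. 1 / (\<i> * of_real x) * (1 / (of_real \<xi> - k))) has_vector_derivative (1 / (\<i> * of_real x)
        * (- 1 / (of_real \<xi> - k)\<^sup>2))) (at \<xi> within {0..R})" .
    have 2: "((\<lambda>\<xi>. cis (x * \<xi>) - 1) has_vector_derivative (\<i> * of_real x * cis (x * \<xi>) - 0))
        (at \<xi> within {0..R})"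
      by (intro has_vector_derivative_diff has_vector_derivative_cis_mult has_vector_derivative_const)
    have alg: "(c - 1) * (1 / a * (- 1 / b\<^sup>2)) + (a * c - 0) * (1 / a * (1 / b))
        = c / b - (c - 1) / (a * b\<^sup>2)"
      if "a \<noteq> 0" "b \<noteq> 0" for a b c :: complex
      using that by (simp add: field_simps power2_eq_square)
    have "\<i> * of_real x \<noteq> 0" using x by simp
    from has_vector_derivative_mult[OF 2 1] alg[OF this ne, of "cis (x * \<xi>)"] show ?thesis
      by (simp only: Gint_def)
  qed
  have c1: "continuous_on {0..R} (\<lambda>\<xi>. cis (x * \<xi>) / (of_real \<xi> - k))"
    using off_ne[OF k] by (intro continuous_intros) auto
  have c2: "continuous_on {0..R} (Gint k x)"
    unfolding Gint_def[abs_def] using off_ne[OF k] x by (intro continuous_intros) auto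
  have "(LINT \<xi>|lborel. indicator {0..R} \<xi> *\<^sub>R ?f \<xi>) = ?F R - ?F 0"
    by (rule integral_FTC_atLeastAtMost[OF R D]) (auto intro!: continuous_intros c1 c2)
  also have "(LINT \<xi>|lborel. indicator {0..R} \<xi> *\<^sub>R ?f \<xi>)
      = (LINT \<xi>|lborel. indicator {0..R} \<xi> *\<^sub>R (cis (x * \<xi>) / (of_real \<xi> - k))) - (LINT \<xi>|lborel. indicator
          {0..R} \<xi> *\<^sub>R Gint k x \<xi>)"
    using borel_integrable_atLeastAtMost'[OF c1] borel_integrable_atLeastAtMost'[OF c2]
    unfolding scaleR_diff_right set_integrable_def by (intro Bochner_Integration.integral_diff)
  finally show ?thesis by (simp add: field_simps)
qed

lemma G_truncated_tendsto:
  assumes k: "off k" and x: "x \<noteq> 0"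
  shows "((\<lambda>R. LINT \<xi>|lborel. indicator {0..R} \<xi> *\<^sub>R (cis (x * \<xi>) / (of_real \<xi> - k))) \<longlongrightarrow> 2 * pi * Gabs k x)
      at_top"
proof -
  obtain \<delta> where d: "\<delta> > 0" "\<And>\<xi>. \<xi> \<ge> 0 \<Longrightarrow> \<delta> * w \<xi> \<le> cmod (of_real \<xi> - k)"
    using off_lower[OF k] by blast
  have "((\<lambda>R. (cis (x * R) - 1) / (\<i> * of_real x * (of_real R - k))) \<longlongrightarrow> 0) at_top"
  proof (rule Lim_null_comparison)
    show "\<forall>\<^sub>F R in at_top. norm ((cis (x * R) - 1) / (\<i> * of_real x * (of_real R - k)))
        \<le> 2 / (\<bar>x\<bar> * \<delta>) * inverse R"
      using eventually_gt_at_top[of 0]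
    proof eventually_elim
      case (elim R)
      have "\<delta> * R \<le> \<delta> * w R" using elim d(1) by (intro mult_left_mono) (auto simp: w_def)
      then have "\<delta> * R \<le> cmod (of_real R - k)" using d(2)[of R] elim by simp
      then have "norm ((cis (x * R) - 1) / (\<i> * of_real x * (of_real R - k))) \<le> 2 / (\<bar>x\<bar> * (\<delta> * R))"
        unfolding norm_divide norm_mult using x d(1) elim
        by (intro frac_le mult_mono cmod_cis_diff_1) auto
      then show ?case by (simp add: divide_inverse mult_ac)
    qed
    have "((\<lambda>R. 2 / (\<bar>x\<bar> * \<delta>) * inverse R) \<longlongrightarrow> 2 / (\<bar>x\<bar> * \<delta>) * 0) at_top"
      by (intro tendsto_intros tendsto_inverse_0_at_top filterlim_ident)
    then show "((\<lambda>R. 2 / (\<bar>x\<bar> * \<delta>) * inverse R) \<longlongrightarrow> 0) at_top" by simp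
  qed
  moreover have "((\<lambda>R. LINT \<xi>|lborel. indicator {0..R} \<xi> *\<^sub>R Gint k x \<xi>) \<longlongrightarrow> (LINT \<xi>|lborel. indicator {0..} \<xi>
      *\<^sub>R Gint k x \<xi>)) at_top"
  proof (rule integral_dominated_convergence_at_top[where w="\<lambda>\<xi>. 2 / (\<bar>x\<bar> * \<delta>\<^sup>2) * w \<xi> powr (- 2)"])
    show "integrable lborel (\<lambda>\<xi>. 2 / (\<bar>x\<bar> * \<delta>\<^sup>2) * w \<xi> powr (- 2))"
      by (intro integrable_mult_right w_powr_integrable) simp
    show "\<forall>\<^sub>F R in at_top. AE \<xi> in lborel. norm (indicator {0..R} \<xi> *\<^sub>R Gint k x \<xi>)
        \<le> 2 / (\<bar>x\<bar> * \<delta>\<^sup>2) * w \<xi> powr (- 2)"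
    proof (intro always_eventually allI AE_I2)
      fix R \<xi>
      show "norm (indicator {0..R} \<xi> *\<^sub>R Gint k x \<xi>) \<le> 2 / (\<bar>x\<bar> * \<delta>\<^sup>2) * w \<xi> powr (- 2)"
        by (rule order_trans[OF _ Gint_bound[OF d(2,1), of "\<bar>x\<bar>" x]]) (use x in \<open>auto simp: indicator_def\<close>)
    qed
    show "AE \<xi> in lborel. ((\<lambda>R. indicator {0..R} \<xi> *\<^sub>R Gint k x \<xi>) \<longlongrightarrow> indicator {0..} \<xi> *\<^sub>R Gint k x \<xi>)
        at_top"
    proof (rule AE_I2)
      fix \<xi>
      have "\<forall>\<^sub>F R in at_top. indicator {0..R} \<xi> *\<^sub>R Gint k x \<xi> = indicator {0..} \<xi> *\<^sub>R Gint k x \<xi>"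
        using eventually_ge_at_top[of "\<xi>"] by eventually_elim (auto simp: indicator_def)
      then show "((\<lambda>R. indicator {0..R} \<xi> *\<^sub>R Gint k x \<xi>) \<longlongrightarrow> indicator {0..} \<xi> *\<^sub>R Gint k x \<xi>) at_top"
        by (rule tendsto_eventually)
    qed
  qed measurable
  ultimately have "((\<lambda>R. (cis (x * R) - 1) / (\<i> * of_real x * (of_real R - k))
      + (LINT \<xi>|lborel. indicator {0..R} \<xi> *\<^sub>R Gint k x \<xi>)) \<longlongrightarrow> 0 + 2 * pi * Gabs k x) at_top"
    unfolding Gabs_def by (intro tendsto_add) auto
  then have "((\<lambda>R. (cis (x * R) - 1) / (\<i> * of_real x * (of_real R - k))
      + (LINT \<xi>|lborel. indicator {0..R} \<xi> *\<^sub>R Gint k x \<xi>)) \<longlongrightarrow> 2 * pi * Gabs k x) at_top"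
    by simp
  then show ?thesis
  proof (rule Lim_transform_eventually)
    show "\<forall>\<^sub>F R in at_top. (cis (x * R) - 1) / (\<i> * of_real x * (of_real R - k))
        + (LINT \<xi>|lborel. indicator {0..R} \<xi> *\<^sub>R Gint k x \<xi>)
      = (LINT \<xi>|lborel. indicator {0..R} \<xi> *\<^sub>R (cis (x * \<xi>) / (of_real \<xi> - k)))"
      using eventually_ge_at_top[of 0] by eventually_elim (rule G_truncated[OF k x, symmetric])
  qed
qed

lemma G_eq_Gabs:
  assumes k: "off k" and x: "x \<noteq> 0" shows "G k x = Gabs k x"
proof -
  have eq: "integral {0..R} (\<lambda>\<xi>. exp (\<i> * of_real (x * \<xi>)) / (of_real \<xi> - k))
      = (LINT \<xi>|lborel. indicator {0..R} \<xi> *\<^sub>R (cis (x * \<xi>) / (of_real \<xi> - k)))" for R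
  proof -
    have "continuous_on {0..R} (\<lambda>\<xi>. cis (x * \<xi>) / (of_real \<xi> - k))"
      using off_ne[OF k] by (intro continuous_intros) auto
    from set_borel_integral_eq_integral(2)[OF borel_integrable_atLeastAtMost'[OF this]]
    show ?thesis unfolding cis_conv_exp set_lebesgue_integral_def by simp
  qed
  have "Lim at_top (\<lambda>R. integral {0..R} (\<lambda>\<xi>. exp (\<i> * of_real (x * \<xi>)) / (of_real \<xi> - k)))
      = 2 * pi * Gabs k x"
    unfolding eq by (rule tendsto_Lim[OF _ G_truncated_tendsto[OF k x]]) simp
  then show ?thesis unfolding G_def by simp
qed

text \<open>Continuity away from 0 is what upgrades an a.e. identity between kernels to one at every
  nonzero \<open>x\<close>. The majorant is uniform as long as the argument stays away from
  0.\<close>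

lemma Gabs_continuous:
  assumes k: "off k" and x: "x \<noteq> 0" shows "isCont (Gabs k) x"
proof -
  obtain \<delta> where d: "\<delta> > 0" "\<And>\<xi>. \<xi> \<ge> 0 \<Longrightarrow> \<delta> * w \<xi> \<le> cmod (of_real \<xi> - k)"
    using off_lower[OF k] by blast
  let ?S = "{y. \<bar>x\<bar> / 2 < \<bar>y\<bar>}"
  have S: "open ?S" "x \<in> ?S" using x by (auto intro!: open_Collect_less continuous_intros)
  have "((\<lambda>y. LINT \<xi>|lborel. indicator {0..} \<xi> *\<^sub>R Gint k y \<xi>) \<longlongrightarrow> (LINT \<xi>|lborel. indicator {0..} \<xi> *\<^sub>R Gint
      k x \<xi>)) (at x within ?S)"
  proof (rule dominated_convergence_at_within[where w="\<lambda>\<xi>. 2 / (\<bar>x\<bar> / 2 * \<delta>\<^sup>2) * w \<xi> powr (- 2)"])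
    show "integrable lborel (\<lambda>\<xi>. 2 / (\<bar>x\<bar> / 2 * \<delta>\<^sup>2) * w \<xi> powr (- 2))"
      by (intro integrable_mult_right w_powr_integrable) simp
    show "AE \<xi> in lborel. norm (indicator {0..} \<xi> *\<^sub>R Gint k y \<xi>) \<le> 2 / (\<bar>x\<bar> / 2 * \<delta>\<^sup>2) * w \<xi> powr (- 2)"
        if "y \<in> ?S" for y
      using Gint_bound[OF d(2,1), of "\<bar>x\<bar> / 2" y] that x by (intro AE_I2) auto
    show "AE \<xi> in lborel. ((\<lambda>y. indicator {0..} \<xi> *\<^sub>R Gint k y \<xi>) \<longlongrightarrow> indicator {0..} \<xi> *\<^sub>R Gint k x \<xi>)
        (at x within ?S)"
    proof (rule AE_I2)
      fix \<xi>
      show "((\<lambda>y. indicator {0..} \<xi> *\<^sub>R Gint k y \<xi>) \<longlongrightarrow> indicator {0..} \<xi> *\<^sub>R Gint k x \<xi>) (at x within ?S)"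
        using off_ne[OF k] x by (cases "\<xi> \<ge> 0") (auto simp: Gint_def intro!: tendsto_intros)
    qed
  qed measurable
  from tendsto_mult_left[OF this, of "1 / (2 * complex_of_real pi)"] show ?thesis
    unfolding isCont_def Gabs_def at_within_open[OF S(2,1)] by simp
qed

text \<open>Needed for the limit at an edge: there the regular part of the kernel is evaluated at a
  parameter that remains off its own cut.\<close>

lemma Gabs_continuous_k:
  assumes k: "off k" and x: "x \<noteq> 0" shows "isCont (\<lambda>k. Gabs k x) k"
proof -
  obtain \<delta> r where d: "\<delta> > 0" "r > 0" "\<And>k' \<xi>. k' \<in> ball k r \<Longrightarrow> \<xi> \<ge> 0 \<Longrightarrow> \<delta> * w \<xi> \<le> cmod (of_real \<xi> - k')"
    using off_lower_uniform[OF k] by metis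
  have "((\<lambda>k. LINT \<xi>|lborel. indicator {0..} \<xi> *\<^sub>R Gint k x \<xi>) \<longlongrightarrow> (LINT \<xi>|lborel. indicator {0..} \<xi> *\<^sub>R Gint
      k x \<xi>)) (at k within ball k r)"
  proof (rule dominated_convergence_at_within[where w="\<lambda>\<xi>. 2 / (\<bar>x\<bar> * \<delta>\<^sup>2) * w \<xi> powr (- 2)"])
    show "integrable lborel (\<lambda>\<xi>. 2 / (\<bar>x\<bar> * \<delta>\<^sup>2) * w \<xi> powr (- 2))"
      by (intro integrable_mult_right w_powr_integrable) simp
    show "AE \<xi> in lborel. norm (indicator {0..} \<xi> *\<^sub>R Gint k' x \<xi>) \<le> 2 / (\<bar>x\<bar> * \<delta>\<^sup>2) * w \<xi> powr (- 2)"
        if "k' \<in> ball k r" for k'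
      using Gint_bound[OF d(3)[OF that] d(1), of "\<bar>x\<bar>" x] x by (intro AE_I2) auto
    show "AE \<xi> in lborel. ((\<lambda>k. indicator {0..} \<xi> *\<^sub>R Gint k x \<xi>) \<longlongrightarrow> indicator {0..} \<xi> *\<^sub>R Gint k x \<xi>)
        (at k within ball k r)"
    proof (rule AE_I2)
      fix \<xi>
      show "((\<lambda>k. indicator {0..} \<xi> *\<^sub>R Gint k x \<xi>) \<longlongrightarrow> indicator {0..} \<xi> *\<^sub>R Gint k x \<xi>) (at k within ball k
          r)"
        using off_ne[OF k] x by (cases "\<xi> \<ge> 0") (auto simp: Gint_def intro!: tendsto_intros)
    qed
  qed measurable
  then have "((\<lambda>k. LINT \<xi>|lborel. indicator {0..} \<xi> *\<^sub>R Gint k x \<xi>) \<longlongrightarrow> (LINT \<xi>|lborel. indicator {0..} \<xi> *\<^sub>R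
      Gint k x \<xi>)) (at k)"
    using d(2) at_within_open[of k "ball k r"] by simp
  from tendsto_mult_left[OF this, of "1 / (2 * complex_of_real pi)"] show ?thesis
    unfolding isCont_def Gabs_def by simp
qed

section \<open>Fourier multipliers and the edge kernels\<close>

definition Pmul :: "complex \<Rightarrow> real \<Rightarrow> complex" where
  "Pmul k \<xi> = indicator {0..} \<xi> / (of_real \<xi> - k)"

definition Nmul :: "complex \<Rightarrow> real \<Rightarrow> complex" where
  "Nmul k \<xi> = indicator {..0} \<xi> / (of_real \<xi> - k)"

lemma mul_measurable [measurable]: "Pmul k \<in> borel_measurable borel" "Nmul k \<in> borel_measurable borel"
  unfolding Pmul_def[abs_def] Nmul_def[abs_def] by measurable

text \<open>Reflection in \<xi> exchanges the half lines, so every bound for \<open>Nmul\<close>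
  near a positive parameter comes from \<open>Pmul\<close> near a negative one. Both contain the
  point 0, a null set.\<close>

lemma Nmul_Pmul: "Nmul k \<xi> = - Pmul (- k) (- \<xi>)"
proof -
  have e: "complex_of_real (- \<xi>) - (- k) = - (of_real \<xi> - k)" by simp
  show ?thesis unfolding Nmul_def Pmul_def e
      by (simp only: divide_minus_right minus_minus) (simp add: indicator_def)
qed

lemma Pmul_decay:
  assumes "\<And>\<xi>. \<xi> \<ge> 0 \<Longrightarrow> \<delta> * w \<xi> \<le> cmod (of_real \<xi> - k)" "0 < \<delta>"
  shows "cmod (Pmul k \<xi>) * w \<xi> \<le> 1 / \<delta>"
proof (cases "\<xi> \<ge> 0")
  case True
  have "0 < \<delta> * w \<xi>" using assms(2) by simp
  then have "0 < cmod (of_real \<xi> - k)" using assms(1)[OF True] by linarith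
  then show ?thesis using assms(2) assms(1)[OF True] True by (simp add: Pmul_def norm_divide field_simps)
qed (use assms(2) in \<open>simp add: Pmul_def\<close>)

lemma Pmul_bounded:
  assumes "off k"
  obtains d where "0 < d" "\<And>\<xi>. cmod (Pmul k \<xi>) * w \<xi> \<le> d" "\<And>\<xi>. cmod (Pmul k \<xi>) \<le> d"
proof -
  obtain \<delta> where d: "\<delta> > 0" "\<And>\<xi>. \<xi> \<ge> 0 \<Longrightarrow> \<delta> * w \<xi> \<le> cmod (of_real \<xi> - k)" using off_lower[OF assms] by blast
  note D = Pmul_decay[OF d(2,1)]
  have "cmod (Pmul k \<xi>) \<le> 1 / \<delta>" for \<xi>
    using D[of \<xi>] mult_left_mono[of 1 "w \<xi>" "cmod (Pmul k \<xi>)"] by simp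
  then show ?thesis using d(1) by (intro that[of "1 / \<delta>"] D) auto
qed

lemma Pmul_L2:
  assumes "off k" shows "Pmul k \<in> L2"
proof -
  obtain d where d: "\<And>\<xi>. cmod (Pmul k \<xi>) * w \<xi> \<le> d" by (rule Pmul_bounded[OF assms]) blast
  show ?thesis by (rule L2_if_decay(1)[OF _ d]) measurable
qed

lemma Pmul_mult:
  assumes k: "off k" and F: "F \<in> L2"
  shows "(\<lambda>\<xi>. Pmul k \<xi> * F \<xi>) \<in> L2" "integrable lborel (\<lambda>\<xi>. Pmul k \<xi> * F \<xi>)"
proof -
  obtain d where d: "\<And>\<xi>. cmod (Pmul k \<xi>) \<le> d" by (rule Pmul_bounded[OF k]) blast
  show "(\<lambda>\<xi>. Pmul k \<xi> * F \<xi>) \<in> L2" by (rule L2_bounded_mult(1)[OF F _ d]) measurable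
  show "integrable lborel (\<lambda>\<xi>. Pmul k \<xi> * F \<xi>)" by (rule L2_mult_integrable[OF Pmul_L2[OF k] F])
qed

lemma Nmul_L2: "off (- k) \<Longrightarrow> Nmul k \<in> L2"
  using L2_cmult[OF L2_reflect(1)[OF Pmul_L2], of "- k" "-1"] by (simp add: Nmul_Pmul[abs_def])

text \<open>The truncated inversion integrals of the multiplier have two limits:
  \<open>inv_fourier\<close> in mean, and the improper integral \<open>G k\<close> at every nonzero
  point. A subsequence converging a.e. identifies them.\<close>

lemma G_AE:
  assumes k: "off k" shows "AE x in lborel. G k x = inv_fourier (Pmul k) x"
proof -
  let ?P = "Pmul k" and ?t = "\<lambda>n. trunc (real n) (Pmul k)"
  have P: "?P \<in> L2" by (rule Pmul_L2[OF k])
  note t = trunc_L2[OF P]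
  have iF: "(\<lambda>n. L2_norm (\<lambda>x. IFT (?t n) x - inv_fourier ?P x)) \<longlonglongrightarrow> 0"
  proof -
    have "L2_norm (\<lambda>x. IFT (?t n) x - inv_fourier ?P x) = cmod (1 / (2 * pi)) * L2_norm (\<lambda>\<xi>. FT (?t n) \<xi>
        - fourier ?P \<xi>)" for n
    proof -
      have "(\<lambda>x. IFT (?t n) x - inv_fourier ?P x)
          = (\<lambda>x. 1 / (2 * pi) * (FT (?t n) (- x) - fourier ?P (- x)))"
        by (auto simp: IFT_FT inv_fourier_def right_diff_distrib)
      then show ?thesis
        using L2_reflect(2)[OF L2_diff[OF FT_Bessel(1)[OF t(2,1)] fourier_L2[OF P]], of "real n"]
        by (simp only: L2_norm_cmult)
    qed
    moreover have "(\<lambda>n. cmod (1 / (2 * pi)) * L2_norm (\<lambda>\<xi>. FT (?t n) \<xi> - fourier ?P \<xi>))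
        \<longlonglongrightarrow> cmod (1 / (2 * pi)) * 0"
      by (intro tendsto_intros fourier_tendsto P)
    ultimately show ?thesis by simp
  qed
  obtain r :: "nat \<Rightarrow> nat" where r: "strict_mono r" "AE x in lborel. (\<lambda>n. IFT (?t (r n)) x)
      \<longlonglongrightarrow> inv_fourier ?P x"
    using L2_AE_subseq[OF IFT_L2[OF t] inv_fourier_L2[OF P] iF] by blast
  have pt: "(\<lambda>n. IFT (?t n) x) \<longlonglongrightarrow> G k x" if x: "x \<noteq> 0" for x
  proof -
    have "IFT (?t n) x = 1 / (2 * pi) * (LINT \<xi>|lborel. indicator {0..real n} \<xi> *\<^sub>R (cis (x
        * \<xi>) / (of_real \<xi> - k)))" for n
      unfolding IFT_def
      by (intro arg_cong[where f="(*) _"] Bochner_Integration.integral_cong) (auto simp: trunc_def Pmul_def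
        indicator_def)
    moreover have "(\<lambda>n. 1 / (2 * pi) * (LINT \<xi>|lborel. indicator {0..real n} \<xi> *\<^sub>R (cis (x * \<xi>) / (of_real \<xi>
        - k)))) \<longlonglongrightarrow> 1 / (2 * pi) * (2 * pi * Gabs k x)"
      by (intro tendsto_mult_left filterlim_compose[OF G_truncated_tendsto[OF k x]
        filterlim_real_sequentially])
    ultimately show ?thesis using G_eq_Gabs[OF k x] by simp
  qed
  have "AE x in lborel. x \<noteq> (0::real)" by (rule AE_lborel_singleton)
  with r(2) show ?thesis
  proof eventually_elim
    case (elim x)
    then show ?case using LIMSEQ_subseq_LIMSEQ[OF pt[OF elim(2)] r(1)] LIMSEQ_unique by (simp add: comp_def)
  qed
qed

lemma G_measurable [measurable]:
  assumes "off k" shows "G k \<in> borel_measurable borel"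
proof -
  have "G k = (\<lambda>x. if x = 0 then G k 0 else Gabs k x)" using G_eq_Gabs[OF assms] by auto
  moreover have [measurable]: "Gabs k \<in> borel_measurable borel"
    unfolding Gabs_def[abs_def] Gint_def by measurable
  have "(\<lambda>x. if x = 0 then G k 0 else Gabs k x) \<in> borel_measurable borel" by measurable
  ultimately show ?thesis by simp
qed

lemma G_L2: "off k \<Longrightarrow> G k \<in> L2"
  by (rule L2_cong_AE[OF inv_fourier_L2[OF Pmul_L2] G_measurable]) (auto intro: eventually_mono[OF G_AE])

lemma fourier_G:
  assumes k: "off k" shows "AE \<xi> in lborel. fourier (G k) \<xi> = Pmul k \<xi>"
proof -
  have "fourier (G k) = fourier (inv_fourier (Pmul k))"
    by (rule fourier_cong_AE[OF _ _ G_AE[OF k]]) (use G_L2[OF k] inv_fourier_L2[OF Pmul_L2[OF k]] in auto)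
  then show ?thesis using fourier_inv_fourier[OF Pmul_L2[OF k]] by simp
qed

section \<open>Convolution as a Fourier multiplier\<close>

lemma L2_translate:
  assumes "f \<in> L2" shows "(\<lambda>x. f (x - a)) \<in> L2" "L2_norm (\<lambda>x. f (x - a)) = L2_norm f"
proof -
  have [measurable]: "f \<in> borel_measurable borel" using assms by measurable
  have "integrable lborel (\<lambda>x. (cmod (f (- a + 1 * x)))\<^sup>2)"
    by (subst lborel_integrable_real_affine_iff) (use assms in \<open>auto simp: L2_iff\<close>)
  then show "(\<lambda>x. f (x - a)) \<in> L2" by (simp add: L2_iff)
  show "L2_norm (\<lambda>x. f (x - a)) = L2_norm f"
    using lborel_integral_real_affine[of 1 "\<lambda>x. (cmod (f x))\<^sup>2" "- a"]
    by (simp add: L2_norm_def)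
qed

lemma fourier_translate:
  assumes f: "f \<in> L2"
  shows "AE \<xi> in lborel. fourier (\<lambda>x. f (x - a)) \<xi> = cis (- (a * \<xi>)) * fourier f \<xi>"
proof (rule L2_limit_AE_unique[where F=sequentially])
  let ?t = "\<lambda>n. trunc (real n) f" and ?h = "\<lambda>n x. trunc (real n) f (x - a)"
  note t = trunc_L2[OF f]
  have hi: "integrable lborel (?h n)" for n
    using lborel_integrable_real_affine[OF t(2)[of "real n"], of 1 "- a"] by simp
  have h2: "?h n \<in> L2" for n by (rule L2_translate(1)[OF t(1)])
  note fa = L2_translate(1)[OF f, of a]
  show "FT (?h n) \<in> L2" for n by (rule FT_Bessel(1)[OF hi h2])
  show "fourier (\<lambda>x. f (x - a)) \<in> L2" by (rule fourier_L2[OF fa])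
  show "(\<lambda>\<xi>. cis (- (a * \<xi>)) * fourier f \<xi>) \<in> L2"
    by (rule L2_bounded_mult(1)[OF fourier_L2[OF f], of _ 1]) auto
  show "(\<lambda>n. L2_norm (\<lambda>\<xi>. FT (?h n) \<xi> - fourier (\<lambda>x. f (x - a)) \<xi>)) \<longlonglongrightarrow> 0"
  proof (rule tendsto_0_squeeze[OF L2_norm_nonneg])
    show "L2_norm (\<lambda>\<xi>. FT (?h n) \<xi> - fourier (\<lambda>x. f (x - a)) \<xi>)
        \<le> sqrt (2 * pi) * L2_norm (\<lambda>x. ?t n x - f x)" for n
      using fourier_near_FT[OF fa h2 hi, of n] L2_translate(2)[OF L2_diff[OF t(1) f], of "real n" a] by simp
    have "(\<lambda>n. sqrt (2 * pi) * L2_norm (\<lambda>x. ?t n x - f x)) \<longlonglongrightarrow> sqrt (2 * pi) * 0"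
      by (intro tendsto_intros trunc_tendsto_nat f)
    then show "(\<lambda>n. sqrt (2 * pi) * L2_norm (\<lambda>x. ?t n x - f x)) \<longlonglongrightarrow> 0" by simp
  qed
  have FTh: "FT (?h n) \<xi> = cis (- (a * \<xi>)) * FT (?t n) \<xi>" for n \<xi>
  proof -
    have "FT (?h n) \<xi> = (LINT x|lborel. cis (- (\<xi> * (a + 1 * x))) * ?h n (a + 1 * x))"
      unfolding FT_def by (subst lborel_integral_real_affine[of 1 _ a]) auto
    also have "\<dots> = (LINT x|lborel. cis (- (a * \<xi>)) * (cis (- (\<xi> * x)) * ?t n x))"
    proof (intro Bochner_Integration.integral_cong refl)
      fix x
      have "cis (- (\<xi> * (a + 1 * x))) = cis (- (a * \<xi>)) * cis (- (\<xi> * x))"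
          by (simp add: cis_mult algebra_simps)
      then show "cis (- (\<xi> * (a + 1 * x))) * ?h n (a + 1 * x)
          = cis (- (a * \<xi>)) * (cis (- (\<xi> * x)) * ?t n x)"
        by simp
    qed
    finally show ?thesis by (simp add: FT_def)
  qed
  show "(\<lambda>n. L2_norm (\<lambda>\<xi>. FT (?h n) \<xi> - cis (- (a * \<xi>)) * fourier f \<xi>)) \<longlonglongrightarrow> 0"
  proof -
    have "L2_norm (\<lambda>\<xi>. FT (?h n) \<xi> - cis (- (a * \<xi>)) * fourier f \<xi>)
        = L2_norm (\<lambda>\<xi>. FT (?t n) \<xi> - fourier f \<xi>)" for n
      unfolding FTh right_diff_distrib[symmetric] by (simp add: L2_norm_def norm_mult)
    then show ?thesis using fourier_tendsto[OF f] by simp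
  qed
qed simp

text \<open>Parseval with the conjugate of the reflected translate of \<open>g\<close>. Both sides
  are absolutely convergent integrals, so the identity holds at every \<open>x\<close>.\<close>

theorem convol_fourier:
  assumes g: "g \<in> L2" and f: "f \<in> L2"
  shows "convol g f x = IFT (\<lambda>\<xi>. fourier g \<xi> * fourier f \<xi>) x"
proof -
  let ?q0 = "\<lambda>y. g (x - y)" and ?r = "\<lambda>y. g (- y)"
  have r: "?r \<in> L2" by (rule L2_reflect(1)[OF g])
  have q0: "?q0 \<in> L2" using L2_translate(1)[OF r, of x] by simp
  let ?q = "\<lambda>y. cnj (?q0 y)"
  have q: "?q \<in> L2" by (rule L2_cnj[OF q0])
  have [measurable]: "fourier f \<in> borel_measurable borel" "fourier g \<in> borel_measurable borel"
      "fourier ?q \<in> borel_measurable borel"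
    using fourier_L2[OF f] fourier_L2[OF g] fourier_L2[OF q] by auto
  have fq: "AE \<xi> in lborel. cnj (fourier ?q \<xi>) = cis (x * \<xi>) * fourier g \<xi>"
    using fourier_cnj[OF q0] AE_reflect[OF fourier_translate[OF r, of x]] AE_reflect[OF fourier_reflect[OF
      g]]
    by eventually_elim simp
  have "convol g f x = (LINT y|lborel. f y * cnj (?q y))" by (simp add: convol_def mult.commute)
  also have "\<dots> = 1 / (2 * pi) * (LINT \<xi>|lborel. fourier f \<xi> * cnj (fourier ?q \<xi>))"
    by (simp add: fourier_Parseval[OF f q])
  also have "(LINT \<xi>|lborel. fourier f \<xi> * cnj (fourier ?q \<xi>))
      = (LINT \<xi>|lborel. cis (x * \<xi>) * (fourier g \<xi> * fourier f \<xi>))"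
    by (rule integral_cong_AE) (use fq in \<open>auto simp: mult_ac elim: eventually_mono\<close>)
  finally show ?thesis by (simp add: IFT_def)
qed

lemma IFT_cong_AE:
  assumes "f \<in> borel_measurable borel" "g \<in> borel_measurable borel" "AE \<xi> in lborel. f \<xi> = g \<xi>"
  shows "IFT f = IFT g"
  unfolding IFT_def[abs_def] using assms by (intro ext arg_cong[where f="(*) _"] integral_cong_AE) auto

text \<open>For \<open>a\<close> and \<open>f\<close> in \<open>L2\<close> the integrand is
  integrable, hence this is the continuous bounded representative of the multiplier applied to
  \<open>f\<close>, even when \<open>a\<close> is not bounded.\<close>

definition mult_op :: "(real \<Rightarrow> complex) \<Rightarrow> (real \<Rightarrow> complex) \<Rightarrow> real \<Rightarrow> complex" where
  "mult_op a f x = IFT (\<lambda>\<xi>. a \<xi> * fourier f \<xi>) x"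

lemma convol_mult_op:
  assumes g: "g \<in> L2" and f: "f \<in> L2" and a: "AE \<xi> in lborel. fourier g \<xi> = a \<xi>"
      "a \<in> borel_measurable borel"
  shows "convol g f x = mult_op a f x"
proof -
  have [measurable]: "fourier f \<in> borel_measurable borel" "fourier g \<in> borel_measurable borel"
      "a \<in> borel_measurable borel"
    using fourier_L2[OF f] fourier_L2[OF g] a by auto
  have "IFT (\<lambda>\<xi>. fourier g \<xi> * fourier f \<xi>) = IFT (\<lambda>\<xi>. a \<xi> * fourier f \<xi>)"
    by (rule IFT_cong_AE) (use a in auto)
  then show ?thesis by (simp add: convol_fourier[OF g f] mult_op_def)
qed

lemma convol_G: "off k \<Longrightarrow> f \<in> L2 \<Longrightarrow> convol (G k) f x = mult_op (Pmul k) f x"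
  by (intro convol_mult_op G_L2 fourier_G) auto

text \<open>The kernel of the negative half line; the substitution of \<open>- \<xi>\<close> for
  \<xi> reduces it to \<open>G\<close>.\<close>

definition Gtilde :: "complex \<Rightarrow> real \<Rightarrow> complex" where
  "Gtilde k x = - G (- k) (- x)"

lemma Gtilde_L2: "off (- k) \<Longrightarrow> Gtilde k \<in> L2"
  using L2_cmult[OF L2_reflect(1)[OF G_L2], of "- k" "-1"] by (simp add: Gtilde_def[abs_def])

lemma fourier_Gtilde:
  assumes k: "off (- k)" shows "AE \<xi> in lborel. fourier (Gtilde k) \<xi> = Nmul k \<xi>"
  using fourier_cmult[OF L2_reflect(1)[OF G_L2[OF k]], of "-1"] fourier_reflect[OF G_L2[OF k]] AE_reflect[OF
    fourier_G[OF k]]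
  by eventually_elim (simp add: Gtilde_def[abs_def] Nmul_Pmul)

text \<open>The inverse transform of the full multiplier \<open>1 / (\<xi> - k)\<close> when
  \<open>k\<close> lies on the side \<open>e\<close> of the real axis. It keeps a meaning, without
  decay, for real \<open>k\<close>.\<close>

definition Eker :: "edge \<Rightarrow> complex \<Rightarrow> real \<Rightarrow> complex" where
  "Eker e k x = of_real (edge_sign e) * \<i> * exp (\<i> * k * of_real x) * indicator {0<..} (edge_sign e * x)"

lemma Eker_measurable [measurable]: "Eker e k \<in> borel_measurable borel"
proof -
  have "continuous_on UNIV (\<lambda>x. exp (\<i> * k * complex_of_real x))" by (intro continuous_intros)
  then have [measurable]: "(\<lambda>x. exp (\<i> * k * complex_of_real x)) \<in> borel_measurable borel"
    by (rule borel_measurable_continuous_onI)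
  show ?thesis unfolding Eker_def[abs_def] by measurable
qed

lemma Eker_Lower: "Eker Lower k x = - Eker Upper (- k) (- x)"
  by (simp add: Eker_def)

lemma edge_sign_abs [simp]: "\<bar>edge_sign e\<bar> = 1" "edge_sign e * edge_sign e = 1" "edge_sign e \<noteq> 0"
  by (cases e; simp)+

lemma cmod_Eker: "cmod (Eker e k x) = exp (- (Im k * x)) * indicator {0<..} (edge_sign e * x)"
  by (simp add: Eker_def norm_mult norm_exp_eq_Re indicator_def)

lemma cmod_Eker_le: "0 \<le> edge_sign e * Im k \<Longrightarrow> cmod (Eker e k x) \<le> 1"
  by (cases e) (auto simp: cmod_Eker indicator_def mult_nonneg_nonneg mult_nonpos_nonpos)

lemma Eker_Upper_L1:
  assumes "0 < Im k" shows "integrable lborel (Eker Upper k)"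
proof -
  have "integrable lborel (\<lambda>x. indicator {0<..} x *\<^sub>R exp (- (x * Im k)))"
    using integrable_I0i_exp_mscale[OF assms] by (simp add: set_integrable_def)
  then show ?thesis
    by (rule Bochner_Integration.integrable_bound) (auto simp: cmod_Eker mult_ac)
qed

lemma Eker_L1:
  assumes "0 < edge_sign e * Im k" shows "integrable lborel (Eker e k)"
proof (cases e)
  case Lower
  have "integrable lborel (\<lambda>x. - Eker Upper (- k) (0 + (-1) * x))"
    by (intro integrable_minus lborel_integrable_real_affine Eker_Upper_L1) (use assms Lower in auto)
  then show ?thesis using Lower by (simp add: Eker_Lower[abs_def])
qed (use Eker_Upper_L1 assms in auto)

lemma Eker_L2:
  assumes "0 < edge_sign e * Im k" shows "Eker e k \<in> L2"
proof -
  have "integrable lborel (\<lambda>x. (cmod (Eker e k x))\<^sup>2)"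
  proof (rule Bochner_Integration.integrable_bound[OF Eker_L1[OF assms]])
    show "AE x in lborel. norm ((cmod (Eker e k x))\<^sup>2) \<le> norm (Eker e k x)"
      using cmod_Eker_le[of e k] assms by (auto intro!: AE_I2 simp: power2_eq_square mult_left_le)
  qed measurable
  then show ?thesis by (simp add: L2_iff)
qed

lemma FT_Eker_Upper:
  assumes k: "0 < Im k" shows "FT (Eker Upper k) \<xi> = 1 / (of_real \<xi> - k)"
proof (rule LIMSEQ_unique)
  let ?c = "\<i> * (k - of_real \<xi>)"
  have ne: "k - of_real \<xi> \<noteq> 0" using k by (auto simp: complex_eq_iff)
  let ?f = "\<lambda>x. \<i> * exp (?c * of_real x)"
  have Ei: "integrable lborel (\<lambda>x. cis (- (\<xi> * x)) * Eker Upper k x)"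
    by (rule FT_integrand[OF Eker_Upper_L1[OF k]])
  show "(\<lambda>n. LINT x|lborel. indicator {0..real n} x *\<^sub>R (cis (- (\<xi> * x)) * Eker Upper k x))
      \<longlonglongrightarrow> FT (Eker Upper k) \<xi>"
    unfolding FT_def
  proof (rule integral_dominated_convergence[where w="\<lambda>x. cmod (cis (- (\<xi> * x)) * Eker Upper k x)"])
    show "AE x in lborel. (\<lambda>n. indicator {0..real n} x *\<^sub>R (cis (- (\<xi> * x)) * Eker Upper k x))
        \<longlonglongrightarrow> cis (- (\<xi> * x)) * Eker Upper k x"
    proof (rule AE_I2)
      fix x
      obtain N :: nat where N: "x \<le> real N" using real_arch_simple by blast
      have "\<forall>\<^sub>F n in sequentially. indicator {0..real n} x *\<^sub>R (cis (- (\<xi> * x)) * Eker Upper k x)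
          = cis (- (\<xi> * x)) * Eker Upper k x"
        using eventually_ge_at_top[of N]
      proof eventually_elim
        case (elim n)
        then have "x \<le> real n" using N by simp
        then show ?case by (auto simp: indicator_def Eker_def)
      qed
      then show "(\<lambda>n. indicator {0..real n} x *\<^sub>R (cis (- (\<xi> * x)) * Eker Upper k x))
          \<longlonglongrightarrow> cis (- (\<xi> * x)) * Eker Upper k x"
        by (rule tendsto_eventually)
    qed
  qed (use Ei in \<open>auto simp: indicator_def\<close>)
  have eq: "(LINT x|lborel. indicator {0..real n} x *\<^sub>R (cis (- (\<xi> * x)) * Eker Upper k x))
      = 1 / (k - of_real \<xi>) * (exp (?c * of_real (real n)) - 1)" for n
  proof -
    have D: "((\<lambda>x. 1 / (k - of_real \<xi>) * exp (?c * of_real x)) has_vector_derivative ?f x) (at x within A)"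
        for x A
    proof -
      have "((\<lambda>z. 1 / (k - of_real \<xi>) * exp (?c * z)) has_field_derivative ?f x) (at (of_real x))"
        using ne by (auto intro!: derivative_eq_intros)
      from has_vector_derivative_real_field[OF this] show ?thesis .
    qed
    have "(LINT x|lborel. indicator {0..real n} x *\<^sub>R (cis (- (\<xi> * x)) * Eker Upper k x))
        = (LINT x|lborel. indicator {0..real n} x *\<^sub>R ?f x)"
    proof (rule integral_cong_AE)
      have "AE x in lborel. x \<noteq> (0::real)" by (rule AE_lborel_singleton)
      then show "AE x in lborel. indicator {0..real n} x *\<^sub>R (cis (- (\<xi> * x)) * Eker Upper k x)
          = indicator {0..real n} x *\<^sub>R ?f x"
        by eventually_elim (auto simp: indicator_def Eker_def cis_conv_exp algebra_simps simp flip: exp_add)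
      have "continuous_on UNIV ?f" by (intro continuous_intros)
      then have [measurable]: "?f \<in> borel_measurable borel" by (rule borel_measurable_continuous_onI)
      show "(\<lambda>x. indicator {0..real n} x *\<^sub>R ?f x) \<in> borel_measurable lborel" by measurable
    qed measurable
    also have "\<dots> = 1 / (k - of_real \<xi>) * exp (?c * of_real (real n)) - 1 / (k - of_real \<xi>)
        * exp (?c * of_real 0)"
      by (rule integral_FTC_atLeastAtMost[OF _ D]) (auto intro!: continuous_intros)
    finally show ?thesis by (simp add: right_diff_distrib)
  qed
  have "(\<lambda>n. exp (?c * of_real (real n))) \<longlonglongrightarrow> 0"
  proof (rule tendsto_norm_zero_cancel)
    have "filterlim (\<lambda>n. Im k * real n) at_top sequentially"
      by (rule filterlim_tendsto_pos_mult_at_top[OF tendsto_const k filterlim_real_sequentially])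
    then have "(\<lambda>n. exp (- (Im k * real n))) \<longlonglongrightarrow> 0"
      by (intro filterlim_compose[OF exp_at_bot] filterlim_uminus_at_bot_at_top[THEN filterlim_compose])
    then show "(\<lambda>n. norm (exp (?c * of_real (real n)))) \<longlonglongrightarrow> 0" by (simp add: norm_exp_eq_Re)
  qed
  then have "(\<lambda>n. 1 / (k - of_real \<xi>) * (exp (?c * of_real (real n)) - 1)) \<longlonglongrightarrow> 1 / (k - of_real \<xi>) * (0 - 1)"
    by (intro tendsto_intros)
  moreover have "1 / (k - of_real \<xi>) * (0 - 1) = 1 / (of_real \<xi> - k)"
    by (metis (no_types, opaque_lifting) diff_0 minus_diff_eq minus_divide_right mult_minus_right
      mult.right_neutral)
  ultimately show "(\<lambda>n. LINT x|lborel. indicator {0..real n} x *\<^sub>R (cis (- (\<xi> * x)) * Eker Upper k x))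
      \<longlonglongrightarrow> 1 / (of_real \<xi> - k)"
    unfolding eq by simp
qed

lemma FT_Eker:
  assumes "0 < edge_sign e * Im k" shows "FT (Eker e k) \<xi> = 1 / (of_real \<xi> - k)"
proof (cases e)
  case Lower
  have "FT (Eker e k) \<xi> = (LINT x|lborel. cis (- (\<xi> * (- x))) * Eker Lower k (- x))"
    unfolding FT_def Lower by (rule integral_reflect[symmetric])
  also have "\<dots> = - FT (Eker Upper (- k)) (- \<xi>)"
    by (simp add: FT_def Eker_Lower)
  also have "\<dots> = - (1 / (of_real (- \<xi>) - (- k)))" using assms Lower by (subst FT_Eker_Upper) auto
  also have "complex_of_real (- \<xi>) - (- k) = - (of_real \<xi> - k)" by simp
  also have "- (1 / - (of_real \<xi> - k)) = 1 / (of_real \<xi> - k)" by (simp only: divide_minus_right minus_minus)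
  finally show ?thesis .
qed (use FT_Eker_Upper assms in auto)

section \<open>Boundary values of the kernel on the cut\<close>

lemma AE_0_isCont:
  fixes h :: "real \<Rightarrow> complex"
  assumes "AE x in lborel. h x = 0" "isCont h a" shows "h a = 0"
proof (rule ccontr)
  assume "h a \<noteq> 0"
  then have "\<forall>\<^sub>F x in nhds a. h x \<noteq> 0"
    using assms(2) tendsto_imp_eventually_ne[of h "h a" "at a" 0]
    by (auto simp: isCont_def eventually_at_filter elim: eventually_mono)
  then obtain d where d: "d > 0" "\<And>x. dist x a < d \<Longrightarrow> h x \<noteq> 0"
    unfolding eventually_nhds_metric by blast
  have "AE x in lborel. x \<notin> {a - d<..<a + d}"
    using assms(1) by eventually_elim (use d(2) in \<open>auto simp: dist_real_def abs_less_iff\<close>)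
  then have "{a - d<..<a + d} \<in> null_sets lborel"
    by (subst AE_iff_null_sets) auto
  then have "emeasure lborel {a - d<..<a + d} = 0" by auto
  then show False using d(1) by simp
qed

lemma Eker_isCont:
  assumes "x \<noteq> 0" shows "isCont (Eker e k) x"
proof -
  let ?S = "{y. 0 < y * x}"
  have S: "open ?S" by (intro open_Collect_less continuous_intros)
  have S': "x \<in> ?S" using assms by (cases "0 < x") (auto simp: zero_less_mult_iff)
  have "continuous_on ?S (\<lambda>y. of_real (edge_sign e) * \<i> * exp (\<i> * k * of_real y)
      * indicator {0<..} (edge_sign e * x))"
    by (intro continuous_intros)
  moreover have "Eker e k y = of_real (edge_sign e) * \<i> * exp (\<i> * k * of_real y)
      * indicator {0<..} (edge_sign e * x)" if "y \<in> ?S" for y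
    using that assms by (cases e) (auto simp: Eker_def indicator_def zero_less_mult_iff)
  ultimately have "continuous_on ?S (Eker e k)" by (simp cong: continuous_on_cong_simp)
  then show ?thesis using S S' by (simp add: continuous_on_eq_continuous_at)
qed

text \<open>The multiplier \<open>1 / (\<xi> - k)\<close> is the sum of its restrictions to the half
  lines, so the transforms agree a.e.; continuity off 0 then gives the identity at each
  point.\<close>

lemma G_decompose:
  assumes s: "0 < edge_sign e * Im k" and x: "x \<noteq> 0"
  shows "G k x = Eker e k x - Gtilde k x"
proof -
  have k: "off k" "off (- k)" using s by (auto simp: off_def)
  have E: "Eker e k \<in> L2" "integrable lborel (Eker e k)" by (rule Eker_L2[OF s], rule Eker_L1[OF s])
  have d: "(\<lambda>x. Eker e k x - Gtilde k x) \<in> L2" by (intro L2_diff E Gtilde_L2 k)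
  have "AE \<xi> in lborel. \<xi> \<noteq> (0::real)" by (rule AE_lborel_singleton)
  with fourier_diff[OF E(1) Gtilde_L2[OF k(2)]] fourier_eq_FT[OF E] fourier_Gtilde[OF k(2)] fourier_G[OF
      k(1)]
  have "AE \<xi> in lborel. fourier (G k) \<xi> = fourier (\<lambda>x. Eker e k x - Gtilde k x) \<xi>"
    by eventually_elim (auto simp: FT_Eker[OF s] Pmul_def Nmul_def indicator_def)
  from fourier_inj[OF G_L2[OF k(1)] d this]
  have "AE x in lborel. G k x = Eker e k x - Gtilde k x" .
  moreover have "AE x in lborel. x \<noteq> (0::real)" by (rule AE_lborel_singleton)
  ultimately have "AE x in lborel. Gabs k x - (Eker e k x + Gabs (- k) (- x)) = 0"
    by eventually_elim (simp add: Gtilde_def G_eq_Gabs[OF k(1)] G_eq_Gabs[OF k(2)])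
  moreover have "isCont (\<lambda>x. Gabs k x - (Eker e k x + Gabs (- k) (- x))) x"
    by (intro continuous_intros Eker_isCont[OF x] Gabs_continuous[OF k(1) x] isCont_o2[OF _
      Gabs_continuous[OF k(2)]]) (use x in auto)
  ultimately have "Gabs k x - (Eker e k x + Gabs (- k) (- x)) = 0" by (rule AE_0_isCont)
  then show ?thesis using x by (simp add: Gtilde_def G_eq_Gabs[OF k(1)] G_eq_Gabs[OF k(2)])
qed

text \<open>Both terms of the decomposition are continuous in \<open>k\<close> up to the positive
  axis: the exponential for each fixed \<open>x\<close>, and \<open>Gtilde\<close> because its cut
  is the negative axis.\<close>

lemma G_edge_eq:
  assumes l: "0 < l" and x: "x \<noteq> 0"
  shows "G_edge e l x = Eker e (of_real l) x - Gtilde (of_real l) x"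
proof -
  let ?k = "\<lambda>\<epsilon>. Complex l (edge_sign e * \<epsilon>)"
  have kl: "(?k \<longlongrightarrow> of_real l) (at_right 0)"
  proof -
    have "((\<lambda>\<epsilon>. of_real l + \<i> * of_real (edge_sign e * \<epsilon>)) \<longlongrightarrow> of_real l + \<i> * of_real (edge_sign e * 0))
        (at_right 0)"
      by (intro tendsto_intros)
    then show ?thesis by (simp add: Complex_eq)
  qed
  have offl: "off (- of_real l)" using l by (auto simp: off_def)
  have "((\<lambda>\<epsilon>. Eker e (?k \<epsilon>) x + Gabs (- ?k \<epsilon>) (- x)) \<longlongrightarrow> Eker e (of_real l) x + Gabs (- of_real l) (- x))
      (at_right 0)"
    unfolding Eker_def
    by (intro tendsto_intros kl isCont_tendsto_compose[OF Gabs_continuous_k[OF offl]]) (use x in auto)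
  moreover have "\<forall>\<^sub>F \<epsilon> in at_right 0. Eker e (?k \<epsilon>) x + Gabs (- ?k \<epsilon>) (- x) = G (?k \<epsilon>) x"
    using eventually_at_right_less[of 0]
  proof eventually_elim
    case (elim \<epsilon>)
    have s: "0 < edge_sign e * Im (?k \<epsilon>)" using elim by (simp flip: mult.assoc)
    then have "off (- ?k \<epsilon>)" by (auto simp: off_def)
    then show ?case using G_decompose[OF s x] x by (simp add: Gtilde_def G_eq_Gabs)
  qed
  ultimately have "((\<lambda>\<epsilon>. G (?k \<epsilon>) x) \<longlongrightarrow> Eker e (of_real l) x + Gabs (- of_real l) (- x)) (at_right 0)"
    by (rule Lim_transform_eventually)
  then have "G_edge e l x = Eker e (of_real l) x + Gabs (- of_real l) (- x)"
    unfolding G_edge_def by (intro tendsto_Lim) auto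
  then show ?thesis using G_eq_Gabs[OF offl, of "- x"] x by (simp add: Gtilde_def)
qed

section \<open>Estimates for the convolution operators\<close>

definition wnorm :: "real \<Rightarrow> (real \<Rightarrow> complex) \<Rightarrow> real" where
  "wnorm a f = L2_norm (\<lambda>x. of_real (w x powr a) * f x)"

lemma L2w_iff: "f \<in> L2w a \<longleftrightarrow> f \<in> borel_measurable borel \<and> (\<lambda>x. of_real (w x powr a) * f x) \<in> L2"
proof -
  have "(cmod (of_real (w x powr a) * f x))\<^sup>2 = (w x powr a * cmod (f x))\<^sup>2" for x
    by (simp add: norm_mult)
  moreover have "(\<lambda>x. of_real (w x powr a) * f x) \<in> borel_measurable borel" if "f \<in> borel_measurable borel"
    using that by measurable
  ultimately show ?thesis by (auto simp: L2w_def)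
qed

lemma L2wD: "f \<in> L2w a \<Longrightarrow> f \<in> borel_measurable borel" "f \<in> L2w a \<Longrightarrow> (\<lambda>x. of_real (w x powr a) * f x) \<in> L2"
  by (blast dest: L2w_iff[THEN iffD1])+

lemma L2wI: "f \<in> borel_measurable borel \<Longrightarrow> (\<lambda>x. of_real (w x powr a) * f x) \<in> L2 \<Longrightarrow> f \<in> L2w a"
  by (rule L2w_iff[THEN iffD2]) blast

lemma wnorm_nonneg [simp]: "0 \<le> wnorm a f"
  by (simp add: wnorm_def)

lemma w_powr_mono: "a \<le> b \<Longrightarrow> w x powr a \<le> w x powr b"
  by (intro powr_mono) auto

lemma L2w_L2:
  assumes "f \<in> L2w a" "0 \<le> a" shows "f \<in> L2" "L2_norm f \<le> wnorm a f"
proof -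
  have *: "AE x in lborel. cmod (f x) \<le> 1 * cmod (of_real (w x powr a) * f x)"
  proof (rule AE_I2)
    fix x
    have "1 \<le> w x powr a" using w_powr_mono[OF assms(2), of x] by simp
    from mult_right_mono[OF this, of "cmod (f x)"] show "cmod (f x) \<le> 1 * cmod (of_real (w x powr a) * f x)"
      by (simp add: norm_mult)
  qed
  note f = L2wD(2)[OF assms(1)] L2wD(1)[OF assms(1)]
  show "f \<in> L2" by (rule L2_dominated[OF f *])
  show "L2_norm f \<le> wnorm a f" using L2_norm_mono[OF f _ *] by (simp add: wnorm_def)
qed

text \<open>Cauchy-Schwarz with the surplus weight \<open>w\<close> to the power
  \<open>- (a - b)\<close>, which is square integrable exactly because the gap exceeds 1/2.\<close>

lemma L2w_weighted_L1:
  assumes f: "f \<in> L2w a" and b: "b < a - 1 / 2"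
  shows "integrable lborel (\<lambda>x. w x powr b * cmod (f x))"
    "(LINT x|lborel. w x powr b * cmod (f x)) \<le> L2_norm (\<lambda>x. of_real (w x powr (- (a - b)))) * wnorm a f"
proof -
  have g: "(\<lambda>x. complex_of_real (w x powr (- (a - b)))) \<in> L2" using b by (intro w_powr_L2) simp
  have wf: "(\<lambda>x. of_real (w x powr a) * f x) \<in> L2" by (rule L2wD(2)[OF f])
  have eq: "cmod (complex_of_real (w x powr (- (a - b)))) * cmod (of_real (w x powr a) * f x)
      = w x powr b * cmod (f x)" for x
  proof -
    have "w x powr (- (a - b)) * w x powr a = w x powr b" by (simp flip: powr_add)
    then show ?thesis by (simp only: norm_mult norm_of_real abs_of_nonneg[OF powr_ge_zero]
        mult.assoc[symmetric])
  qed
  show "integrable lborel (\<lambda>x. w x powr b * cmod (f x))"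
    using integrable_norm[OF L2_mult_integrable[OF g wf]] unfolding norm_mult[of "complex_of_real _"
      "of_real _ * _"] eq .
  show "(LINT x|lborel. w x powr b * cmod (f x)) \<le> L2_norm (\<lambda>x. of_real (w x powr (- (a - b)))) * wnorm a f"
    using L2_Cauchy_Schwarz[OF g wf] unfolding eq wnorm_def .
qed

lemma L2w_L1:
  assumes f: "f \<in> L2w a" and a: "1 / 2 < a"
  shows "integrable lborel f" "(LINT x|lborel. cmod (f x)) \<le> L2_norm (\<lambda>x. of_real (w x powr (- a)))
      * wnorm a f"
proof -
  show "integrable lborel f"
    using L2w_weighted_L1(1)[OF f, of 0] a L2wD(1)[OF f] by (intro integrable_norm_cancel[of lborel f]) auto
  show "(LINT x|lborel. cmod (f x)) \<le> L2_norm (\<lambda>x. of_real (w x powr (- a))) * wnorm a f"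
    using L2w_weighted_L1(2)[OF f, of 0] a by simp
qed

lemma L2w_add_cmult:
  assumes "f \<in> L2w a" "g \<in> L2w a" shows "(\<lambda>x. f x + c * g x) \<in> L2w a"
proof -
  have [measurable]: "f \<in> borel_measurable borel" "g \<in> borel_measurable borel" using assms[THEN L2wD(1)]
      by auto
  have "(\<lambda>x. of_real (w x powr a) * f x + c * (of_real (w x powr a) * g x)) \<in> L2"
    by (intro L2_add L2_cmult L2wD(2) assms)
  then have "(\<lambda>x. of_real (w x powr a) * (f x + c * g x)) \<in> L2"
    by (simp only: distrib_left mult.left_commute)
  then show ?thesis by (rule L2wI[rotated]) measurable
qed

lemma mult_op_integrable: "a \<in> L2 \<Longrightarrow> f \<in> L2 \<Longrightarrow> integrable lborel (\<lambda>\<xi>. cis (x * \<xi>) * (a \<xi> * fourier f \<xi>))"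
  using FT_integrand[OF L2_mult_integrable[OF _ fourier_L2], of a f "- x"] by simp

lemma sqrt_2pi_bound: "1 / (2 * pi) * sqrt (2 * pi) \<le> 1"
proof -
  have "sqrt (2 * pi) \<le> 2 * pi" using pi_gt3
      by (intro real_le_lsqrt) (auto simp: power2_eq_square intro!: self_le_power)
  then show ?thesis by (simp add: field_simps)
qed

text \<open>Only the \<open>L2\<close> norm of the multiplier enters, so convergence of multipliers
  in \<open>L2\<close> gives uniform convergence of the functions. The factors from inversion and
  Plancherel multiply to at most 1.\<close>

lemma mult_op_bound:
  assumes a: "a \<in> L2" and f: "f \<in> L2" shows "cmod (mult_op a f x) \<le> L2_norm a * L2_norm f"
proof -
  have "cmod (mult_op a f x) \<le> 1 / (2 * pi) * (LINT \<xi>|lborel. cmod (a \<xi>) * cmod (fourier f \<xi>))"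
    using IFT_bound[of "\<lambda>\<xi>. a \<xi> * fourier f \<xi>" x] by (simp add: mult_op_def norm_mult)
  also have "\<dots> \<le> 1 / (2 * pi) * (L2_norm a * (sqrt (2 * pi) * L2_norm f))"
    using L2_Cauchy_Schwarz[OF a fourier_L2[OF f]]
      by (intro mult_left_mono) (auto simp: fourier_Plancherel[OF f])
  also have "\<dots> = (1 / (2 * pi) * sqrt (2 * pi)) * (L2_norm a * L2_norm f)" by (simp add: mult_ac)
  also have "\<dots> \<le> 1 * (L2_norm a * L2_norm f)" by (intro mult_right_mono sqrt_2pi_bound) auto
  finally show ?thesis by simp
qed

lemma mult_op_add_cmult:
  assumes a: "a \<in> L2" and f: "f \<in> L2" and g: "g \<in> L2"
  shows "mult_op a (\<lambda>x. f x + c * g x) x = mult_op a f x + c * mult_op a g x"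
proof -
  have [measurable]: "a \<in> borel_measurable borel" "fourier f \<in> borel_measurable borel"
      "fourier g \<in> borel_measurable borel"
    "fourier (\<lambda>x. f x + c * g x) \<in> borel_measurable borel"
    using a fourier_L2[OF f] fourier_L2[OF g] fourier_L2[OF L2_add[OF f L2_cmult[OF g]]] by auto
  have "mult_op a (\<lambda>x. f x + c * g x) x = 1 / (2 * pi) * (LINT \<xi>|lborel. cis (x * \<xi>) * (a \<xi> * fourier f \<xi>)
      + c * (cis (x * \<xi>) * (a \<xi> * fourier g \<xi>)))"
    unfolding mult_op_def IFT_def
    by (intro arg_cong[where f="(*) _"] integral_cong_AE)
       (use fourier_add_cmult[OF f g, of c] in \<open>auto simp: algebra_simps elim: eventually_mono\<close>)
  also have "(LINT \<xi>|lborel. cis (x * \<xi>) * (a \<xi> * fourier f \<xi>) + c * (cis (x * \<xi>) * (a \<xi> * fourier g \<xi>)))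
    = (LINT \<xi>|lborel. cis (x * \<xi>) * (a \<xi> * fourier f \<xi>)) + c * (LINT \<xi>|lborel. cis (x * \<xi>) * (a \<xi> * fourier
        g \<xi>))"
    using mult_op_integrable[OF a f] mult_op_integrable[OF a g] by simp
  finally show ?thesis by (simp add: mult_op_def IFT_def algebra_simps)
qed

lemma mult_op_add_cmult_left:
  assumes a: "a \<in> L2" and b: "b \<in> L2" and f: "f \<in> L2"
  shows "mult_op (\<lambda>\<xi>. a \<xi> + c * b \<xi>) f x = mult_op a f x + c * mult_op b f x"
proof -
  have "(LINT \<xi>|lborel. cis (x * \<xi>) * ((a \<xi> + c * b \<xi>) * fourier f \<xi>))
    = (LINT \<xi>|lborel. cis (x * \<xi>) * (a \<xi> * fourier f \<xi>) + c * (cis (x * \<xi>) * (b \<xi> * fourier f \<xi>)))"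
    by (simp add: algebra_simps)
  also have "\<dots> = (LINT \<xi>|lborel. cis (x * \<xi>) * (a \<xi> * fourier f \<xi>)) + c * (LINT \<xi>|lborel. cis (x * \<xi>)
      * (b \<xi> * fourier f \<xi>))"
    using mult_op_integrable[OF a f] mult_op_integrable[OF b f] by simp
  finally show ?thesis by (simp add: mult_op_def IFT_def algebra_simps)
qed

lemma mult_op_diff_left:
  assumes "a \<in> L2" "b \<in> L2" "f \<in> L2"
  shows "mult_op a f x - mult_op b f x = mult_op (\<lambda>\<xi>. a \<xi> - b \<xi>) f x"
  using mult_op_add_cmult_left[OF assms, of "-1" x] by simp

lemma cmod_cis_diff: "cmod (cis a - cis b) \<le> 2 * \<bar>a - b\<bar> powr (1 / 4)"
proof -
  have "cis a - cis b = cis b * (cis (a - b) - 1)" by (simp add: right_diff_distrib cis_mult)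
  then have "cmod (cis a - cis b) = cmod (cis (a - b) - 1)" by (simp add: norm_mult)
  then show ?thesis using min_powr_bound[of "1/4" "cmod (cis (a - b) - 1)" "\<bar>a - b\<bar>"] cmod_cis_diff_1[of
      "a - b"] by simp
qed

text \<open>A multiplier decaying like \<open>1 / w\<close> tolerates a quarter power of the
  frequency, because \<open>3/4 > 1/2\<close> keeps the result square integrable.\<close>

lemma decay_mult_L2:
  assumes [measurable]: "a \<in> borel_measurable borel" and "\<And>\<xi>. cmod (a \<xi>) * w \<xi> \<le> C"
  shows "(\<lambda>\<xi>. of_real (\<bar>\<xi>\<bar> powr (1 / 4)) * a \<xi>) \<in> L2"
proof (rule L2_dominated[OF w_powr_L2[of "3/4"], of _ C])
  show "AE \<xi> in lborel. cmod (of_real (\<bar>\<xi>\<bar> powr (1 / 4)) * a \<xi>)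
      \<le> C * cmod (complex_of_real (w \<xi> powr (- (3 / 4))))"
  proof (rule AE_I2)
    fix \<xi>
    have "\<bar>\<xi>\<bar> powr (1 / 4) \<le> w \<xi> powr (1 / 4)" by (intro powr_mono2) (auto simp: w_def)
    then have "cmod (of_real (\<bar>\<xi>\<bar> powr (1 / 4)) * a \<xi>) \<le> w \<xi> powr (1 / 4) * cmod (a \<xi>)"
      by (simp add: norm_mult mult_right_mono)
    also have "w \<xi> powr (1 / 4) = w \<xi> * w \<xi> powr (- (3 / 4))"
      using powr_add[of "w \<xi>" 1 "- (3 / 4)"] by simp
    also have "w \<xi> * w \<xi> powr (- (3 / 4)) * cmod (a \<xi>) \<le> C * w \<xi> powr (- (3 / 4))"
      using mult_right_mono[OF assms(2)[of \<xi>], of "w \<xi> powr (- (3 / 4))"] by (simp add: mult_ac)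
    finally show "cmod (of_real (\<bar>\<xi>\<bar> powr (1 / 4)) * a \<xi>)
        \<le> C * cmod (complex_of_real (w \<xi> powr (- (3 / 4))))"
      by simp
  qed
qed auto

text \<open>The quarter power bound for the increment of the phase moves a quarter power of the
  frequency onto the multiplier, where the previous decay absorbs it. The modulus depends on
  \<open>f\<close> only through its norm.\<close>

lemma mult_op_equicont:
  assumes a: "a \<in> L2" "(\<lambda>\<xi>. of_real (\<bar>\<xi>\<bar> powr (1 / 4)) * a \<xi>) \<in> L2" and f: "f \<in> L2"
  shows "cmod (mult_op a f x - mult_op a f y)
    \<le> 2 * \<bar>x - y\<bar> powr (1 / 4) * (L2_norm (\<lambda>\<xi>. of_real (\<bar>\<xi>\<bar> powr (1 / 4)) * a \<xi>) * L2_norm f)"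
proof -
  let ?b = "\<lambda>\<xi>. of_real (\<bar>\<xi>\<bar> powr (1 / 4)) * a \<xi>" and ?c = "2 * \<bar>x - y\<bar> powr (1 / 4)"
  have "mult_op a f x - mult_op a f y = 1 / (2 * pi) * ((LINT \<xi>|lborel. cis (x * \<xi>) * (a \<xi> * fourier f \<xi>))
      - (LINT \<xi>|lborel. cis (y * \<xi>) * (a \<xi> * fourier f \<xi>)))"
    by (simp add: mult_op_def IFT_def right_diff_distrib)
  also have "\<dots> = 1 / (2 * pi) * (LINT \<xi>|lborel. (cis (x * \<xi>) - cis (y * \<xi>)) * (a \<xi> * fourier f \<xi>))"
    using mult_op_integrable[OF a(1) f] by (simp add: left_diff_distrib)
  finally have "cmod (mult_op a f x - mult_op a f y)
      \<le> 1 / (2 * pi) * (LINT \<xi>|lborel. cmod ((cis (x * \<xi>) - cis (y * \<xi>)) * (a \<xi> * fourier f \<xi>)))"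
    using integral_norm_bound[of lborel "\<lambda>\<xi>. (cis (x * \<xi>) - cis (y * \<xi>)) * (a \<xi> * fourier f \<xi>)"]
    by (simp add: norm_mult norm_divide divide_right_mono)
  also have "\<dots> \<le> 1 / (2 * pi) * (LINT \<xi>|lborel. ?c * (cmod (?b \<xi>) * cmod (fourier f \<xi>)))"
  proof (intro mult_left_mono integral_mono)
    show "integrable lborel (\<lambda>\<xi>. cmod ((cis (x * \<xi>) - cis (y * \<xi>)) * (a \<xi> * fourier f \<xi>)))"
      using Bochner_Integration.integrable_diff[OF mult_op_integrable[OF a(1) f, of x] mult_op_integrable[OF
        a(1) f, of y]]
      by (intro integrable_norm) (simp add: left_diff_distrib)
    show "integrable lborel (\<lambda>\<xi>. ?c * (cmod (?b \<xi>) * cmod (fourier f \<xi>)))"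
      using integrable_norm[OF L2_mult_integrable[OF a(2) fourier_L2[OF f]]] by (simp add: norm_mult)
    fix \<xi>
    have "\<bar>x * \<xi> - y * \<xi>\<bar> powr (1 / 4) = \<bar>x - y\<bar> powr (1 / 4) * \<bar>\<xi>\<bar> powr (1 / 4)"
      by (simp add: powr_mult abs_mult flip: left_diff_distrib)
    then have "cmod (cis (x * \<xi>) - cis (y * \<xi>)) \<le> ?c * \<bar>\<xi>\<bar> powr (1 / 4)"
      using cmod_cis_diff[of "x * \<xi>" "y * \<xi>"] by simp
    then have "cmod (cis (x * \<xi>) - cis (y * \<xi>)) * (cmod (a \<xi>) * cmod (fourier f \<xi>))
        \<le> ?c * \<bar>\<xi>\<bar> powr (1 / 4) * (cmod (a \<xi>) * cmod (fourier f \<xi>))"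
      by (rule mult_right_mono) simp
    then show "cmod ((cis (x * \<xi>) - cis (y * \<xi>)) * (a \<xi> * fourier f \<xi>))
        \<le> ?c * (cmod (?b \<xi>) * cmod (fourier f \<xi>))"
      by (simp add: norm_mult mult_ac)
  qed auto
  also have "\<dots> = ?c * (1 / (2 * pi) * (LINT \<xi>|lborel. cmod (?b \<xi>) * cmod (fourier f \<xi>)))"
    by simp
  also have "\<dots> \<le> ?c * (1 / (2 * pi) * (L2_norm ?b * (sqrt (2 * pi) * L2_norm f)))"
    using L2_Cauchy_Schwarz[OF a(2) fourier_L2[OF f]]
      by (intro mult_left_mono) (auto simp: fourier_Plancherel[OF f])
  also have "\<dots> = ?c * ((1 / (2 * pi) * sqrt (2 * pi)) * (L2_norm ?b * L2_norm f))" by (simp add: mult_ac)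
  also have "\<dots> \<le> ?c * (1 * (L2_norm ?b * L2_norm f))"
      by (intro mult_left_mono mult_right_mono sqrt_2pi_bound) auto
  finally show ?thesis by simp
qed

section \<open>Dependence of the multipliers on the spectral parameter\<close>

lemma Pmul_resolvent:
  assumes "off k" "off z" shows "Pmul z \<xi> - Pmul k \<xi> = (z - k) * (Pmul z \<xi> * Pmul k \<xi>)"
proof (cases "\<xi> \<ge> 0")
  case True
  then show ?thesis using off_ne[OF assms(1) True] off_ne[OF assms(2) True]
      by (simp add: Pmul_def field_simps)
qed (simp add: Pmul_def)

lemma Pmul_prod_decay:
  assumes "cmod a * w \<xi> \<le> A" "cmod b * w \<xi> \<le> B" "0 \<le> A" "0 \<le> B"
  shows "cmod (a * b) * w \<xi> \<le> A * B"
proof -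
  have "cmod b * 1 \<le> cmod b * w \<xi>" by (intro mult_left_mono) auto
  then have "cmod b \<le> B" using assms(2) by simp
  then have "(cmod a * w \<xi>) * cmod b \<le> A * B" using assms by (intro mult_mono) auto
  then show ?thesis by (simp add: norm_mult mult_ac)
qed

definition w1 :: real where "w1 = L2_norm (\<lambda>x. complex_of_real (w x powr (- 1)))"

lemma w1_nonneg [simp]: "0 \<le> w1" by (simp add: w1_def)

text \<open>The resolvent identity, applied once for the Lipschitz bound and twice for the
  difference quotient, whose limit is the square of the multiplier. Products of multipliers keep the
  decay \<open>1 / w\<close>, uniformly near \<open>k\<close>.\<close>

lemma Pmul_diff_norm:
  assumes k: "off k"
  obtains C r where "r > 0" "C \<ge> 0" "\<And>z. z \<in> ball k r \<Longrightarrow> off z"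
    "\<And>z z'. z \<in> ball k r \<Longrightarrow> z' \<in> ball k r \<Longrightarrow> L2_norm (\<lambda>\<xi>. Pmul z \<xi> - Pmul z' \<xi>) \<le> C * cmod (z - z')"
    "\<And>z. z \<in> ball k r \<Longrightarrow> z \<noteq> k \<Longrightarrow> L2_norm (\<lambda>\<xi>. (Pmul z \<xi> - Pmul k \<xi>) / (z - k) - Pmul k \<xi> * Pmul k \<xi>)
        \<le> C * cmod (z - k)"
proof -
  obtain \<delta> r where d: "\<delta> > 0" "r > 0" "\<And>k' \<xi>. k' \<in> ball k r \<Longrightarrow> \<xi> \<ge> 0 \<Longrightarrow> \<delta> * w \<xi> \<le> cmod (of_real \<xi> - k')"
    "\<And>k'. k' \<in> ball k r \<Longrightarrow> off k'"
    using off_lower_uniform[OF k] by metis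
  define B where "B = 1 / \<delta>"
  have B0: "0 \<le> B" using d(1) by (simp add: B_def)
  have B: "cmod (Pmul z \<xi>) * w \<xi> \<le> B" if "z \<in> ball k r" for z \<xi>
    unfolding B_def by (rule Pmul_decay[OF d(3)[OF that] d(1)])
  have kk: "k \<in> ball k r" using d(2) by simp
  define C where "C = (B * B + B * (B * B)) * w1"
  have sc: "L2_norm (\<lambda>\<xi>. t * h \<xi>) \<le> C * cmod t" if "h \<in> borel_measurable borel" "\<And>\<xi>. cmod (h \<xi>) * w \<xi> \<le> A"
      "A \<le> B * B + B * (B * B)" for t h A
  proof -
    have "L2_norm h \<le> A * w1" unfolding w1_def by (rule L2_if_decay(2)[OF that(1,2)])
    also have "\<dots> \<le> C" unfolding C_def using that(3) by (intro mult_right_mono) auto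
    finally show ?thesis using mult_right_mono[of "L2_norm h" C "cmod t"]
        by (simp add: L2_norm_cmult mult.commute)
  qed
  show ?thesis
  proof (rule that[OF d(2) _ d(4)])
    show "C \<ge> 0" using B0 by (simp add: C_def)
    show "L2_norm (\<lambda>\<xi>. Pmul z \<xi> - Pmul z' \<xi>) \<le> C * cmod (z - z')" if z: "z \<in> ball k r" "z' \<in> ball k r"
        for z z'
      unfolding Pmul_resolvent[OF d(4)[OF z(2)] d(4)[OF z(1)]]
      by (rule sc[OF _ Pmul_prod_decay[OF B[OF z(1)] B[OF z(2)] B0 B0]]) (use B0 in auto)
    show "L2_norm (\<lambda>\<xi>. (Pmul z \<xi> - Pmul k \<xi>) / (z - k) - Pmul k \<xi> * Pmul k \<xi>) \<le> C * cmod (z - k)"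
      if z: "z \<in> ball k r" "z \<noteq> k" for z
    proof -
      have "(Pmul z \<xi> - Pmul k \<xi>) / (z - k) - Pmul k \<xi> * Pmul k \<xi>
          = (z - k) * (Pmul z \<xi> * (Pmul k \<xi> * Pmul k \<xi>))" for \<xi>
      proof -
        have "(Pmul z \<xi> - Pmul k \<xi>) / (z - k) = Pmul z \<xi> * Pmul k \<xi>"
          unfolding Pmul_resolvent[OF k d(4)[OF z(1)]] using z(2) by simp
        moreover have "Pmul z \<xi> * Pmul k \<xi> - Pmul k \<xi> * Pmul k \<xi> = (Pmul z \<xi> - Pmul k \<xi>) * Pmul k \<xi>"
          by (simp add: left_diff_distrib)
        ultimately show ?thesis unfolding Pmul_resolvent[OF k d(4)[OF z(1)]] by (simp add: mult_ac)
      qed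
      then show ?thesis
        using sc[OF _ Pmul_prod_decay[OF B[OF z(1)] Pmul_prod_decay[OF B[OF kk] B[OF kk] B0 B0] B0], of
          "z - k"] B0
        by simp
    qed
  qed
qed

text \<open>Crossing the positive axis is harmless for \<open>Nmul\<close>, so these bounds hold on
  a full disc around the edge point.\<close>

lemma Nmul_diff_norm:
  assumes l: "0 < l"
  obtains C r where "r > 0" "C \<ge> 0" "\<And>z. z \<in> ball (of_real l) r \<Longrightarrow> off (- z)"
    "\<And>z z'. z \<in> ball (of_real l) r \<Longrightarrow> z' \<in> ball (of_real l) r \<Longrightarrow> L2_norm (\<lambda>\<xi>. Nmul z \<xi> - Nmul z' \<xi>)
        \<le> C * cmod (z - z')"
proof -
  have l': "off (- of_real l)" using l by (auto simp: off_def)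
  show ?thesis
  proof (rule Pmul_diff_norm[OF l'])
    fix C r assume C: "r > 0" "C \<ge> 0" "\<And>z. z \<in> ball (- of_real l) r \<Longrightarrow> off z"
      "\<And>z z'. z \<in> ball (- of_real l) r \<Longrightarrow> z' \<in> ball (- of_real l) r \<Longrightarrow> L2_norm (\<lambda>\<xi>. Pmul z \<xi> - Pmul z' \<xi>)
          \<le> C * cmod (z - z')"
    have m: "- z \<in> ball (- of_real l) r" if "z \<in> ball (of_real l) r" for z :: complex
      using that by (simp add: dist_norm norm_minus_commute)
    show thesis
    proof (rule that[OF C(1,2)])
      fix z z' :: complex assume z: "z \<in> ball (of_real l) r" "z' \<in> ball (of_real l) r"
      have "(\<lambda>\<xi>. Nmul z \<xi> - Nmul z' \<xi>) = (\<lambda>\<xi>. (-1) * ((\<lambda>\<xi>. Pmul (- z) \<xi> - Pmul (- z') \<xi>) (- \<xi>)))"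
        by (auto simp: Nmul_Pmul)
      moreover have "(\<lambda>\<xi>. Pmul (- z) \<xi> - Pmul (- z') \<xi>) \<in> L2"
        by (intro L2_diff Pmul_L2 C(3) m z)
      ultimately have "L2_norm (\<lambda>\<xi>. Nmul z \<xi> - Nmul z' \<xi>) = L2_norm (\<lambda>\<xi>. Pmul (- z) \<xi> - Pmul (- z') \<xi>)"
        using L2_reflect(2) by (simp only: L2_norm_cmult) simp
      then show "L2_norm (\<lambda>\<xi>. Nmul z \<xi> - Nmul z' \<xi>) \<le> C * cmod (z - z')"
        using C(4)[OF m[OF z(1)] m[OF z(2)]] by (simp add: norm_minus_commute)
    qed (use C(3) m in blast)
  qed
qed

section \<open>The one-sided exponential kernel\<close>

lemma exp_diff_bound:
  assumes "Re a \<le> 0" "Re b \<le> 0" shows "cmod (exp a - exp b) \<le> cmod (a - b)" "cmod (exp a - exp b) \<le> 2"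
proof -
  have "cmod (exp a - exp b) \<le> 1 * cmod (a - b)"
  proof (rule field_differentiable_bound[where S="{z. Re z \<le> 0}"])
    show "convex {z. Re z \<le> 0}" by (simp add: convex_halfspace_Re_le)
    show "(exp has_field_derivative exp z) (at z within {z. Re z \<le> 0})" for z :: complex
      by (rule DERIV_subset[OF DERIV_exp]) auto
  qed (use assms in \<open>auto simp: norm_exp_eq_Re\<close>)
  then show "cmod (exp a - exp b) \<le> cmod (a - b)" by simp
  have "cmod (exp a) \<le> 1" "cmod (exp b) \<le> 1" using assms by (auto simp: norm_exp_eq_Re)
  then show "cmod (exp a - exp b) \<le> 2" using norm_triangle_ineq4[of "exp a" "exp b"] by linarith
qed

text \<open>On the supporting ray both exponents have nonpositive real part as long as the
  parameters lie on the closed side \<open>e\<close>. The price of the exponent \<gamma> in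
  \<open>k - k'\<close> is the same power of \<open>\<bar>x\<bar>\<close>.\<close>

lemma Eker_diff:
  assumes k: "0 \<le> edge_sign e * Im k" "0 \<le> edge_sign e * Im k'" and \<gamma>: "0 \<le> \<gamma>" "\<gamma> \<le> 1"
  shows "cmod (Eker e k x - Eker e k' x) \<le> 2 * (cmod (k - k') powr \<gamma> * \<bar>x\<bar> powr \<gamma>)"
proof (cases "0 < edge_sign e * x")
  case True
  have re: "Re (\<i> * k * of_real x) \<le> 0" "Re (\<i> * k' * of_real x) \<le> 0"
    using k True by (cases e; simp add: mult_nonneg_nonneg mult_nonpos_nonpos)+
  have "Eker e k x - Eker e k' x = of_real (edge_sign e) * \<i> * (exp (\<i> * k * of_real x)
      - exp (\<i> * k' * of_real x))"
    using True by (simp add: Eker_def algebra_simps)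
  then have "cmod (Eker e k x - Eker e k' x) = cmod (exp (\<i> * k * of_real x) - exp (\<i> * k' * of_real x))"
    by (simp add: norm_mult)
  moreover have "cmod (\<i> * k * of_real x - \<i> * k' * of_real x) = cmod (k - k') * \<bar>x\<bar>"
    by (simp add: norm_mult flip: left_diff_distrib right_diff_distrib)
  ultimately show ?thesis
    using min_powr_bound[OF \<gamma>, of "cmod (Eker e k x - Eker e k' x)"
      "cmod (k - k') * \<bar>x\<bar>"] exp_diff_bound[OF re]
    by (simp add: powr_mult)
qed (simp add: Eker_def)

lemma convol_Eker_integrable:
  assumes k: "0 \<le> edge_sign e * Im k" and f: "integrable lborel f"
  shows "integrable lborel (\<lambda>y. Eker e k (x - y) * f y)"
proof (rule Bochner_Integration.integrable_bound[OF f])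
  have [measurable]: "f \<in> borel_measurable borel" using f by auto
  show "(\<lambda>y. Eker e k (x - y) * f y) \<in> borel_measurable lborel" by measurable
  show "AE y in lborel. norm (Eker e k (x - y) * f y) \<le> norm (f y)"
    using cmod_Eker_le[OF k] by (auto intro!: AE_I2 simp: norm_mult mult_left_le_one_le)
qed

lemma convol_Eker_bound:
  assumes k: "0 \<le> edge_sign e * Im k" and f: "integrable lborel f"
  shows "cmod (convol (Eker e k) f x) \<le> (LINT y|lborel. cmod (f y))"
  unfolding convol_def
proof (rule order_trans[OF integral_norm_bound], rule integral_mono)
  show "integrable lborel (\<lambda>y. cmod (Eker e k (x - y) * f y))"
      by (intro integrable_norm convol_Eker_integrable k f)
  show "cmod (Eker e k (x - y) * f y) \<le> cmod (f y)" for y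
    using cmod_Eker_le[OF k] by (simp add: norm_mult mult_left_le_one_le)
qed (use f in simp)

text \<open>Since \<open>\<bar>x - y\<bar>\<close> is at most \<open>w x * w y\<close>, the growth
  of the kernel difference splits into a weight that is left outside and a moment of
  \<open>f\<close>.\<close>

lemma convol_Eker_diff:
  assumes k: "0 \<le> edge_sign e * Im k" "0 \<le> edge_sign e * Im k'" and \<gamma>: "0 \<le> \<gamma>" "\<gamma> \<le> 1"
    and f: "integrable lborel f" and wf: "integrable lborel (\<lambda>y. w y powr \<gamma> * cmod (f y))"
  shows "cmod (convol (Eker e k) f x - convol (Eker e k') f x)
    \<le> 2 * cmod (k - k') powr \<gamma> * (w x powr \<gamma> * (LINT y|lborel. w y powr \<gamma> * cmod (f y)))"
proof -
  have "convol (Eker e k) f x - convol (Eker e k') f x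
      = (LINT y|lborel. (Eker e k (x - y) - Eker e k' (x - y)) * f y)"
    unfolding convol_def left_diff_distrib
    by (intro Bochner_Integration.integral_diff[symmetric] convol_Eker_integrable k f)
  also have "cmod \<dots> \<le> (LINT y|lborel. cmod ((Eker e k (x - y) - Eker e k' (x - y)) * f y))"
    by (rule integral_norm_bound)
  also have "\<dots> \<le> (LINT y|lborel. 2 * cmod (k - k') powr \<gamma> * (w x powr \<gamma> * (w y powr \<gamma> * cmod (f y))))"
  proof (rule integral_mono)
    show "integrable lborel (\<lambda>y. cmod ((Eker e k (x - y) - Eker e k' (x - y)) * f y))"
      unfolding left_diff_distrib
      by (intro integrable_norm Bochner_Integration.integrable_diff convol_Eker_integrable k f)
    show "integrable lborel (\<lambda>y. 2 * cmod (k - k') powr \<gamma> * (w x powr \<gamma> * (w y powr \<gamma> * cmod (f y))))"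
      by (intro integrable_mult_right wf)
    fix y
    have "\<bar>x - y\<bar> \<le> w x * w y"
        by (simp add: w_def algebra_simps) (smt (verit) abs_ge_zero mult_nonneg_nonneg)
    then have "\<bar>x - y\<bar> powr \<gamma> \<le> w x powr \<gamma> * w y powr \<gamma>"
      using \<gamma> by (simp add: powr_mono2 flip: powr_mult)
    then have "2 * (cmod (k - k') powr \<gamma> * \<bar>x - y\<bar> powr \<gamma>)
        \<le> 2 * (cmod (k - k') powr \<gamma> * (w x powr \<gamma> * w y powr \<gamma>))"
      by (intro mult_left_mono) auto
    then have "cmod (Eker e k (x - y) - Eker e k' (x - y))
        \<le> 2 * (cmod (k - k') powr \<gamma> * (w x powr \<gamma> * w y powr \<gamma>))"
      using Eker_diff[OF k \<gamma>, of "x - y"] by linarith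
    then have "cmod (Eker e k (x - y) - Eker e k' (x - y)) * cmod (f y)
        \<le> 2 * (cmod (k - k') powr \<gamma> * (w x powr \<gamma> * w y powr \<gamma>)) * cmod (f y)"
      by (rule mult_right_mono) simp
    then show "cmod ((Eker e k (x - y) - Eker e k' (x - y)) * f y)
        \<le> 2 * cmod (k - k') powr \<gamma> * (w x powr \<gamma> * (w y powr \<gamma> * cmod (f y)))"
      by (simp add: norm_mult mult_ac)
  qed
  finally show ?thesis by simp
qed

text \<open>The kernel is Lipschitz on its ray and jumps once. The jump is felt only for
  \<open>y\<close> between \<open>x\<close> and \<open>x'\<close>, an interval whose length enters
  through Cauchy-Schwarz as a square root.\<close>

lemma convol_Eker_equicont:
  assumes k: "0 \<le> edge_sign e * Im k" and f: "integrable lborel f" "f \<in> L2"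
  shows "cmod (convol (Eker e k) f x - convol (Eker e k) f x')
    \<le> cmod k * \<bar>x - x'\<bar> * (LINT y|lborel. cmod (f y)) + sqrt \<bar>x - x'\<bar> * L2_norm f"
proof -
  have [measurable]: "f \<in> borel_measurable borel" using f by auto
  define I where "I = {min x x'..max x x'}"
  let ?i = "\<lambda>y. indicator I y :: complex"
  have i2: "?i \<in> L2" unfolding I_def by (rule indicator_Icc_L2)
  have "(\<lambda>y. (cmod (?i y))\<^sup>2) = indicat_real I" by (auto simp: indicator_def)
  then have "L2_norm ?i = sqrt (LINT y|lborel. indicat_real I y)" by (simp only: L2_norm_def)
  also have "(LINT y|lborel. indicat_real I y) = max x x' - min x x'" by (simp add: I_def)
  also have "\<dots> = \<bar>x - x'\<bar>" by (simp add: max_def min_def)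
  finally have iN: "L2_norm ?i = sqrt \<bar>x - x'\<bar>" .
  have pt: "cmod (Eker e k (x - y) - Eker e k (x' - y)) \<le> cmod k * \<bar>x - x'\<bar> + cmod (?i y)" for y
  proof -
    let ?s = "edge_sign e"
    have "0 < ?s * (x - y) \<and> 0 < ?s * (x' - y) \<or> \<not> 0 < ?s * (x - y) \<and> \<not> 0 < ?s * (x' - y) \<or> y \<in> I"
      by (cases e; cases "x \<le> x'") (auto simp: I_def)
    then consider "0 < ?s * (x - y)" "0 < ?s * (x' - y)" | "\<not> 0 < ?s * (x - y)" "\<not> 0 < ?s * (x' - y)" |
        "y \<in> I"
      by blast
    then show ?thesis
    proof cases
      case 1
      have re: "Re (\<i> * k * of_real (x - y)) \<le> 0" "Re (\<i> * k * of_real (x' - y)) \<le> 0"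
        using k 1 by (cases e; simp add: mult_nonneg_nonneg mult_nonpos_nonpos)+
      have "Eker e k (x - y) - Eker e k (x' - y) = of_real ?s * \<i> * (exp (\<i> * k * of_real (x - y))
          - exp (\<i> * k * of_real (x' - y)))"
        using 1 by (simp add: Eker_def algebra_simps)
      then have "cmod (Eker e k (x - y) - Eker e k (x' - y))
          = cmod (exp (\<i> * k * of_real (x - y)) - exp (\<i> * k * of_real (x' - y)))"
        by (simp add: norm_mult)
      also have "\<dots> \<le> cmod (\<i> * k * of_real (x - y) - \<i> * k * of_real (x' - y))"
          by (rule exp_diff_bound(1)[OF re])
      also have "\<i> * k * of_real (x - y) - \<i> * k * of_real (x' - y) = \<i> * k * of_real (x - x')"
          by (simp add: algebra_simps)
      also have "cmod \<dots> = cmod k * \<bar>x - x'\<bar>" by (simp only: norm_mult norm_of_real) simp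
      finally show ?thesis by (simp add: add_increasing2)
    next
      case 2
      then show ?thesis by (simp add: Eker_def)
    next
      case 3
      \<comment> \<open>For \<open>y\<close> between the two points at most one of the two values is
        nonzero, apart from coinciding points, so the jump is at most 1.\<close>
      have "Eker e k (x - y) = 0 \<or> Eker e k (x' - y) = 0 \<or> x = x' \<or> y = x \<or> y = x'"
        using 3 by (cases e) (auto simp: Eker_def I_def min_def max_def indicator_def split: if_splits)
      then have "cmod (Eker e k (x - y) - Eker e k (x' - y)) \<le> 1"
        using cmod_Eker_le[OF k, of "x - y"] cmod_Eker_le[OF k, of "x' - y"] by (auto simp: Eker_def)
      then show ?thesis using 3 by (simp add: add_increasing)
    qed
  qed
  have "convol (Eker e k) f x - convol (Eker e k) f x'
      = (LINT y|lborel. (Eker e k (x - y) - Eker e k (x' - y)) * f y)"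
    unfolding convol_def left_diff_distrib
    by (intro Bochner_Integration.integral_diff[symmetric] convol_Eker_integrable k f)
  also have "cmod \<dots> \<le> (LINT y|lborel. cmod ((Eker e k (x - y) - Eker e k (x' - y)) * f y))"
    by (rule integral_norm_bound)
  also have "\<dots> \<le> (LINT y|lborel. cmod k * \<bar>x - x'\<bar> * cmod (f y) + cmod (?i y) * cmod (f y))"
  proof (rule integral_mono)
    show "integrable lborel (\<lambda>y. cmod ((Eker e k (x - y) - Eker e k (x' - y)) * f y))"
      unfolding left_diff_distrib
      by (intro integrable_norm Bochner_Integration.integrable_diff convol_Eker_integrable k f)
    show "integrable lborel (\<lambda>y. cmod k * \<bar>x - x'\<bar> * cmod (f y) + cmod (?i y) * cmod (f y))"
      using integrable_norm[OF L2_mult_integrable[OF i2 f(2)]] f(1) by (simp add: norm_mult)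
    show "cmod ((Eker e k (x - y) - Eker e k (x' - y)) * f y) \<le> cmod k * \<bar>x - x'\<bar> * cmod (f y) + cmod (?i y)
        * cmod (f y)" for y
      using mult_right_mono[OF pt[of y], of "cmod (f y)"] by (simp add: norm_mult distrib_right)
  qed
  also have "\<dots> = cmod k * \<bar>x - x'\<bar> * (LINT y|lborel. cmod (f y)) + (LINT y|lborel. cmod (?i y)
      * cmod (f y))"
    using integrable_norm[OF L2_mult_integrable[OF i2 f(2)]] f(1) by (simp add: norm_mult)
  also have "(LINT y|lborel. cmod (?i y) * cmod (f y)) \<le> sqrt \<bar>x - x'\<bar> * L2_norm f"
    using L2_Cauchy_Schwarz[OF i2 f(2)] by (simp only: iN)
  finally show ?thesis by simp
qed

text \<open>Stated for an arbitrary kernel so that it serves both the edge and its neighbourhood;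
  the kernel's value at 0 does not affect the integral.\<close>

lemma convol_decomposed:
  assumes g: "\<And>x. x \<noteq> 0 \<Longrightarrow> g x = Eker e k x - Gtilde k x"
    and k: "0 \<le> edge_sign e * Im k" "off (- k)" and f: "f \<in> L2" "integrable lborel f"
  shows "convol g f x = convol (Eker e k) f x - mult_op (Nmul k) f x"
proof -
  have [measurable]: "f \<in> borel_measurable borel" "Gtilde k \<in> borel_measurable borel"
      using f Gtilde_L2[OF k(2)] by auto
  have "g = (\<lambda>x. if x = 0 then g 0 else Eker e k x - Gtilde k x)" using g by auto
  moreover have "(\<lambda>x. if x = 0 then g 0 else Eker e k x - Gtilde k x) \<in> borel_measurable borel"
      by measurable
  ultimately have [measurable]: "g \<in> borel_measurable borel" by simp
  have "(\<lambda>y. Gtilde k (x - y)) \<in> L2"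
    using L2_translate(1)[OF L2_reflect(1)[OF Gtilde_L2[OF k(2)]], of x] by simp
  then have i: "integrable lborel (\<lambda>y. Gtilde k (x - y) * f y)" by (rule L2_mult_integrable[OF _ f(1)])
  have "convol g f x = (LINT y|lborel. Eker e k (x - y) * f y - Gtilde k (x - y) * f y)"
    unfolding convol_def
  proof (rule integral_cong_AE)
    have "AE y in lborel. y \<noteq> x" by (rule AE_lborel_singleton)
    then show "AE y in lborel. g (x - y) * f y = Eker e k (x - y) * f y - Gtilde k (x - y) * f y"
      by eventually_elim (simp add: g left_diff_distrib)
  qed measurable
  also have "\<dots> = convol (Eker e k) f x - convol (Gtilde k) f x"
    unfolding convol_def by (intro Bochner_Integration.integral_diff convol_Eker_integrable k f i)
  also have "convol (Gtilde k) f x = mult_op (Nmul k) f x"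
    by (rule convol_mult_op[OF Gtilde_L2[OF k(2)] f(1) fourier_Gtilde[OF k(2)]]) measurable
  finally show ?thesis .
qed

lemma convol_G_edge:
  assumes "0 < l" "f \<in> L2" "integrable lborel f"
  shows "convol (G_edge e l) f x = convol (Eker e (of_real l)) f x - mult_op (Nmul (of_real l)) f x"
  using assms by (intro convol_decomposed G_edge_eq) (auto simp: off_def)

lemma convol_G_near_edge:
  assumes "0 < edge_sign e * Im k" "f \<in> L2" "integrable lborel f"
  shows "convol (G k) f x = convol (Eker e k) f x - mult_op (Nmul k) f x"
  using assms by (intro convol_decomposed G_decompose) (auto simp: off_def)

section \<open>Compactness on the weighted space\<close>

text \<open>The substitution \<open>t = x / (1 + \<bar>x\<bar>)\<close> turns decay at infinity into equicontinuity at the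
  endpoints of a compact interval.\<close>

lemma decaying_equicontinuous_subseq:
  fixes g :: "nat \<Rightarrow> real \<Rightarrow>\<^sub>C complex"
  assumes decay: "\<And>n x. cmod (g n x) \<le> C * w x powr (- \<sigma>)" and \<sigma>: "0 < \<sigma>"
    and equi: "\<And>x e. 0 < e \<Longrightarrow> \<exists>d>0. \<forall>n y. \<bar>x - y\<bar> < d \<longrightarrow> cmod (g n x - g n y) < e"
  shows "\<exists>r l. strict_mono r \<and> (\<lambda>n. g (r n)) \<longlonglongrightarrow> l"
proof -
  have C: "0 \<le> C"
  proof -
    have "0 \<le> C * w 0 powr (- \<sigma>)" by (rule order_trans[OF norm_ge_zero decay])
    then show ?thesis by (simp add: w_def)
  qed
  \<comment> \<open>Extending by 0 at the endpoints is the right continuous extension because of the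
    decay.\<close>
  define F where "F n t = (if \<bar>t\<bar> < 1 then g n (t / (1 - \<bar>t\<bar>)) else 0)" for n t
  have Fd: "cmod (F n t) \<le> C * (1 - \<bar>t\<bar>) powr \<sigma>" if "\<bar>t\<bar> < 1" for n t
  proof -
    have "w (t / (1 - \<bar>t\<bar>)) = inverse (1 - \<bar>t\<bar>)"
      using that by (simp add: w_def abs_div field_simps)
    then have "w (t / (1 - \<bar>t\<bar>)) powr (- \<sigma>) = (1 - \<bar>t\<bar>) powr \<sigma>"
      using that by (simp add: powr_minus inverse_powr flip: powr_minus)
    then show ?thesis using decay[of n "t / (1 - \<bar>t\<bar>)"] that by (simp add: F_def)
  qed
  have eqF: "\<exists>d. 0 < d \<and> (\<forall>n t'. t' \<in> {-1..1} \<and> norm (t - t') < d \<longrightarrow> norm (F n t - F n t') < e)"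
    if t: "t \<in> {-1..1}" and e: "0 < e" for t e :: real
  proof (cases "\<bar>t\<bar> < 1")
    case True
    obtain d1 where d1: "d1 > 0" "\<And>n y. \<bar>t / (1 - \<bar>t\<bar>) - y\<bar> < d1 \<Longrightarrow> cmod (g n (t / (1 - \<bar>t\<bar>)) - g n y) < e"
      using equi[OF e, of "t / (1 - \<bar>t\<bar>)"] by blast
    have "isCont (\<lambda>t. t / (1 - \<bar>t\<bar>)) t" using True by (intro continuous_intros) auto
    then obtain d2 where d2: "d2 > 0" "\<And>t'. dist t' t < d2 \<Longrightarrow> dist (t' / (1 - \<bar>t'\<bar>)) (t / (1 - \<bar>t\<bar>)) < d1"
      unfolding continuous_at_eps_delta using d1(1) by blast
    show ?thesis
    proof (intro exI[of _ "min d2 (1 - \<bar>t\<bar>)"] conjI allI impI)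
      fix n t' assume t': "t' \<in> {-1..1} \<and> norm (t - t') < min d2 (1 - \<bar>t\<bar>)"
      then have "\<bar>t'\<bar> < 1" by auto
      moreover have "\<bar>t / (1 - \<bar>t\<bar>) - t' / (1 - \<bar>t'\<bar>)\<bar> < d1"
        using d2(2)[of t'] t' by (simp add: dist_real_def abs_minus_commute)
      ultimately show "norm (F n t - F n t') < e" using d1(2) True by (simp add: F_def)
    qed (use d2 True in auto)
  next
    case False
    then have t1: "\<bar>t\<bar> = 1" using t by auto
    \<comment> \<open>Chosen so that \<open>C\<close> times \<open>d\<close> to the power \<sigma>
      is \<open>e * C / (C + 1)\<close>, strictly below \<open>e\<close> even for
      \<open>C = 0\<close>.\<close>
    define d where "d = (e / (C + 1)) powr (1 / \<sigma>)"
    have d: "d > 0" using e C by (simp add: d_def)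
    have ds: "C * d powr \<sigma> < e"
    proof -
      have "d powr \<sigma> = e / (C + 1)" using e C \<sigma> by (simp add: d_def powr_powr)
      then have "C * d powr \<sigma> = e - d powr \<sigma>" using C by (simp add: field_simps)
      moreover have "0 < d powr \<sigma>" using d by simp
      ultimately show ?thesis by linarith
    qed
    show ?thesis
    proof (intro exI[of _ d] conjI allI impI d)
      fix n t' assume t': "t' \<in> {-1..1} \<and> norm (t - t') < d"
      show "norm (F n t - F n t') < e"
      proof (cases "\<bar>t'\<bar> < 1")
        case True
        have "1 - \<bar>t'\<bar> < d" using t' t1 by auto
        then have "(1 - \<bar>t'\<bar>) powr \<sigma> \<le> d powr \<sigma>" using True \<sigma> by (intro powr_mono2) auto
        then have "C * (1 - \<bar>t'\<bar>) powr \<sigma> \<le> C * d powr \<sigma>" using C by (intro mult_left_mono)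
        then have "cmod (F n t') < e" using Fd[OF True, of n] ds by linarith
        then show ?thesis using False by (simp add: F_def)
      qed (use False e in \<open>simp add: F_def\<close>)
    qed
  qed
  have Fb: "norm (F n t) \<le> C" if "t \<in> {-1..1}" for n t
  proof (cases "\<bar>t\<bar> < 1")
    case True
    have "(1 - \<bar>t\<bar>) powr \<sigma> \<le> 1" using True \<sigma> by (intro powr_le1) auto
    then have "C * (1 - \<bar>t\<bar>) powr \<sigma> \<le> C * 1" using C by (intro mult_left_mono)
    then show ?thesis using Fd[OF True, of n] by simp
  qed (use C in \<open>simp add: F_def\<close>)
  obtain G k where G: "continuous_on {-1..1} G" "strict_mono (k :: nat \<Rightarrow> nat)"
    "\<And>e. 0 < e \<Longrightarrow> \<exists>N. \<forall>n t. n \<ge> N \<and> t \<in> {-1..1} \<longrightarrow> norm (F (k n) t - G t) < e"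
    using Arzela_Ascoli[of "{-1..1::real}" F C, OF compact_Icc Fb eqF] by metis
  define l where "l x = G (x / w x)" for x
  have "uniform_limit UNIV (\<lambda>n. apply_bcontfun (g (k n))) l sequentially"
  proof (rule uniform_limitI)
    fix e :: real assume "0 < e"
    then obtain N where N: "\<And>n t. n \<ge> N \<Longrightarrow> t \<in> {-1..1} \<Longrightarrow> norm (F (k n) t - G t) < e" using G(3) by blast
    have "dist (g (k n) x) (l x) < e" if "n \<ge> N" for n x
    proof -
      let ?t = "x / w x"
      have t: "\<bar>?t\<bar> < 1" by (simp add: abs_div w_def)
      have "1 - \<bar>?t\<bar> = 1 / w x" by (simp add: abs_div w_def field_simps)
      then have "?t / (1 - \<bar>?t\<bar>) = x" by simp
      then have Fg: "F (k n) ?t = g (k n) x" using t by (simp add: F_def)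
      have "?t \<in> {-1..1}" using t unfolding abs_less_iff atLeastAtMost_iff by linarith
      from N[OF that this] show ?thesis by (simp only: dist_norm l_def Fg)
    qed
    then show "\<forall>\<^sub>F n in sequentially. \<forall>x\<in>UNIV. dist (g (k n) x) (l x) < e"
      unfolding eventually_sequentially by blast
  qed
  from uniform_limit_bcontfunE[OF this] obtain l' where "(\<lambda>n. g (k n)) \<longlonglongrightarrow> l'"
    by (metis sequentially_bot)
  with G(2) show ?thesis by blast
qed

section \<open>A common form for the convolution operators on and off the cut\<close>

definition conv_dom :: "cut_point set" where
  "conv_dom = cut_domain {k. off k}"

lemma conv_dom_cases:
  assumes "q \<in> conv_dom"
  obtains k where "q = Off_edge k" "off k" | e l where "q = On_edge e l" "0 < l"
  using assms by (auto simp: conv_dom_def cut_domain_def)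

text \<open>Off the cut the exponential is switched off by \<open>c = 0\<close> and the operator is
  a pure multiplier; on an edge \<open>c = 1\<close>. Boundedness, equicontinuity and linearity then
  need one proof each. No uniformity in \<open>q\<close> is claimed here.\<close>

lemma conv_form:
  assumes "q \<in> conv_dom"
  obtains c e k a where "0 \<le> edge_sign e * Im k" "a \<in> L2" "(\<lambda>\<xi>. of_real (\<bar>\<xi>\<bar> powr (1 / 4)) * a \<xi>) \<in> L2"
    "cmod c \<le> 1"
    "\<And>f x. f \<in> L2 \<Longrightarrow> integrable lborel f \<Longrightarrow> convol (G_cut q) f x = c * convol (Eker e k) f x + mult_op a f x"
  using assms
proof (cases rule: conv_dom_cases)
  case (1 k)
  obtain \<delta> where d: "\<delta> > 0" "\<And>\<xi>. \<xi> \<ge> 0 \<Longrightarrow> \<delta> * w \<xi> \<le> cmod (of_real \<xi> - k)"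
    using off_lower[OF 1(2)] by blast
  show ?thesis
    by (rule that[of Upper 0 "Pmul k" 0])
       (use 1 convol_G in \<open>auto intro!: Pmul_L2 decay_mult_L2 Pmul_decay[OF d(2,1)]\<close>)
next
  case (2 e l)
  have o: "off (- of_real l)" using 2(2) by (auto simp: off_def)
  obtain \<delta> where d: "\<delta> > 0" "\<And>\<xi>. \<xi> \<ge> 0 \<Longrightarrow> \<delta> * w \<xi> \<le> cmod (of_real \<xi> - (- of_real l))"
    using off_lower[OF o] by blast
  have "cmod (Nmul (of_real l) \<xi>) * w \<xi> \<le> 1 / \<delta>" for \<xi>
    using Pmul_decay[OF d(2,1), of "- \<xi>"] by (simp add: Nmul_Pmul w_def)
  then have N: "(\<lambda>\<xi>. of_real (\<bar>\<xi>\<bar> powr (1 / 4)) * (- Nmul (of_real l) \<xi>)) \<in> L2"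
    by (intro decay_mult_L2) auto
  have a: "(\<lambda>\<xi>. - Nmul (of_real l) \<xi>) \<in> L2"
    using L2_cmult[OF Nmul_L2[OF o], of "-1"] by simp
  have "mult_op (\<lambda>\<xi>. - Nmul (of_real l) \<xi>) f x = - mult_op (Nmul (of_real l)) f x" if "f \<in> L2" for f x
    using mult_op_add_cmult_left[OF L2_zero Nmul_L2[OF o] that, of "-1" x]
      by (simp add: mult_op_def IFT_def)
  then show ?thesis
    using 2 convol_G_edge by (intro that[OF _ a N, of e "of_real l" 1]) auto
qed

lemma convol_Eker_add_cmult:
  assumes "0 \<le> edge_sign e * Im k" "integrable lborel f" "integrable lborel g"
  shows "convol (Eker e k) (\<lambda>x. f x + c * g x) x = convol (Eker e k) f x + c * convol (Eker e k) g x"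
proof -
  have "convol (Eker e k) (\<lambda>x. f x + c * g x) x = (LINT y|lborel. Eker e k (x - y) * f y + c
      * (Eker e k (x - y) * g y))"
    unfolding convol_def by (simp add: algebra_simps)
  then show ?thesis
    using convol_Eker_integrable[OF assms(1,2)] convol_Eker_integrable[OF assms(1,3)]
      by (simp add: convol_def)
qed

lemma G_cut_measurable:
  assumes "q \<in> conv_dom" shows "G_cut q \<in> borel_measurable borel"
  using assms
proof (cases rule: conv_dom_cases)
  case (2 e l)
  have "off (- of_real l)" using 2(2) by (auto simp: off_def)
  then have [measurable]: "Gtilde (of_real l) \<in> borel_measurable borel" using Gtilde_L2 by auto
  have "G_edge e l = (\<lambda>x. if x = 0 then G_edge e l 0 else Eker e (of_real l) x - Gtilde (of_real l) x)"
    using G_edge_eq[OF 2(2)] by auto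
  moreover have "(\<lambda>x. if x = 0 then G_edge e l 0 else Eker e (of_real l) x - Gtilde (of_real l) x) \<in>
      borel_measurable borel"
    by measurable
  ultimately show ?thesis using 2(1) by simp
qed (simp add: G_measurable)

section \<open>The integral operator in the weighted space\<close>

locale potential =
  fixes u :: "real \<Rightarrow> real" and s s1 :: real
  assumes s: "s > s1" and s1: "s1 > 1/2" and u: "(\<lambda>x. complex_of_real (u x)) \<in> L2w s"
begin

definition \<sigma> :: real where "\<sigma> = s - s1"

text \<open>The bound by \<sigma> lets the target weight absorb growth of order \<gamma>; half of
  \<open>s1 - 1 / 2\<close> keeps the moment of order \<gamma> of functions in \<open>L2w s1\<close>
  finite; 1/2 keeps the exponent below 1.\<close>

definition \<gamma> :: real where "\<gamma> = min \<sigma> (min ((s1 - 1 / 2) / 2) (1 / 2))"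

lemma sigma_pos: "0 < \<sigma>" using s by (simp add: \<sigma>_def)

lemma gamma: "0 < \<gamma>" "\<gamma> < 1" "\<gamma> \<le> \<sigma>" "\<gamma> < s1 - 1 / 2"
  using sigma_pos s1 by (auto simp: \<gamma>_def min_def)

definition u_norm :: real where "u_norm = wnorm s (\<lambda>x. of_real (u x))"

lemma u_norm_nonneg [simp]: "0 \<le> u_norm" by (simp add: u_norm_def)

lemma u_L2: "(\<lambda>x. complex_of_real (u x)) \<in> L2"
  using L2w_L2(1)[OF u] s s1 by simp

lemma u_measurable [measurable]: "u \<in> borel_measurable borel"
  by (rule measurable_of_real_cancel[OF L2_measurable[OF u_L2]])

text \<open>For \<open>v\<close> equal to \<open>w\<close> to the power \<open>- \<sigma>\<close>
  times \<open>m\<close>, this is \<open>u m\<close>. The weights \<open>s1\<close> and \<sigma> add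
  up to \<open>s\<close>, so bounded \<open>v\<close> are sent to \<open>L2w s1\<close>.\<close>

definition U :: "(real \<Rightarrow> complex) \<Rightarrow> real \<Rightarrow> complex" where
  "U v x = of_real (u x) * (of_real (w x powr \<sigma>) * v x)"

lemma U_L2w:
  assumes v: "v \<in> borel_measurable borel" and b: "AE x in lborel. cmod (v x) \<le> B" and B: "0 \<le> B"
  shows "U v \<in> L2w s1" "wnorm s1 (U v) \<le> B * u_norm"
proof -
  have m: "U v \<in> borel_measurable borel" unfolding U_def[abs_def] using v by measurable
  have ae: "AE x in lborel. cmod (of_real (w x powr s1) * U v x)
      \<le> B * cmod (of_real (w x powr s) * complex_of_real (u x))"
    using b
  proof eventually_elim
    case (elim x)
    have "w x powr s1 * w x powr \<sigma> = w x powr s" by (simp add: \<sigma>_def flip: powr_add)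
    then have "cmod (of_real (w x powr s1) * U v x) = cmod (of_real (w x powr s) * complex_of_real (u x))
        * cmod (v x)"
      by (simp add: U_def norm_mult mult_ac)
    then show ?case using mult_left_mono[OF elim, of "cmod (of_real (w x powr s) * complex_of_real (u x))"]
        by (simp add: mult.commute)
  qed
  have m': "(\<lambda>x. of_real (w x powr s1) * U v x) \<in> borel_measurable borel" using m by measurable
  show "U v \<in> L2w s1" by (rule L2wI[OF m L2_dominated[OF L2wD(2)[OF u] m' ae]])
  show "wnorm s1 (U v) \<le> B * u_norm"
    unfolding wnorm_def u_norm_def by (rule L2_norm_mono[OF L2wD(2)[OF u] m' B ae])
qed

lemma conv_bound:
  assumes "q \<in> conv_dom"
  obtains C where "0 \<le> C" "\<And>f x. f \<in> L2w s1 \<Longrightarrow> cmod (convol (G_cut q) f x) \<le> C * wnorm s1 f"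
proof (rule conv_form[OF assms])
  fix c e k a assume a: "0 \<le> edge_sign e * Im k" "a \<in> L2" "cmod c \<le> 1"
    "\<And>f x. f \<in> L2 \<Longrightarrow> integrable lborel f \<Longrightarrow> convol (G_cut q) f x = c * convol (Eker e k) f x + mult_op a f x"
  define W where "W = L2_norm (\<lambda>x. complex_of_real (w x powr (- s1)))"
  show thesis
  proof (rule that[of "W + L2_norm a"])
    fix f x assume f: "f \<in> L2w s1"
    note f2 = L2w_L2[OF f] and f1 = L2w_L1[OF f s1]
    have s10: "0 \<le> s1" using s1 by simp
    have "cmod (convol (G_cut q) f x) \<le> cmod c * cmod (convol (Eker e k) f x) + cmod (mult_op a f x)"
      unfolding a(4)[OF f2(1)[OF s10] f1(1)] norm_mult[symmetric] by (rule norm_triangle_ineq)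
    moreover have "cmod c * cmod (convol (Eker e k) f x) \<le> 1 * cmod (convol (Eker e k) f x)"
      by (intro mult_right_mono a) auto
    moreover have "cmod (convol (Eker e k) f x) \<le> W * wnorm s1 f"
      unfolding W_def by (rule order_trans[OF convol_Eker_bound[OF a(1) f1(1)] f1(2)])
    moreover have "cmod (mult_op a f x) \<le> L2_norm a * L2_norm f"
        by (rule mult_op_bound[OF a(2) f2(1)[OF s10]])
    moreover have "L2_norm a * L2_norm f \<le> L2_norm a * wnorm s1 f" by (intro mult_left_mono f2 s10) auto
    ultimately show "cmod (convol (G_cut q) f x) \<le> (W + L2_norm a) * wnorm s1 f" unfolding distrib_right
        by linarith
  qed (simp add: W_def)
qed

definition modulus :: "real \<Rightarrow> real" where
  "modulus t = t + sqrt t + t powr (1 / 4)"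

text \<open>The three terms of \<open>modulus\<close> are the Lipschitz part of the exponential, its
  jump, and the multiplier.\<close>

lemma conv_equicont:
  assumes "q \<in> conv_dom"
  obtains C where "0 \<le> C" "\<And>f x y. f \<in> L2w s1 \<Longrightarrow>
     cmod (convol (G_cut q) f x - convol (G_cut q) f y) \<le> C * modulus \<bar>x - y\<bar> * wnorm s1 f"
proof (rule conv_form[OF assms])
  fix c e k a assume a: "0 \<le> edge_sign e * Im k" "a \<in> L2" "(\<lambda>\<xi>. of_real (\<bar>\<xi>\<bar> powr (1 / 4)) * a \<xi>) \<in> L2"
      "cmod c \<le> 1"
    "\<And>f x. f \<in> L2 \<Longrightarrow> integrable lborel f \<Longrightarrow> convol (G_cut q) f x = c * convol (Eker e k) f x + mult_op a f x"
  define W where "W = L2_norm (\<lambda>x. complex_of_real (w x powr (- s1)))"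
  define A where "A = L2_norm (\<lambda>\<xi>. of_real (\<bar>\<xi>\<bar> powr (1 / 4)) * a \<xi>)"
  have W: "0 \<le> W" "0 \<le> A" by (auto simp: W_def A_def)
  show thesis
  proof (rule that[of "cmod k * W + 1 + 2 * A"])
    fix f :: "real \<Rightarrow> complex" and x y :: real assume f: "f \<in> L2w s1"
    have s10: "0 \<le> s1" using s1 by simp
    note f2 = L2w_L2[OF f s10] and f1 = L2w_L1[OF f s1]
    let ?t = "\<bar>x - y\<bar>" and ?n = "wnorm s1 f"
    have m: "?t \<le> modulus ?t" "sqrt ?t \<le> modulus ?t" "?t powr (1 / 4) \<le> modulus ?t" "0 \<le> modulus ?t"
      by (auto simp: modulus_def)
    have "convol (G_cut q) f x - convol (G_cut q) f y = c * (convol (Eker e k) f x - convol (Eker e k) f y)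
        + (mult_op a f x - mult_op a f y)"
      unfolding a(5)[OF f2(1) f1(1)] by (simp add: algebra_simps)
    then have "cmod (convol (G_cut q) f x - convol (G_cut q) f y)
      \<le> cmod c * cmod (convol (Eker e k) f x - convol (Eker e k) f y) + cmod (mult_op a f x - mult_op a f
          y)"
      by (metis norm_mult norm_triangle_ineq)
    moreover have "cmod c * cmod (convol (Eker e k) f x - convol (Eker e k) f y)
        \<le> 1 * cmod (convol (Eker e k) f x - convol (Eker e k) f y)"
      by (intro mult_right_mono a) auto
    moreover have "cmod (convol (Eker e k) f x - convol (Eker e k) f y)
        \<le> cmod k * ?t * (LINT y|lborel. cmod (f y)) + sqrt ?t * L2_norm f"
      by (rule convol_Eker_equicont[OF a(1) f1(1) f2(1)])
    moreover have "cmod k * ?t * (LINT y|lborel. cmod (f y)) \<le> cmod k * modulus ?t * (W * ?n)"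
      using f1(2) m by (intro mult_mono) (auto simp: W_def)
    moreover have "sqrt ?t * L2_norm f \<le> modulus ?t * ?n" using f2 m by (intro mult_mono) auto
    moreover have "cmod (mult_op a f x - mult_op a f y) \<le> 2 * ?t powr (1 / 4) * (A * L2_norm f)"
      unfolding A_def by (rule mult_op_equicont[OF a(2,3) f2(1)])
    moreover have "2 * ?t powr (1 / 4) * (A * L2_norm f) \<le> 2 * modulus ?t * (A * ?n)"
      using f2(2) m W by (intro mult_mono) auto
    moreover have "(cmod k * W + 1 + 2 * A) * modulus ?t * ?n = cmod k * modulus ?t * (W * ?n) + modulus ?t
        * ?n + 2 * modulus ?t * (A * ?n)"
      by (simp add: algebra_simps)
    ultimately show "cmod (convol (G_cut q) f x - convol (G_cut q) f y)
        \<le> (cmod k * W + 1 + 2 * A) * modulus ?t * ?n"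
      by linarith
  qed (use W in simp)
qed

lemma conv_add_cmult:
  assumes "q \<in> conv_dom" "f \<in> L2w s1" "g \<in> L2w s1"
  shows "convol (G_cut q) (\<lambda>x. f x + c * g x) x = convol (G_cut q) f x + c * convol (G_cut q) g x"
proof (rule conv_form[OF assms(1)])
  fix d e k a assume a: "0 \<le> edge_sign e * Im k" "a \<in> L2"
    "\<And>f x. f \<in> L2 \<Longrightarrow> integrable lborel f \<Longrightarrow> convol (G_cut q) f x = d * convol (Eker e k) f x + mult_op a f x"
  have s10: "0 \<le> s1" using s1 by simp
  note f2 = L2w_L2(1)[OF assms(2) s10] L2w_L2(1)[OF assms(3) s10] L2w_L2(1)[OF L2w_add_cmult[OF assms(2,3)]
      s10]
    and f1 = L2w_L1(1)[OF assms(2) s1] L2w_L1(1)[OF assms(3) s1] L2w_L1(1)[OF L2w_add_cmult[OF assms(2,3)]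
        s1]
  show ?thesis
    using mult_op_add_cmult[OF a(2) f2(1,2), of c x] convol_Eker_add_cmult[OF a(1) f1(1,2), of c x]
    by (simp add: a(3)[OF f2(1) f1(1)] a(3)[OF f2(2) f1(2)] a(3)[OF f2(3) f1(3)] algebra_simps)
qed

lemma modulus_tendsto: "((\<lambda>y. modulus \<bar>x - y\<bar>) \<longlongrightarrow> 0) (at x)"
proof -
  have "((\<lambda>y. modulus \<bar>x - y\<bar>) \<longlongrightarrow> \<bar>x - x\<bar> + sqrt \<bar>x - x\<bar> + \<bar>x - x\<bar> powr (1 / 4)) (at x)"
    unfolding modulus_def by (intro tendsto_intros tendsto_powr') auto
  then show ?thesis by simp
qed

lemma conv_continuous:
  assumes "q \<in> conv_dom" "f \<in> L2w s1" shows "isCont (convol (G_cut q) f) x"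
proof (rule conv_equicont[OF assms(1)])
  fix C assume C: "0 \<le> C" "\<And>f x y. f \<in> L2w s1 \<Longrightarrow>
     cmod (convol (G_cut q) f x - convol (G_cut q) f y) \<le> C * modulus \<bar>x - y\<bar> * wnorm s1 f"
  have "((\<lambda>y. C * modulus \<bar>x - y\<bar> * wnorm s1 f) \<longlongrightarrow> C * 0 * wnorm s1 f) (at x)"
    by (intro tendsto_intros modulus_tendsto)
  then have l: "((\<lambda>y. C * modulus \<bar>x - y\<bar> * wnorm s1 f) \<longlongrightarrow> 0) (at x)" by simp
  have "\<forall>\<^sub>F y in at x. norm (convol (G_cut q) f y - convol (G_cut q) f x)
      \<le> C * modulus \<bar>x - y\<bar> * wnorm s1 f"
    using C(2)[OF assms(2), of x] by (intro always_eventually allI) (metis norm_minus_commute)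
  from Lim_null_comparison[OF this l]
  have "((\<lambda>y. convol (G_cut q) f y - convol (G_cut q) f x) \<longlongrightarrow> 0) (at x)" .
  then show ?thesis unfolding isCont_def by (rule LIM_zero_cancel)
qed

text \<open>The integral operator conjugated by the weight, so that the weighted space becomes the
  plain sup norm.\<close>

definition K :: "cut_point \<Rightarrow> (real \<Rightarrow> complex) \<Rightarrow> real \<Rightarrow> complex" where
  "K q v x = of_real (w x powr (- \<sigma>)) * convol (G_cut q) (U v) x"

text \<open>The convolutions are continuous, so the operator can be studied on the Banach space of
  bounded continuous functions, with no null sets involved.\<close>

definition Kb :: "cut_point \<Rightarrow> (real \<Rightarrow>\<^sub>C complex) \<Rightarrow> (real \<Rightarrow>\<^sub>C complex)" where
  "Kb q v = Bcontfun (K q v)"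

lemma bcontfun_measurable [measurable]: "apply_bcontfun (v :: real \<Rightarrow>\<^sub>C complex) \<in> borel_measurable borel"
  by (intro borel_measurable_continuous_onI) auto

lemma U_bcontfun: "U (apply_bcontfun v) \<in> L2w s1" "wnorm s1 (U (apply_bcontfun v)) \<le> norm v * u_norm"
  using U_L2w[OF bcontfun_measurable, of v "norm v"] norm_bounded[of v] by auto

lemma w_neg_powr_le_1: "w x powr (- \<sigma>) \<le> 1"
  using w_powr_mono[of "- \<sigma>" 0 x] sigma_pos by simp

lemma weighted_bcontfun:
  assumes "\<And>x. isCont h x" "\<And>x. cmod (h x) \<le> B"
  shows "(\<lambda>x. of_real (w x powr (- \<sigma>)) * h x) \<in> bcontfun"
proof (rule bcontfun_normI)
  have "isCont w x" for x unfolding w_def[abs_def] by (intro continuous_intros)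
  then show "continuous_on UNIV (\<lambda>x. of_real (w x powr (- \<sigma>)) * h x)"
    using assms(1) by (intro continuous_intros continuous_at_imp_continuous_on ballI) auto
  show "cmod (of_real (w x powr (- \<sigma>)) * h x) \<le> B" for x
    using mult_mono[OF w_neg_powr_le_1[of x] assms(2)[of x]] by (simp add: norm_mult)
qed

lemma K_bcontfun:
  assumes "q \<in> conv_dom" shows "K q (apply_bcontfun v) \<in> bcontfun"
proof (rule conv_bound[OF assms])
  fix C assume C: "0 \<le> C" "\<And>f x. f \<in> L2w s1 \<Longrightarrow> cmod (convol (G_cut q) f x) \<le> C * wnorm s1 f"
  show ?thesis unfolding K_def[abs_def]
    by (rule weighted_bcontfun[OF conv_continuous[OF assms U_bcontfun(1)] C(2)[OF U_bcontfun(1)]])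
qed

lemma Kb_apply: "q \<in> conv_dom \<Longrightarrow> apply_bcontfun (Kb q v) = K q v"
  unfolding Kb_def by (rule Bcontfun_inverse[OF K_bcontfun])

lemma U_add_cmult: "U (\<lambda>x. v x + c * v' x) = (\<lambda>x. U v x + c * U v' x)"
  by (auto simp: U_def algebra_simps)

lemma K_add_cmult:
  assumes "q \<in> conv_dom" "U v \<in> L2w s1" "U v' \<in> L2w s1"
  shows "K q (\<lambda>x. v x + c * v' x) x = K q v x + c * K q v' x"
  unfolding K_def U_add_cmult conv_add_cmult[OF assms] by (simp add: algebra_simps)

text \<open>Only real linearity is recorded for \<open>Kb\<close>; complex combinations are handled
  pointwise through \<open>K_add_cmult\<close>.\<close>

lemma Kb_linear:
  assumes q: "q \<in> conv_dom" shows "bounded_linear (Kb q)"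
proof (rule conv_bound[OF assms])
  fix C assume C: "0 \<le> C" "\<And>f x. f \<in> L2w s1 \<Longrightarrow> cmod (convol (G_cut q) f x) \<le> C * wnorm s1 f"
  show ?thesis
  proof (rule bounded_linear_intro[where K="C * u_norm"])
    fix v v' :: "real \<Rightarrow>\<^sub>C complex"
    show "Kb q (v + v') = Kb q v + Kb q v'"
      using K_add_cmult[OF q U_bcontfun(1) U_bcontfun(1), of v 1 v']
      by (intro bcontfun_eqI) (simp add: Kb_apply[OF q] plus_bcontfun.rep_eq)
    fix r :: real
    have "U (\<lambda>x. 0) \<in> L2w s1" using U_L2w(1)[of "\<lambda>x. 0" 0] by simp
    from K_add_cmult[OF q this U_bcontfun(1), of "of_real r" v]
    show "Kb q (r *\<^sub>R v) = r *\<^sub>R Kb q v"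
      by (intro bcontfun_eqI) (simp add: Kb_apply[OF q] scaleR_bcontfun.rep_eq scaleR_conv_of_real K_def
        U_def convol_def)
    show "norm (Kb q v) \<le> norm v * (C * u_norm)"
    proof (rule norm_bound)
      fix x
      have "cmod (Kb q v x) \<le> 1 * (C * (norm v * u_norm))"
        unfolding Kb_apply[OF q] K_def norm_mult
        using C(1) U_bcontfun(2)[of v] w_neg_powr_le_1[of x]
        by (intro mult_mono order_trans[OF C(2)[OF U_bcontfun(1)]] mult_left_mono) auto
      then show "cmod (Kb q v x) \<le> norm v * (C * u_norm)" by (simp add: mult_ac)
    qed
  qed
qed

text \<open>The convolution is bounded without any weight, so the factor \<open>w\<close> to the
  power \<open>- \<sigma>\<close> is genuine decay at infinity; together with
  \<open>conv_equicont\<close> this is all that the compactness criterion asks for.\<close>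

lemma Kb_compact:
  assumes q: "q \<in> conv_dom" shows "compact_operator (Kb q)"
  unfolding compact_operator_def
proof (intro conjI allI impI Kb_linear[OF q])
  fix v :: "nat \<Rightarrow> real \<Rightarrow>\<^sub>C complex" assume "bounded (range v)"
  then obtain B where B: "\<And>n. norm (v n) \<le> B" by (auto simp: bounded_iff)
  have B0: "0 \<le> B" using B[of 0] norm_ge_zero order_trans by blast
  obtain C where C: "0 \<le> C" "\<And>f x. f \<in> L2w s1 \<Longrightarrow> cmod (convol (G_cut q) f x) \<le> C * wnorm s1 f"
    by (rule conv_bound[OF q]) blast
  obtain C' where C': "0 \<le> C'" "\<And>f x y. f \<in> L2w s1 \<Longrightarrow>
     cmod (convol (G_cut q) f x - convol (G_cut q) f y) \<le> C' * modulus \<bar>x - y\<bar> * wnorm s1 f"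
    by (rule conv_equicont[OF q]) blast
  let ?f = "\<lambda>n. U (v n)" and ?T = "\<lambda>n. convol (G_cut q) (U (v n))"
  have wn: "wnorm s1 (?f n) \<le> B * u_norm" for n
    by (rule order_trans[OF U_bcontfun(2)]) (intro mult_right_mono B, simp)
  have Tb: "cmod (?T n x) \<le> C * (B * u_norm)" for n x
    by (rule order_trans[OF C(2)[OF U_bcontfun(1)]]) (intro mult_left_mono wn C)
  have Te: "cmod (?T n x - ?T n y) \<le> C' * modulus \<bar>x - y\<bar> * (B * u_norm)" for n x y
    by (rule order_trans[OF C'(2)[OF U_bcontfun(1)]]) (intro mult_left_mono wn mult_nonneg_nonneg C', auto
      simp: modulus_def)
  show "\<exists>r l. strict_mono r \<and> (\<lambda>n. Kb q (v (r n))) \<longlonglongrightarrow> l"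
  proof (rule decaying_equicontinuous_subseq[OF _ sigma_pos])
    show "cmod (Kb q (v n) x) \<le> (C * (B * u_norm)) * w x powr (- \<sigma>)" for n x
      using mult_left_mono[OF Tb[of n x], of "w x powr (- \<sigma>)"]
        by (simp add: Kb_apply[OF q] K_def norm_mult mult.commute)
    fix x e :: real assume e: "0 < e"
    \<comment> \<open>A bound for the increment, common to all \<open>n\<close>: one part from the
      convolution, the other from the variation of the weight.\<close>
    define h where "h y = C' * modulus \<bar>x - y\<bar> * (B * u_norm) + \<bar>w x powr (- \<sigma>) - w y powr (- \<sigma>)\<bar>
        * (C * (B * u_norm))" for y
    have kk: "cmod (Kb q (v n) x - Kb q (v n) y) \<le> h y" for n y
    proof -
      have "Kb q (v n) x - Kb q (v n) y = of_real (w x powr (- \<sigma>)) * (?T n x - ?T n y)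
          + of_real (w x powr (- \<sigma>) - w y powr (- \<sigma>)) * ?T n y"
        by (simp add: Kb_apply[OF q] K_def algebra_simps)
      then have "cmod (Kb q (v n) x - Kb q (v n) y) \<le> w x powr (- \<sigma>) * cmod (?T n x - ?T n y)
          + \<bar>w x powr (- \<sigma>) - w y powr (- \<sigma>)\<bar> * cmod (?T n y)"
        using norm_triangle_ineq[of "of_real (w x powr (- \<sigma>)) * (?T n x - ?T n y)"
          "of_real (w x powr (- \<sigma>) - w y powr (- \<sigma>)) * ?T n y"]
        by (simp only: norm_mult norm_of_real abs_of_nonneg[OF powr_ge_zero])
      also have "\<dots> \<le> 1 * (C' * modulus \<bar>x - y\<bar> * (B * u_norm)) + \<bar>w x powr (- \<sigma>) - w y powr (- \<sigma>)\<bar>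
          * (C * (B * u_norm))"
        by (intro add_mono mult_mono w_neg_powr_le_1 Te Tb) auto
      finally show ?thesis by (simp add: h_def)
    qed
    have "isCont w x" unfolding w_def[abs_def] by (intro continuous_intros)
    then have wt: "((\<lambda>y. w y powr (- \<sigma>)) \<longlongrightarrow> w x powr (- \<sigma>)) (at x)"
      unfolding isCont_def by (intro tendsto_powr tendsto_const) auto
    have "(h \<longlongrightarrow> C' * 0 * (B * u_norm) + \<bar>w x powr (- \<sigma>) - w x powr (- \<sigma>)\<bar> * (C * (B * u_norm))) (at x)"
      unfolding h_def by (intro tendsto_intros modulus_tendsto wt)
    then have "(h \<longlongrightarrow> 0) (at x)" by simp
    then have "\<forall>\<^sub>F y in at x. h y < e" by (rule order_tendstoD(2)) (rule e)
    then obtain d where d: "d > 0" "\<And>y. y \<noteq> x \<Longrightarrow> dist y x < d \<Longrightarrow> h y < e"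
      unfolding eventually_at by blast
    show "\<exists>d>0. \<forall>n y. \<bar>x - y\<bar> < d \<longrightarrow> cmod (Kb q (v n) x - Kb q (v n) y) < e"
    proof (intro exI[of _ d] conjI allI impI d)
      fix n y assume y: "\<bar>x - y\<bar> < d"
      show "cmod (Kb q (v n) x - Kb q (v n) y) < e"
        using order_le_less_trans[OF kk d(2)[of y]] y e
        by (cases "y = x") (auto simp: dist_real_def abs_minus_commute)
    qed
  qed
qed

end

section \<open>Solving the integral equations\<close>

lemma Linfw_normI:
  assumes "f \<in> borel_measurable borel" "AE x in lborel. w x powr a * cmod (f x) \<le> B"
  shows "Linfw_norm a f \<le> ennreal B"
  unfolding Linfw_norm_def
proof (rule esssup_I)
  show "AE x in lborel. ennreal (w x powr a * cmod (f x)) \<le> ennreal B"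
    using assms(2) by eventually_elim (rule ennreal_leI)
qed (use assms(1) in measurable)

lemma LinfwI:
  assumes "f \<in> borel_measurable borel" "AE x in lborel. w x powr a * cmod (f x) \<le> B"
  shows "f \<in> Linfw a"
proof -
  have "Linfw_norm a f < \<infinity>" using Linfw_normI[OF assms] by (rule le_less_trans) simp
  then show ?thesis using assms(1) by (simp add: Linfw_def)
qed

lemma LinfwD:
  assumes "f \<in> Linfw a"
  shows "f \<in> borel_measurable borel" "\<exists>B\<ge>0. AE x in lborel. w x powr a * cmod (f x) \<le> B"
proof -
  show f: "f \<in> borel_measurable borel" using assms by (simp add: Linfw_def)
  have fin: "Linfw_norm a f < \<infinity>" using assms by (simp add: Linfw_def)
  have "AE x in lborel. ennreal (w x powr a * cmod (f x)) \<le> Linfw_norm a f"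
    unfolding Linfw_norm_def by (rule esssup_AE)
  then have "AE x in lborel. w x powr a * cmod (f x) \<le> enn2real (Linfw_norm a f)"
  proof eventually_elim
    case (elim x)
    then have "ennreal (w x powr a * cmod (f x)) \<le> ennreal (enn2real (Linfw_norm a f))" using fin by simp
    then show ?case by (subst (asm) ennreal_le_iff) auto
  qed
  then show "\<exists>B\<ge>0. AE x in lborel. w x powr a * cmod (f x) \<le> B"
    by (intro exI[of _ "enn2real (Linfw_norm a f)"]) auto
qed

lemma le_powr_self:
  assumes "0 \<le> t" "t \<le> 1" "0 < a" "a \<le> 1" shows "t \<le> t powr (a::real)"
proof (cases "t = 0")
  case False
  then have "t powr 1 \<le> t powr a" using assms by (intro powr_mono') auto
  then show ?thesis using assms False by simp
qed simp

lemma cut_nbhd_center: "0 < r \<Longrightarrow> p \<in> cut_nbhd p r"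
  by (cases p) auto

lemma cut_nbhd_dist: "q \<in> cut_nbhd p r \<Longrightarrow> dist (cut_pos p) (cut_pos q) < r"
  by (cases p) (auto simp: dist_norm simp flip: of_real_diff)

lemma cut_nbhd_mono: "r \<le> r' \<Longrightarrow> cut_nbhd p r \<subseteq> cut_nbhd p r'"
  by (cases p) auto

definition cut_dist :: "cut_point \<Rightarrow> cut_point \<Rightarrow> real" where
  "cut_dist p q = dist (cut_pos p) (cut_pos q)"

context potential
begin

lemma s1_nonneg: "0 \<le> s1" using s1 by simp

lemma gamma_int:
  assumes "f \<in> L2w s1"
  shows "integrable lborel (\<lambda>x. w x powr \<gamma> * cmod (f x))"
    "(LINT x|lborel. w x powr \<gamma> * cmod (f x)) \<le> L2_norm (\<lambda>x. of_real (w x powr (- (s1 - \<gamma>)))) * wnorm s1 f"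
  using L2w_weighted_L1[OF assms gamma(4)] by auto

text \<open>A Lipschitz bound deliberately weakened, using \<open>t \<le> 1\<close> and
  \<open>w \<ge> 1\<close>, to the shape of the bound for the exponential part.\<close>

lemma mult_op_Holder:
  assumes ab: "a \<in> L2" "b \<in> L2" and d: "L2_norm (\<lambda>\<xi>. a \<xi> - b \<xi>) \<le> C * t" and t: "0 \<le> t" "t \<le> 1"
      and C: "0 \<le> C"
    and f: "f \<in> L2w s1"
  shows "cmod (mult_op a f x - mult_op b f x) \<le> C * t powr \<gamma> * w x powr \<gamma> * wnorm s1 f"
proof -
  note f2 = L2w_L2[OF f s1_nonneg]
  have "cmod (mult_op a f x - mult_op b f x) \<le> L2_norm (\<lambda>\<xi>. a \<xi> - b \<xi>) * L2_norm f"
    unfolding mult_op_diff_left[OF ab f2(1)] by (intro mult_op_bound L2_diff ab f2)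
  also have "\<dots> \<le> (C * t powr \<gamma>) * wnorm s1 f"
  proof (intro mult_mono f2)
    have "C * t \<le> C * t powr \<gamma>" using t gamma by (intro mult_left_mono le_powr_self C) auto
    then show "L2_norm (\<lambda>\<xi>. a \<xi> - b \<xi>) \<le> C * t powr \<gamma>" using d by linarith
  qed (use C in auto)
  also have "\<dots> \<le> (C * t powr \<gamma>) * w x powr \<gamma> * wnorm s1 f"
  proof (rule mult_right_mono)
    have "(C * t powr \<gamma>) * 1 \<le> (C * t powr \<gamma>) * w x powr \<gamma>"
      using w_powr_mono[of 0 \<gamma> x] gamma C by (intro mult_left_mono) auto
    then show "C * t powr \<gamma> \<le> C * t powr \<gamma> * w x powr \<gamma>" by simp
  qed simp
  finally show ?thesis .
qed

text \<open>Off the cut the multiplier alone suffices. Near an edge every point of the one-sided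
  neighbourhood has the same decomposition with the same \<open>e\<close>, so exponential and
  regular part are compared separately. Radius at most 1/2 keeps all distances below 1.\<close>

lemma conv_Holder:
  assumes p: "p \<in> conv_dom"
  obtains r C where "0 < r" "0 \<le> C" "\<And>q q' f x. q \<in> conv_dom \<inter> cut_nbhd p r \<Longrightarrow> q' \<in> conv_dom \<inter> cut_nbhd p r \<Longrightarrow>
      f \<in> L2w s1 \<Longrightarrow>
    cmod (convol (G_cut q) f x - convol (G_cut q') f x) \<le> C * cut_dist q q' powr \<gamma> * w x powr \<gamma> * wnorm s1
        f"
  using p
proof (cases rule: conv_dom_cases)
  case (1 k)
  show ?thesis
  proof (rule Pmul_diff_norm[OF 1(2)])
    fix C r assume C: "r > 0" "C \<ge> 0" "\<And>z. z \<in> ball k r \<Longrightarrow> off z"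
      "\<And>z z'. z \<in> ball k r \<Longrightarrow> z' \<in> ball k r \<Longrightarrow> L2_norm (\<lambda>\<xi>. Pmul z \<xi> - Pmul z' \<xi>) \<le> C * cmod (z - z')"
    show thesis
    proof (rule that[of "min r (1 / 2)" C])
      fix q q' and f :: "real \<Rightarrow> complex" and x
      assume q: "q \<in> conv_dom \<inter> cut_nbhd p (min r (1 / 2))" "q' \<in> conv_dom \<inter> cut_nbhd p (min r (1 / 2))"
          and f: "f \<in> L2w s1"
      obtain z where z: "q = Off_edge z" "z \<in> ball k r" "z \<in> ball k (1 / 2)" using q(1) 1(1) by auto
      obtain z' where z': "q' = Off_edge z'" "z' \<in> ball k r" "z' \<in> ball k (1 / 2)" using q(2) 1(1) by auto
      note f2 = L2w_L2(1)[OF f s1_nonneg]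
      have "cmod (z - z') \<le> cmod (k - z') + cmod (k - z)" using norm_triangle_ineq4[of "k - z'" "k - z"]
          by simp
      then have "cmod (z - z') \<le> 1" using z(3) z'(3) by (simp add: dist_norm)
      then show "cmod (convol (G_cut q) f x - convol (G_cut q') f x) \<le> C * cut_dist q q' powr \<gamma> * w x powr \<gamma>
          * wnorm s1 f"
        using mult_op_Holder[OF Pmul_L2[OF C(3)[OF z(2)]] Pmul_L2[OF C(3)[OF z'(2)]] C(4)[OF z(2) z'(2)] _ _
          C(2) f, of x]
        by (simp add: z(1) z'(1) convol_G[OF C(3)[OF z(2)] f2] convol_G[OF C(3)[OF z'(2)] f2] cut_dist_def
          dist_norm)
    qed (use C in auto)
  qed
next
  case (2 e l)
  show ?thesis
  proof (rule Nmul_diff_norm[OF 2(2)])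
    fix C r assume C: "r > 0" "C \<ge> 0" "\<And>z. z \<in> ball (of_real l) r \<Longrightarrow> off (- z)"
      "\<And>z z'. z \<in> ball (of_real l) r \<Longrightarrow> z' \<in> ball (of_real l) r \<Longrightarrow> L2_norm (\<lambda>\<xi>. Nmul z \<xi> - Nmul z' \<xi>)
          \<le> C * cmod (z - z')"
    define W where "W = L2_norm (\<lambda>x. complex_of_real (w x powr (- (s1 - \<gamma>))))"
    have W: "0 \<le> W" by (simp add: W_def)
    let ?r = "min r (1 / 2)"
    \<comment> \<open>Points inside the half disc and points on the edge are treated alike through
      \<open>cut_pos\<close>; both satisfy the closed sign condition that the exponential estimates
      require.\<close>
    have rep: "cut_pos q \<in> ball (of_real l) ?r \<and> 0 \<le> edge_sign e * Im (cut_pos q) \<and>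
        convol (G_cut q) f x = convol (Eker e (cut_pos q)) f x - mult_op (Nmul (cut_pos q)) f x"
      if q: "q \<in> conv_dom \<inter> cut_nbhd p ?r" and f: "f \<in> L2w s1" for q f x
    proof -
      have f2: "f \<in> L2" by (rule L2w_L2(1)[OF f s1_nonneg])
      have f1: "integrable lborel f" by (rule L2w_L1(1)[OF f s1])
      have b: "cut_pos q \<in> ball (of_real l) ?r" using cut_nbhd_dist[of q p ?r] q 2(1) by simp
      consider z where "q = Off_edge z" "0 < edge_sign e * Im z" | l' where "q = On_edge e l'" "0 < l'"
        using q 2(1) by (auto simp: conv_dom_def cut_domain_def)
      then show ?thesis
      proof cases
        case (1 z)
        then show ?thesis using b convol_G_near_edge[OF 1(2) f2 f1] by simp
      next
        case (2 l')
        then show ?thesis using b convol_G_edge[OF 2(2) f2 f1] by simp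
      qed
    qed
    show thesis
    proof (rule that[of ?r "2 * W + C"])
      fix q q' and f :: "real \<Rightarrow> complex" and x
      assume q: "q \<in> conv_dom \<inter> cut_nbhd p ?r" "q' \<in> conv_dom \<inter> cut_nbhd p ?r" and f: "f \<in> L2w s1"
      let ?z = "cut_pos q" and ?z' = "cut_pos q'"
      note rq = rep[OF q(1) f, of x] and rq' = rep[OF q(2) f, of x]
      have b: "?z \<in> ball (of_real l) r" "?z' \<in> ball (of_real l) r" using rq rq' by auto
      have "cmod (?z - ?z') \<le> cmod (of_real l - ?z') + cmod (of_real l - ?z)"
        using norm_triangle_ineq4[of "of_real l - ?z'" "of_real l - ?z"] by simp
      then have "cmod (?z - ?z') \<le> 1" using rq rq' by (simp add: dist_norm)
      then have B: "cmod (mult_op (Nmul ?z) f x - mult_op (Nmul ?z') f x) \<le> C * cmod (?z - ?z') powr \<gamma>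
          * w x powr \<gamma> * wnorm s1 f"
        by (intro mult_op_Holder Nmul_L2 C(2,3) C(4) b f) auto
      have "cmod (convol (Eker e ?z) f x - convol (Eker e ?z') f x)
          \<le> 2 * cmod (?z - ?z') powr \<gamma> * (w x powr \<gamma> * (LINT y|lborel. w y powr \<gamma> * cmod (f y)))"
        using rq rq' gamma by (intro convol_Eker_diff L2w_L1(1)[OF f s1] gamma_int(1)[OF f]) auto
      also have "\<dots> \<le> 2 * cmod (?z - ?z') powr \<gamma> * (w x powr \<gamma> * (W * wnorm s1 f))"
        using gamma_int(2)[OF f] by (intro mult_left_mono) (auto simp: W_def)
      finally have A: "cmod (convol (Eker e ?z) f x - convol (Eker e ?z') f x) \<le> 2 * cmod (?z - ?z') powr \<gamma>
          * (w x powr \<gamma> * (W * wnorm s1 f))" .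
      have eq: "convol (G_cut q) f x - convol (G_cut q') f x
        = (convol (Eker e ?z) f x - convol (Eker e ?z') f x) - (mult_op (Nmul ?z) f x - mult_op (Nmul ?z') f
            x)"
        using rq rq' by simp
      have "cmod (convol (G_cut q) f x - convol (G_cut q') f x)
        \<le> 2 * cmod (?z - ?z') powr \<gamma> * (w x powr \<gamma> * (W * wnorm s1 f)) + C * cmod (?z - ?z') powr \<gamma> * w x
            powr \<gamma> * wnorm s1 f"
        unfolding eq by (rule order_trans[OF norm_triangle_ineq4 add_mono[OF A B]])
      then show "cmod (convol (G_cut q) f x - convol (G_cut q') f x) \<le> (2 * W + C) * cut_dist q q' powr \<gamma>
          * w x powr \<gamma> * wnorm s1 f"
        by (simp add: cut_dist_def dist_norm algebra_simps)
    qed (use C W in auto)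
  qed
qed

lemma w_neg_gamma: "w x powr (- \<sigma>) * w x powr \<gamma> \<le> 1"
  using w_powr_mono[of "\<gamma> - \<sigma>" 0 x] gamma by (simp flip: powr_add)

lemma Kb_Holder:
  assumes p: "p \<in> conv_dom"
  obtains r C where "0 < r" "0 \<le> C" "\<And>q q' v. q \<in> conv_dom \<inter> cut_nbhd p r \<Longrightarrow> q' \<in> conv_dom \<inter> cut_nbhd p r \<Longrightarrow>
    norm (Kb q v - Kb q' v) \<le> C * cut_dist q q' powr \<gamma> * norm v"
proof (rule conv_Holder[OF p])
  fix r C assume C: "0 < r" "0 \<le> C" "\<And>q q' f x. q \<in> conv_dom \<inter> cut_nbhd p r \<Longrightarrow> q' \<in> conv_dom \<inter> cut_nbhd p r \<Longrightarrow>
      f \<in> L2w s1 \<Longrightarrow>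
    cmod (convol (G_cut q) f x - convol (G_cut q') f x) \<le> C * cut_dist q q' powr \<gamma> * w x powr \<gamma> * wnorm s1
        f"
  show thesis
  proof (rule that[of r "C * u_norm"])
    fix q q' v assume q: "q \<in> conv_dom \<inter> cut_nbhd p r" "q' \<in> conv_dom \<inter> cut_nbhd p r"
    show "norm (Kb q v - Kb q' v) \<le> C * u_norm * cut_dist q q' powr \<gamma> * norm v"
    proof (rule norm_bound)
      fix x
      let ?A = "C * cut_dist q q' powr \<gamma>" and ?n = "wnorm s1 (U (apply_bcontfun v))"
      have "cmod ((Kb q v - Kb q' v) x) = w x powr (- \<sigma>) * cmod (convol (G_cut q) (U v) x
          - convol (G_cut q') (U v) x)"
        using q by (simp add: minus_bcontfun.rep_eq Kb_apply K_def norm_mult flip: right_diff_distrib)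
      also have "\<dots> \<le> w x powr (- \<sigma>) * (?A * w x powr \<gamma> * ?n)"
        by (intro mult_left_mono C(3) q U_bcontfun) auto
      also have "\<dots> = (w x powr (- \<sigma>) * w x powr \<gamma>) * (?A * ?n)" by (simp add: mult_ac)
      also have "\<dots> \<le> 1 * (?A * (norm v * u_norm))"
        using C(2) by (intro mult_mono w_neg_gamma mult_left_mono U_bcontfun) auto
      finally show "cmod ((Kb q v - Kb q' v) x) \<le> C * u_norm * cut_dist q q' powr \<gamma> * norm v"
          by (simp add: mult_ac)
    qed
  qed (use C in auto)
qed

text \<open>Injectivity of \<open>1 - Kb q\<close>, which by compactness is the same as unique
  solvability of the integral equation.\<close>

definition regular :: "cut_point \<Rightarrow> bool" where
  "regular q \<longleftrightarrow> q \<in> conv_dom \<and> (\<forall>v. Kb q v = v \<longrightarrow> v = 0)"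

lemma regular_lower:
  assumes "regular q" shows "\<exists>c>0. \<forall>v. c * norm v \<le> norm (v - Kb q v)"
  using compact_operator_bounded_below[OF Kb_compact, of q] assms by (auto simp: regular_def)

lemma regular_if_lower:
  assumes "q \<in> conv_dom" "0 < c" "\<And>v. c * norm v \<le> norm (v - Kb q v)" shows "regular q"
  unfolding regular_def
proof (intro conjI allI impI assms(1))
  fix v assume "Kb q v = v"
  then have "c * norm v \<le> 0" using assms(3)[of v] by simp
  then show "v = 0" using assms(2) by (simp add: mult_le_0_iff)
qed

definition sol :: "cut_point \<Rightarrow> (real \<Rightarrow>\<^sub>C complex) \<Rightarrow> (real \<Rightarrow>\<^sub>C complex)" where
  "sol q b = (SOME v. v - Kb q v = b)"

lemma sol: "regular q \<Longrightarrow> sol q b - Kb q (sol q b) = b"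
proof -
  assume q: "regular q"
  have "\<exists>v. v - Kb q v = b"
    by (rule Fredholm_alternative[OF Kb_compact]) (use q in \<open>auto simp: regular_def\<close>)
  then show ?thesis unfolding sol_def by (rule someI_ex)
qed

text \<open>The lower bound of \<open>1 - Kb p\<close> survives a perturbation by half of its
  constant, which Hoelder continuity grants near \<open>p\<close>. The result is openness of
  \<open>regular\<close> with uniform constants, on either side of the cut.\<close>

lemma regular_nbhd:
  assumes p: "regular p"
  obtains r c C where "0 < r" "0 < c" "0 \<le> C"
    "\<And>q. q \<in> conv_dom \<inter> cut_nbhd p r \<Longrightarrow> regular q"
    "\<And>q v. q \<in> conv_dom \<inter> cut_nbhd p r \<Longrightarrow> c * norm v \<le> norm (v - Kb q v)"
    "\<And>q q' v. q \<in> conv_dom \<inter> cut_nbhd p r \<Longrightarrow> q' \<in> conv_dom \<inter> cut_nbhd p r \<Longrightarrow>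
      norm (Kb q v - Kb q' v) \<le> C * cut_dist q q' powr \<gamma> * norm v"
proof -
  have pd: "p \<in> conv_dom" using p by (simp add: regular_def)
  obtain c where c: "0 < c" "\<And>v. c * norm v \<le> norm (v - Kb p v)" using regular_lower[OF p] by blast
  show ?thesis
  proof (rule Kb_Holder[OF pd])
    fix r0 C assume C: "0 < r0" "0 \<le> C" "\<And>q q' v. q \<in> conv_dom \<inter> cut_nbhd p r0 \<Longrightarrow>
        q' \<in> conv_dom \<inter> cut_nbhd p r0 \<Longrightarrow>
      norm (Kb q v - Kb q' v) \<le> C * cut_dist q q' powr \<gamma> * norm v"
    \<comment> \<open>The radius at which the Hoelder bound stays below \<open>c / 2\<close>; the
      summand 1 covers \<open>C = 0\<close>.\<close>
    define t where "t = (c / 2 / (C + 1)) powr (1 / \<gamma>)"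
    have t: "0 < t" using c C by (simp add: t_def)
    have "t powr \<gamma> = c / 2 / (C + 1)" using c C gamma by (simp add: t_def powr_powr)
    then have "C * t powr \<gamma> = c / 2 - t powr \<gamma>" using C by (simp add: field_simps)
    then have Ct: "C * t powr \<gamma> \<le> c / 2" by (metis diff_le_eq le_add_same_cancel1 powr_ge_zero)
    define r where "r = min r0 t"
    have r: "0 < r" using C t by (simp add: r_def)
    have sub: "cut_nbhd p r \<subseteq> cut_nbhd p r0" by (rule cut_nbhd_mono) (simp add: r_def)
    have low: "c / 2 * norm v \<le> norm (v - Kb q v)" if q: "q \<in> conv_dom \<inter> cut_nbhd p r" for q v
    proof -
      have "cut_dist q p \<le> t" using cut_nbhd_dist[of q p r] q by (simp add: cut_dist_def r_def dist_commute)
      then have "cut_dist q p powr \<gamma> \<le> t powr \<gamma>" using gamma by (intro powr_mono2) (auto simp: cut_dist_def)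
      then have "C * cut_dist q p powr \<gamma> \<le> c / 2" using Ct mult_left_mono[OF _ C(2)] by (meson order_trans)
      then have "C * cut_dist q p powr \<gamma> * norm v \<le> c / 2 * norm v" by (rule mult_right_mono) simp
      moreover have "norm (Kb q v - Kb p v) \<le> C * cut_dist q p powr \<gamma> * norm v"
        using q sub pd cut_nbhd_center[OF C(1), of p] by (intro C(3)) auto
      moreover have "norm (v - Kb p v) \<le> norm (v - Kb q v) + norm (Kb q v - Kb p v)"
        using norm_triangle_ineq[of "v - Kb q v" "Kb q v - Kb p v"] by simp
      ultimately show ?thesis using c(2)[of v] by (simp add: field_simps)
    qed
    show thesis
    proof (rule that[of r "c / 2" C])
      show "regular q" if "q \<in> conv_dom \<inter> cut_nbhd p r" for q
        using regular_if_lower[of q "c / 2"] low[OF that] that c(1) by auto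
      show "norm (Kb q v - Kb q' v) \<le> C * cut_dist q q' powr \<gamma> * norm v"
        if "q \<in> conv_dom \<inter> cut_nbhd p r" "q' \<in> conv_dom \<inter> cut_nbhd p r" for q q' v
        by (rule C(3)) (use that sub in auto)
      show "c / 2 * norm v \<le> norm (v - Kb q v)" if "q \<in> conv_dom \<inter> cut_nbhd p r" for q v
          by (rule low[OF that])
    qed (use r c C in auto)
  qed
qed

lemma sol_bound:
  assumes "regular q" "\<And>v. c * norm v \<le> norm (v - Kb q v)" "0 < c" shows "norm (sol q b) \<le> norm b / c"
  using assms(2)[of "sol q b"] assms(3) by (simp add: sol[OF assms(1)] field_simps)

text \<open>The parameter \<open>t\<close> stands for any common modulus of operator and source;
  later it is the distance raised to the power \<gamma>.\<close>

lemma sol_diff: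
  assumes q: "regular q" "regular q'" and c: "\<And>v. c * norm v \<le> norm (v - Kb q v)" "\<And>v. c * norm v
      \<le> norm (v - Kb q' v)" "0 < c"
    and K: "\<And>v. norm (Kb q v - Kb q' v) \<le> C * t * norm v" and b: "norm (b - b') \<le> Cb * t" "norm b' \<le> B"
        and t: "0 \<le> C" "0 \<le> t"
  shows "norm (sol q b - sol q' b') \<le> (Cb + C * (B / c)) / c * t"
proof -
  interpret Kq: bounded_linear "Kb q" using q(1) by (intro Kb_linear) (simp add: regular_def)
  let ?v = "sol q b" and ?v' = "sol q' b'"
  \<comment> \<open>The difference of solutions solves the equation at \<open>q\<close>, with a
    source made of the two variations.\<close>
  have "(?v - ?v') - Kb q (?v - ?v') = (?v - Kb q ?v) - (?v' - Kb q' ?v') + (Kb q ?v' - Kb q' ?v')"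
    by (simp add: Kq.diff)
  also have "\<dots> = (b - b') + (Kb q ?v' - Kb q' ?v')" by (simp add: sol q)
  finally have "norm ((?v - ?v') - Kb q (?v - ?v')) \<le> norm (b - b') + norm (Kb q ?v' - Kb q' ?v')"
    by (metis norm_triangle_ineq)
  also have "\<dots> \<le> Cb * t + C * t * (B / c)"
  proof (intro add_mono b order_trans[OF K] mult_left_mono)
    show "norm ?v' \<le> B / c" using sol_bound[OF q(2) c(2,3), of b'] b(2) c(3)
        by (meson divide_right_mono less_imp_le order_trans)
  qed (use t in auto)
  finally have "c * norm (?v - ?v') \<le> Cb * t + C * t * (B / c)" using c(1)[of "?v - ?v'"] by linarith
  then show ?thesis using c(3) by (simp add: field_simps)
qed

section \<open>Solutions for bounded continuous sources\<close>

definition bw :: "(real \<Rightarrow> complex) \<Rightarrow> (real \<Rightarrow>\<^sub>C complex)" where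
  "bw \<beta> = Bcontfun (\<lambda>x. of_real (w x powr (- \<sigma>)) * \<beta> x)"

lemma bw_apply:
  assumes "\<And>x. isCont \<beta> x" "\<And>x. cmod (\<beta> x) \<le> B"
  shows "apply_bcontfun (bw \<beta>) = (\<lambda>x. of_real (w x powr (- \<sigma>)) * \<beta> x)"
  unfolding bw_def by (rule Bcontfun_inverse[OF weighted_bcontfun[OF assms]])

definition msol :: "cut_point \<Rightarrow> (real \<Rightarrow> complex) \<Rightarrow> real \<Rightarrow> complex" where
  "msol q \<beta> x = of_real (w x powr \<sigma>) * apply_bcontfun (sol q (bw \<beta>)) x"

lemma w_cancel [simp]: "w x powr \<sigma> * w x powr (- \<sigma>) = 1" "w x powr (- \<sigma>) * w x powr \<sigma> = 1"
  by (simp_all flip: powr_add)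

lemma w_cancel_complex [simp]:
  "complex_of_real (w x powr \<sigma>) * (complex_of_real (w x powr (- \<sigma>)) * z) = z"
  "complex_of_real (w x powr (- \<sigma>)) * (complex_of_real (w x powr \<sigma>) * z) = z"
  by (simp_all flip: mult.assoc of_real_mult)

lemma msol_measurable [measurable]: "msol q \<beta> \<in> borel_measurable borel"
  unfolding msol_def[abs_def] by measurable

lemma U_msol: "U (apply_bcontfun (sol q (bw \<beta>))) = (\<lambda>y. of_real (u y) * msol q \<beta> y)"
  by (auto simp: U_def msol_def)

lemma msol_eq:
  assumes q: "regular q" and \<beta>: "\<And>x. isCont \<beta> x" "\<And>x. cmod (\<beta> x) \<le> B"
  shows "msol q \<beta> x = \<beta> x + convol (G_cut q) (\<lambda>y. of_real (u y) * msol q \<beta> y) x"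
proof -
  let ?v = "sol q (bw \<beta>)"
  have qd: "q \<in> conv_dom" using q by (simp add: regular_def)
  have "?v x = bw \<beta> x + Kb q ?v x"
    using sol[OF q, of "bw \<beta>"]
      by (metis add.commute add_diff_cancel_left' diff_add_cancel minus_bcontfun.rep_eq
        plus_bcontfun.rep_eq)
  also have "\<dots> = of_real (w x powr (- \<sigma>)) * (\<beta> x + convol (G_cut q) (\<lambda>y. of_real (u y) * msol q \<beta> y) x)"
    by (simp add: bw_apply[OF \<beta>] Kb_apply[OF qd] K_def U_msol distrib_left)
  finally show ?thesis by (simp add: msol_def)
qed

lemma msol_weighted: "cmod (of_real (w x powr (- \<sigma>)) * msol q \<beta> x) \<le> norm (sol q (bw \<beta>))"
  by (simp add: msol_def norm_bounded)

lemma msol_Linfw: "msol q \<beta> \<in> Linfw (- \<sigma>)"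
  by (rule LinfwI[of _ _ "norm (sol q (bw \<beta>))"]) (use msol_weighted in \<open>auto simp: norm_mult\<close>)

text \<open>The equation itself improves the bound: its right-hand side is a bounded source plus a
  convolution that is bounded without weight.\<close>

lemma msol_bounded:
  assumes q: "regular q" and \<beta>: "\<And>x. isCont \<beta> x" "\<And>x. cmod (\<beta> x) \<le> B"
  obtains M where "\<And>x. cmod (msol q \<beta> x) \<le> M"
proof (rule conv_bound)
  show "q \<in> conv_dom" using q by (simp add: regular_def)
  fix C assume C: "0 \<le> C" "\<And>f x. f \<in> L2w s1 \<Longrightarrow> cmod (convol (G_cut q) f x) \<le> C * wnorm s1 f"
  show thesis
  proof (rule that)
    fix x
    show "cmod (msol q \<beta> x) \<le> B + C * wnorm s1 (U (sol q (bw \<beta>)))"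
      unfolding msol_eq[OF q \<beta>, of x] U_msol[symmetric]
      by (intro order_trans[OF norm_triangle_ineq] add_mono \<beta> C U_bcontfun)
  qed
qed

text \<open>Injectivity of \<open>1 - Kb q\<close> concerns continuous functions. A competing
  solution is known only a.e., but the right-hand side of its equation is continuous and serves as
  its representative.\<close>

lemma msol_unique:
  assumes q: "regular q" and \<beta>: "\<And>x. isCont \<beta> x" "\<And>x. cmod (\<beta> x) \<le> B"
  shows "unique_in (Linfw (- \<sigma>)) (solves u (G_cut q) \<beta>) (msol q \<beta>) \<and> msol q \<beta> \<in> Linf"
proof
  have qd: "q \<in> conv_dom" using q by (simp add: regular_def)
  show "msol q \<beta> \<in> Linf"
  proof (rule msol_bounded[OF q \<beta>])
    fix M assume "\<And>x. cmod (msol q \<beta> x) \<le> M"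
    then show ?thesis by (intro LinfwI[of _ _ M]) auto
  qed
  show "unique_in (Linfw (- \<sigma>)) (solves u (G_cut q) \<beta>) (msol q \<beta>)"
    unfolding unique_in_def
  proof (intro conjI ballI impI msol_Linfw)
    show "solves u (G_cut q) \<beta> (msol q \<beta>)" unfolding solves_def by (intro AE_I2 msol_eq[OF q \<beta>])
    fix m assume m: "m \<in> Linfw (- \<sigma>)" "solves u (G_cut q) \<beta> m"
    have [measurable]: "m \<in> borel_measurable borel" by (rule LinfwD(1)[OF m(1)])
    obtain M where M: "0 \<le> M" "AE x in lborel. w x powr (- \<sigma>) * cmod (m x) \<le> M" using LinfwD(2)[OF m(1)]
        by blast
    \<comment> \<open>Measurable and essentially bounded only, hence not yet in the space of
      \<open>Kb\<close>; \<open>v\<close> below is its continuous version.\<close>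
    define v0 where "v0 x = of_real (w x powr (- \<sigma>)) * m x" for x
    have [measurable]: "v0 \<in> borel_measurable borel" unfolding v0_def[abs_def] by measurable
    have U0: "U v0 = (\<lambda>y. of_real (u y) * m y)" by (auto simp: U_def v0_def)
    have f: "U v0 \<in> L2w s1"
      by (rule U_L2w(1)[OF _ _ M(1)]) (use M(2) in \<open>auto simp: v0_def norm_mult\<close>)
    define h where "h x = \<beta> x + convol (G_cut q) (U v0) x" for x
    have hc: "isCont h x" for x unfolding h_def[abs_def]
        by (intro continuous_intros \<beta> conv_continuous[OF qd f])
    obtain C where C: "\<And>f x. f \<in> L2w s1 \<Longrightarrow> cmod (convol (G_cut q) f x) \<le> C * wnorm s1 f"
        by (rule conv_bound[OF qd]) blast
    have hb: "cmod (h x) \<le> B + C * wnorm s1 (U v0)" for x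
      unfolding h_def by (intro order_trans[OF norm_triangle_ineq] add_mono \<beta> C f)
    define v where "v = bw h"
    have v: "apply_bcontfun v = (\<lambda>x. of_real (w x powr (- \<sigma>)) * h x)" unfolding v_def
        by (rule bw_apply[OF hc hb])
    have mh: "AE x in lborel. m x = h x" using m(2) by (simp add: solves_def h_def U0)
    have [measurable]: "h \<in> borel_measurable borel" using hc
        by (intro borel_measurable_continuous_onI continuous_at_imp_continuous_on) auto
    \<comment> \<open>Changing the representative leaves the convolution unchanged at every point,
      so the equation for \<open>v\<close> holds everywhere.\<close>
    have "convol (G_cut q) (U v) x = convol (G_cut q) (U v0) x" for x
    proof -
      have "AE y in lborel. U v0 y = U v y"
        using mh by eventually_elim (simp add: U_def v v0_def)
      moreover have "U v0 \<in> L2w s1" "U v \<in> L2w s1" by (rule f, rule U_bcontfun)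
      moreover have "G_cut q \<in> borel_measurable borel" using G_cut_measurable[OF qd] .
      ultimately show ?thesis
        unfolding convol_def by (intro integral_cong_AE) (auto dest!: L2wD(1))
    qed
    then have "v - Kb q v = bw \<beta>"
      by (intro bcontfun_eqI) (simp add: minus_bcontfun.rep_eq Kb_apply[OF qd] K_def v h_def bw_apply[OF \<beta>]
        algebra_simps)
    then have "v - Kb q v = sol q (bw \<beta>) - Kb q (sol q (bw \<beta>))" by (simp add: sol[OF q])
    moreover have "b - d = a - c" if "a - b = c - d" for a b c d :: "real \<Rightarrow>\<^sub>C complex"
      using that by (metis add_diff_cancel_left' add_diff_eq diff_add_cancel diff_diff_eq2)
    ultimately have "Kb q (v - sol q (bw \<beta>)) = v - sol q (bw \<beta>)"
      unfolding linear_diff[OF bounded_linear.linear[OF Kb_linear[OF qd]]] by blast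
    then have "v - sol q (bw \<beta>) = 0" using q unfolding regular_def by blast
    then have "v = sol q (bw \<beta>)" by simp
    then have vs: "sol q (bw \<beta>) = v" by simp
    have "msol q \<beta> = h" unfolding msol_def[abs_def] vs v by simp
    then show "AE x in lborel. m x = msol q \<beta> x" using mh by simp
  qed
qed

end

section \<open>Uniqueness on the edges\<close>

lemma IFT_modulate: "cis (\<eta> * x) * IFT h x = IFT (\<lambda>\<xi>. h (\<xi> - \<eta>)) x"
proof -
  have "(LINT \<xi>|lborel. cis (x * \<xi>) * h (\<xi> - \<eta>))
      = (LINT \<xi>|lborel. cis (x * (\<eta> + 1 * \<xi>)) * h (\<eta> + 1 * \<xi> - \<eta>))"
    by (subst lborel_integral_real_affine[of 1 _ \<eta>]) auto
  also have "\<dots> = (LINT \<xi>|lborel. cis (\<eta> * x) * (cis (x * \<xi>) * h \<xi>))"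
  proof (intro Bochner_Integration.integral_cong refl)
    fix \<xi>
    have "cis (x * (\<eta> + 1 * \<xi>)) = cis (\<eta> * x) * cis (x * \<xi>)" by (simp add: cis_mult algebra_simps)
    then show "cis (x * (\<eta> + 1 * \<xi>)) * h (\<eta> + 1 * \<xi> - \<eta>) = cis (\<eta> * x) * (cis (x * \<xi>) * h \<xi>)" by simp
  qed
  also have "\<dots> = cis (\<eta> * x) * (LINT \<xi>|lborel. cis (x * \<xi>) * h \<xi>)" by (rule integral_mult_right_zero)
  finally show ?thesis by (simp add: IFT_def)
qed

lemma integrable_translate:
  fixes h :: "real \<Rightarrow> complex"
  shows "integrable lborel h \<Longrightarrow> integrable lborel (\<lambda>\<xi>. h (\<xi> - \<eta>))"
  using lborel_integrable_real_affine[of h 1 "- \<eta>"] by simp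

lemma integral_translate:
  fixes h :: "real \<Rightarrow> complex"
  shows "(LINT \<xi>|lborel. h (\<xi> - \<eta>)) = (LINT \<xi>|lborel. h \<xi>)"
  using lborel_integral_real_affine[of 1 h "- \<eta>"] by simp

text \<open>Multiplication by the test phase is a shift in frequency; this is how the energy
  identity acquires the shifted argument \<open>\<xi> - \<eta>\<close>.\<close>

lemma Parseval_modulated:
  assumes g: "g \<in> L2" "AE \<xi> in lborel. fourier g \<xi> = \<Gamma> \<xi>" "\<Gamma> \<in> borel_measurable borel"
      and h: "h \<in> L2" "integrable lborel h"
  shows "2 * pi * (LINT x|lborel. g x * cnj (cis (\<eta> * x) * IFT h x))
      = (LINT \<xi>|lborel. \<Gamma> \<xi> * cnj (h (\<xi> - \<eta>)))"
proof -
  let ?h = "\<lambda>\<xi>. h (\<xi> - \<eta>)"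
  have h2: "?h \<in> L2" by (rule L2_translate(1)[OF h(1)])
  have hi: "integrable lborel ?h" by (rule integrable_translate[OF h(2)])
  have [measurable]: "h \<in> borel_measurable borel" "fourier g \<in> borel_measurable borel"
      "\<Gamma> \<in> borel_measurable borel" "fourier (IFT ?h) \<in> borel_measurable borel"
    using h g fourier_L2[OF g(1)] fourier_L2[OF IFT_L2[OF h2 hi]] by auto
  have "2 * pi * (LINT x|lborel. g x * cnj (cis (\<eta> * x) * IFT h x))
      = (LINT \<xi>|lborel. fourier g \<xi> * cnj (fourier (IFT ?h) \<xi>))"
    unfolding IFT_modulate by (rule fourier_Parseval[OF g(1) IFT_L2[OF h2 hi], symmetric])
  also have "\<dots> = (LINT \<xi>|lborel. \<Gamma> \<xi> * cnj (h (\<xi> - \<eta>)))"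
    by (rule integral_cong_AE) (use g(2) fourier_IFT[OF h2 hi] in \<open>auto elim: eventually_elim2\<close>)
  finally show ?thesis .
qed

text \<open>With \<open>m = IFT h\<close>, \<open>h = \<chi> F / (\<xi> - k)\<close> the Fourier transform of \<open>m' - i k m\<close> is known on each half
    line; this
  is the Fourier form of the energy identity for \<open>\<bar>m\<bar>\<^sup>2\<close>. The last term is the only one not controlled
  by \<open>m\<close> and \<open>f\<close>, and it lives on \<open>[0, \<eta>]\<close>, away from the pole.\<close>

lemma energy_identity:
  assumes f: "f \<in> L2" "integrable lborel f" and k: "off k" and \<eta>: "0 \<le> \<eta>"
  defines "h \<equiv> \<lambda>\<xi>. Pmul k \<xi> * FT f \<xi>"
  shows "2 * pi * (LINT x|lborel. (f x * cnj (IFT h x) - cnj (f x) * IFT h x) * cis (- (\<eta> * x)))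
    = (of_real \<eta> - 2 * \<i> * of_real (Im k)) * (2 * pi * (LINT x|lborel. IFT h x * cnj (IFT h x) * cis (- (\<eta> *
        x))))
      - (LINT \<xi>|lborel. indicator {0..<\<eta>} \<xi> * (h \<xi> * cnj (FT f (\<xi> - \<eta>))))"
proof -
  let ?F = "FT f" and ?m = "IFT h"
  have F2: "?F \<in> L2" by (rule FT_Bessel(1)[OF f(2,1)])
  have hi: "integrable lborel h" unfolding h_def by (rule Pmul_mult(2)[OF k F2])
  have h2: "h \<in> L2" unfolding h_def by (rule Pmul_mult(1)[OF k F2])
  have m2: "?m \<in> L2" by (rule IFT_L2[OF h2 hi])
  have [measurable]: "f \<in> borel_measurable borel" "h \<in> borel_measurable borel" using f h2 by auto
  have cm: "(\<lambda>x. cis (t * x) * ?m x) \<in> L2" for t by (rule L2_bounded_mult(1)[OF m2, of _ 1]) auto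
  have A: "2 * pi * (LINT x|lborel. f x * cnj (cis (\<eta> * x) * ?m x))
      = (LINT \<xi>|lborel. ?F \<xi> * cnj (h (\<xi> - \<eta>)))"
    by (rule Parseval_modulated[OF f(1) fourier_eq_FT[OF f] _ h2 hi]) measurable
  have D: "2 * pi * (LINT x|lborel. ?m x * cnj (cis (\<eta> * x) * ?m x))
      = (LINT \<xi>|lborel. h \<xi> * cnj (h (\<xi> - \<eta>)))"
    by (rule Parseval_modulated[OF m2 fourier_IFT[OF h2 hi] _ h2 hi]) measurable
  \<comment> \<open>The conjugate pairing is the same formula with the opposite shift, translated
    back and conjugated.\<close>
  have "2 * pi * (LINT x|lborel. f x * cnj (cis (- \<eta> * x) * ?m x))
      = (LINT \<xi>|lborel. ?F \<xi> * cnj (h (\<xi> - - \<eta>)))"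
    by (rule Parseval_modulated[OF f(1) fourier_eq_FT[OF f] _ h2 hi]) measurable
  also have "\<dots> = (LINT \<xi>|lborel. ?F (\<xi> - \<eta>) * cnj (h \<xi>))"
    using integral_translate[of "\<lambda>\<xi>. ?F \<xi> * cnj (h (\<xi> + \<eta>))" \<eta>] by simp
  finally have "cnj (2 * pi * (LINT x|lborel. f x * cnj (cis (- \<eta> * x) * ?m x)))
      = cnj (LINT \<xi>|lborel. ?F (\<xi> - \<eta>) * cnj (h \<xi>))"
    by (rule arg_cong)
  then have B: "2 * pi * (LINT x|lborel. cnj (f x) * (cis (- \<eta> * x) * ?m x))
      = (LINT \<xi>|lborel. cnj (?F (\<xi> - \<eta>)) * h \<xi>)"
    unfolding complex_cnj_mult Bochner_Integration.integral_cnj[symmetric] by simp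
  have cc: "cnj (cis (\<eta> * x)) = cis (- (\<eta> * x))" "cis (- \<eta> * x) = cis (- (\<eta> * x))" for x
      by (simp_all add: cis_cnj)
  have i1: "integrable lborel (\<lambda>x. f x * cnj (cis (\<eta> * x) * ?m x))"
      by (intro L2_mult_integrable L2_cnj cm f)
  have i2: "integrable lborel (\<lambda>x. cnj (f x) * (cis (- \<eta> * x) * ?m x))"
      by (intro L2_mult_integrable L2_cnj cm f)
  have "2 * pi * (LINT x|lborel. (f x * cnj (?m x) - cnj (f x) * ?m x) * cis (- (\<eta> * x)))
      = 2 * pi * (LINT x|lborel. f x * cnj (cis (\<eta> * x) * ?m x) - cnj (f x) * (cis (- \<eta> * x) * ?m x))"
    unfolding complex_cnj_mult cc by (simp add: algebra_simps)
  also have "\<dots> = (LINT \<xi>|lborel. ?F \<xi> * cnj (h (\<xi> - \<eta>))) - (LINT \<xi>|lborel. cnj (?F (\<xi> - \<eta>)) * h \<xi>)"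
    by (subst Bochner_Integration.integral_diff[OF i1 i2]) (simp only: right_diff_distrib A B)
  also have "\<dots> = (LINT \<xi>|lborel. ?F \<xi> * cnj (h (\<xi> - \<eta>)) - cnj (?F (\<xi> - \<eta>)) * h \<xi>)"
    by (intro Bochner_Integration.integral_diff[symmetric] L2_mult_integrable L2_cnj L2_translate(1)[OF h2]
      L2_translate(1)[OF F2] F2 h2)
  also have "\<dots> = (LINT \<xi>|lborel. (of_real \<eta> - 2 * \<i> * of_real (Im k)) * (h \<xi> * cnj (h (\<xi> - \<eta>)))
      - indicator {0..<\<eta>} \<xi> * (h \<xi> * cnj (?F (\<xi> - \<eta>))))"
  proof (intro Bochner_Integration.integral_cong refl)
    fix \<xi>
    \<comment> \<open>Below 0 both values of \<open>h\<close> vanish. On \<open>[0, \<eta>)\<close>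
      only \<open>h \<xi>\<close> survives and gives the extra term. From \<open>\<eta>\<close> on,
      \<open>F\<close> is the symbol times \<open>h\<close> at both frequencies, and the symbols
      differ, after conjugation, by \<open>\<eta> - 2 * \<i> * Im k\<close>.\<close>
    consider "\<xi> < 0" | "0 \<le> \<xi>" "\<xi> < \<eta>" | "\<eta> \<le> \<xi>" by linarith
    then show "?F \<xi> * cnj (h (\<xi> - \<eta>)) - cnj (?F (\<xi> - \<eta>)) * h \<xi>
      = (of_real \<eta> - 2 * \<i> * of_real (Im k)) * (h \<xi> * cnj (h (\<xi> - \<eta>))) - indicator {0..<\<eta>} \<xi> * (h \<xi> * cnj
          (?F (\<xi> - \<eta>)))"
    proof cases
      case 1
      then show ?thesis using \<eta> by (simp add: h_def Pmul_def)
    next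
      case 2
      then show ?thesis by (simp add: h_def Pmul_def)
    next
      case 3
      then have ne: "of_real \<xi> - k \<noteq> 0" "of_real (\<xi> - \<eta>) - k \<noteq> 0"
        using off_ne[OF k, of \<xi>] off_ne[OF k, of "\<xi> - \<eta>"] \<eta> by auto
      have F: "?F \<xi> = (of_real \<xi> - k) * h \<xi>" "?F (\<xi> - \<eta>) = (of_real (\<xi> - \<eta>) - k) * h (\<xi> - \<eta>)"
        unfolding h_def Pmul_def using 3 \<eta> ne by auto
      have "?F \<xi> * cnj (h (\<xi> - \<eta>)) - cnj (?F (\<xi> - \<eta>)) * h \<xi>
        = ((of_real \<xi> - k) - cnj (of_real (\<xi> - \<eta>) - k)) * (h \<xi> * cnj (h (\<xi> - \<eta>)))"
        unfolding F by (simp add: algebra_simps)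
      also have "(of_real \<xi> - k) - cnj (of_real (\<xi> - \<eta>) - k) = of_real \<eta> - 2 * \<i> * of_real (Im k)"
        by (simp add: complex_eq_iff)
      finally show ?thesis using 3 by simp
    qed
  qed
  also have "\<dots> = (of_real \<eta> - 2 * \<i> * of_real (Im k)) * (LINT \<xi>|lborel. h \<xi> * cnj (h (\<xi> - \<eta>)))
      - (LINT \<xi>|lborel. indicator {0..<\<eta>} \<xi> * (h \<xi> * cnj (?F (\<xi> - \<eta>))))"
  proof -
    have j1: "integrable lborel (\<lambda>\<xi>. h \<xi> * cnj (h (\<xi> - \<eta>)))"
      by (intro L2_mult_integrable L2_cnj L2_translate(1)[OF h2] h2)
    have j0: "integrable lborel (\<lambda>\<xi>. h \<xi> * cnj (?F (\<xi> - \<eta>)))"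
      by (intro L2_mult_integrable L2_cnj L2_translate(1)[OF F2] h2)
    have j2: "integrable lborel (\<lambda>\<xi>. indicator {0..<\<eta>} \<xi> * (h \<xi> * cnj (?F (\<xi> - \<eta>))))"
      by (rule Bochner_Integration.integrable_bound[OF j0]) (auto simp: indicator_def)
    show ?thesis using j1 j2 by simp
  qed
  also have "(LINT \<xi>|lborel. h \<xi> * cnj (h (\<xi> - \<eta>))) = 2 * pi * (LINT x|lborel. ?m x * cnj (?m x)
      * cis (- (\<eta> * x)))"
    unfolding D[symmetric] complex_cnj_mult cc by (simp add: mult_ac)
  finally show ?thesis .
qed

section \<open>Fejer averages in the test frequency\<close>

definition fejer :: "real \<Rightarrow> real \<Rightarrow> real" where
  "fejer \<delta> x = (LINT \<eta>|lborel. indicator {0..\<delta>} \<eta> * ((1 - \<eta> / \<delta>) * cos (\<eta> * x)))"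

text \<open>The triangular weight has a nonnegative cosine transform; positivity is what makes Fatou
  applicable after averaging.\<close>

lemma fejer_eq:
  assumes "0 < \<delta>" "x \<noteq> 0" shows "fejer \<delta> x = (1 - cos (\<delta> * x)) / (\<delta> * x\<^sup>2)"
proof -
  let ?F = "\<lambda>\<eta>. (1 - \<eta> / \<delta>) * (sin (\<eta> * x) / x) - cos (\<eta> * x) / (\<delta> * x\<^sup>2)"
  have "(?F has_real_derivative (1 - \<eta> / \<delta>) * cos (\<eta> * x)) (at \<eta> within S)" for \<eta> S
    using assms by (auto intro!: derivative_eq_intros simp: field_simps power2_eq_square)
  then have "(LINT \<eta>|lborel. indicator {0..\<delta>} \<eta> *\<^sub>R ((1 - \<eta> / \<delta>) * cos (\<eta> * x))) = ?F \<delta> - ?F 0"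
    using assms(1) by (intro integral_FTC_atLeastAtMost) (auto intro!: continuous_intros simp:
      has_real_derivative_iff_has_vector_derivative)
  then show ?thesis using assms by (simp add: fejer_def field_simps)
qed

lemma fejer_nonneg: "0 < \<delta> \<Longrightarrow> x \<noteq> 0 \<Longrightarrow> 0 \<le> fejer \<delta> x"
  by (simp add: fejer_eq)

lemma fejer_measurable [measurable]: "fejer \<delta> \<in> borel_measurable borel"
  unfolding fejer_def[abs_def] by measurable

lemma Icc_weight_integrable:
  fixes g :: "real \<Rightarrow> 'a::{banach, second_countable_topology}"
  shows "continuous_on {a..b} g \<Longrightarrow> integrable lborel (\<lambda>\<eta>. indicator {a..b} \<eta> *\<^sub>R g \<eta>)"
  using borel_integrable_atLeastAtMost'[of a b g] by (simp add: set_integrable_def)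

text \<open>The factor \<open>1 / \<eta>\<close> would make absolute estimates diverge as
  \<open>a\<close> tends to 0. Splitting the weight into \<open>1 / \<eta> - 1 / \<delta>\<close>
  gives a sine integral and an elementary term, bounded uniformly in \<open>a\<close>, \<delta> and
  \<open>x\<close>.\<close>

lemma sin_weight_bound:
  assumes B: "\<And>T. \<bar>Si T\<bar> \<le> B" and a: "0 < a" "a \<le> \<delta>"
  shows "\<bar>LINT \<eta>|lborel. indicator {a..\<delta>} \<eta> * ((1 - \<eta> / \<delta>) / \<eta> * sin (\<eta> * x))\<bar> \<le> 2 * B + 1"
proof (cases "x = 0")
  case True
  have "0 \<le> B" using B[of 0] by simp
  then show ?thesis using True by simp
next
  case False
  have d: "0 < \<delta>" using a by simp
  let ?F = "\<lambda>\<eta>. Si (\<eta> * x) + cos (\<eta> * x) / (\<delta> * x)"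
  have "(?F has_real_derivative (1 - \<eta> / \<delta>) / \<eta> * sin (\<eta> * x)) (at \<eta> within S)" if "a \<le> \<eta>" for \<eta> S
  proof -
    have "(?F has_real_derivative sinc (\<eta> * x) * x + (- sin (\<eta> * x) * x) / (\<delta> * x)) (at \<eta> within S)"
      using False d by (auto intro!: derivative_eq_intros DERIV_chain2[OF DERIV_Si] simp: field_simps)
    moreover have "sinc (\<eta> * x) * x + (- sin (\<eta> * x) * x) / (\<delta> * x) = (1 - \<eta> / \<delta>) / \<eta> * sin (\<eta> * x)"
      using False d that a by (simp add: field_simps)
    ultimately show ?thesis by simp
  qed
  then have "(LINT \<eta>|lborel. indicator {a..\<delta>} \<eta> *\<^sub>R ((1 - \<eta> / \<delta>) / \<eta> * sin (\<eta> * x))) = ?F \<delta> - ?F a"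
    using a by (intro integral_FTC_atLeastAtMost) (auto intro!: continuous_intros simp:
      has_real_derivative_iff_has_vector_derivative)
  then have eq: "(LINT \<eta>|lborel. indicator {a..\<delta>} \<eta> * ((1 - \<eta> / \<delta>) / \<eta> * sin (\<eta> * x)))
      = Si (\<delta> * x) - Si (a * x) + (cos (\<delta> * x) - cos (a * x)) / (\<delta> * x)"
    by (simp add: diff_divide_distrib)
  have "cos (\<delta> * x) - cos (a * x) = Re (cis (\<delta> * x) - cis (a * x))" by simp
  then have "\<bar>cos (\<delta> * x) - cos (a * x)\<bar> \<le> cmod (cis (\<delta> * x) - cis (a * x))" by (metis abs_Re_le_cmod)
  also have "cis (\<delta> * x) - cis (a * x) = cis (a * x) * (cis (\<delta> * x - a * x) - 1)"
      by (simp add: right_diff_distrib cis_mult)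
  also have "cmod \<dots> \<le> \<bar>\<delta> * x - a * x\<bar>" by (simp add: norm_mult cmod_cis_diff_1)
  also have "\<dots> = (\<delta> - a) * \<bar>x\<bar>" using a by (simp add: abs_mult flip: left_diff_distrib)
  also have "\<dots> \<le> \<delta> * \<bar>x\<bar>" using a by (intro mult_right_mono) auto
  finally have "\<bar>(cos (\<delta> * x) - cos (a * x)) / (\<delta> * x)\<bar> \<le> 1" using d False by (simp add: abs_mult)
  moreover have aux: "\<bar>p - q + r\<bar> \<le> 2 * B + 1" if "\<bar>p\<bar> \<le> B" "\<bar>q\<bar> \<le> B" "\<bar>r\<bar> \<le> 1" for p q r :: real
    using that unfolding abs_le_iff by simp
  ultimately show ?thesis unfolding eq using aux[OF B B] by blast
qed

text \<open>Used with sine and cosine for \<open>e\<close>: it moves the average over the test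
  frequency inside the space integral.\<close>

lemma Fubini_weight:
  fixes \<beta> g e :: "real \<Rightarrow> real"
  assumes \<beta>: "continuous_on {a..\<delta>} \<beta>" and g: "integrable lborel g" and e: "e \<in> borel_measurable borel"
      "\<And>t. \<bar>e t\<bar> \<le> 1"
  shows "(LINT \<eta>|lborel. indicator {a..\<delta>} \<eta> * (\<beta> \<eta> * (LINT x|lborel. g x * e (\<eta> * x))))
    = (LINT x|lborel. g x * (LINT \<eta>|lborel. indicator {a..\<delta>} \<eta> * (\<beta> \<eta> * e (\<eta> * x))))"
    "integrable lborel (\<lambda>\<eta>. indicator {a..\<delta>} \<eta> * (\<beta> \<eta> * (LINT x|lborel. g x * e (\<eta> * x))))"
    "integrable lborel (\<lambda>x. g x * (LINT \<eta>|lborel. indicator {a..\<delta>} \<eta> * (\<beta> \<eta> * e (\<eta> * x))))"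
proof -
  have [measurable]: "g \<in> borel_measurable borel" "e \<in> borel_measurable borel" using g e by auto
  define b where "b \<eta> = indicator {a..\<delta>} \<eta> *\<^sub>R \<beta> \<eta>" for \<eta>
  have bi: "integrable lborel b" unfolding b_def[abs_def] by (rule Icc_weight_integrable[OF \<beta>])
  then have [measurable]: "b \<in> borel_measurable borel" by auto
  let ?h = "\<lambda>\<eta> x. complex_of_real (b \<eta> * (g x * e (\<eta> * x)))"
  have L: "(LINT x|lborel. ?h \<eta> x)
      = of_real (indicator {a..\<delta>} \<eta> * (\<beta> \<eta> * (LINT x|lborel. g x * e (\<eta> * x))))" for \<eta>
    unfolding integral_complex_of_real integral_mult_right_zero by (simp add: b_def)
  have R: "(LINT \<eta>|lborel. ?h \<eta> x)
      = of_real (g x * (LINT \<eta>|lborel. indicator {a..\<delta>} \<eta> * (\<beta> \<eta> * e (\<eta> * x))))" for x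
    unfolding integral_complex_of_real integral_mult_right_zero[symmetric] by (simp add: b_def mult_ac)
  have m: "case_prod ?h \<in> borel_measurable (lborel \<Otimes>\<^sub>M lborel)" by measurable
  have ba: "integrable lborel (\<lambda>\<eta>. \<bar>b \<eta>\<bar>)" using bi by (rule integrable_abs)
  have gn: "integrable lborel (\<lambda>x. \<bar>g x\<bar>)" using g by (rule integrable_abs)
  have le: "cmod (?h \<eta> x) \<le> \<bar>b \<eta>\<bar> * \<bar>g x\<bar>" for \<eta> x
    using mult_left_mono[OF e(2)[of "\<eta> * x"], of "\<bar>b \<eta>\<bar> * \<bar>g x\<bar>"]
      by (simp only: norm_of_real abs_mult) (simp add: mult_ac)
  note Fub = Fubini_dominated[OF m ba gn le]
  show "(LINT \<eta>|lborel. indicator {a..\<delta>} \<eta> * (\<beta> \<eta> * (LINT x|lborel. g x * e (\<eta> * x))))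
    = (LINT x|lborel. g x * (LINT \<eta>|lborel. indicator {a..\<delta>} \<eta> * (\<beta> \<eta> * e (\<eta> * x))))"
    using Fub(1)[unfolded L R] unfolding integral_complex_of_real of_real_eq_iff .
  show "integrable lborel (\<lambda>\<eta>. indicator {a..\<delta>} \<eta> * (\<beta> \<eta> * (LINT x|lborel. g x * e (\<eta> * x))))"
    using Fub(2) unfolding L complex_of_real_integrable_eq .
  show "integrable lborel (\<lambda>x. g x * (LINT \<eta>|lborel. indicator {a..\<delta>} \<eta> * (\<beta> \<eta> * e (\<eta> * x))))"
    using Fub(3) unfolding R complex_of_real_integrable_eq .
qed

lemma integral_abs_le:
  fixes f g :: "'a \<Rightarrow> real"
  assumes "integrable M f" "integrable M g" "\<And>x. \<bar>f x\<bar> \<le> g x"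
  shows "\<bar>LINT x|M. f x\<bar> \<le> (LINT x|M. g x)"
  by (rule order_trans[OF integral_abs_bound integral_mono]) (use assms in auto)

lemma fejer_abs_le:
  assumes "0 < \<delta>" shows "\<bar>fejer \<delta> x\<bar> \<le> \<delta>"
proof -
  have "\<bar>fejer \<delta> x\<bar> \<le> (LINT \<eta>|lborel. indicator {0..\<delta>} \<eta>)"
    unfolding fejer_def
  proof (rule integral_abs_le)
    show "integrable lborel (\<lambda>\<eta>. indicator {0..\<delta>} \<eta> * ((1 - \<eta> / \<delta>) * cos (\<eta> * x)))"
    proof -
      have "continuous_on {0..\<delta>} (\<lambda>\<eta>. (1 - \<eta> / \<delta>) * cos (\<eta> * x))" using assms
          by (intro continuous_intros) auto
      then show ?thesis using Icc_weight_integrable[of 0 \<delta> "\<lambda>\<eta>. (1 - \<eta> / \<delta>) * cos (\<eta> * x)"] by simp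
    qed
    fix \<eta>
    have "\<bar>1 - \<eta> / \<delta>\<bar> * \<bar>cos (\<eta> * x)\<bar> \<le> 1" if "0 \<le> \<eta>" "\<eta> \<le> \<delta>"
      using that assms by (intro mult_le_one) (auto simp: field_simps abs_le_iff)
    then show "\<bar>indicator {0..\<delta>} \<eta> * ((1 - \<eta> / \<delta>) * cos (\<eta> * x))\<bar> \<le> indicator {0..\<delta>} \<eta>"
      by (auto simp: indicator_def abs_mult)
  qed (rule integrable_real_indicator, use assms in auto)
  then show ?thesis using assms by simp
qed

text \<open>The missing part of the average has length \<open>a\<close> and integrand at most
  1.\<close>

lemma fejer_cut:
  assumes "0 < a" "a \<le> \<delta>"
  shows "fejer \<delta> x - a \<le> (LINT \<eta>|lborel. indicator {a..\<delta>} \<eta> * ((1 - \<eta> / \<delta>) * cos (\<eta> * x)))"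
proof -
  let ?g = "\<lambda>\<eta>. (1 - \<eta> / \<delta>) * cos (\<eta> * x)"
  have i: "integrable lborel (\<lambda>\<eta>. indicator {c..\<delta>} \<eta> * ?g \<eta>)" for c
  proof -
    have "continuous_on {c..\<delta>} ?g" using assms by (intro continuous_intros) auto
    then show ?thesis using Icc_weight_integrable[of c \<delta> ?g] by simp
  qed
  have "fejer \<delta> x - (LINT \<eta>|lborel. indicator {a..\<delta>} \<eta> * ?g \<eta>) = (LINT \<eta>|lborel. indicator {0..\<delta>} \<eta> * ?g \<eta>
      - indicator {a..\<delta>} \<eta> * ?g \<eta>)"
    unfolding fejer_def by (rule Bochner_Integration.integral_diff[symmetric, OF i i])
  also have "\<dots> \<le> (LINT \<eta>|lborel. indicator {0..a} \<eta>)"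
  proof (rule integral_mono)
    fix \<eta>
    have "?g \<eta> \<le> 1" if "0 \<le> \<eta>" "\<eta> \<le> \<delta>"
    proof -
      have "?g \<eta> \<le> (1 - \<eta> / \<delta>) * 1" using that assms by (intro mult_left_mono) auto
      also have "\<dots> \<le> 1" using that assms by auto
      finally show ?thesis .
    qed
    then show "indicator {0..\<delta>} \<eta> * ?g \<eta> - indicator {a..\<delta>} \<eta> * ?g \<eta> \<le> indicator {0..a} \<eta>"
      using assms by (auto simp: indicator_def)
    show "integrable lborel (\<lambda>\<eta>. indicator {0..\<delta>} \<eta> * ?g \<eta> - indicator {a..\<delta>} \<eta> * ?g \<eta>)"
      by (intro Bochner_Integration.integrable_diff i)
  qed (rule integrable_real_indicator, use assms in auto)
  finally show ?thesis using assms by simp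
qed

text \<open>The real part of the energy identity is divided by \<open>\<eta>\<close> and averaged
  with the triangular weight. One multiple \<open>(2 * B + 1) * \<kappa>\<close> bounds the source
  commutator, the other the damping term containing \<open>Im k\<close>; both rest on the uniform
  sine bound. The estimate contains no negative power of \<open>Im k\<close>, so it survives the
  limit to the edge.\<close>

lemma edge_energy:
  assumes f: "f \<in> L2" "integrable lborel f" and k: "off k" and d: "0 < \<delta>" and B: "\<And>T. \<bar>Si T\<bar> \<le> B"
    and Q: "0 \<le> Q" "\<forall>\<xi>\<in>{0..\<delta>}. \<forall>\<xi>'\<in>{- \<delta>..0}.
      Re (FT f \<xi> * cnj (FT f \<xi>') / (of_real \<xi> - k)) \<le> Q"
  defines "m \<equiv> IFT (\<lambda>\<xi>. Pmul k \<xi> * FT f \<xi>)"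
  assumes \<kappa>: "(LINT x|lborel. cmod (f x * cnj (m x) - cnj (f x) * m x)) \<le> \<kappa>"
  shows "integrable lborel (\<lambda>x. (cmod (m x))\<^sup>2 * fejer \<delta> x)"
    "(LINT x|lborel. (cmod (m x))\<^sup>2 * fejer \<delta> x) \<le> 2 * (2 * B + 1) * \<kappa> + Q * \<delta>"
proof -
  let ?F = "FT f"
  define h where "h = (\<lambda>\<xi>. Pmul k \<xi> * ?F \<xi>)"
  define p where "p x = (cmod (m x))\<^sup>2" for x
  \<comment> \<open>The commutator of the source is \<open>\<i>\<close> times this real density;
    \<kappa> bounds its integral in absolute value.\<close>
  define y where "y x = 2 * Im (f x * cnj (m x))" for x
  have F2: "?F \<in> L2" by (rule FT_Bessel(1)[OF f(2,1)])
  have hi: "integrable lborel h" unfolding h_def by (rule Pmul_mult(2)[OF k F2])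
  have h2: "h \<in> L2" unfolding h_def by (rule Pmul_mult(1)[OF k F2])
  have m: "m = IFT h" by (simp add: m_def h_def)
  have m2: "m \<in> L2" unfolding m by (rule IFT_L2[OF h2 hi])
  have [measurable]: "f \<in> borel_measurable borel" "m \<in> borel_measurable borel" "h \<in> borel_measurable borel"
      using f m2 h2 by auto
  have pi: "integrable lborel p" using m2 unfolding p_def[abs_def] L2_iff by simp
  have p0: "0 \<le> p x" for x by (simp add: p_def)
  have [measurable]: "p \<in> borel_measurable borel" "y \<in> borel_measurable borel"
      unfolding p_def[abs_def] y_def[abs_def] by measurable
  have fm: "integrable lborel (\<lambda>x. f x * cnj (m x))" by (intro L2_mult_integrable L2_cnj m2 f)
  have yi: "integrable lborel y" unfolding y_def[abs_def]
      by (intro Bochner_Integration.integrable_mult_right integrable_Im fm)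
  have gy: "f x * cnj (m x) - cnj (f x) * m x = \<i> * of_real (y x)" for x
    unfolding y_def by (simp add: complex_eq_iff algebra_simps)
  have \<kappa>': "(LINT x|lborel. \<bar>y x\<bar>) \<le> \<kappa>" using \<kappa> by (simp add: gy norm_mult)
  have \<kappa>0: "0 \<le> \<kappa>" using order_trans[OF _ \<kappa>'] by simp
  define C where "C \<eta> = (LINT x|lborel. p x * cos (\<eta> * x))" for \<eta>
  define S where "S \<eta> = (LINT x|lborel. p x * sin (\<eta> * x))" for \<eta>
  define I where "I \<eta> = (LINT x|lborel. y x * sin (\<eta> * x))" for \<eta>
  define J where "J \<eta> = (LINT x|lborel. y x * cos (\<eta> * x))" for \<eta>
  have trig: "integrable lborel (\<lambda>x. q x * sin (\<eta> * x))" "integrable lborel (\<lambda>x. q x * cos (\<eta> * x))"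
      if q: "integrable lborel q" for q :: "real \<Rightarrow> real" and \<eta>
  proof -
    have [measurable]: "q \<in> borel_measurable borel" using q by auto
    have "\<bar>q x\<bar> * \<bar>t\<bar> \<le> \<bar>q x\<bar>" if "\<bar>t\<bar> \<le> 1" for x t using mult_left_mono[OF that, of "\<bar>q x\<bar>"] by simp
    then show "integrable lborel (\<lambda>x. q x * sin (\<eta> * x))" "integrable lborel (\<lambda>x. q x * cos (\<eta> * x))"
      by (auto intro!: Bochner_Integration.integrable_bound[OF q] simp: abs_mult)
  qed
  have split: "(LINT x|lborel. of_real (q x) * cis (- (\<eta> * x)))
      = Complex (LINT x|lborel. q x * cos (\<eta> * x)) (- (LINT x|lborel. q x * sin (\<eta> * x)))"
    if q: "integrable lborel q" for q :: "real \<Rightarrow> real" and \<eta>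
  proof -
    have "(LINT x|lborel. of_real (q x) * cis (- (\<eta> * x)))
        = (LINT x|lborel. complex_of_real (q x * cos (\<eta> * x)) - \<i> * complex_of_real (q x * sin (\<eta> * x)))"
      by (intro Bochner_Integration.integral_cong refl) (simp add: complex_eq_iff)
    also have "\<dots> = complex_of_real (LINT x|lborel. q x * cos (\<eta> * x)) - \<i>
        * complex_of_real (LINT x|lborel. q x * sin (\<eta> * x))"
      using trig[OF q, of \<eta>] by (subst Bochner_Integration.integral_diff) (auto simp del: of_real_mult)
    finally show ?thesis by (simp add: complex_eq_iff)
  qed
  have main: "2 * pi * (\<i> * Complex (J \<eta>) (- I \<eta>)) = (of_real \<eta> - 2 * \<i> * of_real (Im k))
      * (2 * pi * Complex (C \<eta>) (- S \<eta>))
      - (LINT \<xi>|lborel. indicator {0..<\<eta>} \<xi> * (h \<xi> * cnj (?F (\<xi> - \<eta>))))" if "0 \<le> \<eta>" for \<eta>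
  proof -
    have "(LINT x|lborel. (f x * cnj (m x) - cnj (f x) * m x) * cis (- (\<eta> * x)))
        = \<i> * Complex (J \<eta>) (- I \<eta>)"
      unfolding gy mult.assoc integral_mult_right_zero split[OF yi] J_def I_def ..
    moreover have "(LINT x|lborel. m x * cnj (m x) * cis (- (\<eta> * x))) = Complex (C \<eta>) (- S \<eta>)"
      unfolding complex_norm_square[symmetric] p_def[symmetric] split[OF pi] C_def S_def
      using split[OF pi, of \<eta>] by (simp add: p_def)
    ultimately show ?thesis
      using energy_identity[OF f k that, folded h_def, folded m] by (simp only: h_def)
  qed
  \<comment> \<open>The extra term lives on an interval of length \<open>\<eta>\<close>, with
    frequencies in \<open>[0, \<eta>)\<close> and shifted ones in \<open>[- \<eta>, 0)\<close>,
    where its integrand has real part at most \<open>Q\<close>. Replacing \<open>Q * \<eta>\<close>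
    by \<open>2 * pi * (Q * \<eta>)\<close> afterwards clears the normalisation.\<close>
  have Re_main: "\<eta> * C \<eta> - 2 * Im k * S \<eta> \<le> I \<eta> + Q * \<eta>" if \<eta>: "0 \<le> \<eta>" "\<eta> \<le> \<delta>" for \<eta>
  proof -
    let ?T = "LINT \<xi>|lborel. indicator {0..<\<eta>} \<xi> * (h \<xi> * cnj (?F (\<xi> - \<eta>)))"
    have j0: "integrable lborel (\<lambda>\<xi>. h \<xi> * cnj (?F (\<xi> - \<eta>)))"
      by (intro L2_mult_integrable L2_cnj L2_translate(1)[OF F2] h2)
    have j2: "integrable lborel (\<lambda>\<xi>. indicator {0..<\<eta>} \<xi> * (h \<xi> * cnj (?F (\<xi> - \<eta>))))"
      by (rule Bochner_Integration.integrable_bound[OF j0]) (auto simp: indicator_def)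
    have "Re ?T = (LINT \<xi>|lborel. Re (indicator {0..<\<eta>} \<xi> * (h \<xi> * cnj (?F (\<xi> - \<eta>)))))"
        by (rule integral_Re[OF j2, symmetric])
    also have "\<dots> \<le> (LINT \<xi>|lborel. indicator {0..<\<eta>} \<xi> * Q)"
    proof (rule integral_mono)
      show "integrable lborel (\<lambda>\<xi>. indicator {0..<\<eta>} \<xi> * Q)"
          by (intro Bochner_Integration.integrable_mult_left integrable_real_indicator) (use \<eta> in auto)
      fix \<xi> show "Re (indicator {0..<\<eta>} \<xi> * (h \<xi> * cnj (?F (\<xi> - \<eta>)))) \<le> indicator {0..<\<eta>} \<xi> * Q"
        using Q(2)[rule_format, of \<xi> "\<xi> - \<eta>"] \<eta> by (auto simp: indicator_def h_def Pmul_def)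
    qed (rule integrable_Re[OF j2])
    also have "\<dots> = Q * \<eta>" using \<eta> by simp
    finally have T: "Re ?T \<le> Q * \<eta>" .
    have "Re (2 * pi * (\<i> * Complex (J \<eta>) (- I \<eta>)))
        = Re ((of_real \<eta> - 2 * \<i> * of_real (Im k)) * (2 * pi * Complex (C \<eta>) (- S \<eta>)) - ?T)"
      by (rule arg_cong[OF main[OF \<eta>(1)]])
    then have "2 * pi * I \<eta> = 2 * pi * (\<eta> * C \<eta> - 2 * Im k * S \<eta>) - Re ?T" by (simp add: algebra_simps)
    then have "2 * pi * (\<eta> * C \<eta> - 2 * Im k * S \<eta> - I \<eta>) \<le> 1 * (Q * \<eta>)" using T by (simp add: algebra_simps)
    also have "1 * (Q * \<eta>) \<le> (2 * pi) * (Q * \<eta>)" using Q(1) \<eta> pi_gt3 by (intro mult_right_mono) auto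
    finally have "2 * pi * (\<eta> * C \<eta> - 2 * Im k * S \<eta> - I \<eta>) \<le> 2 * pi * (Q * \<eta>)" .
    then have "\<eta> * C \<eta> - 2 * Im k * S \<eta> - I \<eta> \<le> Q * \<eta>" by (rule mult_left_le_imp_le) simp
    then show ?thesis by simp
  qed
  \<comment> \<open>The imaginary part at frequency 0, where the extra term is empty: the total mass
    may blow up near the edge, but only like \<open>\<kappa> / \<bar>Im k\<bar>\<close>.\<close>
  have mass: "2 * \<bar>Im k\<bar> * (LINT x|lborel. p x) \<le> \<kappa>"
  proof -
    have "Im (2 * pi * (\<i> * Complex (J 0) (- I 0)))
        = Im ((of_real 0 - 2 * \<i> * of_real (Im k)) * (2 * pi * Complex (C 0) (- S 0))
        - (LINT \<xi>|lborel. indicator {0..<0} \<xi> * (h \<xi> * cnj (?F (\<xi> - 0)))))" by (rule arg_cong[OF main]) simp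
    then have "2 * pi * J 0 = 2 * pi * (- 2 * Im k * C 0)" by (simp add: algebra_simps)
    then have "2 * pi * (LINT x|lborel. y x) = 2 * pi * (- 2 * Im k * (LINT x|lborel. p x))"
        by (simp add: J_def C_def)
    then have e: "(LINT x|lborel. y x) = - 2 * Im k * (LINT x|lborel. p x)"
        by (subst (asm) mult_cancel_left) simp
    have "\<bar>LINT x|lborel. y x\<bar> \<le> \<kappa>" using integral_abs_bound[of lborel y] \<kappa>' by linarith
    moreover have "0 \<le> (LINT x|lborel. p x)" by (intro Bochner_Integration.integral_nonneg p0)
    ultimately show ?thesis unfolding e by (simp add: abs_mult)
  qed
  show pf: "integrable lborel (\<lambda>x. (cmod (m x))\<^sup>2 * fejer \<delta> x)"
    unfolding p_def[symmetric]
    by (rule Bochner_Integration.integrable_bound[OF Bochner_Integration.integrable_mult_right[OF pi, of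
      \<delta>]])
      (use mult_left_mono[OF fejer_abs_le[OF d] p0] p0 d in \<open>auto simp: abs_mult mult_ac\<close>)
  have B0: "0 \<le> 2 * B + 1" using B[of 0] by simp
  \<comment> \<open>The weight divided by \<open>\<eta>\<close> is not integrable at 0, so the
    average starts at \<open>a > 0\<close>. The error is \<open>a\<close> times the mass, finite for
    fixed \<open>k\<close>, and disappears as \<open>a\<close> tends to 0.\<close>
  have cut: "(LINT x|lborel. p x * fejer \<delta> x) \<le> 2 * (2 * B + 1) * \<kappa> + Q * \<delta> + a * (LINT x|lborel. p x)"
      if a: "0 < a" "a \<le> \<delta>" for a
  proof -
    let ?b = "\<lambda>\<eta>. (1 - \<eta> / \<delta>) / \<eta>" and ?i = "indicator {a..\<delta>} :: real \<Rightarrow> real"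
    let ?S = "\<lambda>x. LINT \<eta>|lborel. ?i \<eta> * (?b \<eta> * sin (\<eta> * x))"
        and ?C = "\<lambda>x. LINT \<eta>|lborel. ?i \<eta> * ((1 - \<eta> / \<delta>) * cos (\<eta> * x))"
    have c1: "continuous_on {a..\<delta>} ?b" "continuous_on {a..\<delta>} (\<lambda>\<eta>. 1 - \<eta> / \<delta>)" using a
        by (auto intro!: continuous_intros)
    have ms: "sin \<in> borel_measurable (borel :: real measure)" "\<bar>sin t\<bar> \<le> 1"
        "cos \<in> borel_measurable (borel :: real measure)" "\<bar>cos t\<bar> \<le> 1" for t :: real by auto
    note FC = Fubini_weight[OF c1(2) pi ms(3,4), folded C_def]
        and FS = Fubini_weight[OF c1(1) pi ms(1,2), folded S_def]
      and FI = Fubini_weight[OF c1(1) yi ms(1,2), folded I_def]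
    have Sb: "\<bar>?S x\<bar> \<le> 2 * B + 1" for x by (rule sin_weight_bound[OF B a])
    have iQ: "integrable lborel (\<lambda>\<eta>. ?i \<eta> * Q)"
        by (intro Bochner_Integration.integrable_mult_left integrable_real_indicator) (use a in auto)
    \<comment> \<open>After multiplication by the nonnegative
      \<open>(1 - \<eta> / \<delta>) / \<eta>\<close>, the coefficient of \<open>C \<eta>\<close> is
      the triangular weight and the contribution of \<open>Q\<close> is at most \<open>Q\<close>
      itself.\<close>
    have "(LINT \<eta>|lborel. ?i \<eta> * ((1 - \<eta> / \<delta>) * C \<eta>) - 2 * Im k * (?i \<eta> * (?b \<eta> * S \<eta>)))
        \<le> (LINT \<eta>|lborel. ?i \<eta> * (?b \<eta> * I \<eta>) + ?i \<eta> * Q)"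
    proof (rule integral_mono)
      fix \<eta>
      have "(1 - \<eta> / \<delta>) * C \<eta> - 2 * Im k * (?b \<eta> * S \<eta>) \<le> ?b \<eta> * I \<eta> + Q" if \<eta>: "a \<le> \<eta>" "\<eta> \<le> \<delta>"
      proof -
        have b0: "0 \<le> ?b \<eta>" using \<eta> a d by auto
        have b\<eta>: "?b \<eta> * \<eta> = 1 - \<eta> / \<delta>" using \<eta> a by simp
        have "?b \<eta> * (\<eta> * C \<eta> - 2 * Im k * S \<eta>) \<le> ?b \<eta> * (I \<eta> + Q * \<eta>)"
          by (rule mult_left_mono[OF Re_main b0]) (use \<eta> a in auto)
        moreover have aux: "(b * e) * c - 2 * i * (b * z) \<le> b * t + Q * (b * e)"
            if "b * (e * c - 2 * i * z) \<le> b * (t + Q * e)" for b e c i z t :: real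
          using that by (simp add: algebra_simps)
        ultimately have "(?b \<eta> * \<eta>) * C \<eta> - 2 * Im k * (?b \<eta> * S \<eta>) \<le> ?b \<eta> * I \<eta> + Q * (?b \<eta> * \<eta>)" by blast
        also have "Q * (?b \<eta> * \<eta>) \<le> Q * 1" unfolding b\<eta> using \<eta> a Q d by (intro mult_left_mono) auto
        finally show ?thesis unfolding b\<eta> by simp
      qed
      then show "?i \<eta> * ((1 - \<eta> / \<delta>) * C \<eta>) - 2 * Im k * (?i \<eta> * (?b \<eta> * S \<eta>)) \<le> ?i \<eta> * (?b \<eta> * I \<eta>) + ?i \<eta>
          * Q"
        by (auto simp: indicator_def)
    qed (intro Bochner_Integration.integrable_diff Bochner_Integration.integrable_add
        Bochner_Integration.integrable_mult_right FC(2) FS(2) FI(2) iQ)+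
    moreover have "(LINT \<eta>|lborel. ?i \<eta> * ((1 - \<eta> / \<delta>) * C \<eta>) - 2 * Im k * (?i \<eta> * (?b \<eta> * S \<eta>)))
        = (LINT x|lborel. p x * ?C x) - 2 * Im k * (LINT x|lborel. p x * ?S x)"
      unfolding FC(1)[symmetric] FS(1)[symmetric]
      by (subst Bochner_Integration.integral_diff[OF FC(2) Bochner_Integration.integrable_mult_right[OF
        FS(2)]]) (simp only: integral_mult_right_zero)
    moreover have "(LINT \<eta>|lborel. ?i \<eta> * (?b \<eta> * I \<eta>) + ?i \<eta> * Q) = (LINT x|lborel. y x * ?S x)
        + (LINT \<eta>|lborel. ?i \<eta> * Q)"
      unfolding FI(1)[symmetric] by (rule Bochner_Integration.integral_add[OF FI(2) iQ])
    ultimately have "(LINT x|lborel. p x * ?C x) - 2 * Im k * (LINT x|lborel. p x * ?S x)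
        \<le> (LINT x|lborel. y x * ?S x) + (LINT \<eta>|lborel. ?i \<eta> * Q)"
      by (simp only:)
    moreover have "(LINT \<eta>|lborel. ?i \<eta> * Q) \<le> Q * \<delta>" using a Q by (simp add: mult_left_mono mult.commute)
    moreover have "(LINT x|lborel. y x * ?S x) \<le> (2 * B + 1) * \<kappa>"
    proof -
      have aux: "t * b \<le> c * \<bar>t\<bar>" if "\<bar>b\<bar> \<le> c" for t b c :: real
        using mult_right_mono[OF that, of "\<bar>t\<bar>"] abs_ge_self[of "t * b"]
          by (simp add: abs_mult mult.commute)
      have "(LINT x|lborel. y x * ?S x) \<le> (LINT x|lborel. (2 * B + 1) * \<bar>y x\<bar>)"
      proof (rule integral_mono[OF FI(3)])
        fix x show "y x * ?S x \<le> (2 * B + 1) * \<bar>y x\<bar>"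
          by (rule aux[OF Sb])
      qed (use yi in auto)
      also have "\<dots> \<le> (2 * B + 1) * \<kappa>" using mult_left_mono[OF \<kappa>' B0] by simp
      finally show ?thesis .
    qed
    \<comment> \<open>Neither the sign of \<open>Im k\<close> nor that of the sine average is
      controlled; the mass bound absorbs the factor \<open>Im k\<close>.\<close>
    moreover have "2 * Im k * (LINT x|lborel. p x * ?S x) \<le> (2 * B + 1) * \<kappa>"
    proof -
      have "\<bar>LINT x|lborel. p x * ?S x\<bar> \<le> (LINT x|lborel. (2 * B + 1) * p x)"
      proof (rule integral_abs_le[OF FS(3)])
        fix x show "\<bar>p x * ?S x\<bar> \<le> (2 * B + 1) * p x"
          unfolding abs_mult abs_of_nonneg[OF p0] mult.commute[of _ "p x"]
            by (rule mult_left_mono[OF Sb p0])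
      qed (use pi in auto)
      then have "\<bar>LINT x|lborel. p x * ?S x\<bar> \<le> (2 * B + 1) * (LINT x|lborel. p x)" by simp
      then have "2 * \<bar>Im k\<bar> * \<bar>LINT x|lborel. p x * ?S x\<bar>
          \<le> 2 * \<bar>Im k\<bar> * ((2 * B + 1) * (LINT x|lborel. p x))"
        by (intro mult_left_mono) auto
      also have "\<dots> = (2 * B + 1) * (2 * \<bar>Im k\<bar> * (LINT x|lborel. p x))" by (simp only: mult_ac)
      also have "\<dots> \<le> (2 * B + 1) * \<kappa>" by (rule mult_left_mono[OF mass B0])
      finally have "\<bar>2 * Im k * (LINT x|lborel. p x * ?S x)\<bar> \<le> (2 * B + 1) * \<kappa>" by (simp add: abs_mult)
      then show ?thesis by (rule abs_le_D1)
    qed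
    moreover have "(LINT x|lborel. p x * fejer \<delta> x) - a * (LINT x|lborel. p x)
        \<le> (LINT x|lborel. p x * ?C x)"
    proof -
      have "(LINT x|lborel. p x * fejer \<delta> x) - a * (LINT x|lborel. p x)
          = (LINT x|lborel. p x * fejer \<delta> x - a * p x)"
        using pf[folded p_def] pi by (subst Bochner_Integration.integral_diff) auto
      also have "\<dots> \<le> (LINT x|lborel. p x * ?C x)"
      proof (rule integral_mono[OF _ FC(3)])
        show "integrable lborel (\<lambda>x. p x * fejer \<delta> x - a * p x)"
          by (intro Bochner_Integration.integrable_diff Bochner_Integration.integrable_mult_right pf[folded
            p_def] pi)
        fix x show "p x * fejer \<delta> x - a * p x \<le> p x * ?C x"
          using mult_left_mono[OF fejer_cut[OF a, of x] p0[of x]]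
            by (simp only: right_diff_distrib mult.commute)
      qed
      finally show ?thesis .
    qed
    ultimately show ?thesis by (simp add: algebra_simps)
  qed
  show "(LINT x|lborel. (cmod (m x))\<^sup>2 * fejer \<delta> x) \<le> 2 * (2 * B + 1) * \<kappa> + Q * \<delta>"
    unfolding p_def[symmetric]
  proof (rule tendsto_lowerbound)
    show "((\<lambda>a. 2 * (2 * B + 1) * \<kappa> + Q * \<delta> + a * (LINT x|lborel. p x)) \<longlongrightarrow> 2 * (2 * B + 1) * \<kappa> + Q
        * \<delta>) (at_right 0)"
      by (auto intro!: tendsto_eq_intros)
    show "\<forall>\<^sub>F a in at_right 0. (LINT x|lborel. p x * fejer \<delta> x) \<le> 2 * (2 * B + 1) * \<kappa> + Q * \<delta> + a
        * (LINT x|lborel. p x)"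
      using cut d by (intro eventually_at_rightI[of 0 \<delta>]) auto
  qed simp
qed

section \<open>Passage to the edge\<close>

lemma nn_integral_Fatou_bound:
  fixes f :: "nat \<Rightarrow> 'a \<Rightarrow> ennreal"
  assumes "\<And>n. f n \<in> borel_measurable M" "AE x in M. (\<lambda>n. f n x) \<longlonglongrightarrow> g x"
    "\<And>n. (\<integral>\<^sup>+x. f n x \<partial>M) \<le> c n" "c \<longlonglongrightarrow> C"
  shows "(\<integral>\<^sup>+x. g x \<partial>M) \<le> C"
proof -
  have "(\<integral>\<^sup>+x. g x \<partial>M) = (\<integral>\<^sup>+x. liminf (\<lambda>n. f n x) \<partial>M)"
    by (rule nn_integral_cong_AE) (use assms(2) in eventually_elim, simp add: lim_imp_Liminf)
  also have "\<dots> \<le> liminf (\<lambda>n. \<integral>\<^sup>+x. f n x \<partial>M)" by (rule nn_integral_liminf[OF assms(1)])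
  also have "\<dots> \<le> liminf c" by (intro Liminf_mono always_eventually allI assms(3))
  also have "\<dots> = C" using assms(4) by (simp add: lim_imp_Liminf)
  finally show ?thesis .
qed

text \<open>Divided by \<delta>, the kernel is half the square of a sinc at scale \<delta>, so it
  flattens to the constant 1/2.\<close>

lemma fejer_limit:
  assumes "0 < d" "x \<noteq> 0"
  shows "(\<lambda>j. fejer (d / Suc j) x / (d / Suc j)) \<longlonglongrightarrow> 1 / 2"
proof -
  have e: "fejer \<delta> x / \<delta> = 1 / 2 * (sinc (\<delta> * x / 2))\<^sup>2" if "0 < \<delta>" for \<delta>
  proof -
    have "1 - cos (\<delta> * x) = 2 * (sin (\<delta> * x / 2))\<^sup>2" using cos_double_sin[of "\<delta> * x / 2"] by simp
    then show ?thesis using that assms by (simp add: fejer_eq power_divide) (simp add: power2_eq_square)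
  qed
  have "(\<lambda>j. d / real (Suc j) * x / 2) \<longlonglongrightarrow> 0 * x / 2"
    by (intro tendsto_intros LIMSEQ_Suc[OF lim_const_over_n]) auto
  then have "(\<lambda>j. 1 / 2 * (sinc (d / real (Suc j) * x / 2))\<^sup>2) \<longlonglongrightarrow> 1 / 2 * (sinc 0)\<^sup>2"
    by (intro tendsto_intros isCont_tendsto_compose[OF isCont_sinc]) simp
  moreover have "1 / 2 * (sinc 0)\<^sup>2 = (1 / 2 :: real)" by simp
  ultimately have lim: "(\<lambda>j. 1 / 2 * (sinc (d / real (Suc j) * x / 2))\<^sup>2) \<longlonglongrightarrow> 1 / 2" by (simp only:)
  have "(\<lambda>j. fejer (d / real (Suc j)) x / (d / real (Suc j)))
      = (\<lambda>j. 1 / 2 * (sinc (d / real (Suc j) * x / 2))\<^sup>2)"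
    by (rule ext, rule e) (use assms(1) in simp)
  then show ?thesis using lim by (simp only:)
qed

context potential
begin

text \<open>Near frequency 0 the product of transforms is within \<open>\<epsilon> * (l / 2)\<close>
  of the nonnegative number \<open>F 0 * cnj (F 0)\<close>, while the denominator has real part at
  most \<open>- (l / 2)\<close>. The main term is thus nonpositive and the error at most \<epsilon>,
  for every imaginary part \<open>t\<close> at once.\<close>

lemma edge_source_bound:
  assumes f: "continuous_on UNIV F" and l: "0 < l" and \<epsilon>: "0 < \<epsilon>"
  obtains d where "0 < d" "\<And>\<xi> \<xi>' t. \<bar>\<xi>\<bar> \<le> d \<Longrightarrow> \<bar>\<xi>'\<bar> \<le> d \<Longrightarrow>
    Re (F \<xi> * cnj (F \<xi>') / (of_real \<xi> - Complex l t)) \<le> \<epsilon>"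
proof -
  let ?\<Phi> = "\<lambda>p. F (fst p) * cnj (F (snd p))"
  have "continuous_on UNIV ?\<Phi>"
    by (intro continuous_intros continuous_on_compose2[OF f]) auto
  then have "isCont ?\<Phi> (0, 0)" by (simp add: continuous_on_eq_continuous_at)
  then obtain d0 where d0: "0 < d0" "\<And>p. dist p (0, 0) < d0 \<Longrightarrow> dist (?\<Phi> p) (?\<Phi> (0, 0)) < \<epsilon> * (l / 2)"
    unfolding continuous_at_eps_delta using \<epsilon> l by (metis (no_types, lifting) half_gt_zero mult_pos_pos)
  show ?thesis
  proof (rule that[of "min (d0 / 3) (l / 2)"])
    fix \<xi> \<xi>' t :: real
    assume x: "\<bar>\<xi>\<bar> \<le> min (d0 / 3) (l / 2)" "\<bar>\<xi>'\<bar> \<le> min (d0 / 3) (l / 2)"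
    let ?z = "F \<xi> * cnj (F \<xi>')" and ?y = "F 0 * cnj (F 0)" and ?r = "of_real \<xi> - Complex l t"
    have "dist (\<xi>, \<xi>') (0, 0) \<le> \<bar>\<xi>\<bar> + \<bar>\<xi>'\<bar>" using sqrt_sum_squares_le_sum_abs[of \<xi> \<xi>']
        by (simp add: dist_prod_def)
    then have "dist (\<xi>, \<xi>') (0, 0) < d0" using x d0(1) by linarith
    then have z: "cmod (?z - ?y) \<le> \<epsilon> * (l / 2)" using d0(2)[of "(\<xi>, \<xi>')"] mult_pos_pos[OF \<epsilon> l]
        by (intro less_imp_le) (simp add: dist_norm)
    have "\<bar>\<xi>\<bar> \<le> l / 2" using x(1) by simp
    then have Rr: "Re ?r \<le> - (l / 2)" by (simp add: abs_le_iff)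
    then have r: "l / 2 \<le> cmod ?r" using abs_Re_le_cmod[of ?r] by linarith
    have "?y / ?r = (cmod (F 0))\<^sup>2 *\<^sub>R (1 / ?r)"
      unfolding complex_norm_square[symmetric] by (simp add: scaleR_conv_of_real)
    then have "Re (?y / ?r) = (cmod (F 0))\<^sup>2 * Re (1 / ?r)" by (simp only: scaleR_complex.sel)
    moreover have "Re (1 / ?r) \<le> 0" using Rr l by (simp add: Re_divide) (simp add: divide_le_0_iff)
    ultimately have a: "Re (?y / ?r) \<le> 0" by (simp only: mult_nonneg_nonpos zero_le_power2)
    have "Re ((?z - ?y) / ?r) \<le> cmod (?z - ?y) / cmod ?r" using complex_Re_le_cmod[of "(?z - ?y) / ?r"]
        by (simp only: norm_divide)
    also have "\<dots> \<le> (\<epsilon> * (l / 2)) / (l / 2)" using z r l \<epsilon> by (intro frac_le) auto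
    also have "\<dots> = \<epsilon>" using l by simp
    finally have "Re ((?z - ?y) / ?r) \<le> \<epsilon>" .
    moreover have "Re (?z / ?r) = Re ((?z - ?y) / ?r) + Re (?y / ?r)" by (simp add: diff_divide_distrib)
    ultimately show "Re (?z / ?r) \<le> \<epsilon>" using a by linarith
  qed (use d0 l in auto)
qed

text \<open>\<open>m\<close> is approached by the square integrable \<open>h n\<close> at parameters
  above or below the edge. Two limits are taken in order: \<open>n\<close> to infinity at fixed
  \<delta>, which removes the commutator, and then \<delta> to 0, where the Fejer weight becomes
  constant. What remains bounds the integral of half the square of \<open>m\<close> by an arbitrary
  \<epsilon>.\<close>

lemma edge_kernel_trivial:
  assumes l: "0 < l" and v: "Kb (On_edge e l) v = v"
  shows "v = 0"
proof -
  define q where "q = On_edge e l"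
  have qd: "q \<in> conv_dom" using l by (auto simp: q_def conv_dom_def cut_domain_def)
  define f where "f = U (apply_bcontfun v)"
  define m where "m = convol (G_cut q) f"
  have fw: "f \<in> L2w s1" unfolding f_def by (rule U_bcontfun)
  note f2 = L2w_L2(1)[OF fw s1_nonneg] and f1 = L2w_L1(1)[OF fw s1]
  have [measurable]: "f \<in> borel_measurable borel" using f2 by auto
  have vm: "apply_bcontfun v x = of_real (w x powr (- \<sigma>)) * m x" for x
    using fun_cong[OF Kb_apply[OF qd, of v], of x] v by (simp add: q_def K_def m_def f_def)
  have fm: "f x = of_real (u x) * m x" for x by (simp add: f_def U_def vm)
  have mc: "isCont m x" for x unfolding m_def by (rule conv_continuous[OF qd fw])
  then have [measurable]: "m \<in> borel_measurable borel"
    by (intro borel_measurable_continuous_onI continuous_at_imp_continuous_on) auto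
  obtain B where B: "\<And>T. \<bar>Si T\<bar> \<le> B" using bounded_Si by blast
  define W where "W = (LINT x|lborel. w x powr \<gamma> * cmod (f x))"
  note Wi = gamma_int(1)[OF fw]
  show ?thesis
  proof (rule conv_Holder[OF qd])
    fix r C assume r: "0 < r" and C: "0 \<le> C" and H: "\<And>q1 q2 f x. q1 \<in> conv_dom \<inter> cut_nbhd q r \<Longrightarrow>
        q2 \<in> conv_dom \<inter> cut_nbhd q r \<Longrightarrow> f \<in> L2w s1 \<Longrightarrow>
      cmod (convol (G_cut q1) f x - convol (G_cut q2) f x) \<le> C * cut_dist q1 q2 powr \<gamma> * w x powr \<gamma> * wnorm
          s1 f"
    \<comment> \<open>Halving \<open>r\<close> keeps all approximating parameters strictly inside
      the neighbourhood where the Hoelder bound holds.\<close>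
    define t where "t n = r / 2 / real (Suc n)" for n
    have t0: "0 < t n" for n using r by (simp add: t_def)
    have tr: "t n < r" for n
    proof -
      have "t n \<le> r / 2 / 1" unfolding t_def using r by (intro divide_left_mono) auto
      then show ?thesis using r by linarith
    qed
    have tl: "t \<longlonglongrightarrow> 0" unfolding t_def[abs_def] by (rule LIMSEQ_Suc[OF lim_const_over_n])
    define k where "k n = Complex l (edge_sign e * t n)" for n
    have koff: "off (k n)" for n using t0[of n]
        by (cases e) (auto simp: off_def k_def complex_eq_iff complex_nonneg_Reals_iff)
    have dk: "cmod (of_real l - k n) = t n" for n
    proof -
      have "of_real l - k n = Complex 0 (- (edge_sign e * t n))" by (simp add: k_def complex_eq_iff)
      then show ?thesis using t0[of n] by (simp add: cmod_def abs_mult edge_sign_abs)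
    qed
    have kn: "Off_edge (k n) \<in> conv_dom \<inter> cut_nbhd q r" for n
    proof -
      have "edge_sign e * Im (k n) > 0" using t0[of n] by (cases e) (auto simp: k_def)
      then show ?thesis using koff dk[of n] tr[of n]
          by (auto simp: conv_dom_def cut_domain_def q_def dist_norm)
    qed
    define h where "h n x = convol (G (k n)) f x" for n x
    have hm: "h n = IFT (\<lambda>\<xi>. Pmul (k n) \<xi> * FT f \<xi>)" for n
    proof -
      have "h n = IFT (\<lambda>\<xi>. Pmul (k n) \<xi> * fourier f \<xi>)"
          by (rule ext) (simp add: h_def convol_G[OF koff f2] mult_op_def)
      also have "\<dots> = IFT (\<lambda>\<xi>. Pmul (k n) \<xi> * FT f \<xi>)"
        by (rule IFT_cong_AE) (use fourier_L2[OF f2] fourier_eq_FT[OF f2 f1] in \<open>auto elim: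
          eventually_mono\<close>)
      finally show ?thesis .
    qed
    have hmeas [measurable]: "h n \<in> borel_measurable borel" for n unfolding hm by measurable
    define E where "E n = C * t n powr \<gamma> * wnorm s1 f" for n
    have E0: "E \<longlonglongrightarrow> 0"
    proof -
      have "(\<lambda>n. t n powr \<gamma>) \<longlonglongrightarrow> 0 powr \<gamma>"
        by (rule tendsto_powr'[OF tl tendsto_const]) (use gamma less_imp_le[OF t0] in auto)
      then have "E \<longlonglongrightarrow> C * 0 powr \<gamma> * wnorm s1 f" unfolding E_def[abs_def]
          by (intro tendsto_mult tendsto_const)
      then show ?thesis by simp
    qed
    have En: "0 \<le> E n" for n using C by (simp add: E_def)
    have hE: "cmod (h n x - m x) \<le> E n * w x powr \<gamma>" for n x
      using H[OF kn[of n] _ fw, of q x] cut_nbhd_center[OF r, of q] qd dk[of n]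
      by (simp add: h_def m_def E_def cut_dist_def q_def dist_norm norm_minus_commute mult_ac)
    have hl: "(\<lambda>n. h n x) \<longlonglongrightarrow> m x" for x
    proof (rule LIM_zero_cancel, rule Lim_null_comparison)
      show "\<forall>\<^sub>F n in sequentially. norm (h n x - m x) \<le> E n * w x powr \<gamma>"
          by (intro always_eventually allI hE)
      show "(\<lambda>n. E n * w x powr \<gamma>) \<longlonglongrightarrow> 0" by (rule tendsto_mult_left_zero[OF E0])
    qed
    \<comment> \<open>Since \<open>u\<close> is real, the commutator of \<open>f = u m\<close> with
      \<open>m\<close> vanishes identically, so only the error \<open>h n - m\<close> contributes.
      That error may grow like \<open>w\<close> to the power \<gamma>, which the moment
      \<open>W\<close> of \<open>f\<close> pays for.\<close>
    have \<kappa>: "(LINT x|lborel. cmod (f x * cnj (h n x) - cnj (f x) * h n x)) \<le> 2 * E n * W" for n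
    proof -
      have le: "cmod (f x * cnj (h n x) - cnj (f x) * h n x) \<le> 2 * E n * (w x powr \<gamma> * cmod (f x))" for x
      proof -
        have "f x * cnj (m x) - cnj (f x) * m x = 0" by (simp add: fm)
        then have "f x * cnj (h n x) - cnj (f x) * h n x = f x * cnj (h n x - m x) - cnj (f x)
            * (h n x - m x)"
          by (simp add: algebra_simps)
        also have "cmod \<dots> \<le> cmod (f x) * cmod (h n x - m x) + cmod (f x) * cmod (h n x - m x)"
          by (rule order_trans[OF norm_triangle_ineq4]) (simp add: norm_mult flip: complex_cnj_diff)
        also have "\<dots> \<le> cmod (f x) * (E n * w x powr \<gamma>) + cmod (f x) * (E n * w x powr \<gamma>)"
          by (intro add_mono mult_left_mono hE) auto
        finally show ?thesis by (simp add: mult_ac)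
      qed
      have "(LINT x|lborel. cmod (f x * cnj (h n x) - cnj (f x) * h n x))
          \<le> (LINT x|lborel. 2 * E n * (w x powr \<gamma> * cmod (f x)))"
      proof (rule integral_mono)
        have R: "integrable lborel (\<lambda>x. 2 * E n * (w x powr \<gamma> * cmod (f x)))"
            by (intro Bochner_Integration.integrable_mult_right Wi)
        then show "integrable lborel (\<lambda>x. 2 * E n * (w x powr \<gamma> * cmod (f x)))" .
        show "integrable lborel (\<lambda>x. cmod (f x * cnj (h n x) - cnj (f x) * h n x))"
        proof (rule Bochner_Integration.integrable_bound[OF R])
          show "(\<lambda>x. cmod (f x * cnj (h n x) - cnj (f x) * h n x)) \<in> borel_measurable lborel" by measurable
          show "AE x in lborel. norm (cmod (f x * cnj (h n x) - cnj (f x) * h n x))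
              \<le> norm (2 * E n * (w x powr \<gamma> * cmod (f x)))"
            using order_trans[OF le abs_ge_self] by (intro AE_I2) simp
        qed
        show "cmod (f x * cnj (h n x) - cnj (f x) * h n x) \<le> 2 * E n * (w x powr \<gamma> * cmod (f x))" for x
            by (rule le)
      qed
      then show ?thesis by (simp add: W_def)
    qed
    have FTc: "continuous_on UNIV (FT f)" by (intro continuous_at_imp_continuous_on ballI continuous_FT f1)
    have mass: "(\<integral>\<^sup>+x. ennreal ((cmod (m x))\<^sup>2 / 2) \<partial>lborel) \<le> ennreal \<epsilon>" if \<epsilon>: "0 < \<epsilon>" for \<epsilon>
    proof (rule edge_source_bound[OF FTc l \<epsilon>])
      fix d assume d: "0 < d" and Q: "\<And>\<xi> \<xi>' t. \<bar>\<xi>\<bar> \<le> d \<Longrightarrow> \<bar>\<xi>'\<bar> \<le> d \<Longrightarrow>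
          Re (FT f \<xi> * cnj (FT f \<xi>') / (of_real \<xi> - Complex l t)) \<le> \<epsilon>"
      have nz: "AE x in lborel. x \<noteq> (0::real)" by (rule AE_lborel_singleton)
      \<comment> \<open>The source bound \<epsilon> does not depend on \<open>n\<close>, and
        \<open>E n\<close> tends to 0, so Fatou leaves only
        \<open>\<epsilon> * \<delta>\<close>.\<close>
      have A: "(\<integral>\<^sup>+x. ennreal ((cmod (m x))\<^sup>2 * fejer \<delta> x) \<partial>lborel) \<le> ennreal (\<epsilon> * \<delta>)" if \<delta>: "0 < \<delta>" "\<delta> \<le> d"
          for \<delta>
      proof (rule nn_integral_Fatou_bound[where f = "\<lambda>n x. ennreal ((cmod (h n x))\<^sup>2 * fejer \<delta> x)"
          and c = "\<lambda>n. ennreal (2 * (2 * B + 1) * (2 * E n * W) + \<epsilon> * \<delta>)"])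
        show "AE x in lborel. (\<lambda>n. ennreal ((cmod (h n x))\<^sup>2 * fejer \<delta> x))
            \<longlonglongrightarrow> ennreal ((cmod (m x))\<^sup>2 * fejer \<delta> x)"
          by (intro AE_I2 tendsto_ennrealI tendsto_intros hl)
        have "(\<lambda>n. 2 * (2 * B + 1) * (2 * E n * W) + \<epsilon> * \<delta>) \<longlonglongrightarrow> 2 * (2 * B + 1) * (2 * 0 * W) + \<epsilon> * \<delta>"
          by (intro tendsto_intros E0)
        then show "(\<lambda>n. ennreal (2 * (2 * B + 1) * (2 * E n * W) + \<epsilon> * \<delta>)) \<longlonglongrightarrow> ennreal (\<epsilon> * \<delta>)"
          by (intro tendsto_ennrealI) simp
        fix n
        have Q': "\<forall>\<xi>\<in>{0..\<delta>}. \<forall>\<xi>'\<in>{- \<delta>..0}. Re (FT f \<xi> * cnj (FT f \<xi>') / (of_real \<xi> - k n)) \<le> \<epsilon>"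
          unfolding k_def by (intro ballI Q) (use \<delta> in auto)
        note en = edge_energy[OF f2 f1 koff[of n] \<delta>(1) B less_imp_le[OF \<epsilon>] Q' \<kappa>[unfolded hm], folded hm]
        have "(\<integral>\<^sup>+x. ennreal ((cmod (h n x))\<^sup>2 * fejer \<delta> x) \<partial>lborel)
            = ennreal (LINT x|lborel. (cmod (h n x))\<^sup>2 * fejer \<delta> x)"
          by (rule nn_integral_eq_integral[OF en(1)]) (use nz in eventually_elim, simp add: fejer_nonneg \<delta>)
        also have "\<dots> \<le> ennreal (2 * (2 * B + 1) * (2 * E n * W) + \<epsilon> * \<delta>)" by (rule ennreal_leI[OF en(2)])
        finally show "(\<integral>\<^sup>+x. ennreal ((cmod (h n x))\<^sup>2 * fejer \<delta> x) \<partial>lborel)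
            \<le> ennreal (2 * (2 * B + 1) * (2 * E n * W) + \<epsilon> * \<delta>)" .
      qed measurable
      \<comment> \<open>A sequence of widths shrinking to 0. Dividing by the width makes the
        right-hand side constant in \<open>j\<close>.\<close>
      let ?d = "\<lambda>j. d / real (Suc j)"
      have d': "0 < ?d j" "?d j \<le> d" for j using d mult_left_mono[of 1 "real (Suc j)" d]
          by (auto simp: divide_le_eq simp del: of_nat_Suc)
      show ?thesis
      proof (rule nn_integral_Fatou_bound[where f =
          "\<lambda>j x. ennreal ((cmod (m x))\<^sup>2 * (fejer (?d j) x / ?d j))" and c = "\<lambda>j. ennreal \<epsilon>"])
        show "AE x in lborel. (\<lambda>j. ennreal ((cmod (m x))\<^sup>2 * (fejer (?d j) x / ?d j)))
            \<longlonglongrightarrow> ennreal ((cmod (m x))\<^sup>2 / 2)"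
          using nz
        proof eventually_elim
          case (elim x)
          have "(\<lambda>j. (cmod (m x))\<^sup>2 * (fejer (?d j) x / ?d j)) \<longlonglongrightarrow> (cmod (m x))\<^sup>2 * (1 / 2)"
            by (intro tendsto_mult tendsto_const fejer_limit d elim)
          then show ?case by (intro tendsto_ennrealI) simp
        qed
        fix j
        have "(\<integral>\<^sup>+x. ennreal ((cmod (m x))\<^sup>2 * (fejer (?d j) x / ?d j)) \<partial>lborel)
          = (\<integral>\<^sup>+x. ennreal (1 / ?d j) * ennreal ((cmod (m x))\<^sup>2 * fejer (?d j) x) \<partial>lborel)"
        proof (rule nn_integral_cong_AE, use nz in eventually_elim)
          fix x :: real assume "x \<noteq> 0"
          then show "ennreal ((cmod (m x))\<^sup>2 * (fejer (?d j) x / ?d j))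
              = ennreal (1 / ?d j) * ennreal ((cmod (m x))\<^sup>2 * fejer (?d j) x)"
            using d'(1)[of j] by (subst ennreal_mult[symmetric]) (auto simp: fejer_nonneg less_imp_le[OF d]
              mult_ac simp del: of_nat_Suc)
        qed
        also have "\<dots> = ennreal (1 / ?d j) * (\<integral>\<^sup>+x. ennreal ((cmod (m x))\<^sup>2 * fejer (?d j) x) \<partial>lborel)"
          by (rule nn_integral_cmult) measurable
        also have "\<dots> \<le> ennreal (1 / ?d j) * ennreal (\<epsilon> * ?d j)" by (intro mult_left_mono A d') auto
        also have "\<dots> = ennreal \<epsilon>" using d'(1)[of j] \<epsilon>
            by (subst ennreal_mult[symmetric]) (auto simp: less_imp_le[OF d] simp del: of_nat_Suc)
        finally show "(\<integral>\<^sup>+x. ennreal ((cmod (m x))\<^sup>2 * (fejer (?d j) x / ?d j)) \<partial>lborel) \<le> ennreal \<epsilon>" .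
            show "(\<lambda>x. ennreal ((cmod (m x))\<^sup>2 * (fejer (?d j) x / ?d j))) \<in> borel_measurable lborel"
                by measurable
      qed (rule tendsto_const)
    qed
    have "(\<integral>\<^sup>+x. ennreal ((cmod (m x))\<^sup>2 / 2) \<partial>lborel) \<le> 0"
      by (rule ennreal_le_epsilon) (use mass in simp)
    then have "AE x in lborel. ennreal ((cmod (m x))\<^sup>2 / 2) = 0"
        by (subst nn_integral_0_iff_AE[symmetric]) auto
    then have "AE x in lborel. m x = 0" by eventually_elim (simp add: ennreal_eq_0_iff)
    then have "m x = 0" for x using AE_0_isCont[OF _ mc] by blast
    then show "v = 0" by (intro bcontfun_eqI) (simp add: vm)
  qed
qed

lemma regular_On_edge: "0 < l \<Longrightarrow> regular (On_edge e l)"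
  using edge_kernel_trivial by (auto simp: regular_def conv_dom_def cut_domain_def)

end

section \<open>The resolvent set\<close>

lemma isCont_mult_op:
  assumes "a \<in> L2" "f \<in> L2" shows "isCont (mult_op a f) x"
proof -
  have "isCont (\<lambda>x. 1 / (2 * pi) * FT (\<lambda>\<xi>. a \<xi> * fourier f \<xi>) (- x)) x"
    by (intro continuous_intros isCont_o2[OF _ continuous_FT] L2_mult_integrable assms fourier_L2)
  then show ?thesis by (simp add: mult_op_def[abs_def] IFT_FT)
qed

text \<open>The free resolvent applied to the Hardy projection of \<open>f\<close>: the decay
  \<open>1 / w\<close> of the multiplier is exactly one derivative, so arbitrary \<open>L2\<close>
  data land in the domain.\<close>

lemma mult_op_Pmul:
  assumes k: "off k" and f: "f \<in> L2"
  shows "mult_op (Pmul k) f \<in> Lax_dom" "AE \<xi> in lborel. fourier (mult_op (Pmul k) f) \<xi>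
      = Pmul k \<xi> * fourier f \<xi>"
proof -
  let ?h = "\<lambda>\<xi>. Pmul k \<xi> * fourier f \<xi>" and ?\<phi> = "mult_op (Pmul k) f"
  note F2 = fourier_L2[OF f]
  have [measurable]: "fourier f \<in> borel_measurable borel" using F2 by auto
  have \<phi>: "?\<phi> = IFT ?h" by (simp add: mult_op_def[abs_def])
  obtain d where d: "\<And>\<xi>. cmod (Pmul k \<xi>) * w \<xi> \<le> d" by (rule Pmul_bounded[OF k]) blast
  note h = Pmul_mult(1)[OF k F2] and hi = Pmul_mult(2)[OF k F2]
  have \<phi>2: "?\<phi> \<in> L2" unfolding \<phi> by (rule IFT_L2[OF h hi])
  show F: "AE \<xi> in lborel. fourier ?\<phi> \<xi> = ?h \<xi>" unfolding \<phi> by (rule fourier_IFT[OF h hi])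
  have [measurable]: "fourier ?\<phi> \<in> borel_measurable borel" using fourier_L2[OF \<phi>2] by auto
  show "?\<phi> \<in> Lax_dom"
    unfolding Lax_dom_iff
  proof (intro conjI \<phi>2)
    have "AE \<xi> in lborel. \<xi> \<noteq> (0::real)" by (rule AE_lborel_singleton)
    then show "AE \<xi> in lborel. \<xi> \<le> 0 \<longrightarrow> fourier ?\<phi> \<xi> = 0" using F by eventually_elim (auto simp: Pmul_def)
    have "cmod (of_real \<xi> * Pmul k \<xi>) \<le> d" for \<xi>
    proof -
      have "cmod (of_real \<xi> * Pmul k \<xi>) \<le> cmod (Pmul k \<xi>) * w \<xi>"
          by (simp add: norm_mult w_def mult.commute mult_right_mono)
      then show ?thesis using d[of \<xi>] by linarith
    qed
    then have "(\<lambda>\<xi>. of_real \<xi> * Pmul k \<xi> * fourier f \<xi>) \<in> L2" by (intro L2_bounded_mult(1)[OF F2]) auto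
    then show "(\<lambda>\<xi>. of_real \<xi> * fourier ?\<phi> \<xi>) \<in> L2"
      by (rule L2_cong_AE) (use F in \<open>auto elim: eventually_mono\<close>)
  qed
qed

lemma mult_op_Pmul_norm:
  assumes k: "off k"
  obtains C where "0 \<le> C" "\<And>f. f \<in> L2 \<Longrightarrow> L2_norm (mult_op (Pmul k) f) \<le> C * L2_norm f"
proof -
  obtain d where d: "0 < d" "\<And>\<xi>. cmod (Pmul k \<xi>) \<le> d" by (rule Pmul_bounded[OF k]) blast
  have "L2_norm (mult_op (Pmul k) f) \<le> d * L2_norm f" if f: "f \<in> L2" for f
  proof -
    note \<phi> = mult_op_Pmul[OF k f] and F2 = fourier_L2[OF f]
    have \<phi>2: "mult_op (Pmul k) f \<in> L2" using \<phi>(1) by (simp add: Lax_dom_iff)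
    have [measurable]: "fourier f \<in> borel_measurable borel"
        "fourier (mult_op (Pmul k) f) \<in> borel_measurable borel"
      using F2 fourier_L2[OF \<phi>2] by auto
    have "L2_norm (fourier (mult_op (Pmul k) f)) = L2_norm (\<lambda>\<xi>. Pmul k \<xi> * fourier f \<xi>)"
      by (rule L2_norm_cong_AE[OF _ _ \<phi>(2)]) measurable
    also have "\<dots> \<le> d * L2_norm (fourier f)" by (rule L2_bounded_mult(2)[OF F2 _ d(2)]) measurable
    finally have "sqrt (2 * pi) * L2_norm (mult_op (Pmul k) f) \<le> sqrt (2 * pi) * (d * L2_norm f)"
      by (simp add: fourier_Plancherel[OF \<phi>2] fourier_Plancherel[OF f] mult_ac)
    then show ?thesis by (rule mult_left_le_imp_le) simp
  qed
  then show ?thesis using that[of d] d(1) by simp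
qed

text \<open>The resolvent equation in Lippmann-Schwinger form, the bridge between the operator and
  the integral equation. On the Fourier side it is division by \<open>\<xi> - k\<close> on the
  positive half line.\<close>

lemma Lax_eq_mult_op:
  assumes u: "(\<lambda>x. complex_of_real (u x)) \<in> L2" and k: "off k" and \<phi>: "\<phi> \<in> Lax_dom" and f: "f \<in> Hardy"
  shows "(AE x in lborel. Lax u \<phi> x - k * \<phi> x = f x) \<longleftrightarrow> (AE x in lborel. \<phi> x
      = mult_op (Pmul k) (\<lambda>x. f x + of_real (u x) * \<phi> x) x)"
proof -
  let ?g = "\<lambda>x. f x + of_real (u x) * \<phi> x" and ?Fu = "fourier (\<lambda>x. of_real (u x) * \<phi> x)"
  have f2: "f \<in> L2" and f0: "AE \<xi> in lborel. \<xi> \<le> 0 \<longrightarrow> fourier f \<xi> = 0" using f by (auto simp: Hardy_iff)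
  have \<phi>2: "\<phi> \<in> L2" and \<phi>0: "AE \<xi> in lborel. \<xi> \<le> 0 \<longrightarrow> fourier \<phi> \<xi> = 0" using \<phi> by (auto simp: Lax_dom_iff)
  note u2 = Lax_dom_potential_L2[OF u \<phi>]
  have g2: "?g \<in> L2" by (intro L2_add f2 u2)
  have Fg: "AE \<xi> in lborel. fourier ?g \<xi> = fourier f \<xi> + ?Fu \<xi>" using fourier_add_cmult[OF f2 u2, of 1]
      by simp
  let ?M = "mult_op (Pmul k) ?g"
  note M = mult_op_Pmul[OF k g2]
  have M2: "?M \<in> L2" using M(1) by (simp add: Lax_dom_iff)
  have [measurable]: "\<phi> \<in> borel_measurable borel" "?M \<in> borel_measurable borel"
    "fourier \<phi> \<in> borel_measurable borel" "fourier ?g \<in> borel_measurable borel"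
        using \<phi>2 M2 fourier_L2[OF \<phi>2] fourier_L2[OF g2] by auto
  have nz: "AE \<xi> in lborel. \<xi> \<noteq> (0::real)" by (rule AE_lborel_singleton)
  \<comment> \<open>For negative \<xi> everything vanishes by the support conditions. The point 0 is
    excluded because \<open>Pmul\<close> includes it while the Hardy projection does not.\<close>
  have pw: "((of_real \<xi> - k) * p - indicator {0<..} \<xi> * v = a) \<longleftrightarrow> p = Pmul k \<xi> * (a + v)"
    if "\<xi> \<le> 0 \<longrightarrow> a = 0" "\<xi> \<le> 0 \<longrightarrow> p = 0" "\<xi> \<noteq> 0" for \<xi> p v a
  proof (cases "\<xi> > 0")
    case True
    then have "of_real \<xi> - k \<noteq> 0" using off_ne[OF k, of \<xi>] by simp
    then show ?thesis using True by (auto simp: Pmul_def field_simps)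
  qed (use that in \<open>auto simp: Pmul_def\<close>)
  have "(AE x in lborel. Lax u \<phi> x - k * \<phi> x = f x) \<longleftrightarrow>
    (AE \<xi> in lborel. (of_real \<xi> - k) * fourier \<phi> \<xi> - indicator {0<..} \<xi> * ?Fu \<xi> = fourier f \<xi>)"
    by (rule Lax_eq_iff[OF u \<phi> f2])
  also have "\<dots> \<longleftrightarrow> (AE \<xi> in lborel. fourier \<phi> \<xi> = Pmul k \<xi> * fourier ?g \<xi>)"
  proof
    assume "AE \<xi> in lborel. (of_real \<xi> - k) * fourier \<phi> \<xi> - indicator {0<..} \<xi> * ?Fu \<xi> = fourier f \<xi>"
    then show "AE \<xi> in lborel. fourier \<phi> \<xi> = Pmul k \<xi> * fourier ?g \<xi>"
      using f0 \<phi>0 Fg nz by eventually_elim (use pw in auto)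
  next
    assume "AE \<xi> in lborel. fourier \<phi> \<xi> = Pmul k \<xi> * fourier ?g \<xi>"
    then show "AE \<xi> in lborel. (of_real \<xi> - k) * fourier \<phi> \<xi> - indicator {0<..} \<xi> * ?Fu \<xi> = fourier f \<xi>"
      using f0 \<phi>0 Fg nz
    proof eventually_elim
      case (elim \<xi>)
      show ?case using pw[OF elim(2,3,5)] elim(1,4) by simp
    qed
  qed
  also have "\<dots> \<longleftrightarrow> (AE x in lborel. \<phi> x = ?M x)"
  proof
    assume "AE \<xi> in lborel. fourier \<phi> \<xi> = Pmul k \<xi> * fourier ?g \<xi>"
    then have "IFT (fourier \<phi>) = ?M" unfolding mult_op_def[abs_def] by (intro IFT_cong_AE) auto
    then show "AE x in lborel. \<phi> x = ?M x" using Lax_dom_bounded(2)[OF \<phi>] by simp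
  next
    assume "AE x in lborel. \<phi> x = ?M x"
    then have "fourier \<phi> = fourier ?M" by (intro fourier_cong_AE) auto
    then show "AE \<xi> in lborel. fourier \<phi> \<xi> = Pmul k \<xi> * fourier ?g \<xi>" using M(2) by simp
  qed
  finally show ?thesis .
qed

lemma zero_Hardy: "(\<lambda>x. 0) \<in> Hardy"
proof -
  have "AE \<xi> in lborel. fourier (\<lambda>x. 0) \<xi> = 0" using fourier_diff[OF L2_zero L2_zero] by simp
  then show ?thesis unfolding Hardy_iff by (auto elim: eventually_mono)
qed

context potential
begin

lemma conv_dom_Off_edge [simp]: "Off_edge k \<in> conv_dom \<longleftrightarrow> off k"
  by (auto simp: conv_dom_def cut_domain_def)

lemma conv_dom_On_edge [simp]: "On_edge e l \<in> conv_dom \<longleftrightarrow> 0 < l"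
  by (auto simp: conv_dom_def cut_domain_def)

lemma norm_bw_le:
  assumes "\<And>x. isCont \<beta> x" "\<And>x. cmod (\<beta> x) \<le> B" shows "norm (bw \<beta>) \<le> B"
proof (rule norm_bound)
  fix x
  have "w x powr (- \<sigma>) * cmod (\<beta> x) \<le> 1 * B" by (intro mult_mono w_neg_powr_le_1 assms(2)) auto
  then show "cmod (bw \<beta> x) \<le> B" by (simp add: bw_apply[OF assms] norm_mult)
qed

text \<open>One estimate with two uses: \<open>g = 0\<close> gives uniqueness, and \<open>g\<close>
  equal to the image of \<psi> under the operator gives the resolvent bound. The sup norm lower
  bound of \<open>1 - Kb\<close> first controls the weighted size of \<psi>, hence \<open>u\<close>
  times \<psi> in \<open>L2\<close>, and then the free resolvent controls \<psi>.\<close>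

lemma regular_apriori:
  assumes k: "off k" and reg: "regular (Off_edge k)"
  obtains C where "\<And>\<psi> g. \<psi> \<in> borel_measurable borel \<Longrightarrow> g \<in> L2 \<Longrightarrow> (\<lambda>x. of_real (u x) * \<psi> x) \<in> L2 \<Longrightarrow>
    (AE x in lborel. \<psi> x = mult_op (Pmul k) (\<lambda>x. g x + of_real (u x) * \<psi> x) x) \<Longrightarrow> L2_norm \<psi> \<le> C * L2_norm g"
proof -
  obtain c where c: "0 < c" "\<And>v. c * norm v \<le> norm (v - Kb (Off_edge k) v)" using regular_lower[OF reg]
      by blast
  obtain D where D: "0 \<le> D" "\<And>f. f \<in> L2 \<Longrightarrow> L2_norm (mult_op (Pmul k) f) \<le> D * L2_norm f"
    by (rule mult_op_Pmul_norm[OF k]) blast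
  let ?P = "Pmul k" and ?p = "L2_norm (Pmul k)"
  note P = Pmul_L2[OF k]
  show thesis
  proof (rule that[of "D * (1 + ?p / c * u_norm)"])
    fix \<psi> g assume [measurable]: "\<psi> \<in> borel_measurable borel" and g: "g \<in> L2"
        and u\<psi>: "(\<lambda>x. of_real (u x) * \<psi> x) \<in> L2"
      and eq: "AE x in lborel. \<psi> x = mult_op ?P (\<lambda>x. g x + of_real (u x) * \<psi> x) x"
    let ?g = "\<lambda>x. g x + of_real (u x) * \<psi> x"
    \<comment> \<open>The continuous representative of \<psi>, bounded as the image of a multiplier;
      only it can be fed to \<open>Kb\<close>.\<close>
    define \<phi> where "\<phi> = mult_op ?P ?g"
    have g2: "?g \<in> L2" by (intro L2_add g u\<psi>)
    have \<phi>c: "isCont \<phi> x" for x unfolding \<phi>_def by (rule isCont_mult_op[OF P g2])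
    have \<phi>b: "cmod (\<phi> x) \<le> ?p * L2_norm ?g" for x unfolding \<phi>_def by (rule mult_op_bound[OF P g2])
    have [measurable]: "\<phi> \<in> borel_measurable borel"
      using \<phi>c by (intro borel_measurable_continuous_onI continuous_at_imp_continuous_on) auto
    define v where "v = bw \<phi>"
    have v: "apply_bcontfun v = (\<lambda>x. of_real (w x powr (- \<sigma>)) * \<phi> x)" unfolding v_def
        by (rule bw_apply[OF \<phi>c \<phi>b])
    have Uv: "U v = (\<lambda>x. of_real (u x) * \<phi> x)" by (auto simp: U_def v)
    have Uv2: "U v \<in> L2" by (rule L2w_L2(1)[OF U_bcontfun(1) s1_nonneg])
    have u\<phi>: "AE x in lborel. of_real (u x) * \<psi> x = U v x" using eq by eventually_elim (simp add: Uv \<phi>_def)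
    have "fourier ?g = fourier (\<lambda>x. g x + 1 * U v x)"
      by (rule fourier_cong_AE) (use u\<phi> L2_measurable[OF g] L2_measurable[OF Uv2] in \<open>auto elim:
        eventually_mono\<close>)
    then have \<phi>': "\<phi> = mult_op ?P (\<lambda>x. g x + 1 * U v x)" by (simp add: \<phi>_def mult_op_def[abs_def])
    have \<phi>_eq: "\<phi> x = mult_op ?P g x + mult_op ?P (U v) x" for x
      using fun_cong[OF \<phi>', of x] mult_op_add_cmult[OF P g Uv2, of 1 x] by simp
    have "norm (v - Kb (Off_edge k) v) \<le> ?p * L2_norm g"
    proof (rule norm_bound)
      fix x
      have Kx: "Kb (Off_edge k) v x = of_real (w x powr (- \<sigma>)) * mult_op ?P (U v) x"
        using fun_cong[OF Kb_apply[of "Off_edge k" v], of x] k by (simp add: K_def convol_G[OF k Uv2])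
      have "(v - Kb (Off_edge k) v) x = of_real (w x powr (- \<sigma>)) * mult_op ?P g x"
        unfolding minus_bcontfun.rep_eq Kx fun_cong[OF v, of x] \<phi>_eq[of x] distrib_left
          by (rule add_diff_cancel_right')
      then have "cmod ((v - Kb (Off_edge k) v) x) = w x powr (- \<sigma>) * cmod (mult_op ?P g x)"
        by (simp add: norm_mult)
      also have "\<dots> \<le> 1 * (?p * L2_norm g)" by (intro mult_mono w_neg_powr_le_1 mult_op_bound P g) auto
      finally show "cmod ((v - Kb (Off_edge k) v) x) \<le> ?p * L2_norm g" by simp
    qed
    then have nv: "norm v \<le> ?p * L2_norm g / c" using c(2)[of v] c(1) by (simp add: field_simps)
    have "L2_norm \<psi> = L2_norm \<phi>"
    proof (rule L2_norm_cong_AE)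
      show "AE x in lborel. \<psi> x = \<phi> x" using eq by (simp add: \<phi>_def)
    qed measurable
    also have "\<dots> \<le> D * L2_norm (\<lambda>x. g x + 1 * U v x)" unfolding \<phi>'
        by (intro D(2) L2_add g) (use Uv2 in simp)
    also have "\<dots> \<le> D * (L2_norm g + norm v * u_norm)"
    proof (rule mult_left_mono[OF _ D(1)])
      have "L2_norm (U v) \<le> norm v * u_norm"
          using L2w_L2(2)[OF U_bcontfun(1) s1_nonneg, of v] U_bcontfun(2)[of v] by linarith
      then show "L2_norm (\<lambda>x. g x + 1 * U v x) \<le> L2_norm g + norm v * u_norm" using L2_Minkowski[OF g Uv2]
          by simp
    qed
    also have "\<dots> \<le> D * (L2_norm g + ?p * L2_norm g / c * u_norm)"
      by (intro mult_left_mono add_left_mono mult_right_mono nv D(1)) auto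
    also have "\<dots> = D * (1 + ?p / c * u_norm) * L2_norm g" by (simp add: algebra_simps)
    finally show "L2_norm \<psi> \<le> D * (1 + ?p / c * u_norm) * L2_norm g" .
  qed
qed

text \<open>Existence comes from solving the integral equation with the free resolvent of
  \<open>f\<close> as source; the solution then lies in the domain because it is itself in the range
  of the free resolvent.\<close>

lemma resolvent_if_regular:
  assumes k: "off k" and reg: "regular (Off_edge k)"
  shows "k \<in> Lax_resolvent_set u"
proof (rule regular_apriori[OF k reg])
  fix C assume C: "\<And>\<psi> g. \<psi> \<in> borel_measurable borel \<Longrightarrow> g \<in> L2 \<Longrightarrow> (\<lambda>x. of_real (u x) * \<psi> x) \<in> L2 \<Longrightarrow>
    (AE x in lborel. \<psi> x = mult_op (Pmul k) (\<lambda>x. g x + of_real (u x) * \<psi> x) x) \<Longrightarrow> L2_norm \<psi> \<le> C * L2_norm g"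
  note P = Pmul_L2[OF k]
  have A: "\<exists>\<phi>\<in>Lax_dom. (AE x in lborel. Lax u \<phi> x - k * \<phi> x = f x) \<and>
        (\<forall>\<phi>'\<in>Lax_dom. (AE x in lborel. Lax u \<phi>' x - k * \<phi>' x = f x) \<longrightarrow> (AE x in lborel. \<phi>' x = \<phi>
            x))" if f: "f \<in> Hardy" for f
  proof -
    have f2: "f \<in> L2" using f by (simp add: Hardy_iff)
    define b where "b = mult_op (Pmul k) f"
    define \<phi> where "\<phi> = msol (Off_edge k) b"
    have u\<phi>: "(\<lambda>x. of_real (u x) * \<phi> x) \<in> L2"
      unfolding \<phi>_def U_msol[symmetric] by (rule L2w_L2(1)[OF U_bcontfun(1) s1_nonneg])
    have \<phi>_eq: "\<phi> = mult_op (Pmul k) (\<lambda>x. f x + of_real (u x) * \<phi> x)"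
    proof
      fix x
      have "\<phi> x = b x + convol (G_cut (Off_edge k)) (\<lambda>x. of_real (u x) * \<phi> x) x"
        unfolding \<phi>_def by (rule msol_eq[OF reg]) (auto simp: b_def intro!: isCont_mult_op[OF P f2]
          mult_op_bound[OF P f2])
      then show "\<phi> x = mult_op (Pmul k) (\<lambda>x. f x + of_real (u x) * \<phi> x) x"
        using mult_op_add_cmult[OF P f2 u\<phi>, of 1 x] by (simp add: convol_G[OF k u\<phi>] b_def)
    qed
    have \<phi>d: "\<phi> \<in> Lax_dom" by (subst \<phi>_eq) (intro mult_op_Pmul(1)[OF k] L2_add f2 u\<phi>)
    have "AE x in lborel. \<phi>' x = \<phi> x" if \<phi>': "\<phi>' \<in> Lax_dom" "AE x in lborel. Lax u \<phi>' x - k * \<phi>' x = f x"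
        for \<phi>'
    proof -
      note u\<phi>' = Lax_dom_potential_L2[OF u_L2 \<phi>'(1)]
      have \<phi>2: "\<phi> \<in> L2" "\<phi>' \<in> L2" using \<phi>d \<phi>'(1) by (auto simp: Lax_dom_iff)
      \<comment> \<open>The difference of two solutions satisfies the equation of the a priori
        estimate with zero data.\<close>
      define \<psi> where "\<psi> x = \<phi>' x - \<phi> x" for x
      have \<psi>2: "\<psi> \<in> L2" unfolding \<psi>_def[abs_def] by (intro L2_diff \<phi>2)
      have u\<psi>: "(\<lambda>x. of_real (u x) * \<psi> x) = (\<lambda>x. of_real (u x) * \<phi>' x + (-1) * (of_real (u x) * \<phi> x))"
        by (auto simp: \<psi>_def algebra_simps)
      have "AE x in lborel. \<phi>' x = mult_op (Pmul k) (\<lambda>x. f x + of_real (u x) * \<phi>' x) x"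
        using \<phi>'(2) Lax_eq_mult_op[OF u_L2 k \<phi>'(1) f] by simp
      then have "AE x in lborel. \<psi> x = mult_op (Pmul k) (\<lambda>x. 0 + of_real (u x) * \<psi> x) x"
      proof eventually_elim
        case (elim x)
        have 1: "\<phi>' x = mult_op (Pmul k) f x + mult_op (Pmul k) (\<lambda>x. of_real (u x) * \<phi>' x) x"
          using elim mult_op_add_cmult[OF P f2 u\<phi>', of 1 x] by simp
        have 2: "\<phi> x = mult_op (Pmul k) f x + mult_op (Pmul k) (\<lambda>x. of_real (u x) * \<phi> x) x"
          using fun_cong[OF \<phi>_eq, of x] mult_op_add_cmult[OF P f2 u\<phi>, of 1 x] by simp
        show ?case unfolding add_0 u\<psi> mult_op_add_cmult[OF P u\<phi>' u\<phi>] using 1 2 by (simp add: \<psi>_def)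
      qed
      then have "L2_norm \<psi> \<le> C * L2_norm (\<lambda>x. 0)"
        by (intro C) (use \<psi>2 in \<open>auto simp: u\<psi> intro!: L2_diff u\<phi> u\<phi>'\<close>)
      then have "L2_norm \<psi> = 0" using L2_norm_nonneg[of \<psi>] by simp
      from L2_norm_eq_0[OF \<psi>2 this] show ?thesis by eventually_elim (simp add: \<psi>_def)
    qed
    then show ?thesis using \<phi>d Lax_eq_mult_op[OF u_L2 k \<phi>d f] \<phi>_eq by (intro bexI[of _ \<phi>]) auto
  qed
  have B: "L2_norm \<phi> \<le> C * L2_norm (\<lambda>x. Lax u \<phi> x - k * \<phi> x)" if \<phi>: "\<phi> \<in> Lax_dom" for \<phi>
  proof -
    have "AE x in lborel. \<phi> x = mult_op (Pmul k) (\<lambda>x. (Lax u \<phi> x - k * \<phi> x) + of_real (u x) * \<phi> x) x"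
      using Lax_eq_mult_op[OF u_L2 k \<phi> Lax_Hardy[OF u_L2 \<phi>], of k] by simp
    then show ?thesis
      by (intro C Lax_fourier(1)[OF u_L2 \<phi>] Lax_dom_potential_L2[OF u_L2 \<phi>]) (use \<phi> in \<open>auto simp:
        Lax_dom_iff\<close>)
  qed
  show ?thesis unfolding Lax_resolvent_set_def using A B by blast
qed

text \<open>Off the cut a fixed point of \<open>Kb\<close> is, up to the weight, the free resolvent
  of an \<open>L2\<close> function, so it lies in the domain automatically. It is then an
  eigenfunction and is excluded by the resolvent bound.\<close>

lemma regular_if_resolvent:
  assumes k: "k \<in> Lax_resolvent_set u"
  shows "off k" "regular (Off_edge k)"
proof -
  show ok: "off k"
  proof (rule ccontr)
    assume "\<not> off k"
    then have "k = of_real (Re k)" "0 \<le> Re k" by (auto simp: off_def complex_eq_iff)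
    then show False using resolvent_not_nonneg[OF u_L2, of "Re k"] k by simp
  qed
  obtain C where C: "\<And>\<phi>. \<phi> \<in> Lax_dom \<Longrightarrow> L2_norm \<phi> \<le> C * L2_norm (\<lambda>x. Lax u \<phi> x - k * \<phi> x)"
    using k by (auto simp: Lax_resolvent_set_def)
  show "regular (Off_edge k)"
    unfolding regular_def
  proof (intro conjI allI impI)
    show "Off_edge k \<in> conv_dom" using ok by simp
    fix v assume v: "Kb (Off_edge k) v = v"
    define m where "m = mult_op (Pmul k) (U v)"
    have U2: "U v \<in> L2" by (rule L2w_L2(1)[OF U_bcontfun(1) s1_nonneg])
    have vm: "apply_bcontfun v x = of_real (w x powr (- \<sigma>)) * m x" for x
      using fun_cong[OF Kb_apply[of "Off_edge k" v], of x] v ok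
        by (simp add: K_def m_def convol_G[OF ok U2])
    have Um: "U v = (\<lambda>x. of_real (u x) * m x)" by (auto simp: U_def vm)
    have md: "m \<in> Lax_dom" unfolding m_def by (rule mult_op_Pmul(1)[OF ok U2])
    have "AE x in lborel. m x = mult_op (Pmul k) (\<lambda>x. 0 + of_real (u x) * m x) x"
        by (simp flip: Um) (simp flip: m_def)
    then have L0: "AE x in lborel. Lax u m x - k * m x = 0" using Lax_eq_mult_op[OF u_L2 ok md zero_Hardy]
        by simp
    have "L2_norm (\<lambda>x. Lax u m x - k * m x) = L2_norm (\<lambda>x. 0)"
      by (rule L2_norm_cong_AE[OF _ _ L0]) (use Lax_fourier(1)[OF u_L2 md, of k] in auto)
    then have "L2_norm m = 0" using C[OF md] L2_norm_nonneg[of m] by simp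
    moreover have "m \<in> L2" using md by (simp add: Lax_dom_iff)
    ultimately have "AE x in lborel. m x = 0" by (intro L2_norm_eq_0)
    then have "m x = 0" for x by (rule AE_0_isCont) (simp add: m_def isCont_mult_op[OF Pmul_L2[OF ok] U2])
    then show "v = 0" by (intro bcontfun_eqI) (simp add: vm)
  qed
qed

lemma cut_domain_regular:
  assumes "q \<in> cut_domain (Lax_resolvent_set u)" shows "regular q"
  using assms regular_if_resolvent(2) regular_On_edge by (auto simp: cut_domain_def)

text \<open>Openness is inherited from \<open>regular\<close> through the equivalence of the two
  notions off the cut.\<close>

lemma open_resolvent: "open (Lax_resolvent_set u)"
  unfolding open_contains_ball
proof
  fix k assume k: "k \<in> Lax_resolvent_set u"
  show "\<exists>r>0. ball k r \<subseteq> Lax_resolvent_set u"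
  proof (rule regular_nbhd[OF regular_if_resolvent(2)[OF k]], rule Pmul_diff_norm[OF
      regular_if_resolvent(1)[OF k]])
    fix r r' assume r: "0 < r" "0 < r'" and reg: "\<And>q. q \<in> conv_dom \<inter> cut_nbhd (Off_edge k) r \<Longrightarrow> regular q"
      and off: "\<And>z. z \<in> ball k r' \<Longrightarrow> off z"
    have "z \<in> Lax_resolvent_set u" if z: "z \<in> ball k (min r r')" for z
      by (intro resolvent_if_regular reg off) (use z off[of z] in auto)
    then show ?thesis using r by (intro exI[of _ "min r r'"]) auto
  qed
qed

section \<open>From operators to solutions\<close>

lemma msol_diff_norm: "Linfw_norm (- \<sigma>) (\<lambda>x. msol q \<beta> x - msol q' \<beta>' x)
    \<le> ennreal (norm (sol q (bw \<beta>) - sol q' (bw \<beta>')))"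
proof (rule Linfw_normI)
  show "(\<lambda>x. msol q \<beta> x - msol q' \<beta>' x) \<in> borel_measurable borel" by measurable
  show "AE x in lborel. w x powr (- \<sigma>) * cmod (msol q \<beta> x - msol q' \<beta>' x)
      \<le> norm (sol q (bw \<beta>) - sol q' (bw \<beta>'))"
  proof (rule AE_I2)
    fix x
    let ?d = "sol q (bw \<beta>) - sol q' (bw \<beta>')"
    have "msol q \<beta> x - msol q' \<beta>' x = of_real (w x powr \<sigma>) * ?d x"
      by (simp add: msol_def minus_bcontfun.rep_eq right_diff_distrib)
    then have "w x powr (- \<sigma>) * cmod (msol q \<beta> x - msol q' \<beta>' x) = (w x powr (- \<sigma>) * w x powr \<sigma>)
        * cmod (?d x)" by (simp add: norm_mult)
    also have "\<dots> \<le> norm ?d" using norm_bounded[of ?d x] by simp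
    finally show "w x powr (- \<sigma>) * cmod (msol q \<beta> x - msol q' \<beta>' x) \<le> norm ?d" .
  qed
qed

text \<open>The source may vary together with the parameter, with constant \<open>L\<close>: it is 0
  for the constant source and 2 for the plane wave.\<close>

lemma msol_Holder:
  assumes p: "regular p"
  obtains r c C where "0 < r" "\<And>q q' \<beta> \<beta>' L. q \<in> conv_dom \<inter> cut_nbhd p r \<Longrightarrow> q' \<in> conv_dom \<inter> cut_nbhd p r \<Longrightarrow>
    norm (bw \<beta> - bw \<beta>') \<le> L * cut_dist q q' powr \<gamma> \<Longrightarrow> norm (bw \<beta>') \<le> 1 \<Longrightarrow>
    Linfw_norm (- \<sigma>) (\<lambda>x. msol q \<beta> x - msol q' \<beta>' x) \<le> ennreal ((L + C) / c * cut_dist q q' powr \<gamma>)"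
proof (rule regular_nbhd[OF p])
  fix r c C assume r: "0 < r" and c: "0 < c" and C: "0 \<le> C" and reg: "\<And>q. q \<in> conv_dom \<inter> cut_nbhd p r \<Longrightarrow>
      regular q"
    and low: "\<And>q v. q \<in> conv_dom \<inter> cut_nbhd p r \<Longrightarrow> c * norm v \<le> norm (v - Kb q v)"
    and H: "\<And>q q' v. q \<in> conv_dom \<inter> cut_nbhd p r \<Longrightarrow> q' \<in> conv_dom \<inter> cut_nbhd p r \<Longrightarrow>
      norm (Kb q v - Kb q' v) \<le> C * cut_dist q q' powr \<gamma> * norm v"
  show thesis
  proof (rule that[of r "C * (1 / c)" c, OF r])
    fix q q' \<beta> \<beta>' L assume q: "q \<in> conv_dom \<inter> cut_nbhd p r" "q' \<in> conv_dom \<inter> cut_nbhd p r"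
      and b: "norm (bw \<beta> - bw \<beta>') \<le> L * cut_dist q q' powr \<gamma>" "norm (bw \<beta>') \<le> 1"
    have "norm (sol q (bw \<beta>) - sol q' (bw \<beta>')) \<le> (L + C * (1 / c)) / c * cut_dist q q' powr \<gamma>"
      by (rule sol_diff[OF reg[OF q(1)] reg[OF q(2)] low[OF q(1)] low[OF q(2)] c H[OF q] b C]) simp
    then show "Linfw_norm (- \<sigma>) (\<lambda>x. msol q \<beta> x - msol q' \<beta>' x)
        \<le> ennreal ((L + C * (1 / c)) / c * cut_dist q q' powr \<gamma>)"
      by (intro order_trans[OF msol_diff_norm] ennreal_leI)
  qed
qed

section \<open>Regularity of the solutions\<close>

lemma bw_one: "apply_bcontfun (bw (\<lambda>x. 1)) x = of_real (w x powr (- \<sigma>))" "norm (bw (\<lambda>x. 1)) \<le> 1"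
  using bw_apply[of "\<lambda>x. 1" 1] norm_bw_le[of "\<lambda>x. 1" 1] by auto

lemma bw_exp: "norm (bw (\<lambda>x. exp (\<i> * of_real (l * x)))) \<le> 1"
  by (rule norm_bw_le) (auto intro!: continuous_intros)

text \<open>In the plain sup norm the plane waves do not depend continuously on the frequency. The
  growth of their difference, of order \<gamma>, is compensated by the weight.\<close>

lemma bw_exp_diff: "norm (bw (\<lambda>x. exp (\<i> * of_real (l * x))) - bw (\<lambda>x. exp (\<i> * of_real (l' * x))))
    \<le> 2 * \<bar>l - l'\<bar> powr \<gamma>"
proof (rule norm_bound)
  fix x
  have e: "apply_bcontfun (bw (\<lambda>x. exp (\<i> * of_real (l * x)))) x = of_real (w x powr (- \<sigma>)) * cis (l * x)"
      for l
    by (subst bw_apply[where B = 1]) (auto intro!: continuous_intros simp: cis_conv_exp)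
  have "cis (l * x) - cis (l' * x) = cis (l' * x) * (cis ((l - l') * x) - 1)"
      by (simp add: right_diff_distrib cis_mult left_diff_distrib)
  then have c: "cmod (cis (l * x) - cis (l' * x)) = cmod (cis ((l - l') * x) - 1)" by (simp add: norm_mult)
  have "cmod (cis (l * x) - cis (l' * x)) \<le> 2 * \<bar>(l - l') * x\<bar> powr \<gamma>"
    unfolding c by (intro min_powr_bound cmod_cis_diff_1) (use gamma in auto)
  also have "\<dots> = 2 * \<bar>l - l'\<bar> powr \<gamma> * \<bar>x\<bar> powr \<gamma>" by (simp add: abs_mult powr_mult)
  also have "\<dots> \<le> 2 * \<bar>l - l'\<bar> powr \<gamma> * w x powr \<gamma>" using gamma
      by (intro mult_left_mono powr_mono2) (auto simp: w_def)
  finally have "w x powr (- \<sigma>) * cmod (cis (l * x) - cis (l' * x))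
      \<le> w x powr (- \<sigma>) * (2 * \<bar>l - l'\<bar> powr \<gamma> * w x powr \<gamma>)"
    by (rule mult_left_mono) simp
  also have "\<dots> = (w x powr (- \<sigma>) * w x powr \<gamma>) * (2 * \<bar>l - l'\<bar> powr \<gamma>)" by (simp only: mult_ac)
  also have "\<dots> \<le> 1 * (2 * \<bar>l - l'\<bar> powr \<gamma>)" by (intro mult_right_mono w_neg_gamma) auto
  finally show "cmod ((bw (\<lambda>x. exp (\<i> * of_real (l * x))) - bw (\<lambda>x. exp (\<i> * of_real (l' * x)))) x)
      \<le> 2 * \<bar>l - l'\<bar> powr \<gamma>"
    unfolding minus_bcontfun.rep_eq e right_diff_distrib[symmetric] by (simp add: norm_mult)
qed

lemma m1_Holder:
  "loc_Holder_Linfw (- \<sigma>) \<gamma> cut_nbhd (\<lambda>p q. dist (cut_pos p) (cut_pos q)) (cut_domain (Lax_resolvent_set u))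
      (\<lambda>q. msol q (\<lambda>x. 1))"
  unfolding loc_Holder_Linfw_def
proof (intro conjI ballI msol_Linfw)
  let ?A = "cut_domain (Lax_resolvent_set u)"
  fix p assume p: "p \<in> ?A"
  have cd: "q \<in> conv_dom" if "q \<in> ?A" for q using cut_domain_regular[OF that] by (simp add: regular_def)
  show "\<exists>r>0. \<exists>C. \<forall>q\<in>?A \<inter> cut_nbhd p r. \<forall>q'\<in>?A \<inter> cut_nbhd p r.
      Linfw_norm (- \<sigma>) (\<lambda>x. msol q (\<lambda>x. 1) x - msol q' (\<lambda>x. 1) x) \<le> ennreal (C * dist (cut_pos q) (cut_pos
          q') powr \<gamma>)"
  proof (rule msol_Holder[OF cut_domain_regular[OF p]])
    fix r c C assume r: "0 < r" and H: "\<And>q q' \<beta> \<beta>' L. q \<in> conv_dom \<inter> cut_nbhd p r \<Longrightarrow>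
        q' \<in> conv_dom \<inter> cut_nbhd p r \<Longrightarrow>
      norm (bw \<beta> - bw \<beta>') \<le> L * cut_dist q q' powr \<gamma> \<Longrightarrow> norm (bw \<beta>') \<le> 1 \<Longrightarrow>
      Linfw_norm (- \<sigma>) (\<lambda>x. msol q \<beta> x - msol q' \<beta>' x) \<le> ennreal ((L + C) / c * cut_dist q q' powr \<gamma>)"
    have "Linfw_norm (- \<sigma>) (\<lambda>x. msol q (\<lambda>x. 1) x - msol q' (\<lambda>x. 1) x)
        \<le> ennreal ((0 + C) / c * cut_dist q q' powr \<gamma>)"
      if "q \<in> ?A \<inter> cut_nbhd p r" "q' \<in> ?A \<inter> cut_nbhd p r" for q q'
      by (rule H) (use that cd bw_one(2) in auto)
    then show ?thesis using r unfolding cut_dist_def by blast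
  qed
qed

lemma me_Holder:
  "loc_Holder_Linfw (- \<sigma>) \<gamma> ball dist {0<..} (\<lambda>l. msol (On_edge e l) (\<lambda>x. exp (\<i> * of_real (l * x))))"
  unfolding loc_Holder_Linfw_def
proof (intro conjI ballI msol_Linfw)
  let ?m = "\<lambda>l. msol (On_edge e l) (\<lambda>x. exp (\<i> * of_real (l * x)))"
  fix p :: real assume p: "p \<in> {0<..}"
  show "\<exists>r>0. \<exists>C. \<forall>q\<in>{0<..} \<inter> ball p r. \<forall>q'\<in>{0<..} \<inter> ball p r.
      Linfw_norm (- \<sigma>) (\<lambda>x. ?m q x - ?m q' x) \<le> ennreal (C * dist q q' powr \<gamma>)"
  proof (rule msol_Holder[OF regular_On_edge[of p e]])
    show "0 < p" using p by simp
    fix r c C assume r: "0 < r" and H: "\<And>q q' \<beta> \<beta>' L. q \<in> conv_dom \<inter> cut_nbhd (On_edge e p) r \<Longrightarrow>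
        q' \<in> conv_dom \<inter> cut_nbhd (On_edge e p) r \<Longrightarrow>
      norm (bw \<beta> - bw \<beta>') \<le> L * cut_dist q q' powr \<gamma> \<Longrightarrow> norm (bw \<beta>') \<le> 1 \<Longrightarrow>
      Linfw_norm (- \<sigma>) (\<lambda>x. msol q \<beta> x - msol q' \<beta>' x) \<le> ennreal ((L + C) / c * cut_dist q q' powr \<gamma>)"
    have d: "cut_dist (On_edge e q) (On_edge e q') = \<bar>q - q'\<bar>" for q q'
      by (simp add: cut_dist_def dist_norm flip: of_real_diff)
    have "Linfw_norm (- \<sigma>) (\<lambda>x. ?m q x - ?m q' x)
        \<le> ennreal ((2 + C) / c * cut_dist (On_edge e q) (On_edge e q') powr \<gamma>)"
      if "q \<in> {0<..} \<inter> ball p r" "q' \<in> {0<..} \<inter> ball p r" for q q'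
      by (rule H) (use that bw_exp bw_exp_diff[of q q'] in \<open>auto simp: d\<close>)
    then show ?thesis using r unfolding d dist_real_def by blast
  qed
qed

text \<open>Formal differentiation of the equation shows that the derivative solves the same
  equation at \<open>k\<close>, with source the multiplier \<open>Pmul k\<close> squared applied to
  \<open>u\<close> times the solution. The remainder of the difference quotient again satisfies an
  equation, now at \<open>z\<close>, whose right-hand side is small.\<close>

lemma m1_derivative:
  assumes k: "k \<in> Lax_resolvent_set u"
  shows "\<exists>D \<in> Linfw (- \<sigma>). ((\<lambda>z. Linfw_norm (- \<sigma>) (\<lambda>x. (msol (Off_edge z) (\<lambda>x. 1) x
      - msol (Off_edge k) (\<lambda>x. 1) x) / (z - k) - D x)) \<longlongrightarrow> 0) (at k)"
proof -
  note ok = regular_if_resolvent(1)[OF k] and reg = regular_if_resolvent(2)[OF k]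
  let ?b = "bw (\<lambda>x. 1)" and ?P2 = "\<lambda>\<xi>. Pmul k \<xi> * Pmul k \<xi>"
  define v where "v z = sol (Off_edge z) ?b" for z
  define f where "f = U (v k)"
  have fw: "f \<in> L2w s1" unfolding f_def by (rule U_bcontfun)
  note f2 = L2w_L2(1)[OF fw s1_nonneg]
  obtain d where d: "\<And>\<xi>. cmod (Pmul k \<xi>) \<le> d" by (rule Pmul_bounded[OF ok]) blast
  have P: "Pmul k \<in> L2" and P2: "?P2 \<in> L2" using Pmul_L2[OF ok] L2_bounded_mult(1)[OF Pmul_L2[OF ok] _ d]
      by auto
  define g where "g = mult_op ?P2 f"
  have gc: "isCont g x" for x unfolding g_def by (rule isCont_mult_op[OF P2 f2])
  have gb: "cmod (g x) \<le> L2_norm ?P2 * L2_norm f" for x unfolding g_def by (rule mult_op_bound[OF P2 f2])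
  define Dv where "Dv = sol (Off_edge k) (bw g)"
  define D where "D = msol (Off_edge k) g"
  have Dx: "D x = of_real (w x powr \<sigma>) * Dv x" for x by (simp add: D_def msol_def Dv_def)
  show ?thesis
  proof (rule regular_nbhd[OF reg], rule Pmul_diff_norm[OF ok])
    fix r c C r' C' assume r: "0 < r" "0 < r'" and c: "0 < c" and C: "0 \<le> C" "0 \<le> C'"
      and regz: "\<And>q. q \<in> conv_dom \<inter> cut_nbhd (Off_edge k) r \<Longrightarrow> regular q"
      and low: "\<And>q v. q \<in> conv_dom \<inter> cut_nbhd (Off_edge k) r \<Longrightarrow> c * norm v \<le> norm (v - Kb q v)"
      and H: "\<And>q q' v. q \<in> conv_dom \<inter> cut_nbhd (Off_edge k) r \<Longrightarrow> q' \<in> conv_dom \<inter> cut_nbhd (Off_edge k) r \<Longrightarrow>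
        norm (Kb q v - Kb q' v) \<le> C * cut_dist q q' powr \<gamma> * norm v"
      and off: "\<And>z. z \<in> ball k r' \<Longrightarrow> off z"
      and quot: "\<And>z. z \<in> ball k r' \<Longrightarrow> z \<noteq> k \<Longrightarrow> L2_norm (\<lambda>\<xi>. (Pmul z \<xi> - Pmul k \<xi>) / (z - k) - ?P2 \<xi>)
          \<le> C' * cmod (z - k)"
    \<comment> \<open>The first term comes from the difference quotient of the multiplier. The
      second comes from replacing \<open>Kb\<close> at \<open>k\<close> by \<open>Kb\<close> at
      \<open>z\<close> in the equation of the derivative, for which the Hoelder bound is
      enough.\<close>
    define h where "h z = (C' * cmod (z - k) * L2_norm f + C * cmod (z - k) powr \<gamma> * norm Dv) / c" for z
    have est: "Linfw_norm (- \<sigma>) (\<lambda>x. (msol (Off_edge z) (\<lambda>x. 1) x - msol (Off_edge k) (\<lambda>x. 1) x) / (z - k)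
        - D x) \<le> ennreal (h z)"
      if z: "z \<in> ball k (min r r')" "z \<noteq> k" for z
    proof -
      let ?q = "Off_edge z" and ?p = "Off_edge k" and ?a = "1 / (z - k)"
      have oz: "off z" using off z by simp
      have zq: "?q \<in> conv_dom \<inter> cut_nbhd ?p r" and kq: "?p \<in> conv_dom \<inter> cut_nbhd ?p r" using oz ok z r
          by auto
      have qp: "?q \<in> conv_dom" "?p \<in> conv_dom" using zq kq by auto
      \<comment> \<open>The quotient involves a complex factor, while the bounded continuous
        functions are used as a real normed space; the remainder is therefore built pointwise and
        then shown to lie in the space.\<close>
      define e where "e x = ?a * (v z x - v k x) - Dv x" for x
      have "e \<in> bcontfun"
      proof (rule bcontfun_normI)
        show "continuous_on UNIV e" unfolding e_def[abs_def] by (intro continuous_intros) auto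
        fix x
        have "cmod (e x) \<le> cmod ?a * cmod ((v z - v k) x) + cmod (Dv x)"
          unfolding e_def norm_mult[symmetric] minus_bcontfun.rep_eq by (rule norm_triangle_ineq4)
        also have "\<dots> \<le> cmod ?a * norm (v z - v k) + norm Dv"
          by (intro add_mono mult_left_mono norm_bounded) auto
        finally show "cmod (e x) \<le> cmod ?a * norm (v z - v k) + norm Dv" .
      qed
      then obtain E where E: "apply_bcontfun E = e" by (metis Bcontfun_inverse)
      have Uw: "U (apply_bcontfun y) \<in> L2w s1" for y by (rule U_bcontfun)
      have vz: "v z x - K ?q (v z) x = of_real (w x powr (- \<sigma>))" for x
        using sol[OF regz[OF zq], of ?b] by (metis Kb_apply[OF qp(1)] bw_one(1) minus_bcontfun.rep_eq v_def)
      have vk: "v k x - K ?p (v k) x = of_real (w x powr (- \<sigma>))" for x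
        using sol[OF reg, of ?b] by (metis Kb_apply[OF qp(2)] bw_one(1) minus_bcontfun.rep_eq v_def)
      have Dvx: "Dv x - K ?p Dv x = of_real (w x powr (- \<sigma>)) * g x" for x
        using sol[OF reg, of "bw g"] bw_apply[OF gc gb]
          by (metis Kb_apply[OF qp(2)] minus_bcontfun.rep_eq Dv_def)
      have Ke: "K ?q e x = ?a * (K ?q (v z) x - K ?q (v k) x) - K ?q Dv x" for x
      proof -
        have e': "e = (\<lambda>x. (- Dv x + ?a * v z x) + (- ?a) * v k x)" by (auto simp: e_def algebra_simps)
        have m: "(\<lambda>x. - Dv x) = apply_bcontfun (- Dv)" by (auto simp: uminus_bcontfun.rep_eq)
        have U1: "U (\<lambda>x. - Dv x) \<in> L2w s1" unfolding m by (rule Uw)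
        have U2: "U (\<lambda>x. - Dv x + ?a * v z x) \<in> L2w s1" unfolding U_add_cmult by (intro L2w_add_cmult U1 Uw)
        \<comment> \<open>Negation is obtained from the linearity rule by writing
          \<open>- Dv\<close> as \<open>Dv\<close> plus \<open>- 2\<close> times
          \<open>Dv\<close>.\<close>
        have "K ?q (\<lambda>x. - Dv x) x = - K ?q Dv x"
          using K_add_cmult[OF qp(1) Uw Uw, of Dv "-2" Dv x] by simp
        then show ?thesis unfolding e' K_add_cmult[OF qp(1) U2 Uw] K_add_cmult[OF qp(1) U1 Uw]
            by (simp add: algebra_simps)
      qed
      have KP: "K ?q (v k) x - K ?p (v k) x = of_real (w x powr (- \<sigma>)) * (mult_op (Pmul z) f x
          - mult_op (Pmul k) f x)" for x
        by (simp add: K_def f_def[symmetric] convol_G[OF oz f2] convol_G[OF ok f2] right_diff_distrib)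
      \<comment> \<open>The equations for the solutions at \<open>z\<close> and \<open>k\<close>
        have the same source, so their contribution cancels and only the two small terms
        remain.\<close>
      have split: "(E - Kb ?q E) x = of_real (w x powr (- \<sigma>)) * mult_op (\<lambda>\<xi>. (Pmul z \<xi> - Pmul k \<xi>) / (z - k)
          - ?P2 \<xi>) f x
          + (Kb ?q Dv - Kb ?p Dv) x" for x
      proof -
        have Pz: "Pmul z \<in> L2" by (rule Pmul_L2[OF oz])
        have Pd: "(\<lambda>\<xi>. Pmul z \<xi> + (-1) * Pmul k \<xi>) \<in> L2" by (intro L2_add L2_cmult Pz P)
        have Pa: "(\<lambda>\<xi>. ?a * (Pmul z \<xi> + (-1) * Pmul k \<xi>)) \<in> L2" by (rule L2_cmult[OF Pd])
        have "mult_op (\<lambda>\<xi>. (Pmul z \<xi> - Pmul k \<xi>) / (z - k) - ?P2 \<xi>) f x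
          = mult_op (\<lambda>\<xi>. ?a * (Pmul z \<xi> + (-1) * Pmul k \<xi>)) f x - g x"
          unfolding g_def mult_op_diff_left[OF Pa P2 f2] by (simp add: diff_divide_distrib)
        also have "mult_op (\<lambda>\<xi>. ?a * (Pmul z \<xi> + (-1) * Pmul k \<xi>)) f x
            = ?a * (mult_op (Pmul z) f x - mult_op (Pmul k) f x)"
          using mult_op_add_cmult_left[OF L2_zero Pd f2, of ?a x] mult_op_add_cmult_left[OF Pz P f2, of
            "-1" x]
          by (simp add: mult_op_def IFT_def)
        finally have M: "of_real (w x powr (- \<sigma>)) * mult_op (\<lambda>\<xi>. (Pmul z \<xi> - Pmul k \<xi>) / (z - k) - ?P2 \<xi>) f
            x
          = ?a * (K ?q (v k) x - K ?p (v k) x) - (Dv x - K ?p Dv x)"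
          unfolding KP Dvx by (simp add: right_diff_distrib)
        have a1: "?a * (v z x - K ?q (v z) x - (v k x - K ?p (v k) x)) = 0" unfolding vz vk by simp
        have "(E - Kb ?q E) x = e x - K ?q e x" by (simp add: minus_bcontfun.rep_eq E Kb_apply[OF qp(1)])
        also have "\<dots> = ?a * (v z x - K ?q (v z) x - (v k x - K ?p (v k) x))
            + (?a * (K ?q (v k) x - K ?p (v k) x) - (Dv x - K ?p Dv x)) + (K ?q Dv x - K ?p Dv x)"
          unfolding Ke e_def by (simp only: right_diff_distrib) simp
        finally show ?thesis unfolding a1 M minus_bcontfun.rep_eq Kb_apply[OF qp(1)] Kb_apply[OF qp(2)]
            by simp
      qed
      have "norm (E - Kb ?q E) \<le> C' * cmod (z - k) * L2_norm f + C * cmod (z - k) powr \<gamma> * norm Dv"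
      proof (rule norm_bound)
        fix x
        let ?M = "mult_op (\<lambda>\<xi>. (Pmul z \<xi> - Pmul k \<xi>) / (z - k) - ?P2 \<xi>) f x"
        have al: "(\<lambda>\<xi>. (Pmul z \<xi> - Pmul k \<xi>) / (z - k) - ?P2 \<xi>) \<in> L2"
          using L2_diff[OF L2_cmult[OF L2_diff[OF Pmul_L2[OF oz] P], of ?a] P2] by simp
        have "cmod ?M \<le> L2_norm (\<lambda>\<xi>. (Pmul z \<xi> - Pmul k \<xi>) / (z - k) - ?P2 \<xi>) * L2_norm f"
            by (rule mult_op_bound[OF al f2])
        also have "\<dots> \<le> C' * cmod (z - k) * L2_norm f" by (intro mult_right_mono quot) (use z in auto)
        finally have "w x powr (- \<sigma>) * cmod ?M \<le> 1 * (C' * cmod (z - k) * L2_norm f)"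
            by (intro mult_mono w_neg_powr_le_1) auto
        moreover have "cmod ((Kb ?q Dv - Kb ?p Dv) x) \<le> C * cmod (z - k) powr \<gamma> * norm Dv"
          using norm_bounded[of "Kb ?q Dv - Kb ?p Dv" x] H[OF zq kq, of Dv]
            by (simp add: cut_dist_def dist_norm)
        moreover have "cmod ((E - Kb ?q E) x) \<le> w x powr (- \<sigma>) * cmod ?M + cmod ((Kb ?q Dv - Kb ?p Dv) x)"
          unfolding split by (rule order_trans[OF norm_triangle_ineq]) (simp add: norm_mult)
        ultimately show "cmod ((E - Kb ?q E) x) \<le> C' * cmod (z - k) * L2_norm f + C * cmod (z - k) powr \<gamma>
            * norm Dv" by simp
      qed
      then have "c * norm E \<le> C' * cmod (z - k) * L2_norm f + C * cmod (z - k) powr \<gamma> * norm Dv"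
          using low[OF zq, of E] by linarith
      then have nE: "norm E \<le> h z" using c by (simp add: h_def field_simps)
      show ?thesis
      proof (rule Linfw_normI)
        show "(\<lambda>x. (msol ?q (\<lambda>x. 1) x - msol ?p (\<lambda>x. 1) x) / (z - k) - D x) \<in> borel_measurable borel"
            unfolding D_def by measurable
        show "AE x in lborel. w x powr (- \<sigma>) * cmod ((msol ?q (\<lambda>x. 1) x - msol ?p (\<lambda>x. 1) x) / (z - k)
            - D x) \<le> h z"
        proof (rule AE_I2)
          fix x
          have "(msol ?q (\<lambda>x. 1) x - msol ?p (\<lambda>x. 1) x) / (z - k) - D x = of_real (w x powr \<sigma>) * e x"
            by (simp add: msol_def v_def[symmetric] Dx e_def right_diff_distrib diff_divide_distrib)
          then have "w x powr (- \<sigma>) * cmod ((msol ?q (\<lambda>x. 1) x - msol ?p (\<lambda>x. 1) x) / (z - k) - D x)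
              = (w x powr (- \<sigma>) * w x powr \<sigma>) * cmod (E x)"
            by (simp add: norm_mult E)
          also have "\<dots> \<le> h z" using norm_bounded[of E x] nE by simp
          finally show "w x powr (- \<sigma>) * cmod ((msol ?q (\<lambda>x. 1) x - msol ?p (\<lambda>x. 1) x) / (z - k) - D x)
              \<le> h z" .
        qed
      qed
    qed
    have "((\<lambda>z. cmod (z - k) powr \<gamma>) \<longlongrightarrow> 0 powr \<gamma>) (at k)"
    proof (rule tendsto_powr'[OF _ tendsto_const])
      show "((\<lambda>z. cmod (z - k)) \<longlongrightarrow> 0) (at k)" by (intro tendsto_norm_zero LIM_zero tendsto_ident_at)
    qed (use gamma in auto)
    moreover have "((\<lambda>z. cmod (z - k)) \<longlongrightarrow> 0) (at k)" by (intro tendsto_norm_zero LIM_zero tendsto_ident_at)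
    ultimately have "(h \<longlongrightarrow> (C' * 0 * L2_norm f + C * 0 powr \<gamma> * norm Dv) / c) (at k)"
      unfolding h_def[abs_def]
        by (intro tendsto_divide tendsto_add tendsto_mult tendsto_const) (use c in auto)
    then have "((\<lambda>z. ennreal (h z)) \<longlongrightarrow> ennreal 0) (at k)" by (intro tendsto_ennrealI) simp
    then have hl: "((\<lambda>z. ennreal (h z)) \<longlongrightarrow> 0) (at k)" by simp
    have ev: "\<forall>\<^sub>F z in at k. z \<in> ball k (min r r') \<and> z \<noteq> k"
      using r eventually_at_ball[of "min r r'" k UNIV] by (auto simp: eventually_at_filter)
    have "((\<lambda>z. Linfw_norm (- \<sigma>) (\<lambda>x. (msol (Off_edge z) (\<lambda>x. 1) x - msol (Off_edge k) (\<lambda>x. 1) x) / (z - k)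
        - D x)) \<longlongrightarrow> 0) (at k)"
    proof (rule tendsto_sandwich[OF _ _ tendsto_const hl])
      show "\<forall>\<^sub>F z in at k. Linfw_norm (- \<sigma>) (\<lambda>x. (msol (Off_edge z) (\<lambda>x. 1) x - msol (Off_edge k) (\<lambda>x. 1) x)
          / (z - k) - D x) \<le> ennreal (h z)"
        using ev by eventually_elim (use est in blast)
    qed simp
    then show ?thesis by (intro bexI[of _ D]) (auto simp: D_def intro: msol_Linfw)
  qed
qed

lemma m1_analytic: "analytic_Linfw (- \<sigma>) (Lax_resolvent_set u) (\<lambda>k. msol (Off_edge k) (\<lambda>x. 1))"
  unfolding analytic_Linfw_def using open_resolvent msol_Linfw m1_derivative by blast

end

theorem theorem3p5:
  fixes u :: "real \<Rightarrow> real" and s s1 :: real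
  assumes "s > s1" and "s1 > 1/2"
    and "(\<lambda>x. complex_of_real (u x)) \<in> L2w s"
  shows "\<exists>(m1 :: cut_point \<Rightarrow> real \<Rightarrow> complex) (me :: edge \<Rightarrow> real \<Rightarrow> real \<Rightarrow> complex).
    (\<forall>p \<in> cut_domain (Lax_resolvent_set u).
       unique_in (Linfw (- (s - s1))) (solves u (G_cut p) (\<lambda>x. 1)) (m1 p) \<and> m1 p \<in> Linf) \<and>
    (\<forall>e. \<forall>l>0.
       unique_in (Linfw (- (s - s1)))
         (solves u (G_edge e l) (\<lambda>x. exp (\<i> * of_real (l * x)))) (me e l) \<and> me e l \<in> Linf) \<and>
    analytic_Linfw (- (s - s1)) (Lax_resolvent_set u) (\<lambda>k. m1 (Off_edge k)) \<and>
    (\<exists>\<gamma>. 0 < \<gamma> \<and> \<gamma> < 1 \<and>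
       loc_Holder_Linfw (- (s - s1)) \<gamma> cut_nbhd (\<lambda>p q. dist (cut_pos p) (cut_pos q))
         (cut_domain (Lax_resolvent_set u)) m1 \<and>
       (\<forall>e. loc_Holder_Linfw (- (s - s1)) \<gamma> ball dist {0<..} (me e)))"
proof -
  interpret potential u s s1 by unfold_locales (rule assms)+
  have m1: "unique_in (Linfw (- \<sigma>)) (solves u (G_cut p) (\<lambda>x. 1)) (msol p (\<lambda>x. 1)) \<and> msol p (\<lambda>x. 1) \<in> Linf"
    if "p \<in> cut_domain (Lax_resolvent_set u)" for p
    by (rule msol_unique[OF cut_domain_regular[OF that], of _ 1]) auto
  have me: "unique_in (Linfw (- \<sigma>)) (solves u (G_edge e l) (\<lambda>x. exp (\<i> * of_real (l * x))))
      (msol (On_edge e l) (\<lambda>x. exp (\<i> * of_real (l * x))))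
      \<and> msol (On_edge e l) (\<lambda>x. exp (\<i> * of_real (l * x))) \<in> Linf" if "0 < l" for e l
    using msol_unique[OF regular_On_edge[OF that, of e], of "\<lambda>x. exp (\<i> * of_real (l * x))" 1]
    by (auto intro!: continuous_intros)
  show ?thesis
    unfolding \<sigma>_def[symmetric]
    by (intro exI[of _ "\<lambda>q. msol q (\<lambda>x. 1)"] exI[of _
      "\<lambda>e l. msol (On_edge e l) (\<lambda>x. exp (\<i> * of_real (l * x)))"]
        exI[of _ \<gamma>] conjI ballI allI impI m1[THEN conjunct1] m1[THEN conjunct2] me[THEN conjunct1] me[THEN
            conjunct2]
        m1_analytic m1_Holder me_Holder gamma)
qed

end
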